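(* Let $d\ge2$, $0<p,q\le\infty$ and $d/p<s<1$. Then a radial function $f\in L_p(\mathbb{R}^d)$ belongs to $B^s_{p,q}(\mathbb{R}^d)$ if, and only if, $g:=\operatorname{tr}f$ satisfies $$\|g\|^\#:=\|g\,|L_p(\mathbb{R},|t|^{d-1})\|+\Big(\int_0^1t^{-sq}\Big[\int_{-\infty}^\infty|r|^{d-1}\Big(\sup_{|w|\le t}|g(r+w)-g(r)|\Big)^p\,dr\Big]^{q/p}\frac{dt}{t}\Big)^{1/q}<\infty .$$ Moreover, $\|g\|^\#$ is equivalent to $\|f\,|B^s_{p,q}(\mathbb{R}^d)\|$, i.e. there are constants $c_1,c_2>0$ independent of $f$ such that $c_1\|g\|^\#\le\|f\,|B^s_{p,q}(\mathbb{R}^d)\|\le c_2\|g\|^\#$.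
   Context: Functions are complex-valued and identified when they agree almost everywhere; accordingly the supremum over $w$ is understood as an essential supremum. A (locally integrable) function belongs to $B^s_{p,q}(\mathbb{R}^d)$ if the associated tempered distribution does. If $p=\infty$ or $q=\infty$, integral and sum expressions are replaced by (essential) suprema in the usual way (for $p=\infty$, $d/p=0$, the weight $|r|^{d-1}$ disappears and $\big(\int|r|^{d-1}(\cdot)^p\,dr\big)^{1/p}$ becomes $\operatorname{ess\,sup}_r(\cdot)$). Besov spaces: let $\psi\in C_0^\infty(\mathbb{R}^d)$ with $\psi(x)=1$ for $|x|\le1$ and $\psi(x)=0$ for $|x|\ge2$; put $\varphi_0:=\psi$, $\varphi_1(x):=\varphi_0(x/2)-\varphi_0(x)$, $\varphi_j(x):=\varphi_1(2^{-j+1}x)$ for $j\in\mathbb{N}$. For $0<p,q\le\infty$, $s\in\mathbb{R}$, $B^s_{p,q}(\mathbb{R}^d)$ is the set of all $f\in\mathcal{S}'(\mathbb{R}^d)$ with $$\|f\,|B^s_{p,q}(\mathbb{R}^d)\|:=\Big(\sum_{j=0}^\infty2^{jsq}\|\mathcal{F}^{-1}[\varphi_j\,\mathcal{F}f](\cdot)\,|L_p(\mathbb{R}^d)\|^q\Big)^{1/q}<\infty ,$$ where $\mathcal{F}$ is the Fourier transform. Trace: for a radial function $f$ on $\mathbb{R}^d$, $(\operatorname{tr}f)(t):=f(t,0,\dots,0)$, $t\in\mathbb{R}$; i.e. $\operatorname{tr} f$ is the even function $g$ on $\mathbb{R}$ (determined a.e.) with $f(x)=g(|x|)$ for a.e.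 $x$. Weighted norm: $\|g\,|L_p(\mathbb{R},|t|^{d-1})\|:=\big(\int_{-\infty}^\infty|g(t)|^p|t|^{d-1}dt\big)^{1/p}$ for $p<\infty$, and $\operatorname{ess\,sup}|g|$ for $p=\infty$. *)

theory Defs
  imports "HOL-Analysis.Analysis" "HOL-Probability.Essential_Supremum"
begin

section \<open>Smooth functions, Schwartz functions, tempered distributions\<close>

text \<open>Iterated partial derivatives; a list of basis vectors plays the role of a multi-index.\<close>

fun iter_deriv :: "'a::euclidean_space list \<Rightarrow> ('a \<Rightarrow> complex) \<Rightarrow> 'a \<Rightarrow> complex" where
  "iter_deriv [] f = f"
| "iter_deriv (b # bs) f = (\<lambda>x. frechet_derivative (iter_deriv bs f) (at x) b)"

definition smooth :: "('a::euclidean_space \<Rightarrow> complex) \<Rightarrow> bool" where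
  "smooth f \<longleftrightarrow> (\<forall>bs x. set bs \<subseteq> Basis \<longrightarrow> iter_deriv bs f differentiable (at x))"

definition schwartz :: "('a::euclidean_space \<Rightarrow> complex) \<Rightarrow> bool" where
  "schwartz f \<longleftrightarrow> smooth f \<and>
     (\<forall>k bs. set bs \<subseteq> Basis \<longrightarrow>
        bdd_above (range (\<lambda>x. (1 + norm x) ^ k * norm (iter_deriv bs f x))))"

definition schwartz_seminorm ::
    "nat \<Rightarrow> 'a::euclidean_space list \<Rightarrow> ('a \<Rightarrow> complex) \<Rightarrow> real" where
  "schwartz_seminorm k bs f = (SUP x. (1 + norm x) ^ k * norm (iter_deriv bs f x))"

text \<open>The Schwartz space is metrizable, so for a linear functional sequential continuity at 0 is
  continuity. Functionals are total on the function type; only their values on Schwartz functions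
  are relevant.\<close>

definition tempered_distribution :: "(('a::euclidean_space \<Rightarrow> complex) \<Rightarrow> complex) \<Rightarrow> bool" where
  "tempered_distribution T \<longleftrightarrow>
     (\<forall>u v. schwartz u \<longrightarrow> schwartz v \<longrightarrow> T (\<lambda>x. u x + v x) = T u + T v) \<and>
     (\<forall>c u. schwartz u \<longrightarrow> T (\<lambda>x. c * u x) = c * T u) \<and>
     (\<forall>u. (\<forall>n. schwartz (u n)) \<longrightarrow>
          (\<forall>k bs. set bs \<subseteq> Basis \<longrightarrow> (\<lambda>n. schwartz_seminorm k bs (u n)) \<longlonglongrightarrow> 0) \<longrightarrow>
          (\<lambda>n. T (u n)) \<longlonglongrightarrow> 0)"

definition regular_dist :: "('a::euclidean_space \<Rightarrow> complex) \<Rightarrow> ('a \<Rightarrow> complex) \<Rightarrow> complex" where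
  "regular_dist f u = (LINT x|lebesgue. f x * u x)"

text \<open>Integrability against all Schwartz functions (in particular against Gaussians) makes
  \<open>f\<close> Lebesgue measurable and locally integrable.\<close>

definition represents ::
    "('a::euclidean_space \<Rightarrow> complex) \<Rightarrow> (('a \<Rightarrow> complex) \<Rightarrow> complex) \<Rightarrow> bool" where
  "represents f T \<longleftrightarrow>
     (\<forall>u. schwartz u \<longrightarrow> integrable lebesgue (\<lambda>x. f x * u x) \<and> T u = regular_dist f u)"

section \<open>Fourier transform\<close>

definition fourier :: "('a::euclidean_space \<Rightarrow> complex) \<Rightarrow> 'a \<Rightarrow> complex" where
  "fourier u \<xi> =
     of_real ((2 * pi) powr (- real DIM('a) / 2)) * (LINT x|lebesgue. cis (- (x \<bullet> \<xi>)) * u x)"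

definition inv_fourier :: "('a::euclidean_space \<Rightarrow> complex) \<Rightarrow> 'a \<Rightarrow> complex" where
  "inv_fourier u \<xi> =
     of_real ((2 * pi) powr (- real DIM('a) / 2)) * (LINT x|lebesgue. cis (x \<bullet> \<xi>) * u x)"

text \<open>On distributions all operations are defined by duality.\<close>

definition dist_fourier ::
    "(('a::euclidean_space \<Rightarrow> complex) \<Rightarrow> complex) \<Rightarrow> ('a \<Rightarrow> complex) \<Rightarrow> complex" where
  "dist_fourier T u = T (fourier u)"

definition dist_inv_fourier ::
    "(('a::euclidean_space \<Rightarrow> complex) \<Rightarrow> complex) \<Rightarrow> ('a \<Rightarrow> complex) \<Rightarrow> complex" where
  "dist_inv_fourier T u = T (inv_fourier u)"

definition dist_mult ::
    "('a::euclidean_space \<Rightarrow> complex) \<Rightarrow> (('a \<Rightarrow> complex) \<Rightarrow> complex) \<Rightarrow> ('a \<Rightarrow> complex) \<Rightarrow> complex"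
  where "dist_mult m T u = T (\<lambda>x. m x * u x)"

section \<open>Quasi-norms\<close>

text \<open>Powers in $[0,\infty]$; only used with exponent \<open>a > 0\<close>.\<close>

definition epow :: "ennreal \<Rightarrow> real \<Rightarrow> ennreal" where
  "epow x a = (if x = \<infinity> then \<infinity> else ennreal (enn2real x powr a))"

definition Lp_norm :: "ennreal \<Rightarrow> ('a::euclidean_space \<Rightarrow> complex) \<Rightarrow> ennreal" where
  "Lp_norm p f =
     (if p = \<infinity> then esssup lebesgue (\<lambda>x. ennreal (norm (f x)))
      else epow (\<integral>\<^sup>+x. ennreal (norm (f x) powr enn2real p) \<partial>lebesgue) (1 / enn2real p))"

definition in_Lp :: "ennreal \<Rightarrow> ('a::euclidean_space \<Rightarrow> complex) \<Rightarrow> bool" where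
  "in_Lp p f \<longleftrightarrow> f \<in> borel_measurable lebesgue \<and> Lp_norm p f < \<infinity>"

text \<open>A representing function is unique up to null sets, so the infimum is its $L_p$ quasi-norm;
  it is \<open>\<infinity>\<close> if the distribution is not given by a function.\<close>

definition dist_Lp_norm ::
    "ennreal \<Rightarrow> (('a::euclidean_space \<Rightarrow> complex) \<Rightarrow> complex) \<Rightarrow> ennreal" where
  "dist_Lp_norm p T = (INF h\<in>{h. represents h T}. Lp_norm p h)"

text \<open>$\ell_q$ quasi-norm of $(2^{js} a_j)_j$.\<close>

definition weighted_lq_norm :: "real \<Rightarrow> ennreal \<Rightarrow> (nat \<Rightarrow> ennreal) \<Rightarrow> ennreal" where
  "weighted_lq_norm s q a =
     (if q = \<infinity> then (SUP j. ennreal (2 powr (real j * s)) * a j)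
      else epow (\<Sum>j. ennreal (2 powr (real j * s * enn2real q)) * epow (a j) (enn2real q))
             (1 / enn2real q))"

section \<open>Besov spaces\<close>

definition resolution_generator :: "('a::euclidean_space \<Rightarrow> complex) \<Rightarrow> bool" where
  "resolution_generator \<psi> \<longleftrightarrow>
     smooth \<psi> \<and> (\<forall>x. norm x \<le> 1 \<longrightarrow> \<psi> x = 1) \<and> (\<forall>x. norm x \<ge> 2 \<longrightarrow> \<psi> x = 0)"

definition dyadic :: "('a::euclidean_space \<Rightarrow> complex) \<Rightarrow> nat \<Rightarrow> 'a \<Rightarrow> complex" where
  "dyadic \<psi> j x =
     (if j = 0 then \<psi> x
      else let y = (2 powr (1 - real j)) *\<^sub>R x in \<psi> (y /\<^sub>R 2) - \<psi> y)"

definition besov_norm ::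
    "('a::euclidean_space \<Rightarrow> complex) \<Rightarrow> real \<Rightarrow> ennreal \<Rightarrow> ennreal \<Rightarrow>
     (('a \<Rightarrow> complex) \<Rightarrow> complex) \<Rightarrow> ennreal" where
  "besov_norm \<psi> s p q T =
     weighted_lq_norm s q
       (\<lambda>j. dist_Lp_norm p (dist_inv_fourier (dist_mult (dyadic \<psi> j) (dist_fourier T))))"

definition besov_space ::
    "('a::euclidean_space \<Rightarrow> complex) \<Rightarrow> real \<Rightarrow> ennreal \<Rightarrow> ennreal \<Rightarrow>
     (('a \<Rightarrow> complex) \<Rightarrow> complex) set" where
  "besov_space \<psi> s p q = {T. tempered_distribution T \<and> besov_norm \<psi> s p q T < \<infinity>}"

definition in_besov ::
    "('a::euclidean_space \<Rightarrow> complex) \<Rightarrow> real \<Rightarrow> ennreal \<Rightarrow> ennreal \<Rightarrow> ('a \<Rightarrow> complex) \<Rightarrow> bool" where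
  "in_besov \<psi> s p q f \<longleftrightarrow>
     represents f (regular_dist f) \<and> regular_dist f \<in> besov_space \<psi> s p q"

section \<open>Radial functions, traces, and the one-dimensional quasi-norm\<close>

text \<open>Functions are identified when they agree almost everywhere, so both notions are stated
  modulo null sets. No measurability of \<open>g\<close> is demanded: for measurable \<open>f\<close> it is automatic.\<close>

definition radial :: "('a::euclidean_space \<Rightarrow> complex) \<Rightarrow> bool" where
  "radial f \<longleftrightarrow> (\<exists>h. AE x in lebesgue. f x = h (norm x))"

definition is_trace :: "('a::euclidean_space \<Rightarrow> complex) \<Rightarrow> (real \<Rightarrow> complex) \<Rightarrow> bool" where
  "is_trace f g \<longleftrightarrow>
     (AE t in lebesgue. g (- t) = g t) \<and> (AE x in lebesgue. f x = g (norm x))"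

text \<open>$L_p(\mathbb{R}, |r|^{d-1})$, on $[0,\infty]$-valued functions; no weight for
  \<open>p = \<infinity>\<close>.\<close>

definition weighted_Lp_norm :: "nat \<Rightarrow> ennreal \<Rightarrow> (real \<Rightarrow> ennreal) \<Rightarrow> ennreal" where
  "weighted_Lp_norm d p h =
     (if p = \<infinity> then esssup lebesgue h
      else epow (\<integral>\<^sup>+r. ennreal (\<bar>r\<bar> ^ (d - 1)) * epow (h r) (enn2real p) \<partial>lebesgue)
             (1 / enn2real p))"

definition max_diff :: "(real \<Rightarrow> complex) \<Rightarrow> real \<Rightarrow> real \<Rightarrow> ennreal" where
  "max_diff g t r = esssup (lebesgue_on {-t..t}) (\<lambda>w. ennreal (norm (g (r + w) - g r)))"

text \<open>The bracket $[\int \dots]^{q/p}$ is written as the $q$-th power of the weighted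
  $L_p$ quasi-norm, which also covers \<open>p = \<infinity>\<close>.\<close>

definition trace_seminorm ::
    "nat \<Rightarrow> real \<Rightarrow> ennreal \<Rightarrow> ennreal \<Rightarrow> (real \<Rightarrow> complex) \<Rightarrow> ennreal" where
  "trace_seminorm d s p q g =
     (if q = \<infinity> then
        esssup (lebesgue_on {0<..<1})
          (\<lambda>t. ennreal (t powr (- s)) * weighted_Lp_norm d p (max_diff g t))
      else
        epow (\<integral>\<^sup>+t\<in>{0<..<1}. ennreal (t powr (- s * enn2real q)) *
                 epow (weighted_Lp_norm d p (max_diff g t)) (enn2real q) *
                 ennreal (1 / t) \<partial>lebesgue)
          (1 / enn2real q))"

definition trace_norm ::
    "nat \<Rightarrow> real \<Rightarrow> ennreal \<Rightarrow> ennreal \<Rightarrow> (real \<Rightarrow> complex) \<Rightarrow> ennreal" where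
  "trace_norm d s p q g =
     weighted_Lp_norm d p (\<lambda>t. ennreal (norm (g t))) + trace_seminorm d s p q g"

end

theory Submission
  imports Defs "HOL-Probability.Sinc_Integral" "HOL-Probability.Characteristic_Functions"
begin

text \<open>Both quasi-norms are compared with the discrete $\ell_q$ quasi-norm of $2^{js}\|h_j\|_p$, where
  $h_j$ is the \<open>j\<close>-th Littlewood--Paley piece of $f$, a convolution with a kernel of width $2^{-j}$.
  Note that $d/p < s < 1$ forces $p > d$, so all $L_p$ quasi-norms are norms. Let $E(t)$ be the $L_p$ norm
  of the maximal difference $\sup_{|w|\le t} |g(|x|+w)-g(|x|)|$, which in polar coordinates is the bracket in
  the trace norm.

  Upper bound: the kernels have mean zero for $j \ge 1$ and decay rapidly, so $\|h_j\|_p$ is controlled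
  by the differences of $f$ at the scales $2^{-i}$, $i \le j$, and since $||x+z|-|x|| \le |z|$ these are at
  most $E(2^{-i})$.

  Lower bound: $f = \sum_j h_j$ almost everywhere, and the maximal increment of $h_j$ over a ball of radius
  $2^{-m}$ has $L_p$ norm at most a constant times $2^{j-m}\|h_j\|_p$ if $j \le m$ and $2^{(j-m)d/p}\|h_j\|_p$
  otherwise. For radial $f$ the maximal increment of $f$ over the ball dominates the maximal difference of $g$.

  In both directions $d/p < s < 1$ makes the resulting sums over scales geometric, and a discrete Hardy
  inequality finishes the proof.\<close>

subsection \<open>Powers in $[0,\infty]$\<close>

text \<open>All quantities live in [0,\<infinity>], so membership is equivalent to finiteness as
  soon as the two-sided estimate holds. On the distribution side the norm of a piece is an infimum
  over arbitrary representing functions, of which only pairings with Schwartz functions are known.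
  The way in is that \<open>psi i\<close> times \<open>psi l\<close> is \<open>psi i\<close> for i <
  l: convolution with a kernel of level j + 1 reproduces the kernel of piece j. Testing with
  translates of that Schwartz kernel recovers the convolution from any representative, with an L_1
  bound. The same identity makes each piece an average of itself and so yields its increments: for j
  \<le> m the kernel is Lipschitz at scale 2^(-m), for j > m it is spread over the larger ball, and
  the loss 2^((j-m)d) in mass becomes 2^((j-m)d/p) in norm. On the trace side g is known only up to
  null sets, whereas a maximal difference compares values along a line. In polar coordinates almost
  every line through the origin keeps almost all of its points. Full lines are taken because |x| + w
  may be negative, where evenness of g takes over.\<close>

lemma epow_ennreal: "0 \<le> x \<Longrightarrow> epow (ennreal x) a = ennreal (x powr a)"
  by (simp add: epow_def)

lemma epow_top [simp]: "epow \<infinity> a = \<infinity>" "epow top a = top"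
  by (simp_all add: epow_def)

lemma epow_0 [simp]: "epow 0 a = 0"
  by (simp add: epow_def)

lemma epow_mono: "0 \<le> a \<Longrightarrow> x \<le> y \<Longrightarrow> epow x a \<le> epow y a"
  by (cases x; cases y) (auto simp: epow_ennreal intro!: ennreal_leI powr_mono2 simp: top_unique)

lemma epow_mult: "0 < a \<Longrightarrow> epow (x * y) a = epow x a * epow y a"
  by (cases x; cases y)
    (auto simp: epow_ennreal ennreal_mult[symmetric] powr_mult ennreal_mult_top ennreal_top_mult
      ennreal_eq_0_iff powr_eq_0_iff)

lemma epow_epow: "0 < a \<Longrightarrow> 0 < b \<Longrightarrow> epow (epow x a) b = epow x (a * b)"
  by (cases x) (auto simp: epow_ennreal powr_powr)

lemma epow_1 [simp]: "epow x 1 = x"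
  by (cases x) (auto simp: epow_ennreal)

lemma epow_inverse [simp]: "0 < a \<Longrightarrow> epow (epow x a) (1 / a) = x" "0 < a \<Longrightarrow> epow (epow x (1 / a)) a = x"
  by (simp_all add: epow_epow)

lemma epow_le_iff: "0 < a \<Longrightarrow> epow x (1 / a) \<le> y \<longleftrightarrow> x \<le> epow y a"
  by (metis epow_inverse epow_mono less_imp_le zero_less_divide_1_iff)

lemma epow_le_cancel: "0 < a \<Longrightarrow> epow x a \<le> epow y a \<longleftrightarrow> x \<le> y"
  by (metis epow_inverse(1) epow_mono less_imp_le zero_less_divide_1_iff)

lemma measurable_epow [measurable]:
  "f \<in> borel_measurable M \<Longrightarrow> (\<lambda>x. epow (f x) a) \<in> borel_measurable M"
  unfolding epow_def by simp

subsection \<open>$L_p$ quasi-norms of $[0,\infty]$-valued functions\<close>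

text \<open>Over an arbitrary measure, so that function norms and the sequence norm
  \<open>lq\<close> (counting measure) share the same estimates. Values in [0,\<infinity>] allow
  sums of absolute values to be measured before they are known to converge.\<close>

definition Lpe :: "ennreal \<Rightarrow> 'a measure \<Rightarrow> ('a \<Rightarrow> ennreal) \<Rightarrow> ennreal" where
  "Lpe p M u = (if p = \<infinity> then esssup M u
     else epow (\<integral>\<^sup>+x. epow (u x) (enn2real p) \<partial>M) (1 / enn2real p))"

lemma Lpe_infinity: "Lpe top M u = esssup M u"
  by (simp add: Lpe_def)

lemma Lpe_real: "0 < P \<Longrightarrow> Lpe (ennreal P) M u = epow (\<integral>\<^sup>+x. epow (u x) P \<partial>M) (1 / P)"
  by (simp add: Lpe_def)

lemma esssup_le_iff:
  fixes u :: "'a \<Rightarrow> ennreal"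
  assumes "u \<in> borel_measurable M" shows "esssup M u \<le> B \<longleftrightarrow> (AE x in M. u x \<le> B)"
proof
  assume "esssup M u \<le> B" with esssup_AE[of u M] show "AE x in M. u x \<le> B"
    by (auto elim!: eventually_mono)
qed (use assms in auto)

lemma Lpe_real_le_iff: "0 < P \<Longrightarrow> Lpe (ennreal P) M u \<le> B \<longleftrightarrow> (\<integral>\<^sup>+x. epow (u x) P \<partial>M) \<le> epow B P"
  by (simp add: Lpe_real epow_le_iff)

lemma exponent_cases [consumes 1, case_names infinite finite]:
  assumes "0 < (p::ennreal)"
  obtains "p = \<infinity>" | P where "p = ennreal P" "0 < P"
  using assms by (cases p) (auto simp: infinity_ennreal_def)

lemma Lpe_mono_AE:
  assumes "0 < p" "u \<in> borel_measurable M" "AE x in M. u x \<le> v x"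
  shows "Lpe p M u \<le> Lpe p M v"
  using assms(1)
proof (cases p rule: exponent_cases)
  case infinite with assms show ?thesis by (auto simp: Lpe_infinity intro!: esssup_AE_mono)
next
  case (finite P)
  with assms show ?thesis
    by (auto simp: Lpe_real intro!: epow_mono nn_integral_mono_AE elim!: eventually_mono)
qed

lemma Lpe_cong_AE:
  assumes "0 < p" "u \<in> borel_measurable M" "v \<in> borel_measurable M" "AE x in M. u x = v x"
  shows "Lpe p M u = Lpe p M v"
  using assms by (intro antisym Lpe_mono_AE) (auto elim!: eventually_mono)

lemma Lpe_cmult_le:
  assumes "0 < p" "u \<in> borel_measurable M"
  shows "Lpe p M (\<lambda>x. c * u x) \<le> c * Lpe p M u"
  using assms(1)
proof (cases p rule: exponent_cases)
  case infinite with assms esssup_AE[of u M] show ?thesis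
    by (auto simp: Lpe_infinity intro!: esssup_I mult_left_mono elim!: eventually_mono)
next
  case (finite P)
  with assms show ?thesis
    by (simp add: Lpe_real_le_iff epow_mult nn_integral_cmult) (simp add: Lpe_real)
qed

text \<open>A crude triangle inequality from u + v \<le> 2 max(u, v). The factor 4 is 2 from the
  maximum times 2 from adding two P-th powers, since 2 \<le> 2^P.\<close>

lemma Lpe_add_le:
  assumes p: "0 < p" "1 \<le> p" and [measurable]: "u \<in> borel_measurable M" "v \<in> borel_measurable M"
    and u: "Lpe p M u \<le> B" and v: "Lpe p M v \<le> B"
  shows "Lpe p M (\<lambda>x. u x + v x) \<le> 4 * B"
  using p(1)
proof (cases p rule: exponent_cases)
  case infinite
  with u v have "AE x in M. u x \<le> B" "AE x in M. v x \<le> B" by (auto simp: Lpe_infinity esssup_le_iff)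
  then have "AE x in M. u x + v x \<le> 4 * B"
  proof eventually_elim
    case (elim x)
    have "u x + v x \<le> B + B" using elim by (rule add_mono)
    also have "\<dots> = 2 * B" by (simp add: mult_2)
    also have "\<dots> \<le> 4 * B" by (rule mult_right_mono) auto
    finally show ?case .
  qed
  with infinite show ?thesis by (auto simp: Lpe_infinity intro!: esssup_I)
next
  case (finite P)
  have P: "1 \<le> P" using p finite by simp
  have pw: "epow (u x + v x) P \<le> epow 2 P * (epow (u x) P + epow (v x) P)" for x
  proof -
    have "u x + v x \<le> 2 * max (u x) (v x)"
      by (metis add_mono max.cobounded1 max.cobounded2 mult_2)
    then have "epow (u x + v x) P \<le> epow 2 P * epow (max (u x) (v x)) P"
      using epow_mono[of P] finite by (simp add: epow_mult[symmetric])
    also have "\<dots> \<le> epow 2 P * (epow (u x) P + epow (v x) P)"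
      by (intro mult_left_mono) (auto simp: max_def add_increasing add_increasing2)
    finally show ?thesis .
  qed
  have uv: "(\<integral>\<^sup>+x. epow (u x) P \<partial>M) \<le> epow B P" "(\<integral>\<^sup>+x. epow (v x) P \<partial>M) \<le> epow B P"
    using u v finite by (auto simp: Lpe_real_le_iff)
  have "(\<integral>\<^sup>+x. epow (u x + v x) P \<partial>M) \<le> (\<integral>\<^sup>+x. epow 2 P * (epow (u x) P + epow (v x) P) \<partial>M)"
    by (intro nn_integral_mono pw)
  also have "\<dots> \<le> epow 2 P * (epow B P + epow B P)"
    using uv by (simp add: nn_integral_cmult nn_integral_add) (intro mult_left_mono add_mono, auto)
  also have "\<dots> = 2 * (epow 2 P * epow B P)" by (simp add: mult_2 distrib_left)
  also have "\<dots> \<le> epow 2 P * (epow 2 P * epow B P)"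
  proof (rule mult_right_mono)
    have "(2::real) = 2 powr 1" by simp
    also have "\<dots> \<le> 2 powr P" using P by (intro powr_mono) auto
    finally have "ennreal 2 \<le> ennreal (2 powr P)" by (intro ennreal_leI)
    then show "2 \<le> epow 2 P" using epow_ennreal[of 2 P] by simp
  qed auto
  also have "\<dots> = epow (4 * B) P"
    using finite by (simp add: epow_mult[symmetric] mult.assoc[symmetric])
  finally show ?thesis using finite by (simp add: Lpe_real_le_iff)
qed

text \<open>Convexity: a^p lies above its tangent at l. Being linear in a, the bound can be
  integrated against any measure, after which l is free to be optimised.\<close>

lemma powr_tangent:
  fixes a l p :: real
  assumes "1 \<le> p" "0 \<le> a" "0 < l"
  shows "p * a * l powr (p - 1) \<le> a powr p + (p - 1) * l powr p"
proof (cases "a = 0")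
  case True then show ?thesis using assms by simp
next
  case False
  then have a: "0 < a" using assms by simp
  \<comment> \<open>Young's inequality for the two factors a^p and l^p with exponents 1/p and 1 -
    1/p.\<close>
  have "(a powr p) powr (1 / p) * (l powr p) powr (1 - 1 / p)
      \<le> 1 / p * a powr p + (1 - 1 / p) * l powr p"
    using assms a by (intro Youngs_inequality_0) auto
  then have "a * l powr (p - 1) \<le> 1 / p * a powr p + (1 - 1 / p) * l powr p"
    using assms a by (simp add: powr_powr right_diff_distrib)
  then have "p * (a * l powr (p - 1)) \<le> p * (1 / p * a powr p + (1 - 1 / p) * l powr p)"
    using assms by (intro mult_left_mono) auto
  then show ?thesis using assms by (simp add: algebra_simps)
qed

text \<open>Jensen's inequality for the measure with density v, of total mass W, homogenised by the
  factor W^(p-1). It is obtained by integrating \<open>powr_tangent\<close> and choosing l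
  afterwards.\<close>

lemma nn_integral_power_le:
  assumes [measurable]: "v \<in> borel_measurable M" "u \<in> borel_measurable M"
    and p: "1 \<le> p" and W: "(\<integral>\<^sup>+z. v z \<partial>M) = ennreal W" "0 < W"
  shows "epow (\<integral>\<^sup>+z. v z * u z \<partial>M) p \<le> ennreal (W powr (p - 1)) * (\<integral>\<^sup>+z. v z * epow (u z) p \<partial>M)"
proof (cases "(\<integral>\<^sup>+z. v z * epow (u z) p \<partial>M) = \<infinity>")
  case True then show ?thesis using W by (simp add: ennreal_mult_top)
next
  case fin: False
  define J where "J = enn2real (\<integral>\<^sup>+z. v z * epow (u z) p \<partial>M)"
  have J: "(\<integral>\<^sup>+z. v z * epow (u z) p \<partial>M) = ennreal J" "0 \<le> J"
    using fin by (simp_all add: J_def less_top)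
  have le: "(\<integral>\<^sup>+z. v z * u z \<partial>M) * ennreal (p * l powr (p - 1)) \<le> ennreal (J + (p - 1) * l powr p * W)"
    if l: "0 < l" for l
  proof -
    have pt: "u z * ennreal (p * l powr (p - 1)) \<le> epow (u z) p + ennreal ((p - 1) * l powr p)" for z
    proof (cases "u z")
      case (real r)
      have "ennreal (r * (p * l powr (p - 1))) \<le> ennreal (r powr p + (p - 1) * l powr p)"
        using powr_tangent[of p r l] p l real by (intro ennreal_leI) (simp add: mult_ac)
      then show ?thesis using p real
        by (simp add: epow_ennreal ennreal_mult)
    qed auto
    have "(\<integral>\<^sup>+z. v z * u z \<partial>M) * ennreal (p * l powr (p - 1))
        = (\<integral>\<^sup>+z. v z * (u z * ennreal (p * l powr (p - 1))) \<partial>M)"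
      by (simp add: nn_integral_multc[symmetric] mult.assoc)
    also have "\<dots> \<le> (\<integral>\<^sup>+z. v z * (epow (u z) p + ennreal ((p - 1) * l powr p)) \<partial>M)"
      by (intro nn_integral_mono mult_left_mono pt) auto
    also have "\<dots> = ennreal J + ennreal W * ennreal ((p - 1) * l powr p)"
      using J W by (simp add: distrib_left nn_integral_add nn_integral_multc)
    also have "\<dots> = ennreal (J + (p - 1) * l powr p * W)"
      using J W p by (simp add: ennreal_mult[symmetric] ennreal_plus[symmetric] mult_ac
          del: ennreal_plus)
    finally show ?thesis .
  qed
  have "(\<integral>\<^sup>+z. v z * u z \<partial>M) \<noteq> top"
    using le[of 1] p by (auto simp: ennreal_top_mult top_unique)
  then obtain I where I: "(\<integral>\<^sup>+z. v z * u z \<partial>M) = ennreal I" "0 \<le> I"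
    by (cases "(\<integral>\<^sup>+z. v z * u z \<partial>M)") auto
  have "I powr p \<le> W powr (p - 1) * J"
  proof (cases "I = 0")
    case True then show ?thesis using J by simp
  next
    case False
    then have Ip: "0 < I" using I by simp
    \<comment> \<open>The mean of u with respect to v, where the tangent bound is sharp. The
      instance l = 1 has already shown the integral I to be finite.\<close>
    define l where "l = I / W"
    have l: "0 < l" using Ip W by (simp add: l_def)
    have "I * (p * l powr (p - 1)) \<le> J + (p - 1) * l powr p * W"
      using le[OF l] I p l W J
      by (simp add: ennreal_mult[symmetric] ennreal_plus[symmetric] del: ennreal_plus)
    moreover have "l powr p * W = I * l powr (p - 1)"
      using l W by (simp add: l_def powr_diff divide_simps)
    ultimately have "I * (p * l powr (p - 1)) \<le> J + (p - 1) * (I * l powr (p - 1))"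
      by (simp only: mult.assoc)
    then have "I * l powr (p - 1) \<le> J" by (simp add: algebra_simps)
    moreover have "l powr (p - 1) = I powr (p - 1) / W powr (p - 1)"
      using Ip W by (simp add: l_def powr_divide)
    ultimately have "I * I powr (p - 1) \<le> J * W powr (p - 1)"
      using W by (simp add: divide_simps)
    then show ?thesis using Ip by (simp add: powr_diff mult.commute)
  qed
  then show ?thesis using I J by (simp add: epow_ennreal ennreal_mult[symmetric])
qed

text \<open>A weighted substitute for Minkowski's integral inequality: Jensen's inequality for the
  measure with density \<open>w * c\<close>.\<close>

lemma Lpe_nn_integral_le:
  fixes c :: "'b \<Rightarrow> real"
  assumes "sigma_finite_measure M" "sigma_finite_measure N" and p: "1 \<le> p"
    and u [measurable]: "case_prod u \<in> borel_measurable (M \<Otimes>\<^sub>M N)"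
    and w [measurable]: "w \<in> borel_measurable N" and c [measurable]: "c \<in> borel_measurable N"
    and cpos: "\<And>z. 0 < c z"
    and W: "(\<integral>\<^sup>+z. w z * ennreal (c z) \<partial>N) < \<infinity>"
    and le: "AE z in N. w z \<noteq> 0 \<longrightarrow> Lpe p M (\<lambda>x. u x z) \<le> B * ennreal (c z)"
  shows "Lpe p M (\<lambda>x. \<integral>\<^sup>+z. w z * u x z \<partial>N) \<le> B * (\<integral>\<^sup>+z. w z * ennreal (c z) \<partial>N)"
proof -
  interpret M: sigma_finite_measure M by fact
  interpret N: sigma_finite_measure N by fact
  interpret MN: pair_sigma_finite M N ..
  have p0: "0 < p" using p by (rule less_le_trans[rotated]) simp
  have u1 [measurable]: "(\<lambda>x. u x z) \<in> borel_measurable M" if "z \<in> space N" for z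
    using measurable_compose[OF measurable_Pair2'[OF that] u] by simp
  have u2 [measurable]: "(\<lambda>z. u x z) \<in> borel_measurable N" if "x \<in> space M" for x
    using measurable_compose[OF measurable_Pair1'[OF that] u] by simp
  from p0 show ?thesis
  proof (cases p rule: exponent_cases)
    case infinite
    \<comment> \<open>For an essential supremum the bound on each slice is an a.e. statement, and
      Fubini for null sets exchanges the two variables.\<close>
    have "AE z in N. AE x in M. w z \<noteq> 0 \<longrightarrow> u x z \<le> B * ennreal (c z)"
      using le AE_space
    proof eventually_elim
      case (elim z)
      then show ?case
        using infinite esssup_le_iff[OF u1[of z]] by (auto simp: Lpe_infinity)
    qed
    then have "AE x in M. AE z in N. w z \<noteq> 0 \<longrightarrow> u x z \<le> B * ennreal (c z)"
      by (subst MN.AE_commute) measurable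
    then have "AE x in M. (\<integral>\<^sup>+z. w z * u x z \<partial>N) \<le> B * (\<integral>\<^sup>+z. w z * ennreal (c z) \<partial>N)"
    proof eventually_elim
      case (elim x)
      have "(\<integral>\<^sup>+z. w z * u x z \<partial>N) \<le> (\<integral>\<^sup>+z. B * (w z * ennreal (c z)) \<partial>N)"
        using elim
      proof (intro nn_integral_mono_AE, eventually_elim)
        case (elim z)
        then show ?case
          by (cases "w z = 0") (auto simp: mult.left_commute[of B] intro!: mult_left_mono)
      qed
      then show ?case by (simp add: nn_integral_cmult)
    qed
    then show ?thesis using infinite by (auto simp: Lpe_infinity intro!: esssup_I)
  next
    case (finite P)
    have P: "1 \<le> P" using p finite by simp
    obtain V where V: "(\<integral>\<^sup>+z. w z * ennreal (c z) \<partial>N) = ennreal V" "0 \<le> V"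
      using W by (cases "(\<integral>\<^sup>+z. w z * ennreal (c z) \<partial>N)") auto
    show ?thesis
    proof (cases "V = 0")
      case True
      then have "AE z in N. w z * ennreal (c z) = 0"
        using V by (simp add: nn_integral_0_iff_AE)
      then have "AE z in N. w z = 0"
        by eventually_elim (use cpos in \<open>simp add: ennreal_eq_0_iff not_le[symmetric]\<close>)
      then have "(\<integral>\<^sup>+z. w z * u x z \<partial>N) = 0" for x
        by (subst nn_integral_cong_AE[where v = "\<lambda>_. 0"]) (auto elim!: eventually_mono)
      then show ?thesis using finite by (simp add: Lpe_real)
    next
      case False
      then have V0: "0 < V" using V by simp
      define v where "v = (\<lambda>z. w z * ennreal (c z))"
      have [measurable]: "v \<in> borel_measurable N" by (simp add: v_def)
      \<comment> \<open>Dividing the slices by c makes all their norms at most B, while w c becomes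
        the density of the measure to which Jensen applies.\<close>
      have vu: "v z * (ennreal (1 / c z) * a) = w z * a" for z a
        using cpos[of z] by (simp add: v_def mult.assoc) (simp add: mult.assoc[symmetric] ennreal_mult[symmetric])
      have "(\<integral>\<^sup>+x. epow (\<integral>\<^sup>+z. w z * u x z \<partial>N) P \<partial>M)
          \<le> (\<integral>\<^sup>+x. ennreal (V powr (P - 1)) * (\<integral>\<^sup>+z. v z * epow (ennreal (1 / c z) * u x z) P \<partial>N) \<partial>M)"
      proof (rule nn_integral_mono)
        fix x assume "x \<in> space M"
        then have [measurable]: "(\<lambda>z. u x z) \<in> borel_measurable N" by simp
        show "epow (\<integral>\<^sup>+z. w z * u x z \<partial>N) P
          \<le> ennreal (V powr (P - 1)) * (\<integral>\<^sup>+z. v z * epow (ennreal (1 / c z) * u x z) P \<partial>N)"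
          using nn_integral_power_le[of v N "\<lambda>z. ennreal (1 / c z) * u x z" P V] V V0 P
          by (simp add: vu) (simp add: v_def)
      qed
      also have "\<dots> = ennreal (V powr (P - 1)) *
          (\<integral>\<^sup>+z. (\<integral>\<^sup>+x. v z * epow (ennreal (1 / c z) * u x z) P \<partial>M) \<partial>N)"
        by (subst MN.Fubini') (auto simp: nn_integral_cmult)
      also have "\<dots> \<le> ennreal (V powr (P - 1)) * (\<integral>\<^sup>+z. v z * epow B P \<partial>N)"
      proof (intro mult_left_mono nn_integral_mono_AE)
        show "AE z in N. (\<integral>\<^sup>+x. v z * epow (ennreal (1 / c z) * u x z) P \<partial>M) \<le> v z * epow B P"
          using le AE_space
        proof eventually_elim
          case (elim z)
          have [measurable]: "(\<lambda>x. u x z) \<in> borel_measurable M" using elim by simp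
          show ?case
          proof (cases "w z = 0")
            case True then show ?thesis by (simp add: v_def)
          next
            case False
            have "(\<integral>\<^sup>+x. v z * epow (ennreal (1 / c z) * u x z) P \<partial>M)
                = v z * (epow (ennreal (1 / c z)) P * (\<integral>\<^sup>+x. epow (u x z) P \<partial>M))"
              using P by (simp add: epow_mult nn_integral_cmult)
            also have "\<dots> \<le> v z * (epow (ennreal (1 / c z)) P * epow (B * ennreal (c z)) P)"
              using elim False finite by (intro mult_left_mono) (auto simp: Lpe_real_le_iff)
            also have "\<dots> = v z * epow (ennreal (1 / c z) * (B * ennreal (c z))) P"
              using P by (simp add: epow_mult)
            also have "ennreal (1 / c z) * (B * ennreal (c z)) = B"
              using cpos[of z] by (simp add: mult.left_commute[of _ B] ennreal_mult[symmetric])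
            finally show ?thesis .
          qed
        qed
      qed auto
      also have "\<dots> = epow (ennreal V) P * epow B P"
        using V V0 P by (simp add: nn_integral_multc v_def epow_ennreal mult.assoc[symmetric]
            ennreal_mult[symmetric] powr_diff)
      also have "\<dots> = epow (B * ennreal V) P" using P by (simp add: epow_mult mult.commute)
      finally show ?thesis using finite V by (simp add: Lpe_real_le_iff)
    qed
  qed
qed

text \<open>The case of counting measure: c_j is the expected size of the j-th term, and only the
  sum of these sizes enters the bound.\<close>

lemma Lpe_suminf_le:
  fixes c :: "nat \<Rightarrow> real"
  assumes "sigma_finite_measure M" "1 \<le> p" and [measurable]: "\<And>j. u j \<in> borel_measurable M"
    and c: "\<And>j. 0 < c j" "(\<Sum>j. ennreal (c j)) < \<infinity>"
    and le: "\<And>j. Lpe p M (u j) \<le> B * ennreal (c j)"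
  shows "Lpe p M (\<lambda>x. \<Sum>j. u j x) \<le> B * (\<Sum>j. ennreal (c j))"
proof -
  have "(\<lambda>z. u (snd z) (fst z)) \<in> borel_measurable (M \<Otimes>\<^sub>M count_space UNIV)"
    by (rule measurable_compose_countable) measurable
  then have "case_prod (\<lambda>x j. u j x) \<in> borel_measurable (M \<Otimes>\<^sub>M count_space UNIV)"
    by (simp add: case_prod_beta')
  then show ?thesis
    using Lpe_nn_integral_le[of M "count_space UNIV" p "\<lambda>x j. u j x" "\<lambda>_. 1" c B] assms
    by (simp add: nn_integral_count_space_nat sigma_finite_measure_count_space)
qed

subsection \<open>A discrete Hardy inequality\<close>

text \<open>Terms with i \<le> j and with i > j form two pieces of a geometric series with ratio
  2^(-e), each at most 1 / (1 - 2^(-e)), uniformly in j.\<close>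

lemma sum_geometric_dist_le:
  assumes e: "0 < e"
  shows "(\<Sum>i. ennreal (2 powr (- e * \<bar>real i - real j\<bar>))) \<le> ennreal (2 / (1 - 2 powr - e))"
  unfolding suminf_eq_SUP
proof (rule SUP_least)
  fix n
  define \<gamma> where "\<gamma> = 2 powr - e"
  have \<gamma>: "0 < \<gamma>" "\<gamma> < 1" using e by (auto simp: \<gamma>_def powr_less_one)
  have pw: "2 powr (- e * real k) = \<gamma> ^ k" for k
    by (simp add: \<gamma>_def powr_realpow[symmetric] powr_powr mult.commute)
  have geo: "(\<Sum>i\<in>A. \<gamma> ^ f i) \<le> 1 / (1 - \<gamma>)" if "finite A" "inj_on f A" for f and A :: "nat set"
  proof -
    have "(\<Sum>i\<in>A. \<gamma> ^ f i) = (\<Sum>k\<in>f ` A. \<gamma> ^ k)" using that by (simp add: sum.reindex)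
    also have "\<dots> \<le> (\<Sum>k. \<gamma> ^ k)" using \<gamma> that by (intro sum_le_suminf) auto
    also have "\<dots> = 1 / (1 - \<gamma>)" using \<gamma> by (simp add: suminf_geometric)
    finally show ?thesis .
  qed
  have "(\<Sum>i<n. 2 powr (- e * \<bar>real i - real j\<bar>))
     = (\<Sum>i\<in>{..<n} \<inter> {..j}. 2 powr (- e * \<bar>real i - real j\<bar>)) + (\<Sum>i\<in>{..<n} - {..j}. 2 powr (- e * \<bar>real i - real j\<bar>))"
    by (subst sum.Int_Diff[of _ _ "{..j}"]) auto
  also have "\<dots> = (\<Sum>i\<in>{..<n} \<inter> {..j}. \<gamma> ^ (j - i)) + (\<Sum>i\<in>{..<n} - {..j}. \<gamma> ^ (i - j))"
    by (intro arg_cong2[where f = "(+)"] sum.cong) (auto simp: pw[symmetric] of_nat_diff)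
  also have "\<dots> \<le> 1 / (1 - \<gamma>) + 1 / (1 - \<gamma>)"
    by (intro add_mono geo) (auto simp: inj_on_def)
  finally show "(\<Sum>i<n. ennreal (2 powr (- e * \<bar>real i - real j\<bar>))) \<le> ennreal (2 / (1 - 2 powr - e))"
    by (simp add: sum_ennreal \<gamma>_def[symmetric] ennreal_leI)
qed

section \<open>Sequence quasi-norms and the Hardy inequality\<close>

definition lq :: "ennreal \<Rightarrow> (nat \<Rightarrow> ennreal) \<Rightarrow> ennreal" where
  "lq q = Lpe q (count_space UNIV)"

lemma lq_real_le_iff: "0 < Q \<Longrightarrow> lq (ennreal Q) b \<le> B \<longleftrightarrow> (\<Sum>j. epow (b j) Q) \<le> epow B Q"
  by (simp add: lq_def Lpe_real_le_iff nn_integral_count_space_nat)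

lemma lq_real: "0 < Q \<Longrightarrow> lq (ennreal Q) b = epow (\<Sum>j. epow (b j) Q) (1 / Q)"
  by (simp add: lq_def Lpe_real nn_integral_count_space_nat)

lemma lq_top_le_iff: "lq top b \<le> B \<longleftrightarrow> (\<forall>j. b j \<le> B)"
  by (simp add: lq_def Lpe_infinity esssup_le_iff AE_count_space)

lemma lq_cmult_le: "0 < q \<Longrightarrow> lq q (\<lambda>j. c * b j) \<le> c * lq q b"
  by (simp add: lq_def Lpe_cmult_le)

lemma lq_mono: "0 < q \<Longrightarrow> (\<And>j. b j \<le> c j) \<Longrightarrow> lq q b \<le> lq q c"
  by (auto simp: lq_def intro!: Lpe_mono_AE)

lemma le_lq:
  assumes "0 < q" shows "b j \<le> lq q b"
  using assms
proof (cases q rule: exponent_cases)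
  case infinite then show ?thesis using lq_top_le_iff[of b "lq top b"] by (simp add: infinity_ennreal_def)
next
  case (finite Q)
  have "epow (b j) Q \<le> (\<Sum>j. epow (b j) Q)"
    using sum_le_suminf[of "\<lambda>j. epow (b j) Q" "{j}"] by simp
  also have "\<dots> \<le> epow (lq q b) Q" using finite lq_real_le_iff[of Q b "lq q b"] by simp
  finally show ?thesis using finite by (simp add: epow_le_cancel)
qed

lemma weighted_lq_norm_eq_lq:
  assumes "0 < q" shows "weighted_lq_norm s q a = lq q (\<lambda>j. ennreal (2 powr (real j * s)) * a j)"
  using assms
proof (cases q rule: exponent_cases)
  case infinite
  have "(SUP j. ennreal (2 powr (real j * s)) * a j) \<le> B \<longleftrightarrow> lq top (\<lambda>j. ennreal (2 powr (real j * s)) * a j) \<le> B" for B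
    by (auto simp: lq_top_le_iff SUP_le_iff)
  with infinite show ?thesis by (simp add: weighted_lq_norm_def) (meson order_antisym order_refl)
next
  case (finite Q)
  then show ?thesis
    by (simp add: weighted_lq_norm_def lq_real epow_mult epow_ennreal powr_powr)
qed

text \<open>The hypothesis says c_j \<le> sup_i 2^(-e|i-j|) b_i, phrased through upper bounds B
  because the estimates fed into it have that form. With a supremum in place of a sum every q > 0
  can be treated: for finite q the q-th power of the supremum is at most the sum of the q-th powers,
  and the double sum is exchanged.\<close>

lemma lq_hardy:
  assumes q: "0 < q" and e: "0 < e"
  obtains C where "0 < C"
    and "\<And>b c. (\<And>j B. (\<And>i. ennreal (2 powr (- e * \<bar>real i - real j\<bar>)) * b i \<le> B) \<Longrightarrow> c j \<le> B)
      \<Longrightarrow> lq q c \<le> ennreal C * lq q b"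
  using q
proof (cases q rule: exponent_cases)
  case infinite
  show thesis
  proof (rule that[of 1])
    fix b c assume *: "\<And>j B. (\<And>i. ennreal (2 powr (- e * \<bar>real i - real j\<bar>)) * b i \<le> B) \<Longrightarrow> c j \<le> B"
    have "c j \<le> lq q b" for j
    proof (rule *)
      fix i
      have "ennreal (2 powr (- e * \<bar>real i - real j\<bar>)) \<le> 1"
        using e powr_mono[of "- e * \<bar>real i - real j\<bar>" 0 2] by simp
      then have "ennreal (2 powr (- e * \<bar>real i - real j\<bar>)) * b i \<le> 1 * b i" by (rule mult_right_mono) simp
      also have "\<dots> \<le> lq q b" using le_lq[OF q] by simp
      finally show "ennreal (2 powr (- e * \<bar>real i - real j\<bar>)) * b i \<le> lq q b" .
    qed
    then show "lq q c \<le> ennreal 1 * lq q b" using infinite by (simp add: lq_top_le_iff)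
  qed simp
next
  case (finite Q)
  \<comment> \<open>The geometric constant for the exponent e Q, since the weights 2^(-e|i-j|) are
    raised to the power Q.\<close>
  define K where "K = 2 / (1 - 2 powr - (e * Q))"
  have K: "0 < K" using e finite by (auto simp: K_def powr_less_one)
  have KQ: "epow (ennreal (K powr (1 / Q))) Q = ennreal K"
    using K finite by (simp add: epow_ennreal powr_powr)
  show thesis
  proof (rule that[of "K powr (1 / Q)"])
    fix b c assume *: "\<And>j B. (\<And>i. ennreal (2 powr (- e * \<bar>real i - real j\<bar>)) * b i \<le> B) \<Longrightarrow> c j \<le> B"
    have eQ: "epow (ennreal (2 powr - (e * t))) Q = ennreal (2 powr - (e * Q * t))" for t
      by (simp add: epow_ennreal powr_powr mult_ac)
    have cj: "epow (c j) Q \<le> (\<Sum>i. ennreal (2 powr (- (e * Q) * \<bar>real i - real j\<bar>)) * epow (b i) Q)" for j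
    proof -
      have "c j \<le> epow (\<Sum>i. epow (ennreal (2 powr (- e * \<bar>real i - real j\<bar>)) * b i) Q) (1 / Q)"
      proof (rule *)
        fix i
        show "ennreal (2 powr (- e * \<bar>real i - real j\<bar>)) * b i
          \<le> epow (\<Sum>i. epow (ennreal (2 powr (- e * \<bar>real i - real j\<bar>)) * b i) Q) (1 / Q)"
          using le_lq[OF q, of "\<lambda>i. ennreal (2 powr (- e * \<bar>real i - real j\<bar>)) * b i" i] finite
          by (simp add: lq_real)
      qed
      then have "epow (c j) Q \<le> epow (epow (\<Sum>i. epow (ennreal (2 powr (- e * \<bar>real i - real j\<bar>)) * b i) Q) (1 / Q)) Q"
        using finite by (intro epow_mono) auto
      then show ?thesis using finite by (simp add: epow_mult eQ)
    qed
    have "(\<Sum>j. epow (c j) Q) \<le> (\<Sum>j. \<Sum>i. ennreal (2 powr (- (e * Q) * \<bar>real i - real j\<bar>)) * epow (b i) Q)"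
      by (intro suminf_le cj) auto
    also have "\<dots> = (\<integral>\<^sup>+j. \<integral>\<^sup>+i. ennreal (2 powr (- (e * Q) * \<bar>real i - real j\<bar>)) * epow (b i) Q
        \<partial>count_space UNIV \<partial>count_space UNIV)"
      by (simp add: nn_integral_count_space_nat)
    also have "\<dots> = (\<integral>\<^sup>+i. \<integral>\<^sup>+j. ennreal (2 powr (- (e * Q) * \<bar>real i - real j\<bar>)) * epow (b i) Q
        \<partial>count_space UNIV \<partial>count_space UNIV)"
      by (rule nn_integral_count_space_nn_integral) auto
    also have "\<dots> = (\<Sum>i. (\<Sum>j. ennreal (2 powr (- (e * Q) * \<bar>real j - real i\<bar>))) * epow (b i) Q)"
      by (subst abs_minus_commute) (simp add: nn_integral_count_space_nat)
    also have "\<dots> \<le> (\<Sum>i. ennreal K * epow (b i) Q)"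
      unfolding K_def using e finite
      by (intro suminf_le mult_right_mono sum_geometric_dist_le) auto
    also have "\<dots> = ennreal K * (\<Sum>i. epow (b i) Q)" by (rule ennreal_suminf_cmult)
    also have "\<dots> = epow (ennreal (K powr (1 / Q)) * lq q b) Q"
      using finite by (simp only: epow_mult KQ lq_real epow_inverse)
    finally show "lq q c \<le> ennreal (K powr (1 / Q)) * lq q b" using finite by (simp add: lq_real_le_iff)
  qed (use K in auto)
qed

subsection \<open>Integration on Euclidean space\<close>

lemma nn_integral_affine:
  fixes t :: "'a::euclidean_space"
  assumes [measurable]: "f \<in> borel_measurable borel" and c: "c \<noteq> 0"
  shows "(\<integral>\<^sup>+x. f x \<partial>lborel) = ennreal (\<bar>c\<bar> ^ DIM('a)) * (\<integral>\<^sup>+x. f (t + c *\<^sub>R x) \<partial>lborel)"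
  by (subst lborel_affine[OF c, of t])
     (simp add: nn_integral_density nn_integral_distr nn_integral_cmult)

lemma integrable_affine:
  fixes t :: "'a::euclidean_space" and f :: "'a \<Rightarrow> 'b::{banach, second_countable_topology}"
  assumes f: "integrable lborel f" and c: "c \<noteq> 0"
  shows "integrable lborel (\<lambda>x. f (t + c *\<^sub>R x))"
proof -
  have [measurable]: "f \<in> borel_measurable borel" using f by auto
  have "ennreal (\<bar>c\<bar> ^ DIM('a)) * (\<integral>\<^sup>+x. norm (f (t + c *\<^sub>R x)) \<partial>lborel) < \<infinity>"
    using f nn_integral_affine[of "\<lambda>x. norm (f x)" c t] c by (simp add: integrable_iff_bounded)
  then have "(\<integral>\<^sup>+x. norm (f (t + c *\<^sub>R x)) \<partial>lborel) < \<infinity>"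
    using c by (auto simp: ennreal_mult_less_top)
  then show ?thesis by (simp add: integrable_iff_bounded)
qed

lemma integral_affine:
  fixes t :: "'a::euclidean_space" and f :: "'a \<Rightarrow> 'b::{banach, second_countable_topology}"
  assumes [measurable]: "f \<in> borel_measurable borel" and c: "c \<noteq> 0"
  shows "integral\<^sup>L lborel f = (\<bar>c\<bar> ^ DIM('a)) *\<^sub>R (LINT x|lborel. f (t + c *\<^sub>R x))"
  by (subst lborel_affine[OF c, of t])
     (simp add: integral_density integral_distr)

lemma integral_lebesgue_eq:
  fixes f :: "'a::euclidean_space \<Rightarrow> 'b::{banach, second_countable_topology}"
  shows "f \<in> borel_measurable borel \<Longrightarrow> integral\<^sup>L lebesgue f = integral\<^sup>L lborel f"
  by (simp add: integral_completion)

section \<open>Polynomial weights\<close>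

definition wt :: "nat \<Rightarrow> 'a::euclidean_space \<Rightarrow> real" where
  "wt N x = 1 / (1 + norm x) ^ N"

lemma wt_pos [simp]: "0 < wt N x" and wt_nonneg [simp]: "0 \<le> wt N x"
  by (auto simp: wt_def add_pos_nonneg intro!: divide_pos_pos)

lemma wt_ne_0 [simp]: "wt N x \<noteq> 0"
  by (metis wt_pos less_irrefl)

lemma wt_le_1: "wt N x \<le> 1"
  unfolding wt_def using one_le_power[of "1 + norm x" N]
  by (metis divide_le_eq_1 le_add_same_cancel1 less_le_trans norm_ge_zero zero_less_one)

lemma wt_antimono: "M \<le> N \<Longrightarrow> wt N x \<le> wt M x"
  unfolding wt_def by (intro divide_left_mono power_increasing) (auto simp: add_pos_nonneg)

lemma wt_minus [simp]: "wt N (- x) = wt N x"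
  by (simp add: wt_def)

lemma measurable_wt [measurable]: "wt N \<in> borel_measurable borel"
  unfolding wt_def[abs_def] by measurable

text \<open>Peetre's inequality: 1 + |x| \<le> (1 + |x+z|)(1 + |z|). A translation of the weight
  costs a polynomial in the translation vector, which rapidly decaying factors absorb.\<close>

lemma wt_peetre: "wt N (x + z) \<le> (1 + norm z) ^ N * wt N x"
proof -
  have "norm x \<le> norm (x + z) + norm z"
    using norm_triangle_ineq4[of "x + z" z] by simp
  moreover have "0 \<le> norm (x + z) * norm z" by simp
  moreover have "(1 + norm (x + z)) * (1 + norm z) = 1 + norm (x + z) + norm z + norm (x + z) * norm z"
    by (simp add: algebra_simps)
  ultimately have "1 + norm x \<le> (1 + norm (x + z)) * (1 + norm z)"
    by linarith
  then have "(1 + norm x) ^ N \<le> (1 + norm (x + z)) ^ N * (1 + norm z) ^ N"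
    by (simp add: power_mult_distrib[symmetric] power_mono)
  then show ?thesis
    by (simp add: wt_def divide_simps add_pos_nonneg mult.commute)
qed

lemma wt_mult_power: "wt (M + N) z * (1 + norm z) ^ N = wt M z"
proof -
  have "(1 + norm z) ^ N \<noteq> 0"
    using add_pos_nonneg[of 1 "norm z"] by (simp add: power_not_zero)
  then show ?thesis by (simp add: wt_def power_add)
qed

text \<open>(1 + |x|)^(2d) dominates the product over the coordinates of 1 + x_b^2, so the weight
  lies below a product of the integrable functions 1 / (1 + t^2).\<close>

lemma nn_integral_wt_finite:
  assumes "2 * DIM('a) \<le> N"
  shows "(\<integral>\<^sup>+x. ennreal (wt N (x::'a::euclidean_space)) \<partial>lborel) < \<infinity>"
proof -
  have 1: "(\<integral>\<^sup>+t. ennreal (inverse (1 + (t::real)\<^sup>2)) \<partial>lborel) < \<infinity>"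
  proof -
    have "integrable lborel (\<lambda>t::real. inverse (1 + t\<^sup>2))"
      using integrable_inverse_1_plus_square by (simp add: set_integrable_def)
    then show ?thesis by (simp add: integrable_iff_bounded abs_of_nonneg)
  qed
  have "(\<integral>\<^sup>+x. ennreal (wt N (x::'a)) \<partial>lborel) \<le> (\<integral>\<^sup>+x. (\<Prod>b\<in>(Basis::'a set). ennreal (inverse (1 + (x \<bullet> b)\<^sup>2))) \<partial>lborel)"
  proof (rule nn_integral_mono)
    fix x :: 'a
    have "(\<Prod>b\<in>(Basis::'a set). 1 + (x \<bullet> b)\<^sup>2) \<le> (\<Prod>b\<in>(Basis::'a set). (1 + norm x)\<^sup>2)"
    proof (rule prod_mono, safe)
      fix b :: 'a assume "b \<in> Basis"
      then have "\<bar>x \<bullet> b\<bar> \<le> norm x" by (rule Basis_le_norm)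
      then have "(x \<bullet> b)\<^sup>2 \<le> (norm x)\<^sup>2" by (metis abs_ge_zero power2_abs power_mono)
      moreover have "(1 + norm x)\<^sup>2 = 1 + 2 * norm x + (norm x)\<^sup>2" by (simp add: power2_sum)
      ultimately show "1 + (x \<bullet> b)\<^sup>2 \<le> (1 + norm x)\<^sup>2" using norm_ge_zero[of x] by linarith
    qed auto
    also have "\<dots> = (1 + norm x) ^ (2 * DIM('a))" by (simp add: power_mult)
    finally have "wt (2 * DIM('a)) x \<le> inverse (\<Prod>b\<in>(Basis::'a set). 1 + (x \<bullet> b)\<^sup>2)"
      unfolding wt_def inverse_eq_divide by (intro divide_left_mono mult_pos_pos prod_pos) (auto simp: add_pos_nonneg)
    then have "wt N x \<le> (\<Prod>b\<in>(Basis::'a set). inverse (1 + (x \<bullet> b)\<^sup>2))"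
      using wt_antimono[OF assms, of x] by (simp add: prod_inversef[symmetric] o_def)
    then show "ennreal (wt N x) \<le> (\<Prod>b\<in>(Basis::'a set). ennreal (inverse (1 + (x \<bullet> b)\<^sup>2)))"
      by (simp add: prod_ennreal ennreal_leI)
  qed
  also have "\<dots> = (\<Prod>b\<in>(Basis::'a set). (\<integral>\<^sup>+t. ennreal (inverse (1 + (t::real)\<^sup>2)) \<partial>lborel))"
    by (rule nn_integral_lborel_prod) auto
  also have "\<dots> < \<infinity>" using 1 by (simp add: ennreal_prod_eq_top less_top[symmetric] power_eq_top_ennreal)
  finally show ?thesis .
qed

lemma integrable_wt:
  "2 * DIM('a) \<le> N \<Longrightarrow> integrable lborel (wt N :: 'a::euclidean_space \<Rightarrow> real)"
  using nn_integral_wt_finite[where 'a='a] by (simp add: integrable_iff_bounded)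

subsection \<open>Compactly supported smooth functions\<close>

text \<open>The class for integration, inversion and multipliers; the dyadic functions of all levels
  are handled in it. Smoothness is exploited only for the generator, through
  \<open>test_fun\<close>; the kernels of the other levels inherit decay and regularity by
  scaling.\<close>

definition cont_cs :: "('a::euclidean_space \<Rightarrow> complex) \<Rightarrow> bool" where
  "cont_cs f \<longleftrightarrow> continuous_on UNIV f \<and> (\<exists>R. \<forall>x. R \<le> norm x \<longrightarrow> f x = 0)"

definition test_fun :: "('a::euclidean_space \<Rightarrow> complex) \<Rightarrow> bool" where
  "test_fun f \<longleftrightarrow> smooth f \<and> (\<exists>R. \<forall>x. R \<le> norm x \<longrightarrow> f x = 0)"

lemma cont_cs_radius:
  assumes "cont_cs f" shows "\<exists>R>0. \<forall>x. R \<le> norm x \<longrightarrow> f x = 0"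
proof -
  from assms obtain R where "\<And>x. R \<le> norm x \<Longrightarrow> f x = 0" by (auto simp: cont_cs_def)
  then show ?thesis by (intro exI[of _ "max R 1"]) auto
qed

lemma cont_cs_bounded:
  assumes "cont_cs f" shows "\<exists>B>0. \<forall>x. norm (f x) \<le> B"
proof -
  obtain R where R: "0 < R" "\<And>x. R \<le> norm x \<Longrightarrow> f x = 0" using cont_cs_radius[OF assms] by blast
  have "compact (f ` cball 0 R)"
    using assms by (intro compact_continuous_image) (auto simp: cont_cs_def intro: continuous_on_subset)
  then have "bounded (f ` cball 0 R)" by (rule compact_imp_bounded)
  then obtain B where "\<forall>y\<in>f ` cball 0 R. norm y \<le> B"
    unfolding bounded_iff by blast
  then have B: "\<And>x. x \<in> cball 0 R \<Longrightarrow> norm (f x) \<le> B" by blast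
  have "norm (f x) \<le> max B 1" for x
    using B[of x] R(2)[of x] by (cases "norm x \<le> R") auto
  then show ?thesis by (intro exI[of _ "max B 1"]) auto
qed

lemma cont_cs_measurable: "cont_cs f \<Longrightarrow> f \<in> borel_measurable borel"
  by (auto simp: cont_cs_def intro: borel_measurable_continuous_onI)

lemma cont_cs_decay:
  assumes "cont_cs f" shows "\<exists>C>0. \<forall>x. norm (f x) \<le> C * wt N x"
proof -
  obtain R where R: "0 < R" "\<And>x. R \<le> norm x \<Longrightarrow> f x = 0" using cont_cs_radius[OF assms] by blast
  obtain B where B: "0 < B" "\<And>x. norm (f x) \<le> B" using cont_cs_bounded[OF assms] by blast
  show ?thesis
  proof (intro exI[of _ "B * (1 + R) ^ N"] conjI allI)
    fix x
    show "norm (f x) \<le> B * (1 + R) ^ N * wt N x"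
    proof (cases "R \<le> norm x")
      case True then show ?thesis using R B by simp
    next
      case False
      then have "1 \<le> (1 + R) ^ N * wt N x"
        by (simp add: wt_def divide_simps add_pos_nonneg power_mono)
      then have "B * 1 \<le> B * ((1 + R) ^ N * wt N x)" using B by (intro mult_left_mono) auto
      then show ?thesis using B(2)[of x] by (simp add: mult.assoc)
    qed
  qed (use R B in auto)
qed

lemma integrable_wt_bound:
  fixes f :: "'a::euclidean_space \<Rightarrow> 'b::{banach, second_countable_topology}"
  assumes [measurable]: "f \<in> borel_measurable borel" and "\<And>x. norm (f x) \<le> C * wt (2 * DIM('a)) x"
  shows "integrable lborel f"
proof (rule Bochner_Integration.integrable_bound)
  show "integrable lborel (\<lambda>x::'a. C * wt (2 * DIM('a)) x)"
    by (intro integrable_mult_right integrable_wt order_refl)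
  show "AE x in lborel. norm (f x) \<le> norm (C * wt (2 * DIM('a)) x)"
    by (intro AE_I2) (simp add: order_trans[OF assms(2) abs_ge_self])
qed simp

lemma cont_cs_integrable: "cont_cs f \<Longrightarrow> integrable lborel (f :: 'a::euclidean_space \<Rightarrow> complex)"
proof -
  assume f: "cont_cs f"
  obtain C where "\<And>x. norm (f x) \<le> C * wt (2 * DIM('a)) x"
    using cont_cs_decay[OF f] by blast
  with cont_cs_measurable[OF f] show ?thesis by (rule integrable_wt_bound)
qed

lemma cont_cs_mult: "cont_cs f \<Longrightarrow> continuous_on UNIV g \<Longrightarrow> cont_cs (\<lambda>x. g x * f x)"
  unfolding cont_cs_def by (auto intro: continuous_on_mult) 

section \<open>Iterated derivatives of smooth functions\<close>

lemma iter_deriv_append: "iter_deriv (as @ bs) f = iter_deriv as (iter_deriv bs f)"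
  by (induction as) auto

lemma smooth_differentiable: "smooth f \<Longrightarrow> f differentiable (at x)"
  unfolding smooth_def by (elim allE[of _ "[]"] allE[of _ x]) auto

lemma smooth_iter_deriv: "smooth f \<Longrightarrow> set bs \<subseteq> Basis \<Longrightarrow> smooth (iter_deriv bs f)"
  unfolding smooth_def iter_deriv_append[symmetric] by auto

lemma smooth_continuous: "smooth f \<Longrightarrow> continuous_on UNIV f"
  by (intro continuous_at_imp_continuous_on ballI differentiable_imp_continuous_within smooth_differentiable)

lemma test_fun_cont_cs: "test_fun f \<Longrightarrow> cont_cs f"
  by (auto simp: test_fun_def cont_cs_def smooth_continuous)

lemma frechet_derivative_works': "f differentiable (at x) \<Longrightarrow> (f has_derivative frechet_derivative f (at x)) (at x)"
  by (simp add: frechet_derivative_works)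

lemma test_fun_deriv:
  assumes f: "test_fun f" and b: "b \<in> Basis"
  shows "test_fun (\<lambda>x. frechet_derivative f (at x) b)"
proof -
  obtain R where R: "\<And>x. R \<le> norm x \<Longrightarrow> f x = 0" using f by (auto simp: test_fun_def)
  \<comment> \<open>The margin 1 leaves a whole ball around x on which f vanishes, which determines
    the derivative at x.\<close>
  have "frechet_derivative f (at x) b = 0" if x: "R + 1 \<le> norm x" for x
  proof -
    have "(f has_derivative (\<lambda>h. 0)) (at x)"
    proof (rule has_derivative_transform_within_open[of "\<lambda>_. 0" _ _ _ "ball x 1"])
      fix y assume "y \<in> ball x 1"
      then have "norm (x - y) < 1" by (simp add: dist_norm)
      then have "R \<le> norm y" using norm_triangle_ineq2[of x "x - y"] x by simp
      then show "0 = f y" using R by simp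
    qed auto
    then show ?thesis by (metis frechet_derivative_at)
  qed
  moreover have "smooth (iter_deriv [b] f)" using f b by (intro smooth_iter_deriv) (auto simp: test_fun_def)
  ultimately show ?thesis by (auto simp: test_fun_def)
qed

text \<open>Leibniz' rule: \<open>L\<close> collects the terms in which one derivative falls on the coordinate factor.\<close>

lemma iter_deriv_coordinate_mult:
  assumes f: "smooth f" and bs: "set bs \<subseteq> Basis"
  shows "\<exists>L::(complex \<times> 'a list) list. (\<forall>(c, l)\<in>set L. set l \<subseteq> Basis) \<and>
    iter_deriv bs (\<lambda>x. a * of_real (x \<bullet> b) * f x) =
      (\<lambda>x::'a::euclidean_space. a * of_real (x \<bullet> b) * iter_deriv bs f x + (\<Sum>(c, l)\<leftarrow>L. c * iter_deriv l f x))"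
  using bs
proof (induction bs)
  case Nil then show ?case by (intro exI[of _ "[]"]) auto
next
  case (Cons e bs)
  then obtain L where L: "\<forall>(c, l)\<in>set L. set l \<subseteq> Basis"
    and eq: "iter_deriv bs (\<lambda>x. a * of_real (x \<bullet> b) * f x) =
      (\<lambda>x. a * of_real (x \<bullet> b) * iter_deriv bs f x + (\<Sum>(c, l)\<leftarrow>L. c * iter_deriv l f x))" by auto
  define L' where "L' = (a * of_real (e \<bullet> b), bs) # map (\<lambda>(c, l). (c, e # l)) L"
  have d: "(iter_deriv l f has_derivative frechet_derivative (iter_deriv l f) (at x)) (at x)"
    if "set l \<subseteq> Basis" for l x
    using f that by (intro frechet_derivative_works') (auto simp: smooth_def)
  have dL: "((\<lambda>x. \<Sum>(c, l)\<leftarrow>L. c * iter_deriv l f x) has_derivative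
      (\<lambda>h. \<Sum>(c, l)\<leftarrow>L. c * frechet_derivative (iter_deriv l f) (at x) h)) (at x)" for x
    using L
  proof (induction L)
    case (Cons cl L)
    obtain c l where "cl = (c, l)" by (cases cl)
    with Cons d[of l x] show ?case by (auto intro!: derivative_eq_intros)
  qed auto
  have "((\<lambda>x. a * of_real (x \<bullet> b) * iter_deriv bs f x + (\<Sum>(c, l)\<leftarrow>L. c * iter_deriv l f x)) has_derivative
      (\<lambda>h. a * of_real (x \<bullet> b) * frechet_derivative (iter_deriv bs f) (at x) h
        + a * of_real (h \<bullet> b) * iter_deriv bs f x
        + (\<Sum>(c, l)\<leftarrow>L. c * frechet_derivative (iter_deriv l f) (at x) h))) (at x)" for x
    using Cons.prems by (auto intro!: derivative_eq_intros d dL)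
  from frechet_derivative_at[OF this]
  have "iter_deriv (e # bs) (\<lambda>x. a * of_real (x \<bullet> b) * f x) =
      (\<lambda>x. a * of_real (x \<bullet> b) * iter_deriv (e # bs) f x + (\<Sum>(c, l)\<leftarrow>L'. c * iter_deriv l f x))"
    by (simp add: eq L'_def fun_eq_iff o_def case_prod_beta' flip: add.assoc)
  moreover have "\<forall>(c, l)\<in>set L'. set l \<subseteq> Basis"
    using L Cons.prems by (force simp: L'_def)
  ultimately show ?case by blast
qed

text \<open>Differentiating a Fourier transform multiplies its argument by a coordinate; closure
  under this operation lets derivatives of the transform be iterated.\<close>

lemma test_fun_coordinate_mult:
  assumes f: "test_fun f"
  shows "test_fun (\<lambda>x::'a::euclidean_space. a * of_real (x \<bullet> b) * f x)"
proof -
  have sm: "smooth f" using f by (simp add: test_fun_def)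
  have dL: "(\<lambda>x. \<Sum>(c, l)\<leftarrow>L. c * iter_deriv l f x) differentiable (at x)"
    if "\<forall>(c, l)\<in>set L. set l \<subseteq> Basis" for L :: "(complex \<times> 'a list) list" and x
    using that
  proof (induction L)
    case (Cons cl L)
    obtain c l where cl: "cl = (c, l)" by (cases cl)
    with Cons sm have "iter_deriv l f differentiable (at x)" by (simp add: smooth_def)
    with Cons cl show ?case by (auto intro!: differentiable_add differentiable_mult)
  qed auto
  have "(\<lambda>x. of_real (x \<bullet> b) :: complex) differentiable (at x)" for x
    by (rule differentiableI[of _ "\<lambda>h. of_real (h \<bullet> b)"]) (auto intro!: derivative_eq_intros)
  note dc = this
  have "smooth (\<lambda>x. a * of_real (x \<bullet> b) * f x)"
    unfolding smooth_def
  proof (intro allI impI)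
    fix bs :: "'a list" and x assume bs: "set bs \<subseteq> Basis"
    obtain L :: "(complex \<times> 'a list) list" where L: "\<forall>(c, l)\<in>set L. set l \<subseteq> Basis"
      and eq: "iter_deriv bs (\<lambda>x. a * of_real (x \<bullet> b) * f x) =
        (\<lambda>x. a * of_real (x \<bullet> b) * iter_deriv bs f x + (\<Sum>(c, l)\<leftarrow>L. c * iter_deriv l f x))"
      using iter_deriv_coordinate_mult[OF sm bs, of a b] by blast
    have "iter_deriv bs f differentiable (at x)" using sm bs by (simp add: smooth_def)
    then show "iter_deriv bs (\<lambda>x. a * of_real (x \<bullet> b) * f x) differentiable (at x)"
      unfolding eq by (intro differentiable_add differentiable_mult dc dL L) auto
  qed
  with f show ?thesis by (auto simp: test_fun_def)
qed

lemma norm_diff_le_partials: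
  fixes f :: "'a::euclidean_space \<Rightarrow> complex"
  assumes "convex S" "\<And>x. x \<in> S \<Longrightarrow> f differentiable (at x)"
    and "\<And>x b. x \<in> S \<Longrightarrow> b \<in> Basis \<Longrightarrow> norm (frechet_derivative f (at x) b) \<le> B"
    and "x \<in> S" "y \<in> S"
  shows "norm (f x - f y) \<le> (real DIM('a) * B) * norm (x - y)"
proof (rule differentiable_bound[of S f "\<lambda>x. frechet_derivative f (at x)"])
  fix x assume x: "x \<in> S"
  then have d: "(f has_derivative frechet_derivative f (at x)) (at x)"
    using assms(2) by (intro frechet_derivative_works')
  then show "(f has_derivative frechet_derivative f (at x)) (at x within S)"
    by (rule has_derivative_at_withinI)
  have "onorm (frechet_derivative f (at x)) \<le> (\<Sum>i\<in>Basis. norm (frechet_derivative f (at x) i))"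
    using d by (intro onorm_componentwise) (rule has_derivative_bounded_linear)
  also have "\<dots> \<le> real DIM('a) * B" using assms(3)[OF x] by (rule sum_bounded_above)
  finally show "onorm (frechet_derivative f (at x)) \<le> real DIM('a) * B" .
qed (use assms in auto)

subsection \<open>The Fourier transform of test functions\<close>

definition fconst :: "'a::euclidean_space itself \<Rightarrow> real" where
  "fconst _ = (2 * pi) powr (- real DIM('a) / 2)"

lemma fconst_pos [simp]: "0 < fconst TYPE('a::euclidean_space)"
  by (simp add: fconst_def)

lemma fourier_eq:
  fixes u :: "'a::euclidean_space \<Rightarrow> complex"
  assumes [measurable]: "u \<in> borel_measurable borel"
  shows "fourier u \<xi> = of_real (fconst TYPE('a)) * (LINT x|lborel. cis (- (x \<bullet> \<xi>)) * u x)"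
  unfolding fourier_def fconst_def by (subst integral_lebesgue_eq) (auto simp: cis_conv_exp)

lemma inv_fourier_eq:
  fixes u :: "'a::euclidean_space \<Rightarrow> complex"
  assumes [measurable]: "u \<in> borel_measurable borel"
  shows "inv_fourier u \<xi> = of_real (fconst TYPE('a)) * (LINT x|lborel. cis (x \<bullet> \<xi>) * u x)"
  unfolding inv_fourier_def fconst_def by (subst integral_lebesgue_eq) (auto simp: cis_conv_exp)

lemma measurable_cis [measurable]: "f \<in> borel_measurable M \<Longrightarrow> (\<lambda>x. cis (f x)) \<in> borel_measurable M"
  unfolding cis_conv_exp by measurable

lemma integrable_cis_mult:
  assumes f: "integrable M f" and [measurable]: "g \<in> borel_measurable M"
  shows "integrable M (\<lambda>x. cis (g x) * f x)"
  by (rule Bochner_Integration.integrable_bound[OF f]) (use f in \<open>auto simp: norm_mult\<close>)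

lemma norm_fourier_le:
  fixes u :: "'a::euclidean_space \<Rightarrow> complex"
  assumes u: "integrable lborel u"
  shows "norm (fourier u \<xi>) \<le> fconst TYPE('a) * (LINT x|lborel. norm (u x))"
proof -
  have "norm (fourier u \<xi>) = fconst TYPE('a) * norm (LINT x|lborel. cis (- (x \<bullet> \<xi>)) * u x)"
    using u less_imp_le[OF fconst_pos[where 'a='a]] by (subst fourier_eq) (auto simp: norm_mult)
  also have "\<dots> \<le> fconst TYPE('a) * (LINT x|lborel. norm (cis (- (x \<bullet> \<xi>)) * u x))"
    by (intro mult_left_mono integral_norm_bound less_imp_le[OF fconst_pos])
  finally show ?thesis by (simp add: norm_mult)
qed

lemma norm_cis_remainder: "norm (cis (- t) - 1 + \<i> * of_real t) \<le> t\<^sup>2"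
proof -
  have "norm (cis (- t) - 1 + \<i> * of_real t) \<le> \<bar>- t\<bar> ^ Suc 1 / fact (Suc 1)"
    using iexp_approx1[of "- t" 1] by (simp add: cis_conv_exp algebra_simps)
  also have "\<dots> \<le> t\<^sup>2" by (simp add: power2_eq_square)
  finally show ?thesis .
qed

lemma cont_cs_coordinate_mult: "cont_cs f \<Longrightarrow> cont_cs (\<lambda>x. a * of_real (x \<bullet> h) * f x)"
  by (rule cont_cs_mult) (auto intro!: continuous_intros)

text \<open>Differentiation under the integral sign: the second-order remainder of the exponential
  is at most |x.h|^2, and f has a finite second moment, so the error is O(|h|^2).\<close>

lemma fourier_has_derivative:
  fixes f :: "'a::euclidean_space \<Rightarrow> complex"
  assumes f: "cont_cs f"
  shows "(fourier f has_derivative (\<lambda>h. fourier (\<lambda>x. - \<i> * of_real (x \<bullet> h) * f x) \<xi>)) (at \<xi>)"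
proof (rule has_derivativeI_sandwich[where e = 1])
  have [measurable]: "f \<in> borel_measurable borel" using f by (rule cont_cs_measurable)
  let ?L = "\<lambda>h. fourier (\<lambda>x. - \<i> * of_real (x \<bullet> h) * f x) \<xi>"
  have int: "integrable lborel (\<lambda>x. cis (g x) * (- \<i> * of_real (x \<bullet> h) * f x))"
    if [measurable]: "g \<in> borel_measurable borel" for h g
    by (intro integrable_cis_mult cont_cs_integrable cont_cs_coordinate_mult f) simp
  have intf: "integrable lborel (\<lambda>x. cis (g x) * f x)" if [measurable]: "g \<in> borel_measurable borel" for g
    by (intro integrable_cis_mult cont_cs_integrable f) simp
  have xf: "integrable lborel (\<lambda>x. norm x ^ k * norm (f x))" for k
  proof -
    have "cont_cs (\<lambda>x. of_real (norm x ^ k) * f x)"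
      by (rule cont_cs_mult[OF f]) (intro continuous_intros)
    from integrable_norm[OF cont_cs_integrable[OF this]] show ?thesis
      by (simp add: norm_mult norm_power)
  qed
  show "bounded_linear ?L"
  proof (rule bounded_linear_intro)
    show "?L (h + h') = ?L h + ?L h'" for h h'
      using int[of "\<lambda>x. - (x \<bullet> \<xi>)" h] int[of "\<lambda>x. - (x \<bullet> \<xi>)" h']
      by (simp add: fourier_eq inner_add_right algebra_simps)
    show "?L (r *\<^sub>R h) = r *\<^sub>R ?L h" for r h
    proof -
      have "cis (- (x \<bullet> \<xi>)) * (- \<i> * of_real (x \<bullet> (r *\<^sub>R h)) * f x)
          = of_real r * (cis (- (x \<bullet> \<xi>)) * (- \<i> * of_real (x \<bullet> h) * f x))" for x by simp
      then have "(LINT x|lborel. cis (- (x \<bullet> \<xi>)) * (- \<i> * of_real (x \<bullet> (r *\<^sub>R h)) * f x))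
          = of_real r * (LINT x|lborel. cis (- (x \<bullet> \<xi>)) * (- \<i> * of_real (x \<bullet> h) * f x))"
        by (simp only: integral_mult_right_zero)
      then show ?thesis by (subst (1 2) fourier_eq) (simp_all add: scaleR_conv_of_real)
    qed
    show "norm (?L h) \<le> norm h * (fconst TYPE('a) * (LINT x|lborel. norm x ^ 1 * norm (f x)))" for h
    proof -
      have "norm (?L h) \<le> fconst TYPE('a) * (LINT x|lborel. norm (- \<i> * of_real (x \<bullet> h) * f x))"
        by (intro norm_fourier_le cont_cs_integrable cont_cs_coordinate_mult f)
      also have "\<dots> \<le> fconst TYPE('a) * (LINT x|lborel. norm h * (norm x ^ 1 * norm (f x)))"
      proof (intro mult_left_mono integral_mono)
        show "norm (- \<i> * of_real (x \<bullet> h) * f x) \<le> norm h * (norm x ^ 1 * norm (f x))" for x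
          using mult_right_mono[OF Cauchy_Schwarz_ineq2[of x h], of "norm (f x)"]
          by (simp add: norm_mult mult_ac)
      qed (use xf[of 1] cont_cs_integrable[OF cont_cs_coordinate_mult[OF f]] fconst_pos[where 'a='a] in
            \<open>auto intro: integrable_norm less_imp_le\<close>)
      finally show ?thesis unfolding integral_mult_right_zero by (simp only: mult.left_commute)
    qed
  qed
  define K where "K = fconst TYPE('a) * (LINT x|lborel. norm x ^ 2 * norm (f x))"
  show "norm (fourier f y - fourier f \<xi> - ?L (y - \<xi>)) / norm (y - \<xi>) \<le> norm (y - \<xi>) * K"
    if "y \<noteq> \<xi>" for y
  proof -
    define h where "h = y - \<xi>"
    have "norm (fourier f y - fourier f \<xi> - ?L h)
        = norm (fourier (\<lambda>x. (cis (- (x \<bullet> h)) - 1 + \<i> * of_real (x \<bullet> h)) * f x) \<xi>)"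
    proof -
      have eq: "cis (- (x \<bullet> \<xi>)) * ((cis (- (x \<bullet> h)) - 1 + \<i> * of_real (x \<bullet> h)) * f x)
        = cis (- (x \<bullet> y)) * f x - cis (- (x \<bullet> \<xi>)) * f x - cis (- (x \<bullet> \<xi>)) * (- \<i> * of_real (x \<bullet> h) * f x)" for x
        by (simp add: h_def inner_diff_right algebra_simps cis_mult)
      show ?thesis
        using int[of "\<lambda>x. - (x \<bullet> \<xi>)" h] intf[of "\<lambda>x. - (x \<bullet> \<xi>)"] intf[of "\<lambda>x. - (x \<bullet> y)"]
        by (subst (1 2 3 4) fourier_eq) (auto simp: eq right_diff_distrib distrib_left)
    qed
    also have "\<dots> \<le> fconst TYPE('a) * (LINT x|lborel. norm ((cis (- (x \<bullet> h)) - 1 + \<i> * of_real (x \<bullet> h)) * f x))"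
      by (intro norm_fourier_le cont_cs_integrable cont_cs_mult f)
        (auto simp: cis_conv_exp intro!: continuous_intros)
    also have "\<dots> \<le> fconst TYPE('a) * (LINT x|lborel. (norm h)\<^sup>2 * (norm x ^ 2 * norm (f x)))"
    proof (intro mult_left_mono integral_mono)
      show "norm ((cis (- (x \<bullet> h)) - 1 + \<i> * of_real (x \<bullet> h)) * f x) \<le> (norm h)\<^sup>2 * (norm x ^ 2 * norm (f x))" for x
      proof -
        have "(x \<bullet> h)\<^sup>2 \<le> (norm x * norm h)\<^sup>2"
          using power_mono[OF Cauchy_Schwarz_ineq2[of x h], of 2] by simp
        then have "norm (cis (- (x \<bullet> h)) - 1 + \<i> * of_real (x \<bullet> h)) \<le> (norm x * norm h)\<^sup>2"
          using norm_cis_remainder[of "x \<bullet> h"] by linarith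
        from mult_right_mono[OF this, of "norm (f x)"] show ?thesis
          by (simp add: norm_mult power_mult_distrib mult_ac)
      qed
      show "integrable lborel (\<lambda>x. norm ((cis (- (x \<bullet> h)) - 1 + \<i> * of_real (x \<bullet> h)) * f x))"
        by (intro integrable_norm cont_cs_integrable cont_cs_mult f)
          (auto simp: cis_conv_exp intro!: continuous_intros)
    qed (use xf[of 2] fconst_pos[where 'a='a] in \<open>auto intro: less_imp_le\<close>)
    also have "\<dots> = norm h * (norm h * K)" by (simp add: K_def power2_eq_square)
    finally show ?thesis using that by (simp add: h_def divide_le_eq mult_ac)
  qed
  show "((\<lambda>y. norm (y - \<xi>) * K) \<longlongrightarrow> 0) (at \<xi>)"
    by (auto intro!: tendsto_eq_intros)
qed auto

lemma fourier_frechet_derivative: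
  "cont_cs f \<Longrightarrow> frechet_derivative (fourier f) (at \<xi>) b = fourier (\<lambda>x. - \<i> * of_real (x \<bullet> b) * f x) \<xi>"
  using fun_cong[OF frechet_derivative_at[OF fourier_has_derivative], of f b \<xi>] by simp

text \<open>Derivatives of a transform are again transforms of test functions, so that smoothness
  and decay have to be proved only for transforms themselves.\<close>

lemma iter_deriv_fourier:
  assumes "test_fun f" "set bs \<subseteq> Basis"
  shows "\<exists>f'. test_fun f' \<and> iter_deriv bs (fourier f) = fourier f'"
  using assms(2)
proof (induction bs)
  case Nil with assms show ?case by auto
next
  case (Cons b bs)
  then obtain f' where "test_fun f'" "iter_deriv bs (fourier f) = fourier f'" by auto
  moreover from this have "test_fun (\<lambda>x. - \<i> * of_real (x \<bullet> b) * f' x)"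
    by (intro test_fun_coordinate_mult)
  ultimately show ?case
    by (intro exI[of _ "\<lambda>x. - \<i> * of_real (x \<bullet> b) * f' x"])
      (simp add: fourier_frechet_derivative test_fun_cont_cs)
qed

lemma smooth_fourier: "test_fun f \<Longrightarrow> smooth (fourier (f :: 'a::euclidean_space \<Rightarrow> complex))"
  unfolding smooth_def
proof (intro allI impI)
  fix bs :: "'a list" and x assume "test_fun f" "set bs \<subseteq> Basis"
  then obtain f' where "test_fun f'" "iter_deriv bs (fourier f) = fourier f'"
    using iter_deriv_fourier by blast
  then show "iter_deriv bs (fourier f) differentiable (at x)"
    by (auto intro!: differentiableI fourier_has_derivative test_fun_cont_cs)
qed

text \<open>By translation invariance the transform of f(. + t b) is cis(t \<xi>.b) times that of f.
  Dividing the difference by t and letting t tend to 0 gives the derivative on one side and the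
  factor i \<xi>.b on the other.\<close>

lemma fourier_deriv:
  fixes f :: "'a::euclidean_space \<Rightarrow> complex"
  assumes f: "test_fun f" and b: "b \<in> Basis"
  shows "fourier (\<lambda>x. frechet_derivative f (at x) b) \<xi> = \<i> * of_real (\<xi> \<bullet> b) * fourier f \<xi>"
proof -
  have cf: "cont_cs f" and cd: "cont_cs (\<lambda>x. frechet_derivative f (at x) e)" if "e \<in> Basis" for e
    using f that by (auto intro: test_fun_cont_cs test_fun_deriv)
  have cf: "cont_cs f" using f by (rule test_fun_cont_cs)
  note [measurable] = cont_cs_measurable[OF cf] cont_cs_measurable[OF cd[OF b]]
  have df: "f differentiable (at x)" for x using f by (auto simp: test_fun_def smooth_differentiable)
  obtain R where R: "0 < R" "\<And>x. R \<le> norm x \<Longrightarrow> f x = 0" using cont_cs_radius[OF cf] by blast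
  have "\<exists>B. \<forall>x. norm (frechet_derivative f (at x) e) \<le> B" if "e \<in> Basis" for e
    using cont_cs_bounded[OF cd[OF that]] by blast
  then obtain B where B: "\<And>e x. e \<in> Basis \<Longrightarrow> norm (frechet_derivative f (at x) e) \<le> B e" by metis
  define D where "D = real DIM('a) * (\<Sum>e\<in>Basis. B e)"
  have Bn: "0 \<le> B e" if "e \<in> Basis" for e using B[OF that, of 0] norm_ge_zero by (rule order_trans[rotated])
  have lip: "norm (f x - f y) \<le> D * norm (x - y)" for x y
    unfolding D_def
  proof (rule norm_diff_le_partials[of UNIV])
    show "norm (frechet_derivative f (at x) e) \<le> (\<Sum>e\<in>Basis. B e)" if "e \<in> Basis" for x e
      using B[OF that, of x] member_le_sum[of e Basis B] that Bn by simp
  qed (use df in auto)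
  \<comment> \<open>Step sizes at most 1: the shifted supports stay in the ball of radius R + 1, on
    which the Lipschitz constant D dominates all difference quotients.\<close>
  define t where "t n = 1 / (real n + 1)" for n
  have t: "0 < t n" "t n \<le> 1" for n by (auto simp: t_def divide_simps)
  have t0: "t \<longlonglongrightarrow> 0" unfolding t_def using LIMSEQ_inverse_real_of_nat by (simp add: inverse_eq_divide add.commute)
  have sft: "integrable lborel (\<lambda>x. cis (- (x \<bullet> \<xi>)) * f (x + s *\<^sub>R b))" for s
    using integrable_affine[OF cont_cs_integrable[OF cf], of 1 "s *\<^sub>R b"]
    by (intro integrable_cis_mult) (auto simp: add.commute)
  have q: "(LINT x|lborel. cis (- (x \<bullet> \<xi>)) * ((f (x + t n *\<^sub>R b) - f x) / of_real (t n)))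
      = (cis (t n * (\<xi> \<bullet> b)) - 1) / of_real (t n) * (LINT x|lborel. cis (- (x \<bullet> \<xi>)) * f x)" for n
  proof -
    have "(LINT x|lborel. cis (- (x \<bullet> \<xi>)) * f x)
      = (LINT x|lborel. cis (- ((t n *\<^sub>R b + 1 *\<^sub>R x) \<bullet> \<xi>)) * f (t n *\<^sub>R b + 1 *\<^sub>R x))"
      by (subst integral_affine[of _ 1 "t n *\<^sub>R b"]) auto
    also have "\<dots> = (LINT x|lborel. cis (- (t n * (\<xi> \<bullet> b))) * (cis (- (x \<bullet> \<xi>)) * f (x + t n *\<^sub>R b)))"
      by (intro Bochner_Integration.integral_cong)
        (auto simp: inner_add_left inner_commute[of b] add.commute cis_mult mult.assoc[symmetric])
    also have "\<dots> = cis (- (t n * (\<xi> \<bullet> b))) * (LINT x|lborel. cis (- (x \<bullet> \<xi>)) * f (x + t n *\<^sub>R b))"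
      using sft by simp
    finally have "cis (t n * (\<xi> \<bullet> b)) * (LINT x|lborel. cis (- (x \<bullet> \<xi>)) * f x)
      = cis (t n * (\<xi> \<bullet> b)) * cis (- (t n * (\<xi> \<bullet> b))) * (LINT x|lborel. cis (- (x \<bullet> \<xi>)) * f (x + t n *\<^sub>R b))"
      by (simp only: mult.assoc)
    then have s: "(LINT x|lborel. cis (- (x \<bullet> \<xi>)) * f (x + t n *\<^sub>R b))
      = cis (t n * (\<xi> \<bullet> b)) * (LINT x|lborel. cis (- (x \<bullet> \<xi>)) * f x)"
      by (simp add: cis_mult)
    have "(LINT x|lborel. cis (- (x \<bullet> \<xi>)) * ((f (x + t n *\<^sub>R b) - f x) / of_real (t n)))
      = (LINT x|lborel. (cis (- (x \<bullet> \<xi>)) * f (x + t n *\<^sub>R b) - cis (- (x \<bullet> \<xi>)) * f x) / of_real (t n))"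
      by (simp add: right_diff_distrib)
    also have "\<dots> = ((LINT x|lborel. cis (- (x \<bullet> \<xi>)) * f (x + t n *\<^sub>R b)) - (LINT x|lborel. cis (- (x \<bullet> \<xi>)) * f x)) / of_real (t n)"
      using sft[of "t n"] sft[of 0] by simp
    also have "\<dots> = (cis (t n * (\<xi> \<bullet> b)) - 1) / of_real (t n) * (LINT x|lborel. cis (- (x \<bullet> \<xi>)) * f x)"
      by (simp add: s algebra_simps)
    finally show ?thesis .
  qed
  have "(\<lambda>n. LINT x|lborel. cis (- (x \<bullet> \<xi>)) * ((f (x + t n *\<^sub>R b) - f x) / of_real (t n)))
     \<longlonglongrightarrow> (LINT x|lborel. cis (- (x \<bullet> \<xi>)) * frechet_derivative f (at x) b)"
  proof (rule integral_dominated_convergence[where w = "\<lambda>x::'a. D * indicator (cball 0 (R + 1)) x"])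
    show "integrable lborel (\<lambda>x::'a. D * indicator (cball 0 (R + 1)) x :: real)"
      using emeasure_lborel_cball_finite[of "0::'a" "R + 1"]
      by (intro integrable_mult_right integrable_real_indicator) auto
    have "(\<lambda>n. (f (x + t n *\<^sub>R b) - f x) / of_real (t n)) \<longlonglongrightarrow> frechet_derivative f (at x) b" for x
    proof -
      let ?f' = "frechet_derivative f (at x)"
      have "((\<lambda>y. ((f y - f x) - ?f' (y - x)) /\<^sub>R norm (y - x)) \<longlongrightarrow> 0) (at x)"
        using frechet_derivative_works'[OF df[of x]] by (simp add: has_derivative_at_within)
      moreover have "filterlim (\<lambda>n. x + t n *\<^sub>R b) (at x) sequentially"
      proof -
        have "(\<lambda>n. x + t n *\<^sub>R b) \<longlonglongrightarrow> x + 0 *\<^sub>R b" by (intro tendsto_intros t0)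
        moreover have "x + t n *\<^sub>R b \<noteq> x" for n using t[of n] b by auto
        ultimately show ?thesis by (simp add: filterlim_at)
      qed
      ultimately have "(\<lambda>n. ((f (x + t n *\<^sub>R b) - f x) - ?f' (x + t n *\<^sub>R b - x)) /\<^sub>R norm (x + t n *\<^sub>R b - x)) \<longlonglongrightarrow> 0"
        by (rule filterlim_compose)
      moreover have "((f (x + t n *\<^sub>R b) - f x) - ?f' (x + t n *\<^sub>R b - x)) /\<^sub>R norm (x + t n *\<^sub>R b - x)
          = (f (x + t n *\<^sub>R b) - f x) /\<^sub>R t n - ?f' b" for n
        using linear_cmul[OF linear_frechet_derivative[OF df[of x]], of "t n" b] t[of n] b
        by (simp add: scaleR_diff_right)
      ultimately have "(\<lambda>n. (f (x + t n *\<^sub>R b) - f x) /\<^sub>R t n) \<longlonglongrightarrow> ?f' b"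
        by (simp add: LIM_zero_iff)
      then show ?thesis by (simp add: scaleR_conv_of_real divide_inverse mult.commute)
    qed
    then show "AE x in lborel. (\<lambda>n. cis (- (x \<bullet> \<xi>)) * ((f (x + t n *\<^sub>R b) - f x) / of_real (t n)))
       \<longlonglongrightarrow> cis (- (x \<bullet> \<xi>)) * frechet_derivative f (at x) b"
      by (intro AE_I2 tendsto_mult tendsto_const) auto
    show "AE x in lborel. norm (cis (- (x \<bullet> \<xi>)) * ((f (x + t n *\<^sub>R b) - f x) / of_real (t n)))
        \<le> D * indicator (cball 0 (R + 1)) x" for n
    proof (rule AE_I2)
      fix x
      have tb: "norm (t n *\<^sub>R b) = t n" using t[of n] b by simp
      show "norm (cis (- (x \<bullet> \<xi>)) * ((f (x + t n *\<^sub>R b) - f x) / of_real (t n))) \<le> D * indicator (cball 0 (R + 1)) x"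
      proof (cases "norm x \<le> R + 1")
        case True
        have "norm (f (x + t n *\<^sub>R b) - f x) \<le> D * t n" using lip[of "x + t n *\<^sub>R b" x] tb by simp
        with True t[of n] show ?thesis by (simp add: norm_mult norm_divide divide_le_eq)
      next
        case False
        have "norm x \<le> norm (x + t n *\<^sub>R b) + norm (t n *\<^sub>R b)"
          using norm_triangle_ineq4[of "x + t n *\<^sub>R b" "t n *\<^sub>R b"] by simp
        with False tb t[of n] have "R \<le> norm (x + t n *\<^sub>R b)" "R \<le> norm x" by linarith+
        with False show ?thesis by (simp add: R)
      qed
    qed
  qed auto
  moreover have "(\<lambda>n. (cis (t n * a) - 1) / of_real (t n)) \<longlonglongrightarrow> \<i> * of_real a" for a
  proof -
    have b: "norm ((cis (t n * a) - 1) / of_real (t n) - \<i> * of_real a) \<le> t n * a\<^sup>2" for n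
    proof -
      have "(cis (t n * a) - 1) / of_real (t n) - \<i> * of_real a
        = (cis (- (- (t n * a))) - 1 + \<i> * of_real (- (t n * a))) / of_real (t n)"
        using t[of n] by (simp add: field_simps)
      also have "norm \<dots> \<le> (- (t n * a))\<^sup>2 / t n"
        using t[of n] norm_cis_remainder[of "- (t n * a)"] by (simp add: norm_divide divide_right_mono)
      also have "\<dots> = t n * a\<^sup>2" using t[of n] by (simp add: power2_eq_square)
      finally show ?thesis .
    qed
    have l: "(\<lambda>n. t n * a\<^sup>2) \<longlonglongrightarrow> 0" using tendsto_mult[OF t0 tendsto_const] by simp
    have "(\<lambda>n. (cis (t n * a) - 1) / of_real (t n) - \<i> * of_real a) \<longlonglongrightarrow> 0"
      by (rule Lim_null_comparison[OF always_eventually l]) (use b in blast)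
    then show ?thesis by (rule LIM_zero_cancel)
  qed
  note tendsto_mult_right[OF this[of "\<xi> \<bullet> b"], of "LINT x|lborel. cis (- (x \<bullet> \<xi>)) * f x"]
  ultimately have "(LINT x|lborel. cis (- (x \<bullet> \<xi>)) * frechet_derivative f (at x) b)
     = (\<i> * of_real (\<xi> \<bullet> b)) * (LINT x|lborel. cis (- (x \<bullet> \<xi>)) * f x)"
    unfolding q by (rule LIMSEQ_unique)
  then show ?thesis by (simp add: fourier_eq)
qed

text \<open>Induction on N, with f arbitrary: 1 + |\<xi>| is at most 1 plus the sum of the
  |\<xi>_b|, and \<xi>_b times the transform of f is, up to a unit, the transform of a derivative of
  f, to which the induction hypothesis applies.\<close>

lemma fourier_decay:
  fixes f :: "'a::euclidean_space \<Rightarrow> complex"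
  assumes "test_fun f"
  shows "\<exists>C>0. \<forall>\<xi>. norm (fourier f \<xi>) \<le> C * wt N \<xi>"
  using assms
proof (induction N arbitrary: f)
  case 0
  let ?C = "fconst TYPE('a) * (LINT x|lborel. norm (f x))"
  have "norm (fourier f \<xi>) \<le> (?C + 1) * wt 0 \<xi>" for \<xi>
    using norm_fourier_le[OF cont_cs_integrable[OF test_fun_cont_cs[OF 0]], of \<xi>] by (simp add: wt_def)
  moreover have "0 \<le> ?C" by (intro mult_nonneg_nonneg less_imp_le[OF fconst_pos] integral_nonneg) auto
  ultimately show ?case by (intro exI[of _ "?C + 1"]) auto
next
  case (Suc N)
  obtain C where C: "0 < C" "\<And>\<xi>. norm (fourier f \<xi>) \<le> C * wt N \<xi>" using Suc by blast
  have "\<exists>C>0. \<forall>\<xi>. norm (fourier (\<lambda>x. frechet_derivative f (at x) b) \<xi>) \<le> C * wt N \<xi>" if "b \<in> Basis" for b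
    using Suc test_fun_deriv that by blast
  then obtain C' where C': "\<And>b. b \<in> Basis \<Longrightarrow> 0 < C' b"
    "\<And>b \<xi>. b \<in> Basis \<Longrightarrow> norm (fourier (\<lambda>x. frechet_derivative f (at x) b) \<xi>) \<le> C' b * wt N \<xi>" by metis
  have "norm (fourier f \<xi>) \<le> (C + (\<Sum>b\<in>Basis. C' b)) * wt (Suc N) \<xi>" for \<xi>
  proof -
    have "(1 + norm \<xi>) * norm (fourier f \<xi>) \<le> (1 + (\<Sum>b\<in>Basis. \<bar>\<xi> \<bullet> b\<bar>)) * norm (fourier f \<xi>)"
      using norm_le_l1[of \<xi>] by (intro mult_right_mono) auto
    also have "\<dots> = norm (fourier f \<xi>) + (\<Sum>b\<in>Basis. norm (fourier (\<lambda>x. frechet_derivative f (at x) b) \<xi>))"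
      using Suc.prems by (simp add: fourier_deriv norm_mult distrib_right sum_distrib_right)
    also have "\<dots> \<le> C * wt N \<xi> + (\<Sum>b\<in>Basis. C' b * wt N \<xi>)"
      by (intro add_mono sum_mono C C')
    also have "\<dots> = (C + (\<Sum>b\<in>Basis. C' b)) * wt N \<xi>" by (simp add: distrib_right sum_distrib_right)
    finally have "norm (fourier f \<xi>) \<le> (C + (\<Sum>b\<in>Basis. C' b)) * wt N \<xi> / (1 + norm \<xi>)"
      using add_pos_nonneg[of 1 "norm \<xi>"] by (simp add: pos_le_divide_eq mult.commute)
    also have "\<dots> = (C + (\<Sum>b\<in>Basis. C' b)) * wt (Suc N) \<xi>" by (simp add: wt_def)
    finally show ?thesis .
  qed
  moreover have "0 < C + (\<Sum>b\<in>Basis. C' b)" using C C' by (intro add_pos_nonneg sum_nonneg) (auto intro: less_imp_le)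
  ultimately show ?case by blast
qed

lemma schwartz_fourier:
  assumes f: "test_fun f" shows "schwartz (fourier f)"
  unfolding schwartz_def
proof (intro conjI allI impI smooth_fourier[OF f])
  fix k and bs :: "'a list" assume "set bs \<subseteq> Basis"
  then obtain f' where f': "test_fun f'" "iter_deriv bs (fourier f) = fourier f'"
    using iter_deriv_fourier[OF f] by blast
  obtain C where C: "0 < C" "\<And>\<xi>. norm (fourier f' \<xi>) \<le> C * wt k \<xi>" using fourier_decay[OF f'(1)] by blast
  show "bdd_above (range (\<lambda>x. (1 + norm x) ^ k * norm (iter_deriv bs (fourier f) x)))"
  proof (rule bdd_aboveI2)
    fix x :: 'a
    have "0 < (1 + norm x) ^ k" using add_pos_nonneg[of 1 "norm x"] by simp
    then show "(1 + norm x) ^ k * norm (iter_deriv bs (fourier f) x) \<le> C"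
      using C(2)[of x] f'(2) by (simp add: wt_def field_simps)
  qed
qed

subsection \<open>Fourier inversion\<close>

lemma integral_lborel_prod:
  fixes f :: "'a::euclidean_space \<Rightarrow> real \<Rightarrow> complex"
  assumes f: "\<And>b. b \<in> Basis \<Longrightarrow> integrable lborel (f b)"
  shows "(LINT x|lborel. (\<Prod>b\<in>Basis. f b (x \<bullet> b))) = (\<Prod>b\<in>Basis. LINT t|lborel. f b t)"
proof -
  interpret product_sigma_finite "\<lambda>_::'a. lborel :: real measure" ..
  have [measurable]: "f b \<in> borel_measurable borel" if "b \<in> Basis" for b using f[OF that] by auto
  have "(LINT x|lborel. (\<Prod>b\<in>Basis. f b (x \<bullet> b)))
      = (LINT g|(\<Pi>\<^sub>M b\<in>Basis. lborel). (\<Prod>b\<in>Basis. f b ((\<Sum>e\<in>Basis. g e *\<^sub>R e) \<bullet> b)))"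
    by (subst lborel_eq) (simp add: integral_distr)
  also have "\<dots> = (LINT g|(\<Pi>\<^sub>M b\<in>(Basis::'a set). lborel). (\<Prod>b\<in>Basis. f b (g b)))"
    by (simp cong: prod.cong)
  also have "\<dots> = (\<Prod>b\<in>Basis. LINT t|lborel. f b t)"
    using f by (intro product_integral_prod) auto
  finally show ?thesis .
qed

definition gauss :: "'a::euclidean_space \<Rightarrow> real" where
  "gauss x = exp (- (norm x)\<^sup>2 / 2)"

lemma gauss_eq_prod: "gauss x = (\<Prod>b\<in>Basis. exp (- (x \<bullet> b)\<^sup>2 / 2))"
proof -
  have "- (norm x)\<^sup>2 / 2 = (\<Sum>b\<in>Basis. - (x \<bullet> b)\<^sup>2 / 2)"
    by (subst power2_norm_eq_inner, subst euclidean_inner)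
      (simp add: sum_divide_distrib[symmetric] sum_negf power2_eq_square)
  then show ?thesis by (simp add: gauss_def exp_sum)
qed

lemma measurable_gauss [measurable]: "gauss \<in> borel_measurable borel"
  unfolding gauss_def[abs_def] by measurable

lemma gauss_bounds: "0 < gauss x" "gauss x \<le> 1"
  by (auto simp: gauss_def)

lemma gaussian_integrable_real: "integrable lborel (\<lambda>t::real. exp (- t\<^sup>2 / 2))"
proof -
  have "integrable lborel (\<lambda>t. sqrt (2 * pi) * std_normal_density t)"
    by (intro integrable_mult_right integrable_normal_density) simp
  then show ?thesis by (simp add: std_normal_density_def)
qed

lemma integrable_gauss: "integrable lborel (gauss :: 'a::euclidean_space \<Rightarrow> real)"
proof -
  have "(\<integral>\<^sup>+x. ennreal (gauss (x::'a)) \<partial>lborel) = (\<integral>\<^sup>+x. (\<Prod>b\<in>(Basis::'a set). ennreal (exp (- (x \<bullet> b)\<^sup>2 / 2))) \<partial>lborel)"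
    by (simp add: gauss_eq_prod prod_ennreal)
  also have "\<dots> = (\<Prod>b\<in>(Basis::'a set). (\<integral>\<^sup>+t. ennreal (exp (- t\<^sup>2 / 2)) \<partial>lborel))"
    by (rule nn_integral_lborel_prod) auto
  also have "\<dots> < \<infinity>"
    using gaussian_integrable_real
    by (simp add: integrable_iff_bounded less_top[symmetric] power_eq_top_ennreal)
  finally show ?thesis by (simp add: integrable_iff_bounded abs_of_pos gauss_bounds)
qed

text \<open>Read off from the characteristic function of the standard normal distribution, whose
  density carries the extra factor 1 / sqrt(2 pi).\<close>

lemma gaussian_fourier_real:
  "(LINT t|lborel. cis (s * t) * of_real (exp (- t\<^sup>2 / 2))) = of_real (sqrt (2 * pi) * exp (- s\<^sup>2 / 2))"
proof -
  have "of_real (exp (- s\<^sup>2 / 2)) = (LINT t|std_normal_distribution. iexp (s * t))"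
    using fun_cong[OF char_std_normal_distribution, of s] by (simp add: char_def)
  also have "\<dots> = (LINT t|lborel. std_normal_density t *\<^sub>R iexp (s * t))"
    by (subst integral_density) auto
  also have "\<dots> = (LINT t|lborel. of_real (1 / sqrt (2 * pi)) * (cis (s * t) * of_real (exp (- t\<^sup>2 / 2))))"
    by (intro Bochner_Integration.integral_cong)
      (auto simp: std_normal_density_def scaleR_conv_of_real cis_conv_exp mult_ac)
  also have "\<dots> = of_real (1 / sqrt (2 * pi)) * (LINT t|lborel. cis (s * t) * of_real (exp (- t\<^sup>2 / 2)))"
    by (rule integral_mult_right_zero)
  finally have "of_real (sqrt (2 * pi)) * of_real (exp (- s\<^sup>2 / 2))
    = of_real (sqrt (2 * pi)) * (of_real (1 / sqrt (2 * pi)) * (LINT t|lborel. cis (s * t) * complex_of_real (exp (- t\<^sup>2 / 2))))"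
    by simp
  then show ?thesis by (simp add: mult.assoc[symmetric] flip: of_real_mult)
qed

lemma gaussian_fourier:
  fixes y :: "'a::euclidean_space"
  shows "(LINT \<xi>|lborel. cis (y \<bullet> \<xi>) * of_real (gauss \<xi>)) = of_real (gauss y / fconst TYPE('a))"
proof -
  have cis: "cis (y \<bullet> \<xi>) = (\<Prod>b\<in>Basis. cis ((y \<bullet> b) * (\<xi> \<bullet> b)))" for \<xi>
    by (subst euclidean_inner) (simp add: cis_conv_exp exp_sum sum_distrib_left)
  have "(LINT \<xi>|lborel. cis (y \<bullet> \<xi>) * of_real (gauss \<xi>))
      = (LINT \<xi>|lborel. (\<Prod>b\<in>Basis. cis ((y \<bullet> b) * (\<xi> \<bullet> b)) * of_real (exp (- (\<xi> \<bullet> b)\<^sup>2 / 2))))"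
    by (simp only: cis gauss_eq_prod of_real_prod prod.distrib)
  also have "\<dots> = (\<Prod>b\<in>Basis. LINT t|lborel. cis ((y \<bullet> b) * t) * of_real (exp (- t\<^sup>2 / 2)))"
    by (rule integral_lborel_prod, rule integrable_cis_mult)
      (use gaussian_integrable_real in \<open>auto intro: integrable_of_real\<close>)
  also have "\<dots> = (\<Prod>b\<in>Basis. of_real (sqrt (2 * pi) * exp (- (y \<bullet> b)\<^sup>2 / 2)))"
    by (simp only: gaussian_fourier_real)
  also have "\<dots> = of_real (sqrt (2 * pi) ^ DIM('a) * gauss y)"
    by (simp only: gauss_eq_prod of_real_prod[symmetric] prod.distrib prod_constant)
  also have "sqrt (2 * pi) ^ DIM('a) = 1 / fconst TYPE('a)"
    by (simp add: fconst_def powr_minus powr_half_sqrt[symmetric] powr_realpow[symmetric] powr_powr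
        inverse_eq_divide mult.commute)
  finally show ?thesis by simp
qed

text \<open>Tonelli for products. It supplies the integrability behind the Fubini exchanges below,
  because the oscillating factors have modulus 1.\<close>

lemma integrable_pair_mult:
  fixes f :: "'a::euclidean_space \<Rightarrow> complex" and g :: "'b::euclidean_space \<Rightarrow> complex"
  assumes f: "integrable lborel f" and g: "integrable lborel g"
  shows "integrable (lborel \<Otimes>\<^sub>M lborel) (\<lambda>(x, y). f x * g y)"
proof -
  have [measurable]: "f \<in> borel_measurable borel" "g \<in> borel_measurable borel" using f g by auto
  have "(\<integral>\<^sup>+z. norm (f (fst z) * g (snd z)) \<partial>(lborel \<Otimes>\<^sub>M lborel))
      = (\<integral>\<^sup>+x. \<integral>\<^sup>+y. ennreal (norm (f x)) * ennreal (norm (g y)) \<partial>lborel \<partial>lborel)"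
    by (subst lborel.nn_integral_fst[symmetric]) (auto simp: norm_mult ennreal_mult)
  also have "\<dots> = (\<integral>\<^sup>+x. norm (f x) \<partial>lborel) * (\<integral>\<^sup>+y. norm (g y) \<partial>lborel)"
    by (simp add: nn_integral_cmult nn_integral_multc)
  also have "\<dots> < \<infinity>" using f g by (simp add: integrable_iff_bounded ennreal_mult_less_top)
  finally show ?thesis by (simp add: integrable_iff_bounded case_prod_beta')
qed

text \<open>Gaussian regularisation: under the factor exp(-|t \<xi>|^2 / 2) the two integrals may be
  exchanged, and the result is a Gaussian average of f at scale t. As t tends to 0, integrability of
  the transform governs one side, continuity and boundedness of f the other.\<close>

lemma fourier_inversion:
  fixes f :: "'a::euclidean_space \<Rightarrow> complex"
  assumes f: "cont_cs f" and Ff: "integrable lborel (fourier f)"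
  shows "inv_fourier (fourier f) x = f x"
proof -
  define c where "c = fconst TYPE('a)"
  have c: "0 < c" by (simp add: c_def)
  have fi: "integrable lborel f" using f by (rule cont_cs_integrable)
  have [measurable]: "f \<in> borel_measurable borel" "fourier f \<in> borel_measurable borel"
    using fi Ff by auto
  obtain B where B: "0 < B" "\<And>x. norm (f x) \<le> B" using cont_cs_bounded[OF f] by blast
  define t where "t n = 1 / (real n + 1)" for n
  have t: "0 < t n" "t n \<noteq> 0" for n by (auto simp: t_def add_nonneg_eq_0_iff)
  have t0: "t \<longlonglongrightarrow> 0" unfolding t_def using LIMSEQ_inverse_real_of_nat by (simp add: inverse_eq_divide add.commute)
  define A where "A n = (LINT \<xi>|lborel. cis (x \<bullet> \<xi>) * fourier f \<xi> * of_real (gauss (t n *\<^sub>R \<xi>)))" for n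
  have lim1: "A \<longlonglongrightarrow> (LINT \<xi>|lborel. cis (x \<bullet> \<xi>) * fourier f \<xi>)"
    unfolding A_def
  proof (rule integral_dominated_convergence[where w = "\<lambda>\<xi>. norm (fourier f \<xi>)"])
    show "AE \<xi> in lborel. (\<lambda>n. cis (x \<bullet> \<xi>) * fourier f \<xi> * of_real (gauss (t n *\<^sub>R \<xi>))) \<longlonglongrightarrow> cis (x \<bullet> \<xi>) * fourier f \<xi>"
    proof (rule AE_I2)
      fix \<xi> :: 'a
      have "(\<lambda>n. gauss (t n *\<^sub>R \<xi>)) \<longlonglongrightarrow> exp (- (\<bar>0\<bar> * norm \<xi>)\<^sup>2 / 2)"
        unfolding gauss_def norm_scaleR by (intro tendsto_intros t0) auto
      from tendsto_mult_left[OF tendsto_of_real[OF this], of "cis (x \<bullet> \<xi>) * fourier f \<xi>"]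
      show "(\<lambda>n. cis (x \<bullet> \<xi>) * fourier f \<xi> * of_real (gauss (t n *\<^sub>R \<xi>))) \<longlonglongrightarrow> cis (x \<bullet> \<xi>) * fourier f \<xi>" by simp
    qed
    show "AE \<xi> in lborel. norm (cis (x \<bullet> \<xi>) * fourier f \<xi> * of_real (gauss (t n *\<^sub>R \<xi>))) \<le> norm (fourier f \<xi>)" for n
      by (intro AE_I2) (simp add: norm_mult mult_left_le gauss_bounds less_imp_le)
  qed (use Ff in auto)
  have A: "A n = of_real (1 / c) * (of_real c * (LINT z|lborel. f (x + t n *\<^sub>R z) * of_real (gauss z)))" for n
  proof -
    have gi: "integrable lborel (\<lambda>\<xi>::'a. complex_of_real (gauss (t n *\<^sub>R \<xi>)))"
      using integrable_affine[OF integrable_gauss t(2), of 0 n] by (auto intro: integrable_of_real)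
    have fub: "integrable (lborel \<Otimes>\<^sub>M lborel) (case_prod (\<lambda>\<xi> y. cis ((x - y) \<bullet> \<xi>) * (complex_of_real (gauss (t n *\<^sub>R \<xi>)) * f y)))"
      using integrable_cis_mult[OF integrable_pair_mult[OF gi fi], of "\<lambda>(\<xi>, y). (x - y) \<bullet> \<xi>"]
      by (simp add: case_prod_beta')
    \<comment> \<open>The transform of the dilated Gaussian: width 1/t on the frequency side becomes
      width t in space.\<close>
    have inner: "(LINT \<xi>|lborel. cis (w \<bullet> \<xi>) * of_real (gauss (t n *\<^sub>R \<xi>))) = of_real (gauss (w /\<^sub>R t n) / c / t n ^ DIM('a))" for w :: 'a
    proof -
      have "of_real (gauss (w /\<^sub>R t n) / c) = (LINT \<xi>|lborel. cis ((w /\<^sub>R t n) \<bullet> \<xi>) * complex_of_real (gauss \<xi>))"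
        by (simp only: gaussian_fourier c_def)
      also have "\<dots> = \<bar>t n\<bar> ^ DIM('a) *\<^sub>R (LINT \<xi>|lborel. cis ((w /\<^sub>R t n) \<bullet> (0 + t n *\<^sub>R \<xi>)) * complex_of_real (gauss (0 + t n *\<^sub>R \<xi>)))"
        by (rule integral_affine) (use t in auto)
      also have "\<dots> = of_real (t n ^ DIM('a)) * (LINT \<xi>|lborel. cis (w \<bullet> \<xi>) * of_real (gauss (t n *\<^sub>R \<xi>)))"
        using t[of n] by (simp add: scaleR_conv_of_real mult.assoc[symmetric])
      finally have "of_real (t n ^ DIM('a)) * (LINT \<xi>|lborel. cis (w \<bullet> \<xi>) * of_real (gauss (t n *\<^sub>R \<xi>))) / of_real (t n ^ DIM('a))
          = complex_of_real (gauss (w /\<^sub>R t n) / c) / of_real (t n ^ DIM('a))" by simp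
      then show ?thesis using t[of n] by simp
    qed
    have "A n = (LINT \<xi>|lborel. of_real c * (LINT y|lborel. cis ((x - y) \<bullet> \<xi>) * (of_real (gauss (t n *\<^sub>R \<xi>)) * f y)))"
      unfolding A_def
    proof (rule Bochner_Integration.integral_cong[OF refl])
      fix \<xi> :: 'a
      have "(LINT y|lborel. cis ((x - y) \<bullet> \<xi>) * (of_real (gauss (t n *\<^sub>R \<xi>)) * f y))
        = (LINT y|lborel. cis (x \<bullet> \<xi>) * of_real (gauss (t n *\<^sub>R \<xi>)) * (cis (- (y \<bullet> \<xi>)) * f y))"
      proof (rule Bochner_Integration.integral_cong[OF refl])
        fix y
        have "cis ((x - y) \<bullet> \<xi>) = cis (x \<bullet> \<xi>) * cis (- (y \<bullet> \<xi>))"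
          by (simp add: cis_mult inner_diff_left)
        then show "cis ((x - y) \<bullet> \<xi>) * (of_real (gauss (t n *\<^sub>R \<xi>)) * f y)
          = cis (x \<bullet> \<xi>) * of_real (gauss (t n *\<^sub>R \<xi>)) * (cis (- (y \<bullet> \<xi>)) * f y)" by simp
      qed
      also have "\<dots> = cis (x \<bullet> \<xi>) * of_real (gauss (t n *\<^sub>R \<xi>)) * (LINT y|lborel. cis (- (y \<bullet> \<xi>)) * f y)"
        by (rule integral_mult_right_zero)
      finally show "cis (x \<bullet> \<xi>) * fourier f \<xi> * of_real (gauss (t n *\<^sub>R \<xi>))
        = of_real c * (LINT y|lborel. cis ((x - y) \<bullet> \<xi>) * (of_real (gauss (t n *\<^sub>R \<xi>)) * f y))"
        by (simp add: fourier_eq c_def mult_ac)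
    qed
    also have "\<dots> = of_real c * (LINT \<xi>|lborel. LINT y|lborel. cis ((x - y) \<bullet> \<xi>) * (of_real (gauss (t n *\<^sub>R \<xi>)) * f y))"
      by (rule integral_mult_right_zero)
    also have "\<dots> = of_real c * (LINT y|lborel. LINT \<xi>|lborel. cis ((x - y) \<bullet> \<xi>) * (of_real (gauss (t n *\<^sub>R \<xi>)) * f y))"
      by (subst lborel_pair.Fubini_integral[OF fub]) simp
    also have "\<dots> = of_real c * (LINT y|lborel. f y * of_real (gauss ((x - y) /\<^sub>R t n) / c / t n ^ DIM('a)))"
    proof -
      have "(LINT \<xi>|lborel. cis ((x - y) \<bullet> \<xi>) * (of_real (gauss (t n *\<^sub>R \<xi>)) * f y))
        = f y * of_real (gauss ((x - y) /\<^sub>R t n) / c / t n ^ DIM('a))" for y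
      proof -
        have "(LINT \<xi>|lborel. cis ((x - y) \<bullet> \<xi>) * (of_real (gauss (t n *\<^sub>R \<xi>)) * f y))
          = (LINT \<xi>|lborel. cis ((x - y) \<bullet> \<xi>) * of_real (gauss (t n *\<^sub>R \<xi>)) * f y)"
          by (simp only: mult.assoc)
        also have "\<dots> = (LINT \<xi>|lborel. cis ((x - y) \<bullet> \<xi>) * of_real (gauss (t n *\<^sub>R \<xi>))) * f y"
          by (rule integral_mult_left_zero)
        finally show ?thesis by (simp only: inner mult.commute)
      qed
      then show ?thesis by simp
    qed
    \<comment> \<open>Substituting y = x + t z fixes the Gaussian and moves the dependence on t into
      the argument of f.\<close>
    also have "(LINT y|lborel. f y * of_real (gauss ((x - y) /\<^sub>R t n) / c / t n ^ DIM('a)))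
      = \<bar>t n\<bar> ^ DIM('a) *\<^sub>R (LINT z|lborel. f (x + t n *\<^sub>R z) * of_real (gauss ((x - (x + t n *\<^sub>R z)) /\<^sub>R t n) / c / t n ^ DIM('a)))"
      by (rule integral_affine) (use t in auto)
    also have "\<dots> = (LINT z|lborel. \<bar>t n\<bar> ^ DIM('a) *\<^sub>R (f (x + t n *\<^sub>R z) * of_real (gauss ((x - (x + t n *\<^sub>R z)) /\<^sub>R t n) / c / t n ^ DIM('a))))"
      by (rule integral_scaleR_right[symmetric]) 
    also have "\<dots> = (LINT z|lborel. of_real (1 / c) * (f (x + t n *\<^sub>R z) * of_real (gauss z)))"
      using t[of n] by (intro Bochner_Integration.integral_cong[OF refl]) (simp add: scaleR_conv_of_real gauss_def)
    also have "\<dots> = of_real (1 / c) * (LINT z|lborel. f (x + t n *\<^sub>R z) * of_real (gauss z))"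
      by (rule integral_mult_right_zero)
    finally show ?thesis by (simp only: mult.left_commute)
  qed
  have lim2: "(\<lambda>n. LINT z|lborel. f (x + t n *\<^sub>R z) * of_real (gauss z)) \<longlonglongrightarrow> (LINT z::'a|lborel. f x * of_real (gauss z))"
  proof (rule integral_dominated_convergence[where w = "\<lambda>z. B * gauss z"])
    show "AE z in lborel. (\<lambda>n. f (x + t n *\<^sub>R z) * of_real (gauss z)) \<longlonglongrightarrow> f x * of_real (gauss z)"
    proof (rule AE_I2)
      fix z :: 'a
      have "isCont f x" using f by (simp add: cont_cs_def continuous_on_eq_continuous_at)
      moreover have "(\<lambda>n. x + t n *\<^sub>R z) \<longlonglongrightarrow> x + 0 *\<^sub>R z" by (intro tendsto_intros t0)
      ultimately have "(\<lambda>n. f (x + t n *\<^sub>R z)) \<longlonglongrightarrow> f x" by (simp add: isCont_tendsto_compose[of x f])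
      then show "(\<lambda>n. f (x + t n *\<^sub>R z) * of_real (gauss z)) \<longlonglongrightarrow> f x * of_real (gauss z)"
        by (rule tendsto_mult_right)
    qed
    show "AE z in lborel. norm (f (x + t n *\<^sub>R z) * complex_of_real (gauss z)) \<le> B * gauss z" for n
      by (intro AE_I2) (simp add: norm_mult abs_of_pos gauss_bounds B mult_right_mono less_imp_le)
  qed (use integrable_gauss in auto)
  have "(LINT z::'a|lborel. f x * of_real (gauss z)) = f x * of_real (1 / c)"
    using gaussian_fourier[of "0::'a"] by (simp add: gauss_def c_def)
  note lz = this
  have "A \<longlonglongrightarrow> of_real (1 / c) * (of_real c * (LINT z::'a|lborel. f x * of_real (gauss z)))"
    unfolding A[THEN ext[of A]] by (intro tendsto_mult_left lim2)
  then have "A \<longlonglongrightarrow> of_real (1 / c) * f x"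
    using c by (simp only: lz) simp
  with lim1 have "(LINT \<xi>|lborel. cis (x \<bullet> \<xi>) * fourier f \<xi>) = of_real (1 / c) * f x" by (rule LIMSEQ_unique)
  then show ?thesis
    using c by (subst inv_fourier_eq) (simp_all add: c_def[symmetric] inner_commute[of _ x])
qed

text \<open>The bridge from multipliers on the frequency side to convolution kernels; continuity and
  compact support of m together with integrability of u justify Fubini.\<close>

lemma fourier_mult_inv_fourier:
  fixes m u :: "'a::euclidean_space \<Rightarrow> complex"
  assumes m: "cont_cs m" and u: "integrable lborel u"
  shows "fourier (\<lambda>\<xi>. m \<xi> * inv_fourier u \<xi>) x
    = of_real (fconst TYPE('a)) * (LINT y|lborel. u y * fourier m (x - y))"
proof -
  define c where "c = fconst TYPE('a)"
  have mi: "integrable lborel m" using m by (rule cont_cs_integrable)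
  have [measurable]: "m \<in> borel_measurable borel" "u \<in> borel_measurable borel" using mi u by auto
  have iu: "inv_fourier u = (\<lambda>\<xi>. of_real c * (LINT y|lborel. cis (y \<bullet> \<xi>) * u y))"
    by (simp add: inv_fourier_eq c_def fun_eq_iff)
  have fub: "integrable (lborel \<Otimes>\<^sub>M lborel) (case_prod (\<lambda>\<xi> y. cis (- (\<xi> \<bullet> (x - y))) * (m \<xi> * u y)))"
    using integrable_cis_mult[OF integrable_pair_mult[OF mi u], of "\<lambda>(\<xi>, y). - (\<xi> \<bullet> (x - y))"]
    by (simp add: case_prod_beta')
  have [measurable]: "inv_fourier u \<in> borel_measurable borel" unfolding iu by measurable
  have "fourier (\<lambda>\<xi>. m \<xi> * inv_fourier u \<xi>) x = of_real c * (LINT \<xi>|lborel. cis (- (\<xi> \<bullet> x)) * (m \<xi> * inv_fourier u \<xi>))"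
    by (subst fourier_eq) (auto simp: c_def)
  also have "(LINT \<xi>|lborel. cis (- (\<xi> \<bullet> x)) * (m \<xi> * inv_fourier u \<xi>))
    = (LINT \<xi>|lborel. of_real c * (LINT y|lborel. cis (- (\<xi> \<bullet> (x - y))) * (m \<xi> * u y)))"
  proof (rule Bochner_Integration.integral_cong[OF refl])
    fix \<xi>
    have "(LINT y|lborel. cis (- (\<xi> \<bullet> (x - y))) * (m \<xi> * u y))
      = (LINT y|lborel. cis (- (\<xi> \<bullet> x)) * m \<xi> * (cis (y \<bullet> \<xi>) * u y))"
    proof (rule Bochner_Integration.integral_cong[OF refl])
      fix y
      have "cis (- (\<xi> \<bullet> (x - y))) = cis (- (\<xi> \<bullet> x)) * cis (y \<bullet> \<xi>)"
        by (simp add: cis_mult inner_diff_right inner_commute[of y])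
      then show "cis (- (\<xi> \<bullet> (x - y))) * (m \<xi> * u y) = cis (- (\<xi> \<bullet> x)) * m \<xi> * (cis (y \<bullet> \<xi>) * u y)" by simp
    qed
    then show "cis (- (\<xi> \<bullet> x)) * (m \<xi> * inv_fourier u \<xi>) = of_real c * (LINT y|lborel. cis (- (\<xi> \<bullet> (x - y))) * (m \<xi> * u y))"
      by (simp add: iu)
  qed
  also have "\<dots> = of_real c * (LINT \<xi>|lborel. LINT y|lborel. cis (- (\<xi> \<bullet> (x - y))) * (m \<xi> * u y))"
    by (rule integral_mult_right_zero)
  also have "(LINT \<xi>|lborel. LINT y|lborel. cis (- (\<xi> \<bullet> (x - y))) * (m \<xi> * u y))
     = (LINT y|lborel. LINT \<xi>|lborel. cis (- (\<xi> \<bullet> (x - y))) * (m \<xi> * u y))"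
    by (rule lborel_pair.Fubini_integral[OF fub, symmetric])
  also have "\<dots> = (LINT y|lborel. u y * (LINT \<xi>|lborel. cis (- (\<xi> \<bullet> (x - y))) * m \<xi>))"
  proof (rule Bochner_Integration.integral_cong[OF refl])
    fix y
    have "(LINT \<xi>|lborel. cis (- (\<xi> \<bullet> (x - y))) * (m \<xi> * u y)) = (LINT \<xi>|lborel. u y * (cis (- (\<xi> \<bullet> (x - y))) * m \<xi>))"
      by (simp only: mult_ac)
    then show "(LINT \<xi>|lborel. cis (- (\<xi> \<bullet> (x - y))) * (m \<xi> * u y)) = u y * (LINT \<xi>|lborel. cis (- (\<xi> \<bullet> (x - y))) * m \<xi>)"
      by (simp only: integral_mult_right_zero)
  qed
  also have "of_real c * (LINT y|lborel. u y * (LINT \<xi>|lborel. cis (- (\<xi> \<bullet> (x - y))) * m \<xi>))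
     = (LINT y|lborel. u y * fourier m (x - y))"
    by (simp add: fourier_eq c_def mult.left_commute[of "u _"])
  finally show ?thesis by (simp add: c_def)
qed

subsection \<open>Schwartz functions\<close>

lemma schwartz_continuous: "schwartz u \<Longrightarrow> continuous_on UNIV u"
  by (simp add: schwartz_def smooth_continuous)

lemma schwartz_measurable: "schwartz u \<Longrightarrow> u \<in> borel_measurable borel"
  by (intro borel_measurable_continuous_onI schwartz_continuous)

lemma wt_eq_inverse: "a \<le> C * wt N x \<longleftrightarrow> (1 + norm x) ^ N * a \<le> C"
proof -
  have "0 < (1 + norm x) ^ N" using add_pos_nonneg[of 1 "norm x"] by simp
  then show ?thesis by (simp add: wt_def pos_le_divide_eq mult.commute)
qed

lemma schwartz_decay:
  assumes "schwartz u" shows "\<exists>C>0. \<forall>x. norm (u x) \<le> C * wt N x"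
proof -
  have "bdd_above (range (\<lambda>x. (1 + norm x) ^ N * norm (iter_deriv [] u x)))"
    using assms unfolding schwartz_def by (metis empty_subsetI list.set(1))
  then obtain C where "\<And>x. (1 + norm x) ^ N * norm (u x) \<le> C" by (auto simp: bdd_above_def)
  then have "norm (u x) \<le> max C 1 * wt N x" for x
    unfolding wt_eq_inverse by (metis max.coboundedI1)
  then show ?thesis by (intro exI[of _ "max C 1"]) auto
qed

lemma iter_deriv_affine:
  fixes u :: "'a::euclidean_space \<Rightarrow> complex"
  assumes u: "smooth u" and bs: "set bs \<subseteq> Basis"
  shows "iter_deriv bs (\<lambda>y. a * u (c *\<^sub>R (y - x))) = (\<lambda>y. a * of_real c ^ length bs * iter_deriv bs u (c *\<^sub>R (y - x)))"
  using bs
proof (induction bs)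
  case (Cons b bs)
  let ?g = "iter_deriv bs u"
  have "(?g has_derivative frechet_derivative ?g (at z)) (at z)" for z
    using u Cons.prems by (intro frechet_derivative_works') (auto simp: smooth_def)
  then have "((\<lambda>y. a * of_real c ^ length bs * ?g (c *\<^sub>R (y - x))) has_derivative
     (\<lambda>h. a * of_real c ^ length bs * frechet_derivative ?g (at (c *\<^sub>R (y - x))) (c *\<^sub>R h))) (at y)" for y
    by (intro has_derivative_mult_right has_derivative_compose[of "\<lambda>y. c *\<^sub>R (y - x)" "\<lambda>h. c *\<^sub>R h" y UNIV ?g])
      (auto intro!: derivative_eq_intros)
  note D = this
  have lin: "frechet_derivative ?g (at z) (c *\<^sub>R b) = of_real c * frechet_derivative ?g (at z) b" for z
    using u Cons.prems linear_cmul[OF linear_frechet_derivative[of ?g "at z"], of c b]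
    by (auto simp: smooth_def scaleR_conv_of_real)
  have "iter_deriv (b # bs) (\<lambda>y. a * u (c *\<^sub>R (y - x)))
      = (\<lambda>y. frechet_derivative (\<lambda>y. a * of_real c ^ length bs * ?g (c *\<^sub>R (y - x))) (at y) b)"
    using Cons by simp
  also have "\<dots> = (\<lambda>y. a * of_real c ^ length bs * (of_real c * frechet_derivative ?g (at (c *\<^sub>R (y - x))) b))"
    by (simp only: frechet_derivative_at[OF D, symmetric] lin)
  finally show ?case by (simp add: mult_ac)
qed simp

text \<open>With c \<ge> 1 the weight 1 + |y| is at most (1 + |x|)(1 + |c(y - x)|), so the seminorms
  of u control those of its dilated translates. This is what makes every translate of a kernel at
  any level an admissible test function.\<close>

lemma schwartz_affine:
  fixes u :: "'a::euclidean_space \<Rightarrow> complex"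
  assumes u: "schwartz u" and c: "1 \<le> c"
  shows "schwartz (\<lambda>y. a * u (c *\<^sub>R (y - x)))"
proof -
  have sm: "smooth u" using u by (simp add: schwartz_def)
  show ?thesis unfolding schwartz_def
  proof (intro conjI allI impI)
    show "smooth (\<lambda>y. a * u (c *\<^sub>R (y - x)))" unfolding smooth_def
    proof (intro allI impI)
      fix bs :: "'a list" and y assume bs: "set bs \<subseteq> Basis"
      have "(iter_deriv bs u \<circ> (\<lambda>y. c *\<^sub>R (y - x))) differentiable (at y)"
        using sm bs by (intro differentiable_chain_at) (auto simp: smooth_def)
      then show "iter_deriv bs (\<lambda>y. a * u (c *\<^sub>R (y - x))) differentiable (at y)"
        unfolding iter_deriv_affine[OF sm bs] o_def by (intro differentiable_mult) auto
    qed
  next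
    fix k and bs :: "'a list" assume bs: "set bs \<subseteq> Basis"
    then have "bdd_above (range (\<lambda>y. (1 + norm y) ^ k * norm (iter_deriv bs u y)))"
      using u by (simp add: schwartz_def)
    then obtain C where C: "\<And>y. (1 + norm y) ^ k * norm (iter_deriv bs u y) \<le> C" by (auto simp: bdd_above_def)
    show "bdd_above (range (\<lambda>y. (1 + norm y) ^ k * norm (iter_deriv bs (\<lambda>y. a * u (c *\<^sub>R (y - x))) y)))"
    proof (rule bdd_aboveI2)
      fix y
      have "norm y \<le> norm (y - x) + norm x" using norm_triangle_ineq[of "y - x" x] by simp
      moreover have "norm (y - x) \<le> norm (c *\<^sub>R (y - x))" using c mult_right_mono[of 1 c "norm (y - x)"] by simp
      moreover have "(1 + norm x) * (1 + norm (c *\<^sub>R (y - x))) = 1 + norm x + norm (c *\<^sub>R (y - x)) + norm x * norm (c *\<^sub>R (y - x))"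
        by (simp add: algebra_simps)
      moreover have "0 \<le> norm x * norm (c *\<^sub>R (y - x))" by simp
      ultimately have "1 + norm y \<le> (1 + norm x) * (1 + norm (c *\<^sub>R (y - x)))" by linarith
      then have "(1 + norm y) ^ k \<le> ((1 + norm x) * (1 + norm (c *\<^sub>R (y - x)))) ^ k" by (intro power_mono) auto
      also have "\<dots> = (1 + norm x) ^ k * (1 + norm (c *\<^sub>R (y - x))) ^ k" by (rule power_mult_distrib)
      finally have "(1 + norm y) ^ k * norm (iter_deriv bs u (c *\<^sub>R (y - x)))
         \<le> (1 + norm x) ^ k * (1 + norm (c *\<^sub>R (y - x))) ^ k * norm (iter_deriv bs u (c *\<^sub>R (y - x)))"
        by (rule mult_right_mono) simp
      also have "\<dots> \<le> (1 + norm x) ^ k * C"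
        using C[of "c *\<^sub>R (y - x)"] by (simp only: mult.assoc) (intro mult_left_mono, auto)
      finally have "(norm a * c ^ length bs) * ((1 + norm y) ^ k * norm (iter_deriv bs u (c *\<^sub>R (y - x)))) \<le> (norm a * c ^ length bs) * ((1 + norm x) ^ k * C)"
        using c by (intro mult_left_mono) auto
      then show "(1 + norm y) ^ k * norm (iter_deriv bs (\<lambda>y. a * u (c *\<^sub>R (y - x))) y) \<le> (norm a * c ^ length bs) * ((1 + norm x) ^ k * C)"
        using c unfolding iter_deriv_affine[OF sm bs] by (simp add: norm_mult norm_power mult_ac)
    qed
  qed
qed

subsection \<open>The convolution kernels of a dyadic resolution of unity\<close>

locale resolution_of_unity =
  fixes \<psi> :: "'a::euclidean_space \<Rightarrow> complex"
  assumes resolution: "resolution_generator \<psi>"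
begin

text \<open>By telescoping this is the sum of the dyadic functions up to level l, a cut-off equal to
  1 on the ball of radius 2^l.\<close>

definition psi :: "nat \<Rightarrow> 'a \<Rightarrow> complex" where
  "psi l x = \<psi> (x /\<^sub>R 2 ^ l)"

text \<open>The kernel of the low-pass filter \<open>psi l\<close>, written as an
  integral-preserving dilation of a single function so that all estimates scale;
  \<open>fconst\<close> absorbs the normalisation of the Fourier transform.\<close>

definition kern :: "nat \<Rightarrow> 'a \<Rightarrow> complex" where
  "kern l z = of_real (fconst TYPE('a) * 2 ^ (l * DIM('a))) * fourier \<psi> (2 ^ l *\<^sub>R z)"

text \<open>A difference, so that partial sums telescope. Level 0 keeps the low-pass kernel and
  hence has integral 1, where all others have integral 0.\<close>

definition dkern :: "nat \<Rightarrow> 'a \<Rightarrow> complex" where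
  "dkern j z = (if j = 0 then kern 0 z else kern j z - kern (j - 1) z)"

lemma test_fun_generator: "test_fun \<psi>"
  using resolution by (auto simp: test_fun_def resolution_generator_def)

lemma psi_eq_1: "norm x \<le> 2 ^ l \<Longrightarrow> psi l x = 1"
  using resolution by (simp add: psi_def resolution_generator_def divide_simps)

lemma psi_eq_0: "2 ^ Suc l \<le> norm x \<Longrightarrow> psi l x = 0"
  using resolution by (simp add: psi_def resolution_generator_def divide_simps)

lemma cont_cs_psi: "cont_cs (psi l)"
proof -
  have "continuous_on UNIV \<psi>" using test_fun_generator by (auto simp: test_fun_def smooth_continuous)
  then have "continuous_on UNIV (\<lambda>x. \<psi> (x /\<^sub>R 2 ^ l))"
    by (rule continuous_on_compose2) (auto intro!: continuous_intros)
  then show ?thesis using psi_eq_0[of l] by (auto simp: cont_cs_def psi_def[abs_def])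
qed

lemma fourier_psi: "of_real (fconst TYPE('a)) * fourier (psi l) z = kern l z"
proof -
  have [measurable]: "\<psi> \<in> borel_measurable borel" "psi l \<in> borel_measurable borel"
    using test_fun_generator cont_cs_psi by (auto intro: cont_cs_measurable test_fun_cont_cs)
  have "(LINT x|lborel. cis (- (x \<bullet> z)) * psi l x)
      = \<bar>2 ^ l\<bar> ^ DIM('a) *\<^sub>R (LINT x|lborel. cis (- ((0 + 2 ^ l *\<^sub>R x) \<bullet> z)) * psi l (0 + 2 ^ l *\<^sub>R x))"
    by (rule integral_affine) auto
  also have "\<dots> = of_real (2 ^ (l * DIM('a))) * (LINT x|lborel. cis (- (x \<bullet> (2 ^ l *\<^sub>R z))) * \<psi> x)"
    by (simp add: psi_def scaleR_conv_of_real power_mult)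
  finally show ?thesis by (simp add: kern_def fourier_eq mult_ac)
qed

lemma dkern_eq: "dkern j z = of_real (fconst TYPE('a)) * fourier (dyadic \<psi> j) z"
proof (cases "j = 0")
  case True
  have "dyadic \<psi> 0 = psi 0" by (auto simp: dyadic_def psi_def)
  then show ?thesis using True fourier_psi[of 0] by (simp add: dkern_def)
next
  case False
  have "dyadic \<psi> j = (\<lambda>x. psi j x - psi (j - 1) x)"
  proof
    fix x
    \<comment> \<open>At level j the generator is evaluated at x / 2^j and at x / 2^(j-1).\<close>
    have "2 powr (1 - real j) = 1 / 2 ^ (j - 1)"
      using False by (simp add: powr_diff powr_realpow power_diff)
    moreover have "(2::real) ^ j = 2 * 2 ^ (j - 1)" using False by (cases j) auto
    ultimately show "dyadic \<psi> j x = psi j x - psi (j - 1) x"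
      using False by (simp add: dyadic_def psi_def inverse_eq_divide Let_def)
  qed
  moreover have "fourier (\<lambda>x. psi j x - psi (j - 1) x) z = fourier (psi j) z - fourier (psi (j - 1)) z"
  proof -
    have i: "integrable lborel (\<lambda>x. cis (- (x \<bullet> z)) * psi l x)" for l
      by (intro integrable_cis_mult cont_cs_integrable cont_cs_psi) simp
    have [measurable]: "psi l \<in> borel_measurable borel" for l by (intro cont_cs_measurable cont_cs_psi)
    show ?thesis using i by (simp add: fourier_eq right_diff_distrib)
  qed
  ultimately show ?thesis using False by (simp add: dkern_def right_diff_distrib fourier_psi)
qed

lemma schwartz_kern: "schwartz (\<lambda>y. kern l (y - x))"
  unfolding kern_def by (intro schwartz_affine schwartz_fourier test_fun_generator) simp

lemma schwartz_kern0: "schwartz (kern l)"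
  using schwartz_kern[of l 0] by simp

lemma continuous_kern: "continuous_on UNIV (kern l)"
  by (intro schwartz_continuous schwartz_kern0)

lemma measurable_kern [measurable]: "kern l \<in> borel_measurable borel"
  by (intro schwartz_measurable schwartz_kern0)

lemma measurable_dkern [measurable]: "dkern j \<in> borel_measurable borel"
  unfolding dkern_def[abs_def] by measurable

lemma integrable_kern: "integrable lborel (kern l)"
proof -
  obtain C where "\<And>x. norm (kern l x) \<le> C * wt (2 * DIM('a)) x" using schwartz_decay[OF schwartz_kern0] by blast
  then show ?thesis by (intro integrable_wt_bound) auto
qed

lemma integrable_fourier_psi: "integrable lborel (fourier (psi l))"
proof -
  have "integrable lborel (\<lambda>z. of_real (1 / fconst TYPE('a)) * kern l z)"
    by (intro integrable_mult_right integrable_kern)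
  moreover have "of_real (1 / fconst TYPE('a)) * kern l z = fourier (psi l) z" for z
    using less_imp_neq[OF fconst_pos[where 'a='a]]
    by (simp add: fourier_psi[symmetric] mult.assoc[symmetric])
  ultimately show ?thesis by simp
qed

text \<open>Fourier inversion at the origin, where \<open>psi l\<close> equals 1.\<close>

lemma kern_integral: "(LINT z|lborel. kern l z) = 1"
proof -
  have [measurable]: "fourier (psi l) \<in> borel_measurable borel" using integrable_fourier_psi by auto
  have "inv_fourier (fourier (psi l)) 0 = psi l 0" by (intro fourier_inversion cont_cs_psi integrable_fourier_psi)
  then show ?thesis by (simp add: inv_fourier_eq psi_eq_1 fourier_psi[symmetric])
qed

text \<open>The reproducing property: \<open>psi i\<close> vanishes outside the ball of radius
  2^(i+1), which for i < l lies in the ball where \<open>psi l\<close> equals 1, so the product of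
  the two is \<open>psi i\<close>.\<close>

lemma kern_convolution:
  assumes "i < l"
  shows "(LINT y|lborel. kern l (y - w) * kern i (x - y)) = kern i (x - w)"
proof -
  define c where "c = complex_of_real (fconst TYPE('a))"
  have "fourier (\<lambda>\<xi>. psi i \<xi> * inv_fourier (fourier (psi l)) \<xi>) (x - w)
     = c * (LINT y|lborel. fourier (psi l) y * fourier (psi i) ((x - w) - y))"
    unfolding c_def by (intro fourier_mult_inv_fourier cont_cs_psi integrable_fourier_psi)
  moreover have "psi i \<xi> * inv_fourier (fourier (psi l)) \<xi> = psi i \<xi>" for \<xi>
  proof (cases "norm \<xi> \<le> 2 ^ l")
    case True then show ?thesis by (simp add: fourier_inversion cont_cs_psi integrable_fourier_psi psi_eq_1)
  next
    case False
    have "(2::real) ^ Suc i \<le> 2 ^ l" using assms by (intro power_increasing) auto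
    with False have "psi i \<xi> = 0" by (intro psi_eq_0) linarith
    then show ?thesis by simp
  qed
  ultimately have "c * fourier (psi i) (x - w) = c * (c * (LINT y|lborel. fourier (psi l) y * fourier (psi i) ((x - w) - y)))" by simp
  also have "\<dots> = (LINT y|lborel. c * fourier (psi l) y * (c * fourier (psi i) ((x - w) - y)))"
    by (simp only: integral_mult_right_zero[symmetric] mult_ac)
  also have "\<dots> = (LINT y|lborel. kern l y * kern i ((x - w) - y))" by (simp only: c_def fourier_psi)
  also have "\<dots> = \<bar>1\<bar> ^ DIM('a) *\<^sub>R (LINT y|lborel. kern l (- w + 1 *\<^sub>R y) * kern i ((x - w) - (- w + 1 *\<^sub>R y)))"
    by (rule integral_affine) auto
  finally show ?thesis by (simp add: c_def fourier_psi)
qed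

lemma kern_decay: "\<exists>C>0. \<forall>l z. norm (kern l z) \<le> C * 2 ^ (l * DIM('a)) * wt N (2 ^ l *\<^sub>R z)"
proof -
  obtain C where C: "0 < C" "\<And>\<xi>. norm (fourier \<psi> \<xi>) \<le> C * wt N \<xi>"
    using fourier_decay[OF test_fun_generator] by blast
  show ?thesis
  proof (intro exI[of _ "fconst TYPE('a) * C"] conjI allI)
    fix l and z :: 'a
    have "norm (kern l z) = fconst TYPE('a) * 2 ^ (l * DIM('a)) * norm (fourier \<psi> (2 ^ l *\<^sub>R z))"
      by (simp add: kern_def norm_mult norm_power abs_of_pos[OF fconst_pos])
    also have "\<dots> \<le> fconst TYPE('a) * 2 ^ (l * DIM('a)) * (C * wt N (2 ^ l *\<^sub>R z))"
      by (intro mult_left_mono C mult_nonneg_nonneg less_imp_le[OF fconst_pos]) auto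
    finally show "norm (kern l z) \<le> fconst TYPE('a) * C * 2 ^ (l * DIM('a)) * wt N (2 ^ l *\<^sub>R z)"
      by (simp add: mult_ac)
  qed (use C in auto)
qed

text \<open>After scaling, the increment has norm at most 2, and over such a ball Peetre's
  inequality changes the weight by at most 3^N. The bound 2 leaves room for the later use one level
  up, at l = j + 1 with |h| \<le> 2^(-j).\<close>

lemma kern_lipschitz:
  "\<exists>C>0. \<forall>l z h. 2 ^ l * norm h \<le> 2 \<longrightarrow>
     norm (kern l (z + h) - kern l z) \<le> C * 2 ^ (l * DIM('a)) * (2 ^ l * norm h) * wt N (2 ^ l *\<^sub>R z)"
proof -
  have "\<exists>C>0. \<forall>\<xi>. norm (frechet_derivative (fourier \<psi>) (at \<xi>) b) \<le> C * wt N \<xi>" for b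
    unfolding fourier_frechet_derivative[OF test_fun_cont_cs[OF test_fun_generator]]
    by (intro fourier_decay test_fun_coordinate_mult test_fun_generator)
  then obtain C where C: "\<And>b. 0 < C b" "\<And>b \<xi>. norm (frechet_derivative (fourier \<psi>) (at \<xi>) b) \<le> C b * wt N \<xi>" by metis
  define D where "D = (\<Sum>b\<in>Basis. C b)"
  have D: "0 < D" unfolding D_def using C by (intro sum_pos) auto
  have bound: "norm (fourier \<psi> (\<zeta> + \<eta>) - fourier \<psi> \<zeta>) \<le> real DIM('a) * (D * 3 ^ N * wt N \<zeta>) * norm \<eta>"
    if \<eta>: "norm \<eta> \<le> 2" for \<zeta> \<eta>
  proof -
    have "norm (fourier \<psi> (\<zeta> + \<eta>) - fourier \<psi> \<zeta>) \<le> real DIM('a) * (D * 3 ^ N * wt N \<zeta>) * norm ((\<zeta> + \<eta>) - \<zeta>)"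
    proof (rule norm_diff_le_partials[of "cball \<zeta> 2"])
      fix x assume "x \<in> cball \<zeta> 2"
      then have x: "norm (x - \<zeta>) \<le> 2" by (simp add: dist_norm norm_minus_commute)
      show "fourier \<psi> differentiable (at x)" by (intro smooth_differentiable smooth_fourier test_fun_generator)
      fix b :: 'a assume b: "b \<in> Basis"
      have "norm (frechet_derivative (fourier \<psi>) (at x) b) \<le> C b * wt N x" by (rule C)
      also have "\<dots> \<le> D * wt N x"
        unfolding D_def using b C by (intro mult_right_mono member_le_sum) (auto intro: less_imp_le)
      also have "wt N x \<le> (1 + norm (x - \<zeta>)) ^ N * wt N \<zeta>" using wt_peetre[of N \<zeta> "x - \<zeta>"] by simp
      also have "\<dots> \<le> 3 ^ N * wt N \<zeta>" using x by (intro mult_right_mono power_mono) auto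
      finally show "norm (frechet_derivative (fourier \<psi>) (at x) b) \<le> D * 3 ^ N * wt N \<zeta>"
        using D by (simp add: mult.assoc)
    qed (use \<eta> in \<open>auto simp: dist_norm\<close>)
    then show ?thesis by simp
  qed
  define K where "K = fconst TYPE('a) * (real DIM('a) * (D * 3 ^ N))"
  show ?thesis
  proof (intro exI[of _ K] conjI allI impI)
    show "0 < K" using D by (simp add: K_def)
    fix l and z h :: 'a assume h: "2 ^ l * norm h \<le> 2"
    have "norm (kern l (z + h) - kern l z)
       = fconst TYPE('a) * 2 ^ (l * DIM('a)) * norm (fourier \<psi> (2 ^ l *\<^sub>R z + 2 ^ l *\<^sub>R h) - fourier \<psi> (2 ^ l *\<^sub>R z))"
      by (simp add: kern_def right_diff_distrib[symmetric] norm_mult scaleR_add_right abs_mult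
          abs_of_pos[OF fconst_pos] del: of_real_mult of_real_power)
    also have "\<dots> \<le> fconst TYPE('a) * 2 ^ (l * DIM('a)) * (real DIM('a) * (D * 3 ^ N * wt N (2 ^ l *\<^sub>R z)) * norm (2 ^ l *\<^sub>R h))"
      using h by (intro mult_left_mono bound mult_nonneg_nonneg less_imp_le[OF fconst_pos]) auto
    finally show "norm (kern l (z + h) - kern l z) \<le> K * 2 ^ (l * DIM('a)) * (2 ^ l * norm h) * wt N (2 ^ l *\<^sub>R z)"
      by (simp add: K_def mult_ac)
  qed
qed

end

subsection \<open>Convolution with rapidly decaying kernels\<close>

lemma continuous_wt: "continuous_on UNIV (wt N :: 'a::euclidean_space \<Rightarrow> real)"
proof -
  have "(1 + norm x) ^ N \<noteq> 0" for x :: 'a using add_pos_nonneg[of 1 "norm x"] by simp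
  then show ?thesis unfolding wt_def[abs_def] by (intro continuous_intros) auto
qed

text \<open>Fubini uses only decay, so this class covers Schwartz functions and compactly supported
  continuous ones at once.\<close>

definition rapid :: "('a::euclidean_space \<Rightarrow> complex) \<Rightarrow> bool" where
  "rapid u \<longleftrightarrow> u \<in> borel_measurable borel \<and> (\<forall>N. \<exists>C>0. \<forall>x. norm (u x) \<le> C * wt N x)"

text \<open>Integrability against some polynomial weight: it holds for Borel functions in L_p with p
  \<ge> 1 and makes pairings with \<open>rapid\<close> functions converge.\<close>

definition wint :: "('a::euclidean_space \<Rightarrow> complex) \<Rightarrow> bool" where
  "wint f \<longleftrightarrow> f \<in> borel_measurable borel \<and> (\<exists>N. integrable lborel (\<lambda>x. norm (f x) * wt N x))"

text \<open>This is convolution with the reflected kernel, which is why \<open>kern\<close> is built from the Fourier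
  transform of the generator and not from its inverse Fourier transform.\<close>

definition conv :: "('a::euclidean_space \<Rightarrow> complex) \<Rightarrow> ('a \<Rightarrow> complex) \<Rightarrow> 'a \<Rightarrow> complex" where
  "conv k f y = (LINT x|lborel. f x * k (x - y))"

lemma rapid_schwartz: "schwartz u \<Longrightarrow> rapid u"
  by (simp add: rapid_def schwartz_measurable schwartz_decay)

lemma rapid_cont_cs: "cont_cs u \<Longrightarrow> rapid u"
  by (simp add: rapid_def cont_cs_measurable cont_cs_decay)

lemma rapid_integrable: "rapid u \<Longrightarrow> integrable lborel (u :: 'a::euclidean_space \<Rightarrow> complex)"
  unfolding rapid_def by (metis integrable_wt_bound)

lemma rapid_diff:
  assumes "rapid u" "rapid v" shows "rapid (\<lambda>x. u x - v x)"
  unfolding rapid_def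
proof (intro conjI allI)
  show "(\<lambda>x. u x - v x) \<in> borel_measurable borel" using assms by (auto simp: rapid_def)
  fix N
  obtain C D where C: "0 < C" "\<And>x. norm (u x) \<le> C * wt N x" and D: "0 < D" "\<And>x. norm (v x) \<le> D * wt N x"
    using assms unfolding rapid_def by metis
  have "norm (u x - v x) \<le> (C + D) * wt N x" for x
    using norm_triangle_ineq4[of "u x" "v x"] C(2)[of x] D(2)[of x] by (simp add: distrib_right)
  then show "\<exists>C>0. \<forall>x. norm (u x - v x) \<le> C * wt N x" using C D by (intro exI[of _ "C + D"]) auto
qed

lemma rapid_translate:
  assumes "rapid u" shows "rapid (\<lambda>x. u (x - y))"
  unfolding rapid_def
proof (intro conjI allI)
  have [measurable]: "u \<in> borel_measurable borel" using assms by (auto simp: rapid_def)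
  show "(\<lambda>x. u (x - y)) \<in> borel_measurable borel" by measurable
  fix N
  obtain C where C: "0 < C" "\<And>x. norm (u x) \<le> C * wt N x" using assms unfolding rapid_def by metis
  have "norm (u (x - y)) \<le> C * (1 + norm y) ^ N * wt N x" for x
  proof -
    have "wt N (x - y) \<le> (1 + norm y) ^ N * wt N x" using wt_peetre[of N x "- y"] by simp
    then have "C * wt N (x - y) \<le> C * ((1 + norm y) ^ N * wt N x)" using C(1) by (intro mult_left_mono) auto
    then show ?thesis using C(2)[of "x - y"] by (simp add: mult.assoc)
  qed
  then show "\<exists>C>0. \<forall>x. norm (u (x - y)) \<le> C * wt N x"
    using C by (intro exI[of _ "C * (1 + norm y) ^ N"]) (auto simp: add_pos_nonneg)
qed

lemma wint_mult_rapid_integrable: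
  assumes f: "wint f" and u: "rapid u"
  shows "integrable lborel (\<lambda>x. f x * u x)"
proof -
  obtain N where N: "integrable lborel (\<lambda>x. norm (f x) * wt N x)" using f by (auto simp: wint_def)
  obtain C where C: "0 < C" "\<And>x. norm (u x) \<le> C * wt N x" using u unfolding rapid_def by metis
  have [measurable]: "f \<in> borel_measurable borel" "u \<in> borel_measurable borel" using f u by (auto simp: wint_def rapid_def)
  show ?thesis
  proof (rule Bochner_Integration.integrable_bound)
    show "integrable lborel (\<lambda>x. C * (norm (f x) * wt N x))" using N by (rule integrable_mult_right)
    show "AE x in lborel. norm (f x * u x) \<le> norm (C * (norm (f x) * wt N x))"
    proof (rule AE_I2)
      fix x
      have "norm (f x) * norm (u x) \<le> norm (f x) * (C * wt N x)" using C by (intro mult_left_mono) auto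
      then show "norm (f x * u x) \<le> norm (C * (norm (f x) * wt N x))"
        using C by (simp add: norm_mult abs_mult mult_ac)
    qed
  qed simp
qed

text \<open>Peetre's inequality moves the decay of k(x - y) onto x, where integrability of f asks
  for it, at the cost of (1 + |y|)^N, which the decay of u pays. What remains is a product of
  integrable functions of x and of y.\<close>

lemma conv_pair_integrable:
  fixes f k u :: "'a::euclidean_space \<Rightarrow> complex"
  assumes f: "wint f" and k: "rapid k" and u: "rapid u"
  shows "integrable (lborel \<Otimes>\<^sub>M lborel) (case_prod (\<lambda>x y. f x * (k (x - y) * u y)))"
proof -
  have [measurable]: "f \<in> borel_measurable borel" "k \<in> borel_measurable borel" "u \<in> borel_measurable borel"
    using f k u by (auto simp: wint_def rapid_def)
  obtain N where N: "integrable lborel (\<lambda>x. norm (f x) * wt N x)" using f by (auto simp: wint_def)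
  obtain C where C: "0 < C" "\<And>x. norm (k x) \<le> C * wt N x" using k unfolding rapid_def by metis
  obtain D where D: "0 < D" "\<And>x. norm (u x) \<le> D * wt (2 * DIM('a) + N) x" using u unfolding rapid_def by metis
  have i1: "integrable lborel (\<lambda>x. complex_of_real (norm (f x) * wt N x))" using N by (rule integrable_of_real)
  have i2: "integrable lborel (\<lambda>y::'a. complex_of_real (wt (2 * DIM('a)) y))" by (intro integrable_of_real integrable_wt order_refl)
  show ?thesis
  proof (rule Bochner_Integration.integrable_bound)
    show "integrable (lborel \<Otimes>\<^sub>M lborel) (\<lambda>z. complex_of_real (C * D) *
        (case z of (x, y) \<Rightarrow> complex_of_real (norm (f x) * wt N x) * complex_of_real (wt (2 * DIM('a)) (y::'a))))"
      by (intro integrable_mult_right integrable_pair_mult[OF i1 i2])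
    show "AE z in lborel \<Otimes>\<^sub>M lborel. norm (case_prod (\<lambda>x y. f x * (k (x - y) * u y)) z)
      \<le> norm (complex_of_real (C * D) * (case z of (x, y) \<Rightarrow> complex_of_real (norm (f x) * wt N x) * complex_of_real (wt (2 * DIM('a)) (y::'a))))"
    proof (rule AE_I2, clarify)
      fix x y :: 'a
      have "norm (k (x - y)) \<le> C * ((1 + norm y) ^ N * wt N x)"
      proof -
        have "wt N (x - y) \<le> (1 + norm y) ^ N * wt N x" using wt_peetre[of N x "- y"] by simp
        then have "C * wt N (x - y) \<le> C * ((1 + norm y) ^ N * wt N x)" using C(1) by (intro mult_left_mono) auto
        then show ?thesis using C(2)[of "x - y"] by linarith
      qed
      then have "norm (k (x - y)) * norm (u y) \<le> (C * ((1 + norm y) ^ N * wt N x)) * (D * wt (2 * DIM('a) + N) y)"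
        using D C by (intro mult_mono) auto
      also have "\<dots> = C * D * wt N x * (wt (2 * DIM('a) + N) y * (1 + norm y) ^ N)" by (simp add: mult_ac)
      also have "\<dots> = C * D * wt N x * wt (2 * DIM('a)) y" by (simp only: wt_mult_power)
      finally have "norm (f x) * (norm (k (x - y)) * norm (u y)) \<le> norm (f x) * (C * D * wt N x * wt (2 * DIM('a)) y)"
        by (rule mult_left_mono) simp
      then show "norm (f x * (k (x - y) * u y)) \<le> norm (complex_of_real (C * D) * (complex_of_real (norm (f x) * wt N x) * complex_of_real (wt (2 * DIM('a)) (y::'a))))"
        using C D by (simp add: norm_mult mult_ac)
    qed
  qed simp
qed

lemma conv_adjoint:
  fixes f k u :: "'a::euclidean_space \<Rightarrow> complex"
  assumes "wint f" "rapid k" "rapid u"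
  shows "integrable lborel (\<lambda>y. conv k f y * u y)"
    and "(LINT x|lborel. f x * (LINT y|lborel. k (x - y) * u y)) = (LINT y|lborel. conv k f y * u y)"
proof -
  note fub = conv_pair_integrable[OF assms]
  have "(LINT x|lborel. f x * (k (x - y) * u y)) = (LINT x|lborel. f x * k (x - y) * u y)" for y
    by (simp only: mult.assoc)
  then have eq: "(LINT x|lborel. f x * (k (x - y) * u y)) = conv k f y * u y" for y
    by (simp only: conv_def integral_mult_left_zero)
  show "integrable lborel (\<lambda>y. conv k f y * u y)"
    using lborel_pair.integrable_snd[OF fub] by (simp only: eq)
  show "(LINT x|lborel. f x * (LINT y|lborel. k (x - y) * u y)) = (LINT y|lborel. conv k f y * u y)"
    using lborel_pair.Fubini_integral[OF fub] by (simp only: eq integral_mult_right_zero)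
qed

lemma conv_measurable:
  assumes [measurable]: "f \<in> borel_measurable borel" "k \<in> borel_measurable borel"
  shows "conv k f \<in> borel_measurable borel"
  unfolding conv_def[abs_def] by measurable

lemma conv_diff:
  assumes "wint f" "rapid k" "rapid k'"
  shows "conv (\<lambda>x. k x - k' x) f y = conv k f y - conv k' f y"
  using wint_mult_rapid_integrable[OF assms(1) rapid_translate[OF assms(2)], of y]
    wint_mult_rapid_integrable[OF assms(1) rapid_translate[OF assms(3)], of y]
  by (simp add: conv_def right_diff_distrib)

text \<open>The fundamental lemma of the calculus of variations. A positive weight makes f
  integrable without changing its zeros; the hypothesis extends to indicators of closed sets by
  limits of cut-offs, then to all Borel sets since closed sets form an intersection-stable
  generator.\<close>

lemma AE_eq_0_test:
  fixes f :: "'a::euclidean_space \<Rightarrow> complex"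
  assumes f: "wint f" and zero: "\<And>u. cont_cs u \<Longrightarrow> (LINT x|lborel. f x * u x) = 0"
  shows "AE x in lborel. f x = 0"
proof -
  have [measurable]: "f \<in> borel_measurable borel" using f by (auto simp: wint_def)
  obtain N where N: "integrable lborel (\<lambda>x. norm (f x) * wt N x)" using f by (auto simp: wint_def)
  define E where "E x = f x * of_real (wt N x)" for x
  have [measurable]: "E \<in> borel_measurable borel" by (simp add: E_def[abs_def])
  have E: "integrable lborel E"
    by (rule Bochner_Integration.integrable_bound[OF N]) (auto simp: E_def norm_mult)
  have E0: "(LINT x|lborel. E x * u x) = 0" if "cont_cs u" for u
  proof -
    have "cont_cs (\<lambda>x. of_real (wt N x) * u x)"
      by (intro cont_cs_mult that continuous_on_of_real continuous_wt)
    from zero[OF this] show ?thesis by (simp add: E_def mult_ac)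
  qed
  have closed: "(LINT x:S|lborel. E x) = 0" if S: "closed S" for S
  proof (cases "S = {}")
    case False
    \<comment> \<open>The first factor decreases to the indicator of S, the second exhausts space
      and gives compact support.\<close>
    define v :: "nat \<Rightarrow> 'a \<Rightarrow> real" where "v n x = max 0 (1 - real n * infdist x S) * max 0 (min 1 (real n - norm x))" for n x
    have "(\<lambda>n. LINT x|lborel. E x * of_real (v n x)) \<longlonglongrightarrow> (LINT x|lborel. E x * of_real (indicator S x))"
    proof (rule integral_dominated_convergence[where w = "\<lambda>x. norm (E x)"])
      show "AE x in lborel. (\<lambda>n. E x * of_real (v n x)) \<longlonglongrightarrow> E x * of_real (indicator S x)"
      proof (rule AE_I2)
        fix x :: 'a
        obtain n1 where n1: "norm x + 1 \<le> real n1" using real_arch_simple by blast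
        have "\<exists>n2. \<forall>n\<ge>n2. max 0 (1 - real n * infdist x S) = indicator S x"
        proof (cases "x \<in> S")
          case False
          then have pos: "0 < infdist x S" using S \<open>S \<noteq> {}\<close> by (metis in_closed_iff_infdist_zero infdist_nonneg order_le_less)
          obtain n2 where n2: "1 / infdist x S \<le> real n2" using real_arch_simple by blast
          have "1 - real n * infdist x S \<le> 0" if "n2 \<le> n" for n
          proof -
            have "1 / infdist x S \<le> real n" using n2 that by linarith
            then show ?thesis using pos by (simp add: divide_le_eq)
          qed
          then show ?thesis using False by (intro exI[of _ n2]) (auto simp: max_absorb1)
        qed auto
        then obtain n2 where n2: "\<And>n. n2 \<le> n \<Longrightarrow> max 0 (1 - real n * infdist x S) = indicator S x" by blast
        have "\<forall>\<^sub>F n in sequentially. E x * of_real (v n x) = E x * of_real (indicator S x)"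
          using eventually_ge_at_top[of "max n1 n2"]
        proof eventually_elim
          case (elim n)
          then have "real n1 \<le> real n" by simp
          then have "max 0 (min 1 (real n - norm x)) = 1" using n1 by (simp add: max_def min_def)
          then show ?case using n2[of n] elim by (simp add: v_def)
        qed
        then show "(\<lambda>n. E x * of_real (v n x)) \<longlonglongrightarrow> E x * of_real (indicator S x)" by (rule tendsto_eventually)
      qed
      have "\<bar>v n x\<bar> \<le> 1" for n x
        using mult_mono[of "max 0 (1 - real n * infdist x S)" 1 "max 0 (min 1 (real n - norm x))" 1]
        by (simp add: v_def abs_mult infdist_nonneg)
      then show "AE x in lborel. norm (E x * of_real (v n x)) \<le> norm (E x)" for n
        by (simp add: norm_mult mult_left_le)
      show "(\<lambda>x. E x * of_real (v n x)) \<in> borel_measurable lborel" for n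
      proof -
        have [measurable]: "(\<lambda>x. infdist x S) \<in> borel_measurable borel"
          by (intro borel_measurable_continuous_onI continuous_intros)
        show ?thesis unfolding v_def by measurable
      qed
      show "(\<lambda>x. E x * of_real (indicator S x)) \<in> borel_measurable lborel" using S by (auto simp: borel_closed)
    qed (use E in auto)
    moreover have "(LINT x|lborel. E x * of_real (v n x)) = 0" for n
      by (rule E0) (auto simp: cont_cs_def v_def intro!: continuous_intros exI[of _ "real n"])
    ultimately have "(LINT x|lborel. E x * of_real (indicator S x)) = 0" by (simp add: LIMSEQ_const_iff)
    then show ?thesis by (simp add: set_lebesgue_integral_def scaleR_conv_of_real mult.commute)
  qed (simp add: set_lebesgue_integral_def)
  have all: "(LINT x:A|lborel. E x) = 0" if "A \<in> sets borel" for A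
  proof -
    have "Int_stable (Collect closed :: 'a set set)" by (auto simp: Int_stable_def)
    moreover have "Collect closed \<subseteq> Pow (UNIV :: 'a set)" by simp
    moreover have "A \<in> sigma_sets UNIV (Collect closed)" using that by (simp add: borel_eq_closed)
    ultimately show ?thesis
    proof (induction rule: sigma_sets_induct_disjoint)
      case (basic A) then show ?case using closed by simp
    next
      case (compl A)
      then have A: "A \<in> sets borel" by (simp add: borel_eq_closed)
      have "(LINT x:UNIV|lborel. E x) = (LINT x:A|lborel. E x) + (LINT x:UNIV - A|lborel. E x)"
        using set_integral_Un[of A "UNIV - A" lborel E] A
          integrable_mult_indicator[of A lborel E] integrable_mult_indicator[of "UNIV - A" lborel E] E
        by (simp add: set_integrable_def)
      then show ?case using compl closed[of UNIV] by simp
    next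
      case (union A)
      then have A: "A i \<in> sets borel" for i by (auto simp: borel_eq_closed)
      have "(LINT x:(\<Union>i. A i)|lborel. E x) = (\<Sum>i. LINT x:A i|lborel. E x)"
        using A E union(1) unfolding disjoint_family_on_def
        by (intro lebesgue_integral_countable_add) (auto simp: set_integrable_def intro!: integrable_mult_indicator)
      then show ?case using union by simp
    qed (simp add: set_lebesgue_integral_def)
  qed
  have "AE x in lborel. E x = 0"
    by (rule sigma_finite_measure.density_zero[OF lborel.sigma_finite_measure_axioms E]) (simp add: all)
  then show ?thesis by eventually_elim (auto simp: E_def)
qed

section \<open>Littlewood--Paley pieces as convolutions\<close>

context resolution_of_unity
begin

lemma rapid_kern: "rapid (kern l)"
  by (intro rapid_schwartz schwartz_kern0)

lemma rapid_dkern: "rapid (dkern j)"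
proof -
  have "dkern j = (if j = 0 then kern 0 else (\<lambda>x. kern j x - kern (j - 1) x))" by (auto simp: dkern_def)
  then show ?thesis by (auto intro: rapid_kern rapid_diff)
qed

text \<open>Telescoping: the partial sums of the Littlewood--Paley series are low-pass filters of
  f.\<close>

lemma sum_conv_dkern:
  assumes "wint f" shows "(\<Sum>j\<le>J. conv (dkern j) f y) = conv (kern J) f y"
proof (induction J)
  case 0 then show ?case by (simp add: conv_def dkern_def)
next
  case (Suc J)
  have "conv (dkern (Suc J)) f y = conv (\<lambda>x. kern (Suc J) x - kern J x) f y" by (simp add: conv_def dkern_def)
  with Suc show ?case by (simp add: conv_diff assms rapid_kern)
qed

lemma dkern_convolution:
  assumes "j < l" shows "(LINT y|lborel. dkern j (x - y) * kern l (y - w)) = dkern j (x - w)"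
proof -
  have int: "integrable lborel (\<lambda>y. kern l (y - w) * kern i (x - y))" for i
  proof -
    obtain C where C: "\<And>x. norm (kern i x) \<le> C * wt 0 x" using rapid_kern unfolding rapid_def by metis
    show ?thesis
    proof (rule Bochner_Integration.integrable_bound)
      show "integrable lborel (\<lambda>y. C * norm (kern l (y - w)))"
        by (intro integrable_mult_right integrable_norm rapid_integrable rapid_translate rapid_kern)
      show "AE y in lborel. norm (kern l (y - w) * kern i (x - y)) \<le> norm (C * norm (kern l (y - w)))"
      proof (rule AE_I2)
        fix y
        have "norm (kern i (x - y)) \<le> \<bar>C\<bar>" using C[of "x - y"] by (simp add: wt_def)
        then show "norm (kern l (y - w) * kern i (x - y)) \<le> norm (C * norm (kern l (y - w)))"
          by (simp add: norm_mult abs_mult mult.commute mult_right_mono)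
      qed
    qed simp
  qed
  show ?thesis
  proof (cases "j = 0")
    case True then show ?thesis using kern_convolution[of 0 l w x] assms by (simp add: dkern_def mult.commute)
  next
    case False
    then have "(LINT y|lborel. dkern j (x - y) * kern l (y - w))
       = (LINT y|lborel. kern l (y - w) * kern j (x - y) - kern l (y - w) * kern (j - 1) (x - y))"
      by (simp add: dkern_def algebra_simps)
    also have "\<dots> = dkern j (x - w)"
      using False assms int kern_convolution[of j l w x] kern_convolution[of "j - 1" l w x] by (simp add: dkern_def)
    finally show ?thesis .
  qed
qed

abbreviation LP_piece :: "nat \<Rightarrow> ('a \<Rightarrow> complex) \<Rightarrow> ('a \<Rightarrow> complex) \<Rightarrow> complex" where
  "LP_piece j f \<equiv> dist_inv_fourier (dist_mult (dyadic \<psi> j) (dist_fourier (regular_dist f)))"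

lemma cont_cs_dyadic: "cont_cs (dyadic \<psi> j)"
proof -
  have c: "continuous_on UNIV \<psi>" using test_fun_generator by (auto simp: test_fun_def smooth_continuous)
  have cc: "continuous_on UNIV (\<lambda>x. \<psi> (c *\<^sub>R x))" for c
    by (rule continuous_on_compose2[OF c]) (auto intro!: continuous_intros)
  have "continuous_on UNIV (dyadic \<psi> j)"
    using c cc[of "2 powr (1 - real j)"] cc[of "(1 / 2) * 2 powr (1 - real j)"]
    by (cases "j = 0") (auto simp: dyadic_def[abs_def] Let_def inverse_eq_divide intro!: continuous_on_diff)
  moreover have "dyadic \<psi> j x = 0" if x: "2 ^ Suc j \<le> norm x" for x
  proof -
    define y where "y = 2 powr (1 - real j) *\<^sub>R x"
    have "2 powr (1 - real j) = 2 / 2 ^ j" by (simp add: powr_diff powr_realpow)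
    then have "norm y = 2 * norm x / 2 ^ j" by (simp add: y_def)
    then have y: "4 \<le> norm y" using x by (simp add: le_divide_eq)
    have z: "\<psi> v = 0" if "2 \<le> norm v" for v using resolution that by (simp add: resolution_generator_def)
    have "(2::real) \<le> 2 ^ Suc j" by simp
    with x have "2 \<le> norm x" by linarith
    with y show ?thesis by (simp add: dyadic_def Let_def y_def[symmetric] z)
  qed
  ultimately show ?thesis by (auto simp: cont_cs_def)
qed

lemma LP_piece_eq:
  assumes f: "wint f" and u: "rapid u"
  shows "LP_piece j f u = (LINT x|lborel. f x * (LINT y|lborel. dkern j (x - y) * u y))"
proof -
  have [measurable]: "f \<in> borel_measurable borel" "u \<in> borel_measurable borel" using f u by (auto simp: wint_def rapid_def)
  have "fourier (\<lambda>\<xi>. dyadic \<psi> j \<xi> * inv_fourier u \<xi>) x = (LINT y|lborel. dkern j (x - y) * u y)" for x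
    unfolding fourier_mult_inv_fourier[OF cont_cs_dyadic rapid_integrable[OF u]] dkern_eq
    by (simp only: integral_mult_right_zero[symmetric] mult_ac)
  then have "LP_piece j f u = (LINT x|lebesgue. f x * (LINT y|lborel. dkern j (x - y) * u y))"
    by (simp add: dist_inv_fourier_def dist_mult_def dist_fourier_def regular_dist_def)
  also have "\<dots> = (LINT x|lborel. f x * (LINT y|lborel. dkern j (x - y) * u y))"
    by (rule integral_lebesgue_eq) measurable
  finally show ?thesis .
qed

text \<open>The adjoint identity moves the kernel from the test function to f. The convolution
  thereby becomes a competitor in the infimum that defines \<open>dist_Lp_norm\<close>.\<close>

lemma represents_conv:
  assumes f: "wint f" shows "represents (conv (dkern j) f) (LP_piece j f)"
  unfolding represents_def
proof (intro allI impI conjI)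
  fix u :: "'a \<Rightarrow> complex" assume u: "schwartz u"
  have [measurable]: "conv (dkern j) f \<in> borel_measurable borel" "u \<in> borel_measurable borel"
    using f u by (auto simp: wint_def schwartz_measurable intro!: conv_measurable)
  note adj = conv_adjoint[OF f rapid_dkern rapid_schwartz[OF u], of j]
  show "integrable lebesgue (\<lambda>x. conv (dkern j) f x * u x)"
    using adj(1) by (subst integrable_completion) auto
  show "LP_piece j f u = regular_dist (conv (dkern j) f) u"
    by (simp add: LP_piece_eq[OF f rapid_schwartz[OF u]] adj(2) regular_dist_def integral_lebesgue_eq)
qed

text \<open>Pair the distribution with a translate of \<open>kern l\<close>. For j < l convolution
  with \<open>kern l\<close> leaves \<open>dkern j\<close> unchanged, so every representing function
  h, whatever its values on null sets, yields the same pointwise defined convolution.\<close>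

lemma represents_reproducing:
  assumes f: "wint f" and h: "represents h (LP_piece j f)" and "j < l"
  shows "integrable lebesgue (\<lambda>y. h y * kern l (y - x))"
    and "conv (dkern j) f x = (LINT y|lebesgue. h y * kern l (y - x))"
proof -
  note k = schwartz_kern[of l x]
  show "integrable lebesgue (\<lambda>y. h y * kern l (y - x))" using h k unfolding represents_def by blast
  have "(LINT y|lebesgue. h y * kern l (y - x)) = LP_piece j f (\<lambda>y. kern l (y - x))"
    using h k unfolding represents_def regular_dist_def by auto
  also have "\<dots> = conv (dkern j) f x"
    using assms(3) by (simp add: LP_piece_eq[OF f rapid_schwartz[OF k]] dkern_convolution conv_def)
  finally show "conv (dkern j) f x = (LINT y|lebesgue. h y * kern l (y - x))" ..
qed

end

subsection \<open>Translations and Young's inequality\<close>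

lemma AE_translate:
  fixes z :: "'a::euclidean_space"
  assumes "AE x in lborel. P x" shows "AE x in lborel. P (x + z)"
proof -
  have "AE x in distr lborel borel ((+) z). P x" by (subst lborel_distr_plus) (rule assms)
  then have "AE x in lborel. P (z + x)" by (rule AE_distrD[rotated]) simp
  then show ?thesis by (simp add: add.commute)
qed

lemma nn_integral_translate:
  fixes z :: "'a::euclidean_space"
  assumes "f \<in> borel_measurable borel"
  shows "(\<integral>\<^sup>+x. f (x + z) \<partial>lborel) = (\<integral>\<^sup>+x. f x \<partial>lborel)"
  using nn_integral_affine[OF assms, of 1 z] by (simp add: add.commute)

lemma Lpe_translate_le:
  fixes z :: "'a::euclidean_space"
  assumes p: "0 < p" and [measurable]: "v \<in> borel_measurable borel"
  shows "Lpe p lborel (\<lambda>x. v (x + z)) \<le> Lpe p lborel v"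
  using p
proof (cases p rule: exponent_cases)
  case infinite
  have "AE x in lborel. v (x + z) \<le> esssup lborel v" using esssup_AE by (rule AE_translate)
  then show ?thesis using infinite by (auto simp: Lpe_infinity intro!: esssup_I)
next
  case (finite P)
  then show ?thesis using nn_integral_translate[of "\<lambda>x. epow (v x) P" z] by (simp add: Lpe_real)
qed

text \<open>The weighted Minkowski inequality with c = 1, as no translate of v has a larger norm
  than v.\<close>

lemma Lpe_young:
  fixes v w :: "'a::euclidean_space \<Rightarrow> ennreal"
  assumes p: "1 \<le> p" and [measurable]: "v \<in> borel_measurable borel" "w \<in> borel_measurable borel"
    and w: "(\<integral>\<^sup>+z. w z \<partial>lborel) < \<infinity>"
  shows "Lpe p lborel (\<lambda>x. \<integral>\<^sup>+z. w z * v (x + z) \<partial>lborel) \<le> Lpe p lborel v * (\<integral>\<^sup>+z. w z \<partial>lborel)"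
proof -
  have p0: "0 < p" using p by (rule less_le_trans[rotated]) simp
  have "Lpe p lborel (\<lambda>x. \<integral>\<^sup>+z. w z * v (x + z) \<partial>lborel) \<le> Lpe p lborel v * (\<integral>\<^sup>+z. w z * ennreal 1 \<partial>lborel)"
    by (rule Lpe_nn_integral_le)
      (use p w Lpe_translate_le[OF p0, of v] in \<open>auto simp: lborel.sigma_finite_measure_axioms\<close>)
  then show ?thesis by simp
qed

lemma Lpe_lebesgue_eq:
  assumes p: "0 < p" and [measurable]: "v \<in> borel_measurable borel" and u: "u \<in> borel_measurable lebesgue"
    and eq: "AE x in lebesgue. u x = v x"
  shows "Lpe p lebesgue u = Lpe p lborel v"
proof -
  have v: "v \<in> borel_measurable lebesgue" by (intro measurable_completion) simp
  have "Lpe p lebesgue u = Lpe p lebesgue v" using p u v eq by (rule Lpe_cong_AE)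
  also have "\<dots> = Lpe p lborel v"
    using p
  proof (cases p rule: exponent_cases)
    case infinite
    have "esssup lebesgue v \<le> B \<longleftrightarrow> esssup lborel v \<le> B" for B
      using v by (simp add: esssup_le_iff AE_completion_iff)
    then show ?thesis using infinite by (simp add: Lpe_infinity) (meson order_antisym order_refl)
  next
    case (finite P)
    then show ?thesis by (simp add: Lpe_real nn_integral_completion)
  qed
  finally show ?thesis .
qed

lemma nn_integral_wt_scaled:
  assumes "0 < c"
  shows "(\<integral>\<^sup>+x. ennreal (wt N (c *\<^sub>R (x - z :: 'a::euclidean_space))) \<partial>lborel) = ennreal (1 / c ^ DIM('a)) * (\<integral>\<^sup>+x. ennreal (wt N (x::'a)) \<partial>lborel)"
proof -
  have "(\<integral>\<^sup>+x. ennreal (wt N (c *\<^sub>R (x - z))) \<partial>lborel)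
     = ennreal (\<bar>1 / c\<bar> ^ DIM('a)) * (\<integral>\<^sup>+x. ennreal (wt N (c *\<^sub>R (z + (1 / c) *\<^sub>R x - z))) \<partial>lborel)"
    by (rule nn_integral_affine) (use assms in auto)
  then show ?thesis using assms by (simp add: power_divide)
qed

definition wt_mass :: "'a::euclidean_space itself \<Rightarrow> real" where
  "wt_mass _ = (LINT x::'a|lborel. wt (2 * DIM('a)) x)"

lemma nn_integral_wt: "(\<integral>\<^sup>+x. ennreal (wt (2 * DIM('a)) (x::'a::euclidean_space)) \<partial>lborel) = ennreal (wt_mass TYPE('a))"
  unfolding wt_mass_def by (intro nn_integral_eq_integral integrable_wt) auto

lemma wt_mass_pos: "0 < wt_mass TYPE('a::euclidean_space)"
proof -
  have "0 \<le> wt_mass TYPE('a)" unfolding wt_mass_def by (intro Bochner_Integration.integral_nonneg) auto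
  moreover have "wt_mass TYPE('a) \<noteq> 0"
  proof
    assume "wt_mass TYPE('a) = 0"
    then have "AE x::'a in lborel. ennreal (wt (2 * DIM('a)) x) = 0"
      using nn_integral_wt[where 'a='a] by (simp add: nn_integral_0_iff_AE)
    then have "AE x::'a in lborel. False" by eventually_elim (metis ennreal_eq_0_iff not_le wt_pos)
    then show False by (simp add: ae_filter_eq_bot_iff eventually_False)
  qed
  ultimately show ?thesis by simp
qed

lemma nn_integral_wt_dyadic:
  "(\<integral>\<^sup>+x. ennreal (C * 2 ^ (l * DIM('a)) * wt (2 * DIM('a)) (2 ^ l *\<^sub>R (x - z :: 'a::euclidean_space))) \<partial>lborel)
    = ennreal (C * wt_mass TYPE('a))" if "0 \<le> C"
proof -
  have "(\<integral>\<^sup>+x. ennreal (C * 2 ^ (l * DIM('a)) * wt (2 * DIM('a)) (2 ^ l *\<^sub>R (x - z))) \<partial>lborel)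
     = ennreal (C * 2 ^ (l * DIM('a))) * (\<integral>\<^sup>+x. ennreal (wt (2 * DIM('a)) (2 ^ l *\<^sub>R (x - z))) \<partial>lborel)"
    using that by (simp add: ennreal_mult nn_integral_cmult)
  also have "\<dots> = ennreal (C * 2 ^ (l * DIM('a))) * (ennreal (1 / (2 ^ l) ^ DIM('a)) * ennreal (wt_mass TYPE('a)))"
    by (simp add: nn_integral_wt_scaled nn_integral_wt)
  also have "\<dots> = ennreal (C * wt_mass TYPE('a))"
    using that wt_mass_pos[where 'a='a] by (simp add: ennreal_mult[symmetric] power_mult less_imp_le)
  finally show ?thesis .
qed

context resolution_of_unity
begin

subsection \<open>The Littlewood--Paley series represents the function\<close>

text \<open>Convergence is assumed; the limit S is identified weakly. Paired with a test function u,
  the filters tend to the pairing of S with u by domination, while moving the kernel onto u produces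
  mollifications of u, which converge to u.\<close>

lemma conv_kern_limit:
  assumes f: "wint f" and G [measurable]: "G \<in> borel_measurable borel"
    and Gi: "integrable lborel (\<lambda>x. G x * wt N x)"
    and bd: "AE y in lborel. \<forall>J. norm (conv (kern J) f y) \<le> G y"
    and cv: "AE y in lborel. convergent (\<lambda>J. conv (kern J) f y)"
  shows "AE y in lborel. (\<lambda>J. conv (kern J) f y) \<longlonglongrightarrow> f y"
proof -
  have [measurable]: "f \<in> borel_measurable borel" using f by (auto simp: wint_def)
  have [measurable]: "conv (kern J) f \<in> borel_measurable borel" for J by (intro conv_measurable) auto
  define S where "S y = lim (\<lambda>J. conv (kern J) f y)" for y
  have [measurable]: "S \<in> borel_measurable borel" unfolding S_def by measurable
  have SL: "AE y in lborel. (\<lambda>J. conv (kern J) f y) \<longlonglongrightarrow> S y"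
    using cv by eventually_elim (simp add: S_def convergent_LIMSEQ_iff)
  have SG: "AE y in lborel. norm (S y) \<le> G y"
    using SL bd by eventually_elim (auto intro: LIMSEQ_le_const2[OF tendsto_norm])
  have G0: "AE y in lborel. 0 \<le> G y" using SG by eventually_elim (metis norm_ge_zero order_trans)
  have "wint S" unfolding wint_def
  proof (intro conjI exI)
    show "integrable lborel (\<lambda>x. norm (S x) * wt N x)"
      by (rule Bochner_Integration.integrable_bound[OF Gi])
        (use SG in \<open>auto elim!: eventually_mono simp: abs_mult intro!: mult_right_mono\<close>)
  qed simp
  have test: "(LINT y|lborel. (S y - f y) * u y) = 0" if u: "cont_cs u" for u
  proof -
    have [measurable]: "u \<in> borel_measurable borel" using u by (rule cont_cs_measurable)
    obtain D where D: "0 < D" "\<And>x. norm (u x) \<le> D * wt N x" using cont_cs_decay[OF u] by blast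
    have lim1: "(\<lambda>J. LINT y|lborel. conv (kern J) f y * u y) \<longlonglongrightarrow> (LINT y|lborel. S y * u y)"
    proof (rule integral_dominated_convergence[where w = "\<lambda>y. D * (G y * wt N y)"])
      show "AE y in lborel. (\<lambda>J. conv (kern J) f y * u y) \<longlonglongrightarrow> S y * u y"
        using SL by eventually_elim (intro tendsto_intros)
      show "AE y in lborel. norm (conv (kern J) f y * u y) \<le> D * (G y * wt N y)" for J
        using bd
      proof eventually_elim
        case (elim y)
        have "norm (conv (kern J) f y) * norm (u y) \<le> G y * (D * wt N y)"
          using elim D order_trans[OF norm_ge_zero, of "conv (kern J) f y" "G y"] by (intro mult_mono) auto
        then show ?case by (simp add: norm_mult mult_ac)
      qed
    qed (use Gi in auto)
    \<comment> \<open>With the kernel moved onto u and rescaled to level 0, J remains only in the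
      argument of u.\<close>
    have eq: "(LINT y|lborel. conv (kern J) f y * u y) = (LINT x|lborel. f x * (LINT z|lborel. kern 0 z * u (x - (1 / 2 ^ J) *\<^sub>R z)))" for J
    proof -
      have "(LINT y|lborel. kern J (x - y) * u y) = (LINT z|lborel. kern 0 z * u (x - (1 / 2 ^ J) *\<^sub>R z))" for x
      proof -
        have "(LINT y|lborel. kern J (x - y) * u y) = \<bar>- (1 / 2 ^ J)\<bar> ^ DIM('a) *\<^sub>R
          (LINT z|lborel. kern J (x - (x + (- (1 / 2 ^ J)) *\<^sub>R z)) * u (x + (- (1 / 2 ^ J)) *\<^sub>R z))"
          by (rule integral_affine) auto
        also have "\<dots> = (LINT z|lborel. \<bar>- (1 / 2 ^ J)\<bar> ^ DIM('a) *\<^sub>R (kern J (x - (x + (- (1 / 2 ^ J)) *\<^sub>R z)) * u (x + (- (1 / 2 ^ J)) *\<^sub>R z)))"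
          by (rule integral_scaleR_right[symmetric])
        also have "\<dots> = (LINT z|lborel. kern 0 z * u (x - (1 / 2 ^ J) *\<^sub>R z))"
          by (intro Bochner_Integration.integral_cong[OF refl])
            (simp add: kern_def scaleR_conv_of_real power_mult power_divide)
        finally show ?thesis .
      qed
      then show ?thesis using conv_adjoint(2)[OF f rapid_kern rapid_cont_cs[OF u], of J] by simp
    qed
    obtain M where M: "integrable lborel (\<lambda>x. norm (f x) * wt M x)" using f by (auto simp: wint_def)
    obtain E where E: "0 < E" "\<And>x. norm (u x) \<le> E * wt M x" using cont_cs_decay[OF u] by blast
    obtain K where K: "0 < K" "\<And>x. norm (kern 0 x) \<le> K * wt (2 * DIM('a) + M) x"
      using rapid_kern[of 0] unfolding rapid_def by metis
    \<comment> \<open>A bound uniform in J, as 2^(-J) \<le> 1: it dominates the z-integrals and,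
      once integrated in z, the x-integrals.\<close>
    have point: "norm (kern 0 z * u (x - (1 / 2 ^ J) *\<^sub>R z)) \<le> K * E * wt M x * wt (2 * DIM('a)) z" for x z J
    proof -
      have "wt M (x - (1 / 2 ^ J) *\<^sub>R z) \<le> (1 + norm ((1 / 2 ^ J) *\<^sub>R z)) ^ M * wt M x"
        using wt_peetre[of M x "- ((1 / 2 ^ J) *\<^sub>R z)"] by simp
      also have "\<dots> \<le> (1 + norm z) ^ M * wt M x"
      proof (intro mult_right_mono power_mono add_mono)
        have "1 / 2 ^ J \<le> (1::real)" by simp
        from mult_right_mono[OF this, of "norm z"] show "norm ((1 / 2 ^ J) *\<^sub>R z) \<le> norm z" by simp
      qed auto
      finally have "E * wt M (x - (1 / 2 ^ J) *\<^sub>R z) \<le> E * ((1 + norm z) ^ M * wt M x)" using E by (intro mult_left_mono) auto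
      then have "norm (u (x - (1 / 2 ^ J) *\<^sub>R z)) \<le> E * ((1 + norm z) ^ M * wt M x)" using E(2) by (rule order_trans[rotated])
      then have "norm (kern 0 z * u (x - (1 / 2 ^ J) *\<^sub>R z)) \<le> (K * wt (2 * DIM('a) + M) z) * (E * ((1 + norm z) ^ M * wt M x))"
        unfolding norm_mult using K by (intro mult_mono) auto
      also have "\<dots> = K * E * wt M x * (wt (2 * DIM('a) + M) z * (1 + norm z) ^ M)" by (simp add: mult_ac)
      finally show ?thesis by (simp only: wt_mult_power)
    qed
    have int: "integrable lborel (\<lambda>z. kern 0 z * u (x - (1 / 2 ^ J) *\<^sub>R z))" for x J
      by (rule integrable_wt_bound[OF _ point]) simp
    have bound: "norm (LINT z|lborel. kern 0 z * u (x - (1 / 2 ^ J) *\<^sub>R z)) \<le> K * E * wt_mass TYPE('a) * wt M x" for x J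
    proof -
      have "norm (LINT z|lborel. kern 0 z * u (x - (1 / 2 ^ J) *\<^sub>R z)) \<le> (LINT z|lborel. norm (kern 0 z * u (x - (1 / 2 ^ J) *\<^sub>R z)))"
        by (rule integral_norm_bound)
      also have "\<dots> \<le> (LINT z|lborel. K * E * wt M x * wt (2 * DIM('a)) (z::'a))"
        by (intro integral_mono integrable_norm int integrable_mult_right integrable_wt point) simp
      finally show ?thesis by (simp add: wt_mass_def mult_ac)
    qed
    have lim2: "(\<lambda>J. LINT x|lborel. f x * (LINT z|lborel. kern 0 z * u (x - (1 / 2 ^ J) *\<^sub>R z))) \<longlonglongrightarrow> (LINT x|lborel. f x * u x)"
    proof (rule integral_dominated_convergence[where w = "\<lambda>x. (K * E * wt_mass TYPE('a)) * (norm (f x) * wt M x)"])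
      show "AE x in lborel. (\<lambda>J. f x * (LINT z|lborel. kern 0 z * u (x - (1 / 2 ^ J) *\<^sub>R z))) \<longlonglongrightarrow> f x * u x"
      proof (intro AE_I2 tendsto_mult_left)
        fix x
        have "(\<lambda>J. LINT z|lborel. kern 0 z * u (x - (1 / 2 ^ J) *\<^sub>R z)) \<longlonglongrightarrow> (LINT z|lborel. kern 0 z * u x)"
        proof (rule integral_dominated_convergence[where w = "\<lambda>z. K * E * wt M x * wt (2 * DIM('a)) z"])
          show "AE z in lborel. (\<lambda>J. kern 0 z * u (x - (1 / 2 ^ J) *\<^sub>R z)) \<longlonglongrightarrow> kern 0 z * u x"
          proof (intro AE_I2 tendsto_mult_left)
            fix z
            have "isCont u x" using u by (simp add: cont_cs_def continuous_on_eq_continuous_at)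
            moreover have "(\<lambda>J. (1 / 2 ^ J :: real)) \<longlonglongrightarrow> 0"
              using LIMSEQ_realpow_zero[of "1 / 2 :: real"] by (simp add: power_divide)
            then have "(\<lambda>J. x - (1 / 2 ^ J) *\<^sub>R z) \<longlonglongrightarrow> x - 0 *\<^sub>R z" by (intro tendsto_intros)
            ultimately show "(\<lambda>J. u (x - (1 / 2 ^ J) *\<^sub>R z)) \<longlonglongrightarrow> u x" by (simp add: isCont_tendsto_compose[of x u])
          qed
          show "integrable lborel (\<lambda>z::'a. K * E * wt M x * wt (2 * DIM('a)) z)" by (intro integrable_mult_right integrable_wt) simp
        qed (use point in auto)
        then show "(\<lambda>J. LINT z|lborel. kern 0 z * u (x - (1 / 2 ^ J) *\<^sub>R z)) \<longlonglongrightarrow> u x"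
          by (simp only: integral_mult_left_zero kern_integral mult_1)
      qed
      show "AE x in lborel. norm (f x * (LINT z|lborel. kern 0 z * u (x - (1 / 2 ^ J) *\<^sub>R z))) \<le> (K * E * wt_mass TYPE('a)) * (norm (f x) * wt M x)" for J
      proof (rule AE_I2)
        fix x
        show "norm (f x * (LINT z|lborel. kern 0 z * u (x - (1 / 2 ^ J) *\<^sub>R z))) \<le> (K * E * wt_mass TYPE('a)) * (norm (f x) * wt M x)"
          using mult_left_mono[OF bound[of x J] norm_ge_zero[of "f x"]] by (simp add: norm_mult mult_ac)
      qed
    qed (use M in auto)
    have "(LINT y|lborel. S y * u y) = (LINT x|lborel. f x * u x)"
      using lim1 lim2 unfolding eq by (rule LIMSEQ_unique)
    then show ?thesis
      using wint_mult_rapid_integrable[OF \<open>wint S\<close> rapid_cont_cs[OF u]] wint_mult_rapid_integrable[OF f rapid_cont_cs[OF u]]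
      by (simp add: left_diff_distrib)
  qed
  have "wint (\<lambda>y. S y - f y)"
  proof -
    obtain M where M: "integrable lborel (\<lambda>x. norm (f x) * wt M x)" using f by (auto simp: wint_def)
    \<comment> \<open>The sum of the two weight exponents serves S and f at once.\<close>
    have "integrable lborel (\<lambda>x. norm (S x - f x) * wt (M + N) x)"
    proof (rule Bochner_Integration.integrable_bound)
      show "integrable lborel (\<lambda>x. G x * wt N x + norm (f x) * wt M x)" using Gi M by (rule Bochner_Integration.integrable_add)
      show "AE x in lborel. norm (norm (S x - f x) * wt (M + N) x) \<le> norm (G x * wt N x + norm (f x) * wt M x)"
        using SG
      proof eventually_elim
        case (elim x)
        have "norm (S x - f x) * wt (M + N) x \<le> (norm (S x) + norm (f x)) * wt (M + N) x"
          by (intro mult_right_mono norm_triangle_ineq4) auto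
        also have "\<dots> = norm (S x) * wt (M + N) x + norm (f x) * wt (M + N) x" by (simp add: distrib_right)
        also have "\<dots> \<le> G x * wt N x + norm (f x) * wt M x"
          using elim order_trans[OF norm_ge_zero elim] by (intro add_mono mult_mono wt_antimono) auto
        finally show ?case by simp
      qed
    qed simp
    then show ?thesis by (auto simp: wint_def)
  qed
  then have "AE y in lborel. S y - f y = 0" using test by (rule AE_eq_0_test)
  with SL show ?thesis by eventually_elim simp
qed

subsection \<open>Littlewood--Paley pieces and distributional norms\<close>

definition piece_norm :: "ennreal \<Rightarrow> nat \<Rightarrow> ('a \<Rightarrow> complex) \<Rightarrow> ennreal" where
  "piece_norm p j f = Lpe p lborel (\<lambda>x. ennreal (norm (conv (dkern j) f x)))"

lemma Lp_norm_eq_Lpe: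
  assumes "0 < p" shows "Lp_norm p f = Lpe p lebesgue (\<lambda>x. ennreal (norm (f x)))"
  using assms by (cases p rule: exponent_cases) (auto simp: Lp_norm_def Lpe_real Lpe_infinity epow_ennreal)

lemma measurable_conv_dkern: "wint f \<Longrightarrow> conv (dkern j) f \<in> borel_measurable borel"
  by (intro conv_measurable) (auto simp: wint_def)

lemma dist_Lp_norm_le_piece_norm:
  assumes "0 < p" "wint f"
  shows "dist_Lp_norm p (LP_piece j f) \<le> piece_norm p j f"
proof -
  have [measurable]: "conv (dkern j) f \<in> borel_measurable borel" using assms by (intro measurable_conv_dkern)
  have "dist_Lp_norm p (LP_piece j f) \<le> Lp_norm p (conv (dkern j) f)"
    unfolding dist_Lp_norm_def using represents_conv[OF assms(2)] by (intro INF_lower) auto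
  also have "\<dots> = piece_norm p j f"
    unfolding piece_norm_def Lp_norm_eq_Lpe[OF assms(1)]
    by (rule Lpe_lebesgue_eq) (use assms in \<open>auto intro: measurable_completion\<close>)
  finally show ?thesis .
qed

text \<open>\<open>represents\<close> does not ask for measurability of the representing function, but some translate of
  the kernel is nonzero near any given point.\<close>

lemma represents_measurable:
  assumes f: "wint f" and h: "represents h (LP_piece j f)"
  shows "h \<in> borel_measurable lebesgue"
proof -
  define k where "k = kern (Suc j)"
  define U where "U = {x. k x \<noteq> 0}"
  have "continuous_on UNIV k" by (simp add: k_def continuous_kern)
  then have "open U" unfolding U_def by (intro open_Collect_neq) auto
  have "U \<noteq> {}"
  proof
    assume "U = {}"
    then have "k = (\<lambda>_. 0)" by (auto simp: U_def)
    then show False using kern_integral[of "Suc j"] by (simp add: k_def)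
  qed
  obtain D :: "'a set" where D: "countable D" "\<And>V. open V \<Longrightarrow> V \<noteq> {} \<Longrightarrow> \<exists>d\<in>D. d \<in> V"
    using countable_dense_exists by blast
  have "D \<noteq> {}" using D(2)[of UNIV] by auto
  \<comment> \<open>Translates, by a countable dense set, of the open set where the kernel is
    nonzero; they cover the space. On each of them h is the quotient of the integrable product h k(.
    - d) by k(. - d).\<close>
  define A where "A n = (\<lambda>y. y - from_nat_into D n) -` U" for n
  have cover: "\<exists>n. y \<in> A n" for y
  proof -
    have "open ((\<lambda>x. y - x) -` U)" using \<open>open U\<close> by (intro open_vimage) (auto intro!: continuous_intros)
    moreover have "(\<lambda>x. y - x) -` U \<noteq> {}"
    proof -
      obtain u where "u \<in> U" using \<open>U \<noteq> {}\<close> by auto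
      then have "y - u \<in> (\<lambda>x. y - x) -` U" by simp
      then show ?thesis by blast
    qed
    ultimately obtain d where "d \<in> D" "y - d \<in> U" using D(2)[of "(\<lambda>x. y - x) -` U"] by auto
    then obtain n where "from_nat_into D n = d" using D(1) by (meson from_nat_into_surj)
    then show ?thesis using \<open>y - d \<in> U\<close> by (auto simp: A_def)
  qed
  have A: "A n \<in> sets lebesgue" for n
  proof -
    have "open (A n)" unfolding A_def using \<open>open U\<close> by (intro open_vimage) (auto intro!: continuous_intros)
    then show ?thesis by simp
  qed
  have "(\<lambda>x. if x \<in> A n then h x else 0) \<in> borel_measurable lebesgue" for n
  proof -
    define d where "d = from_nat_into D n"
    have "integrable lebesgue (\<lambda>y. h y * k (y - d))"
      unfolding k_def by (rule represents_reproducing(1)[OF f h]) simp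
    then have 1: "(\<lambda>y. h y * k (y - d)) \<in> borel_measurable lebesgue" by auto
    have "(\<lambda>y. k (y - d)) \<in> borel_measurable borel" by (simp add: k_def)
    then have 2: "(\<lambda>y. k (y - d)) \<in> borel_measurable lebesgue" by (intro measurable_completion) simp
    have "(\<lambda>x. if x \<in> A n then (h x * k (x - d)) / k (x - d) else 0) \<in> borel_measurable lebesgue"
      using 1 2 A[of n] by (intro measurable_If_set borel_measurable_divide) auto
    moreover have "(\<lambda>x. if x \<in> A n then (h x * k (x - d)) / k (x - d) else 0) = (\<lambda>x. if x \<in> A n then h x else 0)"
      by (auto simp: A_def d_def U_def)
    ultimately show ?thesis by simp
  qed
  moreover have "(\<lambda>x. indicator (A n) x *\<^sub>R h x) = (\<lambda>x. if x \<in> A n then h x else 0)" for n by auto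
  ultimately have m: "h \<in> borel_measurable (restrict_space lebesgue (A n))" for n
    using A[of n] by (subst borel_measurable_restrict_space_iff) auto
  show ?thesis
  proof (rule measurable_piecewise_restrict[where C = "range A"])
    show "space lebesgue \<subseteq> \<Union> (range A)" using cover by auto
  qed (use A m in auto)
qed

lemma kern_mass: "\<exists>C>0. \<forall>l. (\<integral>\<^sup>+z. ennreal (norm (kern l z)) \<partial>lborel) \<le> ennreal C"
proof -
  obtain C where C: "0 < C" "\<And>l z. norm (kern l z) \<le> C * 2 ^ (l * DIM('a)) * wt (2 * DIM('a)) (2 ^ l *\<^sub>R z)"
    using kern_decay by blast
  have "(\<integral>\<^sup>+z. ennreal (norm (kern l z)) \<partial>lborel) \<le> ennreal (C * wt_mass TYPE('a))" for l
  proof -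
    have "(\<integral>\<^sup>+z. ennreal (norm (kern l z)) \<partial>lborel)
      \<le> (\<integral>\<^sup>+z. ennreal (C * 2 ^ (l * DIM('a)) * wt (2 * DIM('a)) (2 ^ l *\<^sub>R (z - 0 :: 'a))) \<partial>lborel)"
      using C by (intro nn_integral_mono ennreal_leI) simp
    also have "\<dots> = ennreal (C * wt_mass TYPE('a))" using C(1) by (intro nn_integral_wt_dyadic) simp
    finally show ?thesis .
  qed
  then show ?thesis using C wt_mass_pos[where 'a='a] by (intro exI[of _ "C * wt_mass TYPE('a)"]) auto
qed

text \<open>Any competitor in the infimum reproduces the piece by averaging with
  \<open>kern (Suc j)\<close>, whose L_1 norm is bounded independently of j; Young's inequality then
  compares the norms.\<close>

lemma piece_norm_le_dist_Lp_norm: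
  assumes p: "1 \<le> p"
  shows "\<exists>C>0. \<forall>f j. wint f \<longrightarrow> piece_norm p j f \<le> ennreal C * dist_Lp_norm p (LP_piece j f)"
proof -
  have p0: "0 < p" using p by (rule less_le_trans[rotated]) simp
  obtain C where C: "0 < C" "\<And>l. (\<integral>\<^sup>+z. ennreal (norm (kern l z)) \<partial>lborel) \<le> ennreal C" using kern_mass by blast
  have "piece_norm p j f \<le> ennreal C * Lp_norm p h" if f: "wint f" and h: "represents h (LP_piece j f)" for f h j
  proof -
    have hm: "(\<lambda>x. ennreal (norm (h x))) \<in> borel_measurable lebesgue"
      using represents_measurable[OF f h] by simp
    obtain v where [measurable]: "v \<in> borel_measurable borel" and v: "AE x in lborel. ennreal (norm (h x)) = v x"
      using completion_ex_borel_measurable[OF hm] by auto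
    have "ennreal (norm (conv (dkern j) f x)) \<le> (\<integral>\<^sup>+z. ennreal (norm (kern (Suc j) z)) * v (x + z) \<partial>lborel)" for x
    proof -
      note r = represents_reproducing[OF f h lessI, of x]
      have "ennreal (norm (conv (dkern j) f x)) \<le> (\<integral>\<^sup>+y. ennreal (norm (h y * kern (Suc j) (y - x))) \<partial>lebesgue)"
        unfolding r(2) by (rule integral_norm_bound_ennreal[OF r(1)])
      also have "\<dots> = (\<integral>\<^sup>+y. ennreal (norm (h y * kern (Suc j) (y - x))) \<partial>lborel)" by (rule nn_integral_completion)
      also have "\<dots> = (\<integral>\<^sup>+y. ennreal (norm (kern (Suc j) (y - x))) * v (x + (y - x)) \<partial>lborel)"
        by (rule nn_integral_cong_AE) (use v in \<open>auto elim!: eventually_mono simp: norm_mult ennreal_mult mult.commute\<close>)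
      also have "\<dots> = (\<integral>\<^sup>+z. ennreal (norm (kern (Suc j) (z + x - x))) * v (x + (z + x - x)) \<partial>lborel)"
        by (rule nn_integral_translate[symmetric]) measurable
      finally show ?thesis by simp
    qed
    then have "piece_norm p j f \<le> Lpe p lborel (\<lambda>x. \<integral>\<^sup>+z. ennreal (norm (kern (Suc j) z)) * v (x + z) \<partial>lborel)"
      unfolding piece_norm_def using measurable_conv_dkern[OF f]
      by (intro Lpe_mono_AE[OF p0]) auto
    also have "\<dots> \<le> Lpe p lborel v * (\<integral>\<^sup>+z. ennreal (norm (kern (Suc j) z)) \<partial>lborel)"
      by (rule Lpe_young) (use p C(2)[of "Suc j"] in \<open>auto intro: le_less_trans\<close>)
    also have "\<dots> \<le> Lpe p lborel v * ennreal C" by (intro mult_left_mono C) auto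
    also have "Lpe p lborel v = Lp_norm p h"
      unfolding Lp_norm_eq_Lpe[OF p0] by (rule Lpe_lebesgue_eq[symmetric]) (use p0 hm v in \<open>auto simp: AE_completion\<close>)
    finally show ?thesis by (simp add: mult.commute)
  qed
  note le = this
  have "piece_norm p j f \<le> ennreal C * dist_Lp_norm p (LP_piece j f)" if f: "wint f" for f j
  proof -
    \<comment> \<open>The constant is moved to the left side first, where the bound by each
      competitor passes to the infimum, and back afterwards.\<close>
    have C1: "ennreal (1 / C) * (ennreal C * a) = a" "ennreal C * (ennreal (1 / C) * a) = a" for a
      using C(1) by (simp_all add: mult.assoc[symmetric] ennreal_mult[symmetric])
    have "ennreal (1 / C) * piece_norm p j f \<le> dist_Lp_norm p (LP_piece j f)"
      unfolding dist_Lp_norm_def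
    proof (rule INF_greatest)
      fix h assume "h \<in> {h. represents h (LP_piece j f)}"
      then have "piece_norm p j f \<le> ennreal C * Lp_norm p h" using le[OF f] by simp
      then have "ennreal (1 / C) * piece_norm p j f \<le> ennreal (1 / C) * (ennreal C * Lp_norm p h)" by (rule mult_left_mono) simp
      then show "ennreal (1 / C) * piece_norm p j f \<le> Lp_norm p h" by (simp only: C1)
    qed
    then have "ennreal C * (ennreal (1 / C) * piece_norm p j f) \<le> ennreal C * dist_Lp_norm p (LP_piece j f)" by (rule mult_left_mono) simp
    then show ?thesis by (simp only: C1)
  qed
  then show ?thesis using C(1) by blast
qed

subsection \<open>Littlewood--Paley pieces are controlled by differences\<close>

lemma dkern_decay: "\<exists>C>0. \<forall>j z. norm (dkern j z) \<le> C * 2 ^ (j * DIM('a)) * wt N (2 ^ j *\<^sub>R z)"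
proof -
  obtain C where C: "0 < C" "\<And>l z. norm (kern l z) \<le> C * 2 ^ (l * DIM('a)) * wt N (2 ^ l *\<^sub>R z)"
    using kern_decay by blast
  have "norm (dkern j z) \<le> (C + C * 2 ^ N) * 2 ^ (j * DIM('a)) * wt N (2 ^ j *\<^sub>R z)" for j z
  proof (cases "j = 0")
    case True
    have "norm (kern 0 z) \<le> C * wt N z" using C(2)[of 0 z] by simp
    also have "\<dots> \<le> (C + C * 2 ^ N) * wt N z" using C(1) by (intro mult_right_mono) auto
    finally show ?thesis using True by (simp add: dkern_def)
  next
    case False
    then obtain i where i: "j = Suc i" by (cases j) auto
    \<comment> \<open>The coarser kernel is measured at the scale of the finer one; this doubles the
      argument of the weight and costs 2^N.\<close>
    have "wt N (2 ^ i *\<^sub>R z) \<le> 2 ^ N * wt N (2 ^ j *\<^sub>R z)"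
    proof -
      have "1 + norm (2 ^ j *\<^sub>R z) \<le> 2 * (1 + norm (2 ^ i *\<^sub>R z))" by (simp add: i)
      then have "(1 + norm (2 ^ j *\<^sub>R z)) ^ N \<le> 2 ^ N * (1 + norm (2 ^ i *\<^sub>R z)) ^ N"
        by (subst power_mult_distrib[symmetric]) (intro power_mono, auto)
      moreover have "0 < (1 + norm (2 ^ i *\<^sub>R z)) ^ N" "0 < (1 + norm (2 ^ j *\<^sub>R z)) ^ N"
        by (auto intro!: zero_less_power add_pos_nonneg)
      ultimately show ?thesis by (simp add: wt_def divide_simps)
    qed
    moreover have "(2::real) ^ (i * DIM('a)) \<le> 2 ^ (j * DIM('a))" by (intro power_increasing) (auto simp: i)
    ultimately have "C * 2 ^ (i * DIM('a)) * wt N (2 ^ i *\<^sub>R z) \<le> C * 2 ^ (j * DIM('a)) * (2 ^ N * wt N (2 ^ j *\<^sub>R z))"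
      using C(1) by (intro mult_mono) auto
    moreover have "norm (dkern j z) \<le> norm (kern j z) + norm (kern i z)"
      using False i norm_triangle_ineq4[of "kern j z" "kern i z"] by (simp add: dkern_def)
    ultimately have "norm (dkern j z) \<le> C * 2 ^ (j * DIM('a)) * wt N (2 ^ j *\<^sub>R z) + C * 2 ^ (j * DIM('a)) * (2 ^ N * wt N (2 ^ j *\<^sub>R z))"
      using C(2)[of j z] C(2)[of i z] by linarith
    then show ?thesis by (simp add: distrib_left distrib_right mult_ac)
  qed
  then show ?thesis using C(1) by (intro exI[of _ "C + C * 2 ^ N"]) (auto intro!: add_pos_pos)
qed

text \<open>The base 2 + 2 * 2^j |z| of the weight bounds 2^(j-i) when |z| is of order 2^(-i). Its
  square is absorbed by two extra powers of decay of the kernel.\<close>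

lemma dkern_weighted_mass:
  "\<exists>C>0. \<forall>j. (\<integral>\<^sup>+z. ennreal (norm (dkern j z)) * ennreal ((2 + 2 * (2 ^ j * norm z)) ^ 2) \<partial>lborel) \<le> ennreal C"
proof -
  obtain C where C: "0 < C" "\<And>l z. norm (dkern l z) \<le> C * 2 ^ (l * DIM('a)) * wt (2 * DIM('a) + 2) (2 ^ l *\<^sub>R z)"
    using dkern_decay by blast
  have "(\<integral>\<^sup>+z. ennreal (norm (dkern j z)) * ennreal ((2 + 2 * (2 ^ j * norm z)) ^ 2) \<partial>lborel) \<le> ennreal (4 * C * wt_mass TYPE('a))" for j
  proof -
    have "(\<integral>\<^sup>+z. ennreal (norm (dkern j z)) * ennreal ((2 + 2 * (2 ^ j * norm z)) ^ 2) \<partial>lborel)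
      \<le> (\<integral>\<^sup>+z. ennreal ((4 * C) * 2 ^ (j * DIM('a)) * wt (2 * DIM('a)) (2 ^ j *\<^sub>R (z - 0 :: 'a))) \<partial>lborel)"
    proof (rule nn_integral_mono)
      fix z :: 'a
      have sq: "(2 + 2 * (2 ^ j * norm z)) ^ 2 = 4 * (1 + norm (2 ^ j *\<^sub>R z)) ^ 2"
        by (simp add: power2_eq_square algebra_simps)
      have "norm (dkern j z) * (2 + 2 * (2 ^ j * norm z)) ^ 2
         \<le> (C * 2 ^ (j * DIM('a)) * wt (2 * DIM('a) + 2) (2 ^ j *\<^sub>R z)) * (2 + 2 * (2 ^ j * norm z)) ^ 2"
        by (intro mult_right_mono C) auto
      also have "\<dots> = (4 * C) * 2 ^ (j * DIM('a)) * (wt (2 * DIM('a) + 2) (2 ^ j *\<^sub>R z) * (1 + norm (2 ^ j *\<^sub>R z)) ^ 2)"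
        unfolding sq by (simp only: mult_ac)
      also have "\<dots> = (4 * C) * 2 ^ (j * DIM('a)) * wt (2 * DIM('a)) (2 ^ j *\<^sub>R (z - 0))"
        by (simp only: wt_mult_power diff_zero)
      finally show "ennreal (norm (dkern j z)) * ennreal ((2 + 2 * (2 ^ j * norm z)) ^ 2) \<le> ennreal ((4 * C) * 2 ^ (j * DIM('a)) * wt (2 * DIM('a)) (2 ^ j *\<^sub>R (z - 0 :: 'a)))"
        by (simp only: ennreal_mult'[symmetric] ennreal_mult[symmetric] norm_ge_zero zero_le_power2 ennreal_leI)
    qed
    also have "\<dots> = ennreal (4 * C * wt_mass TYPE('a))" using C(1) by (intro nn_integral_wt_dyadic) simp
    finally show ?thesis .
  qed
  then show ?thesis using C wt_mass_pos[where 'a='a] by (intro exI[of _ "4 * C * wt_mass TYPE('a)"]) auto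
qed

lemma dkern_integral: "0 < j \<Longrightarrow> (LINT z|lborel. dkern j z) = 0"
  using integrable_kern by (simp add: dkern_def kern_integral)

text \<open>i is the dyadic exponent of r clipped to 0..j, so the upper bound may fail at i = 0 and
  the lower bound at i = j.\<close>

lemma dyadic_scale:
  fixes r :: real
  shows "\<exists>i\<le>j. (i = 0 \<or> r \<le> 1 / 2 ^ i) \<and> (i = j \<or> 1 / 2 ^ Suc i < r)"
proof (induction j)
  case (Suc j)
  then obtain i where i: "i \<le> j" "i = 0 \<or> r \<le> 1 / 2 ^ i" "i = j \<or> 1 / 2 ^ Suc i < r" by blast
  show ?case
  proof (cases "1 / 2 ^ Suc i < r")
    case True with i show ?thesis by (intro exI[of _ i]) auto
  next
    case False with i show ?thesis by (intro exI[of _ "Suc j"]) auto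
  qed
qed auto

text \<open>For j \<ge> 1 the kernel has mean zero, so the piece is an average of differences of f.
  A difference with |z| of order 2^(-i) is bounded by e_i, and the growth 4^(j-i) is paid by the
  decay of the kernel. Long differences fall to e_0 by the triangle inequality, hence the comparison
  of e_0 with 4 times the norm of f.\<close>

lemma piece_norm_le_differences:
  assumes p: "1 \<le> p"
  shows "\<exists>C>0. \<forall>f j e B. wint f \<longrightarrow> 4 * Lpe p lborel (\<lambda>x. ennreal (norm (f x))) \<le> e 0 \<longrightarrow>
    (\<forall>i\<ge>1. AE z in lborel. norm z \<le> 1 / 2 ^ i \<longrightarrow> Lpe p lborel (\<lambda>x. ennreal (norm (f (x + z) - f x))) \<le> e i) \<longrightarrow>
    (\<forall>i\<le>j. e i \<le> ennreal (4 ^ (j - i)) * B) \<longrightarrow> piece_norm p j f \<le> ennreal C * B"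
proof -
  have p0: "0 < p" using p by (rule less_le_trans[rotated]) simp
  obtain C where C: "0 < C" "\<And>j. (\<integral>\<^sup>+z. ennreal (norm (dkern j z)) * ennreal ((2 + 2 * (2 ^ j * norm z)) ^ 2) \<partial>lborel) \<le> ennreal C"
    using dkern_weighted_mass by blast
  have "piece_norm p j f \<le> ennreal C * B" if f: "wint f" and e0: "4 * Lpe p lborel (\<lambda>x. ennreal (norm (f x))) \<le> e 0"
    and e: "\<And>i. 1 \<le> i \<Longrightarrow> AE z in lborel. norm z \<le> 1 / 2 ^ i \<longrightarrow> Lpe p lborel (\<lambda>x. ennreal (norm (f (x + z) - f x))) \<le> e i"
    and B: "\<And>i. i \<le> j \<Longrightarrow> e i \<le> ennreal (4 ^ (j - i)) * B" for f j e B
  proof -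
    have [measurable]: "f \<in> borel_measurable borel" using f by (auto simp: wint_def)
    note [measurable] = measurable_conv_dkern[OF f]
    define F where "F = Lpe p lborel (\<lambda>x. ennreal (norm (f x)))"
    have F: "4 * F \<le> e 0" using e0 by (simp add: F_def)
    have "F \<le> 4 * F" using mult_right_mono[of 1 4 F] by simp
    \<comment> \<open>At j = 0 the kernel has integral 1, so f itself is averaged and not its
      differences.\<close>
    define u where "u x z = (if j = 0 then ennreal (norm (f (x + z))) else ennreal (norm (f (x + z) - f x)))" for x z
    have um [measurable]: "case_prod u \<in> borel_measurable (lborel \<Otimes>\<^sub>M lborel)" unfolding u_def by measurable
    have point: "ennreal (norm (conv (dkern j) f x)) \<le> (\<integral>\<^sup>+z. ennreal (norm (dkern j z)) * u x z \<partial>lborel)" for x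
    proof -
      have i1: "integrable lborel (\<lambda>y. f y * dkern j (y - x))"
        by (intro wint_mult_rapid_integrable f rapid_translate rapid_dkern)
      have i2: "integrable lborel (\<lambda>z. f (x + z) * dkern j z)" using integrable_affine[OF i1, of 1 x] by simp
      have "conv (dkern j) f x = \<bar>1\<bar> ^ DIM('a) *\<^sub>R (LINT z|lborel. f (x + 1 *\<^sub>R z) * dkern j (x + 1 *\<^sub>R z - x))"
        unfolding conv_def by (rule integral_affine) auto
      then have eq: "conv (dkern j) f x = (LINT z|lborel. f (x + z) * dkern j z)" by simp
      show ?thesis
      proof (cases "j = 0")
        case True
        then show ?thesis using integral_norm_bound_ennreal[OF i2] unfolding eq
          by (simp add: u_def norm_mult ennreal_mult mult.commute)
      next
        case False
        have i3: "integrable lborel (\<lambda>z. f x * dkern j z)" by (intro integrable_mult_right rapid_integrable rapid_dkern)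
        have "conv (dkern j) f x = (LINT z|lborel. f (x + z) * dkern j z) - (LINT z|lborel. f x * dkern j z)"
          using False by (simp add: eq dkern_integral)
        also have "\<dots> = (LINT z|lborel. f (x + z) * dkern j z - f x * dkern j z)"
          by (rule Bochner_Integration.integral_diff[OF i2 i3, symmetric])
        finally have "ennreal (norm (conv (dkern j) f x)) \<le> (\<integral>\<^sup>+z. ennreal (norm (f (x + z) * dkern j z - f x * dkern j z)) \<partial>lborel)"
          using integral_norm_bound_ennreal[OF Bochner_Integration.integrable_diff[OF i2 i3]] by simp
        moreover have "f (x + z) * dkern j z - f x * dkern j z = dkern j z * (f (x + z) - f x)" for z
          by (simp add: algebra_simps)
        ultimately show ?thesis using False by (simp add: u_def norm_mult ennreal_mult)
      qed
    qed
    have "AE z in lborel. \<forall>i\<in>{1..}. norm z \<le> 1 / 2 ^ i \<longrightarrow> Lpe p lborel (\<lambda>x. ennreal (norm (f (x + z) - f x))) \<le> e i"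
      using e by (subst AE_ball_countable) auto
    then have "AE z in lborel. Lpe p lborel (\<lambda>x. u x z) \<le> B * ennreal ((2 + 2 * (2 ^ j * norm z)) ^ 2)"
    proof eventually_elim
      case (elim z)
      have tr: "Lpe p lborel (\<lambda>x. ennreal (norm (f (x + z)))) \<le> F"
        unfolding F_def using p0 by (rule Lpe_translate_le[of p "\<lambda>x. ennreal (norm (f x))"]) simp
      show ?case
      proof (cases "j = 0")
        case True
        have "F \<le> B" using \<open>F \<le> 4 * F\<close> F B[of 0] True by auto
        also have "B * 1 \<le> B * ennreal ((2 + 2 * (2 ^ j * norm z)) ^ 2)"
          by (intro mult_left_mono) (auto simp: one_le_power)
        finally show ?thesis using tr True by (simp add: u_def)
      next
        case False
        obtain i where i: "i \<le> j" "i = 0 \<or> norm z \<le> 1 / 2 ^ i" "i = j \<or> 1 / 2 ^ Suc i < norm z"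
          using dyadic_scale by blast
        have "Lpe p lborel (\<lambda>x. ennreal (norm (f (x + z) - f x))) \<le> e i"
        proof (cases "i = 0")
          case True
          have "Lpe p lborel (\<lambda>x. ennreal (norm (f (x + z) - f x))) \<le> Lpe p lborel (\<lambda>x. ennreal (norm (f (x + z))) + ennreal (norm (f x)))"
            by (intro Lpe_mono_AE[OF p0] AE_I2) (auto simp: ennreal_plus[symmetric] norm_triangle_ineq4 intro!: ennreal_leI simp del: ennreal_plus)
          also have "\<dots> \<le> 4 * F" by (intro Lpe_add_le p0 p tr) (auto simp: F_def)
          finally show ?thesis using F True by auto
        next
          case False
          with elim i show ?thesis by auto
        qed
        also have "e i \<le> ennreal (4 ^ (j - i)) * B" using i by (intro B)
        also have "ennreal (4 ^ (j - i)) \<le> ennreal ((2 + 2 * (2 ^ j * norm z)) ^ 2)"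
        proof (rule ennreal_leI)
          have "(2::real) ^ (j - i) \<le> 2 + 2 * (2 ^ j * norm z)"
          proof (cases "i = j")
            case False
            with i have "1 / 2 ^ Suc i < norm z" by simp
            then have "2 ^ j * (1 / 2 ^ Suc i) \<le> 2 ^ j * norm z" by (intro mult_left_mono) auto
            moreover have "(2::real) ^ (j - i) = 2 * (2 ^ j * (1 / 2 ^ Suc i))" using i by (simp add: power_diff)
            ultimately show ?thesis by linarith
          qed (simp add: add_increasing2)
          then have "(2 ^ (j - i)) ^ 2 \<le> (2 + 2 * (2 ^ j * norm z)) ^ 2" by (intro power_mono) auto
          moreover have "((2::real) ^ (j - i)) ^ 2 = 4 ^ (j - i)" by (simp add: power_mult[symmetric] mult.commute[of _ 2]) (simp add: power_mult)
          ultimately show "(4::real) ^ (j - i) \<le> (2 + 2 * (2 ^ j * norm z)) ^ 2" by simp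
        qed
        finally show ?thesis using False by (simp add: u_def mult.commute mult_right_mono)
      qed
    qed
    note AEu = this
    have "piece_norm p j f \<le> Lpe p lborel (\<lambda>x. \<integral>\<^sup>+z. ennreal (norm (dkern j z)) * u x z \<partial>lborel)"
      unfolding piece_norm_def using point by (intro Lpe_mono_AE[OF p0]) auto
    also have "\<dots> \<le> B * (\<integral>\<^sup>+z. ennreal (norm (dkern j z)) * ennreal ((2 + 2 * (2 ^ j * norm z)) ^ 2) \<partial>lborel)"
    proof (rule Lpe_nn_integral_le)
      show "0 < (2 + 2 * (2 ^ j * norm z)) ^ 2" for z :: 'a by (intro zero_less_power add_pos_nonneg) auto
      show "(\<integral>\<^sup>+z. ennreal (norm (dkern j z)) * ennreal ((2 + 2 * (2 ^ j * norm z)) ^ 2) \<partial>lborel) < \<infinity>"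
        using C(2)[of j] by (auto intro: le_less_trans)
      show "AE z in lborel. ennreal (norm (dkern j z)) \<noteq> 0 \<longrightarrow> Lpe p lborel (\<lambda>x. u x z) \<le> B * ennreal ((2 + 2 * (2 ^ j * norm z)) ^ 2)"
        using AEu by eventually_elim simp
    qed (use p in \<open>auto simp: lborel.sigma_finite_measure_axioms\<close>)
    also have "\<dots> \<le> B * ennreal C" by (intro mult_left_mono C) auto
    finally show ?thesis by (simp add: mult.commute)
  qed
  then show ?thesis using C(1) by (intro exI[of _ C]) blast
qed

subsection \<open>Increments of Littlewood--Paley pieces\<close>

lemma piece_reproducing:
  assumes f: "wint f"
  shows "integrable lborel (\<lambda>y. conv (dkern j) f y * kern (Suc j) (y - x))"
    and "conv (dkern j) f x = (LINT y|lborel. conv (dkern j) f y * kern (Suc j) (y - x))"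
proof -
  note [measurable] = measurable_conv_dkern[OF f]
  note r = represents_reproducing[OF f represents_conv[OF f] lessI, of j x]
  show "integrable lborel (\<lambda>y. conv (dkern j) f y * kern (Suc j) (y - x))"
    using r(1) by (subst (asm) integrable_completion) auto
  show "conv (dkern j) f x = (LINT y|lborel. conv (dkern j) f y * kern (Suc j) (y - x))"
    unfolding r(2) by (rule integral_lebesgue_eq) measurable
qed

text \<open>By the reproducing formula the increment falls on the kernel of level j + 1, whose
  Lipschitz bound at |h| \<le> 2^(-m) contributes 2^(j-m). The resulting majorant does not depend on
  h, and Young's inequality gives its norm.\<close>

lemma piece_increment_small:
  assumes p: "1 \<le> p"
  shows "\<exists>C>0. \<forall>f j m. wint f \<longrightarrow> j \<le> m \<longrightarrow> (\<exists>M\<in>borel_measurable borel.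
    (\<forall>x h. norm h \<le> 1 / 2 ^ m \<longrightarrow> ennreal (norm (conv (dkern j) f (x + h) - conv (dkern j) f x)) \<le> M x) \<and>
    Lpe p lborel M \<le> ennreal (C * (1 / 2 ^ (m - j))) * piece_norm p j f)"
proof -
  obtain C where C: "0 < C" "\<And>l z h. 2 ^ l * norm h \<le> 2 \<Longrightarrow>
     norm (kern l (z + h) - kern l z) \<le> C * 2 ^ (l * DIM('a)) * (2 ^ l * norm h) * wt (2 * DIM('a)) (2 ^ l *\<^sub>R z)"
    using kern_lipschitz by blast
  define K where "K = 2 * C * wt_mass TYPE('a)"
  have K: "0 < K" using C wt_mass_pos[where 'a='a] by (simp add: K_def)
  have "\<exists>M\<in>borel_measurable borel.
    (\<forall>x h. norm h \<le> 1 / 2 ^ m \<longrightarrow> ennreal (norm (conv (dkern j) f (x + h) - conv (dkern j) f x)) \<le> M x) \<and>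
    Lpe p lborel M \<le> ennreal (K * (1 / 2 ^ (m - j))) * piece_norm p j f" if f: "wint f" and jm: "j \<le> m" for f j m
  proof -
    note [measurable] = measurable_conv_dkern[OF f]
    let ?v = "\<lambda>y. ennreal (norm (conv (dkern j) f y))"
    let ?k = "kern (Suc j)"
    \<comment> \<open>The factor 2 is the one level between j and j + 1: 2^(j+1) |h| \<le> 2 *
      2^(j-m).\<close>
    define a where "a = 2 * C * (1 / 2 ^ (m - j))"
    have a: "0 \<le> a" using C by (simp add: a_def)
    define w where "w z = ennreal (a * 2 ^ (Suc j * DIM('a)) * wt (2 * DIM('a)) (2 ^ Suc j *\<^sub>R (z - 0 :: 'a)))" for z
    have [measurable]: "w \<in> borel_measurable borel" unfolding w_def by measurable
    have wI: "(\<integral>\<^sup>+z. w z \<partial>lborel) = ennreal (K * (1 / 2 ^ (m - j)))"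
      unfolding w_def nn_integral_wt_dyadic[OF a] by (simp add: a_def K_def mult_ac)
    define M where "M x = (\<integral>\<^sup>+z. w z * ?v (x + z) \<partial>lborel)" for x
    have [measurable]: "M \<in> borel_measurable borel" unfolding M_def by measurable
    have "ennreal (norm (conv (dkern j) f (x + h) - conv (dkern j) f x)) \<le> M x" if h: "norm h \<le> 1 / 2 ^ m" for x h
    proof -
      have h2: "2 ^ Suc j * norm h \<le> 2 * (1 / 2 ^ (m - j))"
      proof -
        have "2 ^ Suc j * norm h \<le> 2 ^ Suc j * (1 / 2 ^ m)" using h by (intro mult_left_mono) auto
        also have "\<dots> = 2 * (1 / 2 ^ (m - j))" using jm by (simp add: power_diff)
        finally show ?thesis .
      qed
      moreover have "1 / 2 ^ (m - j) \<le> (1::real)" by simp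
      ultimately have "2 ^ Suc j * norm h \<le> 2" by linarith
      then have h2': "2 ^ Suc j * norm (- h) \<le> 2" by (simp only: norm_minus_cancel)
      have kd: "norm (?k (y - (x + h)) - ?k (y - x)) \<le> a * 2 ^ (Suc j * DIM('a)) * wt (2 * DIM('a)) (2 ^ Suc j *\<^sub>R (y - x))" for y
      proof -
        have "norm (?k ((y - x) + (- h)) - ?k (y - x)) \<le> C * 2 ^ (Suc j * DIM('a)) * (2 ^ Suc j * norm (- h)) * wt (2 * DIM('a)) (2 ^ Suc j *\<^sub>R (y - x))"
          using h2' by (rule C)
        also have "\<dots> \<le> C * 2 ^ (Suc j * DIM('a)) * (2 * (1 / 2 ^ (m - j))) * wt (2 * DIM('a)) (2 ^ Suc j *\<^sub>R (y - x))"
          using h2 C(1) by (intro mult_right_mono mult_left_mono) (auto simp del: power_Suc)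
        also have "\<dots> = a * 2 ^ (Suc j * DIM('a)) * wt (2 * DIM('a)) (2 ^ Suc j *\<^sub>R (y - x))"
          by (simp add: a_def mult_ac)
        finally show ?thesis by (simp add: diff_diff_eq)
      qed
      have "conv (dkern j) f (x + h) - conv (dkern j) f x = (LINT y|lborel. conv (dkern j) f y * ?k (y - (x + h)) - conv (dkern j) f y * ?k (y - x))"
        unfolding piece_reproducing(2)[OF f, of j "x + h"] piece_reproducing(2)[OF f, of j x]
        by (rule Bochner_Integration.integral_diff[OF piece_reproducing(1)[OF f] piece_reproducing(1)[OF f], symmetric])
      then have "ennreal (norm (conv (dkern j) f (x + h) - conv (dkern j) f x))
         \<le> (\<integral>\<^sup>+y. ennreal (norm (conv (dkern j) f y * ?k (y - (x + h)) - conv (dkern j) f y * ?k (y - x))) \<partial>lborel)"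
        using integral_norm_bound_ennreal[OF Bochner_Integration.integrable_diff[OF piece_reproducing(1)[OF f] piece_reproducing(1)[OF f]]]
        by simp
      also have "\<dots> \<le> (\<integral>\<^sup>+y. w (y - x) * ?v (x + (y - x)) \<partial>lborel)"
      proof (rule nn_integral_mono)
        fix y
        have "norm (conv (dkern j) f y * ?k (y - (x + h)) - conv (dkern j) f y * ?k (y - x))
          = norm (?k (y - (x + h)) - ?k (y - x)) * norm (conv (dkern j) f y)"
          by (simp add: right_diff_distrib[symmetric] norm_mult mult.commute)
        also have "\<dots> \<le> (a * 2 ^ (Suc j * DIM('a)) * wt (2 * DIM('a)) (2 ^ Suc j *\<^sub>R (y - x))) * norm (conv (dkern j) f y)"
          by (intro mult_right_mono kd) auto
        finally have "ennreal (norm (conv (dkern j) f y * ?k (y - (x + h)) - conv (dkern j) f y * ?k (y - x)))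
          \<le> ennreal ((a * 2 ^ (Suc j * DIM('a)) * wt (2 * DIM('a)) (2 ^ Suc j *\<^sub>R (y - x))) * norm (conv (dkern j) f y))"
          by (rule ennreal_leI)
        also have "\<dots> = w (y - x) * ?v (x + (y - x))"
          unfolding w_def using a by (subst ennreal_mult) (auto simp del: power_Suc mult_Suc)
        finally show "ennreal (norm (conv (dkern j) f y * ?k (y - (x + h)) - conv (dkern j) f y * ?k (y - x))) \<le> w (y - x) * ?v (x + (y - x))" .
      qed
      also have "\<dots> = (\<integral>\<^sup>+z. w (z + x - x) * ?v (x + (z + x - x)) \<partial>lborel)"
        by (rule nn_integral_translate[symmetric]) measurable
      finally show ?thesis by (simp add: M_def)
    qed
    moreover have "Lpe p lborel M \<le> piece_norm p j f * ennreal (K * (1 / 2 ^ (m - j)))"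
      unfolding M_def piece_norm_def wI[symmetric]
      by (rule Lpe_young) (use p wI in auto)
    ultimately show ?thesis by (intro bexI[of _ M]) (auto simp: mult.commute)
  qed
  then show ?thesis using K by (intro exI[of _ K]) blast
qed

lemma piece_pointwise:
  assumes f: "wint f"
  shows "ennreal (norm (conv (dkern j) f x)) \<le> (\<integral>\<^sup>+y. ennreal (norm (kern (Suc j) (y - x))) * ennreal (norm (conv (dkern j) f y)) \<partial>lborel)"
proof -
  have "ennreal (norm (conv (dkern j) f x)) \<le> (\<integral>\<^sup>+y. ennreal (norm (conv (dkern j) f y * kern (Suc j) (y - x))) \<partial>lborel)"
    unfolding piece_reproducing(2)[OF f, of j x] by (rule integral_norm_bound_ennreal[OF piece_reproducing(1)[OF f]])
  then show ?thesis by (simp add: norm_mult ennreal_mult mult.commute)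
qed

text \<open>For p = \<infinity> a constant majorant is enough, since d/p = 0. The reproducing
  formula bounds the piece at every point by a multiple of its essential supremum.\<close>

lemma piece_increment_large_infinite:
  "\<exists>C>0. \<forall>f j. wint f \<longrightarrow> (\<exists>M\<in>borel_measurable borel.
    (\<forall>x h. ennreal (norm (conv (dkern j) f (x + h) - conv (dkern j) f x)) \<le> M x) \<and>
    Lpe top lborel M \<le> ennreal C * piece_norm top j f)"
proof -
  obtain C where C: "0 < C" "\<And>l. (\<integral>\<^sup>+z. ennreal (norm (kern l z)) \<partial>lborel) \<le> ennreal C" using kern_mass by blast
  have "\<exists>M\<in>borel_measurable borel.
    (\<forall>x h. ennreal (norm (conv (dkern j) f (x + h) - conv (dkern j) f x)) \<le> M x) \<and>
    Lpe top lborel M \<le> ennreal (2 * C) * piece_norm top j f" if f: "wint f" for f j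
  proof -
    note [measurable] = measurable_conv_dkern[OF f]
    let ?A = "piece_norm top j f"
    have AE: "AE y in lborel. ennreal (norm (conv (dkern j) f y)) \<le> ?A"
      unfolding piece_norm_def Lpe_infinity by (rule esssup_AE)
    have b: "ennreal (norm (conv (dkern j) f x)) \<le> ennreal C * ?A" for x
    proof -
      have "ennreal (norm (conv (dkern j) f x)) \<le> (\<integral>\<^sup>+y. ennreal (norm (kern (Suc j) (y - x))) * ?A \<partial>lborel)"
        by (rule order_trans[OF piece_pointwise[OF f]], rule nn_integral_mono_AE)
          (use AE in \<open>auto elim!: eventually_mono intro!: mult_left_mono\<close>)
      also have "\<dots> = (\<integral>\<^sup>+y. ennreal (norm (kern (Suc j) (y - x))) \<partial>lborel) * ?A" by (rule nn_integral_multc) measurable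
      also have "(\<integral>\<^sup>+y. ennreal (norm (kern (Suc j) (y - x))) \<partial>lborel) = (\<integral>\<^sup>+y. ennreal (norm (kern (Suc j) y)) \<partial>lborel)"
        using nn_integral_translate[of "\<lambda>y. ennreal (norm (kern (Suc j) y))" "- x"] by simp
      also have "\<dots> * ?A \<le> ennreal C * ?A" by (intro mult_right_mono C) auto
      finally show ?thesis .
    qed
    have "ennreal (norm (conv (dkern j) f (x + h) - conv (dkern j) f x)) \<le> ennreal (2 * C) * ?A" for x h
    proof -
      have "ennreal (norm (conv (dkern j) f (x + h) - conv (dkern j) f x)) \<le> ennreal (norm (conv (dkern j) f (x + h))) + ennreal (norm (conv (dkern j) f x))"
        by (simp add: ennreal_plus[symmetric] norm_triangle_ineq4 ennreal_leI del: ennreal_plus)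
      also have "\<dots> \<le> ennreal C * ?A + ennreal C * ?A" by (intro add_mono b)
      also have "\<dots> = ennreal (2 * C) * ?A"
      proof -
        have "ennreal (2 * C) = ennreal C + ennreal C" using C(1) by (simp add: ennreal_plus[symmetric] del: ennreal_plus)
        then show ?thesis by (simp only: distrib_right)
      qed
      finally show ?thesis .
    qed
    moreover have "Lpe top lborel (\<lambda>x::'a. ennreal (2 * C) * ?A) \<le> ennreal (2 * C) * ?A"
      unfolding Lpe_infinity by (intro esssup_I) auto
    ultimately show ?thesis by (intro bexI[of _ "\<lambda>x. ennreal (2 * C) * ?A"]) auto
  qed
  then show ?thesis using C(1) by (intro exI[of _ "2 * C"]) auto
qed

text \<open>Jensen's inequality bounds |piece|^P at x + h by an average of |piece|^P with a kernel
  of width 2^(-j). Widening it to 2^(-m) makes it insensitive to h but multiplies its mass by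
  2^((j-m)d), so the norm grows by 2^((j-m)d/P).\<close>

lemma piece_increment_large_finite:
  assumes P: "1 \<le> P"
  shows "\<exists>C>0. \<forall>f j m. wint f \<longrightarrow> m \<le> j \<longrightarrow> (\<exists>M\<in>borel_measurable borel.
    (\<forall>x h. norm h \<le> 1 / 2 ^ m \<longrightarrow> ennreal (norm (conv (dkern j) f (x + h) - conv (dkern j) f x)) \<le> M x) \<and>
    Lpe (ennreal P) lborel M \<le> ennreal (C * 2 powr (real (j - m) * (DIM('a) / P))) * piece_norm (ennreal P) j f)"
proof -
  define N where "N = 2 * DIM('a)"
  obtain C where C: "0 < C" "\<And>l z. norm (kern l z) \<le> C * 2 ^ (l * DIM('a)) * wt N (2 ^ l *\<^sub>R z)"
    using kern_decay by blast
  define W where "W = C * wt_mass TYPE('a)"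
  have W: "0 < W" using C(1) wt_mass_pos[where 'a='a] by (simp add: W_def)
  \<comment> \<open>Collects the constants of the P-th power estimate; the factor 2^d comes from
    using the kernel at level j + 1.\<close>
  define D where "D = W powr (P - 1) * (2 ^ N * C * 2 ^ DIM('a)) * wt_mass TYPE('a)"
  have D: "0 < D" using C(1) W wt_mass_pos[where 'a='a] by (simp add: D_def)
  define K where "K = 2 * D powr (1 / P)"
  have K: "0 < K" using D by (simp add: K_def)
  have "\<exists>M\<in>borel_measurable borel.
    (\<forall>x h. norm h \<le> 1 / 2 ^ m \<longrightarrow> ennreal (norm (conv (dkern j) f (x + h) - conv (dkern j) f x)) \<le> M x) \<and>
    Lpe (ennreal P) lborel M \<le> ennreal (K * 2 powr (real (j - m) * (DIM('a) / P))) * piece_norm (ennreal P) j f"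
    if f: "wint f" and mj: "m \<le> j" for f j m
  proof -
    note [measurable] = measurable_conv_dkern[OF f]
    let ?v = "\<lambda>y. ennreal (norm (conv (dkern j) f y))"
    define b where "b = W powr (P - 1) * (2 ^ N * C * 2 ^ (Suc j * DIM('a)))"
    have b: "0 \<le> b" using C(1) by (simp add: b_def)
    define R where "R x = ennreal b * (\<integral>\<^sup>+y. ennreal (wt N (2 ^ m *\<^sub>R (y - x))) * epow (?v y) P \<partial>lborel)" for x
    have [measurable]: "R \<in> borel_measurable borel" unfolding R_def by measurable
    have pt: "epow (?v (x + h)) P \<le> R x" if h: "norm h \<le> 1 / 2 ^ m" for x h
    proof -
      define w where "w y = C * 2 ^ (Suc j * DIM('a)) * wt N (2 ^ Suc j *\<^sub>R (y - (x + h)))" for y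
      have w0: "0 \<le> w y" for y using C(1) by (simp add: w_def)
      have [measurable]: "w \<in> borel_measurable borel" unfolding w_def by measurable
      have wI: "(\<integral>\<^sup>+y. ennreal (w y) \<partial>lborel) = ennreal W"
        unfolding w_def N_def W_def using C(1) by (intro nn_integral_wt_dyadic) simp
      have "?v (x + h) \<le> (\<integral>\<^sup>+y. ennreal (w y) * ?v y \<partial>lborel)"
        by (rule order_trans[OF piece_pointwise[OF f]])
          (intro nn_integral_mono mult_right_mono ennreal_leI, auto simp: w_def simp del: power_Suc mult_Suc intro!: C(2))
      then have "epow (?v (x + h)) P \<le> epow (\<integral>\<^sup>+y. ennreal (w y) * ?v y \<partial>lborel) P"
        using P by (intro epow_mono) auto
      also have "\<dots> \<le> ennreal (W powr (P - 1)) * (\<integral>\<^sup>+y. ennreal (w y) * epow (?v y) P \<partial>lborel)"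
        by (rule nn_integral_power_le) (use P W wI in auto)
      also have "\<dots> \<le> ennreal (W powr (P - 1)) * (\<integral>\<^sup>+y. ennreal (2 ^ N * C * 2 ^ (Suc j * DIM('a))) * (ennreal (wt N (2 ^ m *\<^sub>R (y - x))) * epow (?v y) P) \<partial>lborel)"
      proof (intro mult_left_mono nn_integral_mono)
        fix y
        \<comment> \<open>As 2^m |h| \<le> 1 and m < j + 1, dropping h and widening the weight costs
          at most the factor 2^N.\<close>
        have "wt N (2 ^ Suc j *\<^sub>R (y - (x + h))) \<le> 2 ^ N * wt N (2 ^ m *\<^sub>R (y - x))"
        proof -
          have "norm (y - x) \<le> norm (y - (x + h)) + norm h"
            using norm_triangle_ineq[of "y - (x + h)" h] by simp
          then have "2 ^ m * norm (y - x) \<le> 2 ^ m * (norm (y - (x + h)) + norm h)" by (intro mult_left_mono) auto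
          also have "\<dots> = 2 ^ m * norm (y - (x + h)) + 2 ^ m * norm h" by (rule distrib_left)
          also have "\<dots> \<le> 2 ^ Suc j * norm (y - (x + h)) + 1"
          proof (intro add_mono mult_right_mono power_increasing)
            show "2 ^ m * norm h \<le> 1" using mult_left_mono[OF h, of "2 ^ m"] by simp
          qed (use mj in auto)
          finally have "2 ^ m * norm (y - x) \<le> 2 ^ Suc j * norm (y - (x + h)) + 1" .
          then have "norm (2 ^ m *\<^sub>R (y - x)) \<le> norm (2 ^ Suc j *\<^sub>R (y - (x + h))) + 1"
            by (simp only: norm_scaleR power_abs abs_numeral)
          moreover have "1 + u \<le> 2 * (1 + v)" if "u \<le> v + 1" "0 \<le> v" for u v :: real using that by simp
          ultimately have "1 + norm (2 ^ m *\<^sub>R (y - x)) \<le> 2 * (1 + norm (2 ^ Suc j *\<^sub>R (y - (x + h))))"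
            using norm_ge_zero by blast
          then have "(1 + norm (2 ^ m *\<^sub>R (y - x))) ^ N \<le> 2 ^ N * (1 + norm (2 ^ Suc j *\<^sub>R (y - (x + h)))) ^ N"
            by (subst power_mult_distrib[symmetric]) (intro power_mono, auto)
          moreover have "0 < (1 + norm (2 ^ m *\<^sub>R (y - x))) ^ N" "0 < (1 + norm (2 ^ Suc j *\<^sub>R (y - (x + h)))) ^ N"
            by (auto intro!: zero_less_power add_pos_nonneg)
          ultimately show ?thesis by (simp only: wt_def) (simp add: divide_simps del: power_Suc)
        qed
        then have "w y \<le> 2 ^ N * C * 2 ^ (Suc j * DIM('a)) * wt N (2 ^ m *\<^sub>R (y - x))"
          unfolding w_def using C(1)
            mult_left_mono[of "wt N (2 ^ Suc j *\<^sub>R (y - (x + h)))" "2 ^ N * wt N (2 ^ m *\<^sub>R (y - x))" "C * 2 ^ (Suc j * DIM('a))"]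
          by (simp only: mult_ac) simp
        then have "ennreal (w y) \<le> ennreal (2 ^ N * C * 2 ^ (Suc j * DIM('a))) * ennreal (wt N (2 ^ m *\<^sub>R (y - x)))"
          using C(1) by (subst ennreal_mult[symmetric]) (auto intro: ennreal_leI)
        then show "ennreal (w y) * epow (?v y) P \<le> ennreal (2 ^ N * C * 2 ^ (Suc j * DIM('a))) * (ennreal (wt N (2 ^ m *\<^sub>R (y - x))) * epow (?v y) P)"
          by (simp only: mult.assoc[symmetric]) (rule mult_right_mono, auto)
      qed auto
      also have "\<dots> = ennreal (W powr (P - 1)) * (ennreal (2 ^ N * C * 2 ^ (Suc j * DIM('a))) * (\<integral>\<^sup>+y. ennreal (wt N (2 ^ m *\<^sub>R (y - x))) * epow (?v y) P \<partial>lborel))"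
        by (subst nn_integral_cmult) auto
      also have "\<dots> = R x"
        unfolding R_def b_def using C(1) by (subst ennreal_mult) (auto simp: mult.assoc)
      finally show ?thesis .
    qed
    \<comment> \<open>The factor 2 covers the two values whose difference is taken, both bounded
      through R.\<close>
    define M where "M x = 2 * epow (R x) (1 / P)" for x
    have [measurable]: "M \<in> borel_measurable borel" unfolding M_def by measurable
    have "ennreal (norm (conv (dkern j) f (x + h) - conv (dkern j) f x)) \<le> M x" if h: "norm h \<le> 1 / 2 ^ m" for x h
    proof -
      have le: "?v (x + h') \<le> epow (R x) (1 / P)" if "norm h' \<le> 1 / 2 ^ m" for h'
      proof -
        have "epow (epow (?v (x + h')) P) (1 / P) \<le> epow (R x) (1 / P)" using P by (intro epow_mono pt that) auto
        then show ?thesis using P by simp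
      qed
      have "ennreal (norm (conv (dkern j) f (x + h) - conv (dkern j) f x)) \<le> ?v (x + h) + ?v x"
        by (simp add: ennreal_plus[symmetric] norm_triangle_ineq4 ennreal_leI del: ennreal_plus)
      also have "\<dots> \<le> epow (R x) (1 / P) + epow (R x) (1 / P)"
        using le[OF h] le[of 0] by (intro add_mono) auto
      finally show ?thesis by (simp add: M_def mult_2)
    qed
    moreover have "Lpe (ennreal P) lborel M \<le> ennreal (K * 2 powr (real (j - m) * (DIM('a) / P))) * piece_norm (ennreal P) j f"
    proof -
      have PN: "epow (piece_norm (ennreal P) j f) P = (\<integral>\<^sup>+y. epow (?v y) P \<partial>lborel)"
        using P by (simp add: piece_norm_def Lpe_real)
      have "(\<integral>\<^sup>+x. epow (M x) P \<partial>lborel) = epow 2 P * (\<integral>\<^sup>+x. R x \<partial>lborel)"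
        using P by (simp add: M_def epow_mult nn_integral_cmult)
      also have "(\<integral>\<^sup>+x. R x \<partial>lborel) = ennreal b * (\<integral>\<^sup>+x. \<integral>\<^sup>+y. ennreal (wt N (2 ^ m *\<^sub>R (y - x))) * epow (?v y) P \<partial>lborel \<partial>lborel)"
        unfolding R_def by (rule nn_integral_cmult) measurable
      also have "(\<integral>\<^sup>+x. \<integral>\<^sup>+y. ennreal (wt N (2 ^ m *\<^sub>R (y - x))) * epow (?v y) P \<partial>lborel \<partial>lborel)
         = (\<integral>\<^sup>+y. \<integral>\<^sup>+x. ennreal (wt N (2 ^ m *\<^sub>R (y - x))) * epow (?v y) P \<partial>lborel \<partial>lborel)"
        by (rule lborel_pair.Fubini') measurable
      also have "\<dots> = (\<integral>\<^sup>+y. ennreal (1 / (2 ^ m) ^ DIM('a)) * ennreal (wt_mass TYPE('a)) * epow (?v y) P \<partial>lborel)"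
      proof (rule nn_integral_cong)
        fix y :: 'a
        have "wt N (2 ^ m *\<^sub>R (y - x)) = wt N (2 ^ m *\<^sub>R (x - y))" for x
          using wt_minus[of N "2 ^ m *\<^sub>R (y - x)"] by (simp add: scaleR_right_diff_distrib)
        then have "(\<integral>\<^sup>+x. ennreal (wt N (2 ^ m *\<^sub>R (y - x))) \<partial>lborel) = ennreal (1 / (2 ^ m) ^ DIM('a)) * ennreal (wt_mass TYPE('a))"
          by (simp add: nn_integral_wt_scaled N_def nn_integral_wt)
        then show "(\<integral>\<^sup>+x. ennreal (wt N (2 ^ m *\<^sub>R (y - x))) * epow (?v y) P \<partial>lborel) = ennreal (1 / (2 ^ m) ^ DIM('a)) * ennreal (wt_mass TYPE('a)) * epow (?v y) P"
          by (subst nn_integral_multc) auto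
      qed
      also have "\<dots> = ennreal (1 / (2 ^ m) ^ DIM('a)) * ennreal (wt_mass TYPE('a)) * (\<integral>\<^sup>+y. epow (?v y) P \<partial>lborel)"
        by (rule nn_integral_cmult) measurable
      also have "ennreal b * \<dots> = ennreal (b * (1 / (2 ^ m) ^ DIM('a)) * wt_mass TYPE('a)) * (\<integral>\<^sup>+y. epow (?v y) P \<partial>lborel)"
      proof -
        have "ennreal b * (ennreal t * ennreal u * I) = ennreal (b * t * u) * I" if "0 \<le> t" "0 \<le> u" for t u I
          using b that by (simp add: ennreal_mult mult.assoc)
        then show ?thesis using less_imp_le[OF wt_mass_pos[where 'a='a]] by simp
      qed
      \<comment> \<open>The kernel contributes 2^((j+1)d) and the integral of the weight at scale
        2^(-m) contributes 2^(-md); up to 2^d the product is the loss 2^((j-m)d).\<close>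
      also have "b * (1 / (2 ^ m) ^ DIM('a)) * wt_mass TYPE('a) = D * 2 ^ ((j - m) * DIM('a))"
      proof -
        have "(2::real) ^ (Suc j * DIM('a)) = 2 ^ DIM('a) * (2 ^ ((j - m) * DIM('a)) * 2 ^ (m * DIM('a)))"
          using mj by (simp add: power_add[symmetric] algebra_simps)
        then show ?thesis by (simp add: b_def D_def power_mult[of 2 m] del: mult_Suc)
      qed
      also have "epow 2 P * (ennreal (D * 2 ^ ((j - m) * DIM('a))) * (\<integral>\<^sup>+y. epow (?v y) P \<partial>lborel))
        = epow (ennreal (K * 2 powr (real (j - m) * (DIM('a) / P))) * piece_norm (ennreal P) j f) P"
      proof -
        have e2: "epow 2 P = ennreal (2 powr P)" using epow_ennreal[of 2 P] by simp
        have tP: "(K * 2 powr (real (j - m) * (DIM('a) / P))) powr P = 2 powr P * (D * 2 ^ ((j - m) * DIM('a)))"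
          using P D by (simp add: K_def powr_mult powr_powr powr_realpow[symmetric])
        have "epow (ennreal t * piece_norm (ennreal P) j f) P = ennreal (t powr P) * (\<integral>\<^sup>+y. epow (?v y) P \<partial>lborel)"
          if "0 \<le> t" for t
          using that P by (simp only: epow_mult[of P] epow_ennreal PN)
        from this[of "K * 2 powr (real (j - m) * (DIM('a) / P))"] K D show ?thesis
          by (simp only: tP e2) (simp add: ennreal_mult mult.assoc)
      qed
      finally show ?thesis using P by (simp add: Lpe_real_le_iff)
    qed
    ultimately show ?thesis by (intro bexI[of _ M]) auto
  qed
  then show ?thesis using K by (intro exI[of _ K]) blast
qed

text \<open>For \<open>p = \<infinity>\<close> the exponent reads \<open>enn2real p = 0\<close>, so the quotient is \<open>0\<close>, as it should be.\<close>

lemma piece_increment: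
  assumes p: "1 \<le> p"
  shows "\<exists>C>0. \<forall>f j m. wint f \<longrightarrow> (\<exists>M\<in>borel_measurable borel.
    (\<forall>x h. norm h \<le> 1 / 2 ^ m \<longrightarrow> ennreal (norm (conv (dkern j) f (x + h) - conv (dkern j) f x)) \<le> M x) \<and>
    Lpe p lborel M \<le> ennreal (C * (if j \<le> m then 2 powr (real j - real m) else 2 powr ((real j - real m) * (DIM('a) / enn2real p))))
      * piece_norm p j f)"
proof -
  have p0: "0 < p" using p by (rule less_le_trans[rotated]) simp
  obtain C1 where C1: "0 < C1" and small: "\<And>f j m. wint f \<Longrightarrow> j \<le> m \<Longrightarrow> (\<exists>M\<in>borel_measurable borel.
    (\<forall>x h. norm h \<le> 1 / 2 ^ m \<longrightarrow> ennreal (norm (conv (dkern j) f (x + h) - conv (dkern j) f x)) \<le> M x) \<and>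
    Lpe p lborel M \<le> ennreal (C1 * (1 / 2 ^ (m - j))) * piece_norm p j f)"
    using piece_increment_small[OF p] by blast
  obtain C2 where C2: "0 < C2" and large: "\<And>f j m. wint f \<Longrightarrow> m \<le> j \<Longrightarrow> (\<exists>M\<in>borel_measurable borel.
    (\<forall>x h. norm h \<le> 1 / 2 ^ m \<longrightarrow> ennreal (norm (conv (dkern j) f (x + h) - conv (dkern j) f x)) \<le> M x) \<and>
    Lpe p lborel M \<le> ennreal (C2 * 2 powr (real (j - m) * (DIM('a) / enn2real p))) * piece_norm p j f)"
    using p0
  proof (cases p rule: exponent_cases)
    case infinite
    obtain C where "0 < C" "\<And>f j. wint f \<Longrightarrow> (\<exists>M\<in>borel_measurable borel.
      (\<forall>x h. ennreal (norm (conv (dkern j) f (x + h) - conv (dkern j) f x)) \<le> M x) \<and>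
      Lpe top lborel M \<le> ennreal C * piece_norm top j f)"
      using piece_increment_large_infinite by blast
    with infinite show thesis by (intro that[of C]) (simp_all, blast)
  next
    case (finite P)
    then have "1 \<le> P" using p by simp
    from piece_increment_large_finite[OF this] finite show thesis by (metis that enn2real_ennreal less_imp_le)
  qed
  have mono: "ennreal (Ci * t) * N \<le> ennreal (max C1 C2 * t) * N" if "Ci \<le> max C1 C2" "0 \<le> t" for Ci t N
    using that by (intro mult_right_mono ennreal_leI) auto
  show ?thesis
  proof (intro exI[of _ "max C1 C2"] conjI allI impI)
    show "0 < max C1 C2" using C1 by simp
    fix f :: "'a \<Rightarrow> complex" and j m assume f: "wint f"
    show "\<exists>M\<in>borel_measurable borel.
    (\<forall>x h. norm h \<le> 1 / 2 ^ m \<longrightarrow> ennreal (norm (conv (dkern j) f (x + h) - conv (dkern j) f x)) \<le> M x) \<and>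
    Lpe p lborel M \<le> ennreal (max C1 C2 * (if j \<le> m then 2 powr (real j - real m) else 2 powr ((real j - real m) * (DIM('a) / enn2real p))))
      * piece_norm p j f"
    proof (cases "j \<le> m")
      case True
      have "2 powr (real j - real m) = 1 / 2 ^ (m - j)"
        using True by (simp add: powr_diff powr_realpow power_diff)
      moreover obtain M where "M \<in> borel_measurable borel"
        "\<forall>x h. norm h \<le> 1 / 2 ^ m \<longrightarrow> ennreal (norm (conv (dkern j) f (x + h) - conv (dkern j) f x)) \<le> M x"
        "Lpe p lborel M \<le> ennreal (C1 * (1 / 2 ^ (m - j))) * piece_norm p j f"
        using small[OF f True] by blast
      moreover note mono[of C1 "1 / 2 ^ (m - j)" "piece_norm p j f"]
      ultimately show ?thesis using True by (intro bexI[of _ M] conjI) auto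
    next
      case False
      then have eq: "real j - real m = real (j - m)" by (simp add: of_nat_diff)
      obtain M where M: "M \<in> borel_measurable borel"
        "\<forall>x h. norm h \<le> 1 / 2 ^ m \<longrightarrow> ennreal (norm (conv (dkern j) f (x + h) - conv (dkern j) f x)) \<le> M x"
        and le: "Lpe p lborel M \<le> ennreal (C2 * 2 powr (real (j - m) * (DIM('a) / enn2real p))) * piece_norm p j f"
        using large[OF f, of m j] False by auto
      have "Lpe p lborel M \<le> ennreal (max C1 C2 * (if j \<le> m then 2 powr (real j - real m) else 2 powr ((real j - real m) * (DIM('a) / enn2real p)))) * piece_norm p j f"
        unfolding if_not_P[OF False] eq by (rule order_trans[OF le mono]) auto
      with M show ?thesis by blast
    qed
  qed
qed

end

subsection \<open>Polar coordinates\<close>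

lemma measurable_sgn_euclidean [measurable]: "(sgn :: 'a::euclidean_space \<Rightarrow> 'a) \<in> borel_measurable borel"
  unfolding sgn_div_norm[abs_def] by measurable

lemma norm_scaleR_sgn [simp]: "norm x *\<^sub>R sgn x = (x :: 'a::euclidean_space)"
  by (cases "x = 0") (auto simp: sgn_div_norm)

text \<open>The factor \<open>DIM('a)\<close> compensates $\int_0^1 r^{d-1}\,dr = 1/d$, so that \<open>ang\<close> is the surface
  measure of the unit sphere.\<close>

definition ang :: "'a::euclidean_space measure" where
  "ang = distr (density lborel (\<lambda>x. ennreal (DIM('a)) * indicator (cball 0 1) x)) borel sgn"

definition rad :: "'a::euclidean_space itself \<Rightarrow> real measure" where
  "rad _ = density lborel (\<lambda>r. ennreal (r ^ (DIM('a) - 1)) * indicator {0..} r)"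

lemma sets_ang [simp, measurable_cong]: "sets ang = sets borel" and space_ang [simp]: "space ang = UNIV"
  by (auto simp: ang_def)

lemma sets_rad [simp, measurable_cong]: "sets (rad t) = sets borel" and space_rad [simp]: "space (rad t) = UNIV"
  by (auto simp: rad_def)

lemma measurable_ang_density [measurable]:
  "(\<lambda>x::'a::euclidean_space. ennreal (DIM('a)) * indicator (cball 0 1) x) \<in> borel_measurable borel"
proof -
  have [measurable]: "cball (0::'a) 1 \<in> sets borel" by simp
  show ?thesis by measurable
qed

lemma emeasure_ang:
  assumes [measurable]: "B \<in> sets borel"
  shows "emeasure ang (B :: 'a::euclidean_space set) = ennreal (DIM('a)) * emeasure lborel {x. norm x \<le> 1 \<and> sgn x \<in> B}"
proof -
  have [measurable]: "{x::'a. norm x \<le> 1 \<and> sgn x \<in> B} \<in> sets borel" by measurable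
  have [measurable]: "sgn -` B \<in> sets borel" using measurable_sets[OF measurable_sgn_euclidean assms] by simp
  have "emeasure ang B = (\<integral>\<^sup>+x. ennreal (DIM('a)) * indicator (cball 0 1) x * indicator (sgn -` B) x \<partial>(lborel :: 'a measure))"
    unfolding ang_def by (subst emeasure_distr, simp_all, subst emeasure_density) simp_all
  also have "\<dots> = (\<integral>\<^sup>+x. ennreal (DIM('a)) * indicator {x. norm x \<le> 1 \<and> sgn x \<in> B} x \<partial>(lborel :: 'a measure))"
    by (intro nn_integral_cong) (auto simp: indicator_def)
  finally show ?thesis by (simp add: nn_integral_cmult)
qed

lemma ang_finite: "emeasure ang (B :: 'a::euclidean_space set) < \<infinity>"
proof -
  have "emeasure ang B \<le> emeasure ang (UNIV :: 'a set)" by (rule emeasure_space[of ang, simplified])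
  also have "\<dots> = ennreal (DIM('a)) * emeasure lborel (cball (0::'a) 1)"
    by (subst emeasure_ang) (auto simp: cball_def dist_norm)
  also have "\<dots> < \<infinity>" using emeasure_lborel_cball_finite[of "0::'a" 1] by (auto simp: ennreal_mult_less_top)
  finally show ?thesis .
qed

lemma ang_UNIV_pos: "0 < emeasure ang (UNIV :: 'a::euclidean_space set)"
proof -
  have "emeasure ang (UNIV :: 'a set) = ennreal (DIM('a)) * emeasure lborel (cball (0::'a) 1)"
    by (subst emeasure_ang) (auto simp: cball_def dist_norm)
  then show ?thesis
    by (simp add: emeasure_cball ennreal_zero_less_mult_iff unit_ball_vol_pos)
qed

lemma emeasure_rad_atMost:
  assumes a: "0 \<le> a" shows "emeasure (rad TYPE('a::euclidean_space)) {..a} = ennreal (a ^ DIM('a) / DIM('a))"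
proof -
  have "emeasure (rad TYPE('a)) {..a} = (\<integral>\<^sup>+r. ennreal (r ^ (DIM('a) - 1)) * indicator {0..a} r \<partial>lborel)"
    by (simp add: rad_def emeasure_density) (auto intro!: nn_integral_cong simp: indicator_def)
  also have "\<dots> = ennreal (a ^ DIM('a) / DIM('a) - 0 ^ DIM('a) / DIM('a))"
  proof (rule nn_integral_FTC_Icc)
    fix x :: real
    have "DIM('a) \<noteq> 0" by simp
    then show "DERIV (\<lambda>x. x ^ DIM('a) / DIM('a)) x :> x ^ (DIM('a) - 1)"
      by (auto intro!: derivative_eq_intros)
  qed (use a in auto)
  finally show ?thesis by (simp add: power_0_left)
qed

lemma sigma_finite_rad: "sigma_finite_measure (rad t)"
  unfolding rad_def by (subst sigma_finite_measure.sigma_finite_iff_density_finite[OF lborel.sigma_finite_measure_axioms]) (auto simp: indicator_def ennreal_mult_eq_top_iff)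

lemma sigma_finite_ang: "sigma_finite_measure (ang :: 'a::euclidean_space measure)"
proof -
  have "finite_measure (ang :: 'a measure)" using ang_finite[of "UNIV :: 'a set"] by (intro finite_measureI) simp
  then show ?thesis by (simp add: finite_measure_def)
qed

text \<open>Dilation by a scales volumes by a^d; the factor d inside \<open>ang\<close> cancels the
  1/d of the radial mass.\<close>

lemma emeasure_cone:
  fixes B :: "'a::euclidean_space set"
  assumes [measurable]: "B \<in> sets borel" and a: "0 \<le> a"
  shows "emeasure lborel {x. norm x \<le> a \<and> sgn x \<in> B} = emeasure ang B * ennreal (a ^ DIM('a) / DIM('a))"
proof (cases "a = 0")
  case True
  have "emeasure lborel {x. norm x \<le> a \<and> sgn x \<in> B} \<le> emeasure lborel {0::'a}"
    using True by (intro emeasure_mono) auto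
  then show ?thesis using True by simp
next
  case False
  then have a: "0 < a" using a by simp
  have m [measurable]: "{x::'a. norm x \<le> c \<and> sgn x \<in> B} \<in> sets borel" for c by measurable
  have "emeasure lborel {x. norm x \<le> a \<and> sgn x \<in> B} = (\<integral>\<^sup>+x. indicator {x. norm x \<le> a \<and> sgn x \<in> B} x \<partial>lborel)" by simp
  also have "\<dots> = ennreal (\<bar>a\<bar> ^ DIM('a)) * (\<integral>\<^sup>+x. indicator {x. norm x \<le> a \<and> sgn x \<in> B} (0 + a *\<^sub>R x) \<partial>lborel)"
    by (rule nn_integral_affine) (use a in auto)
  also have "(\<integral>\<^sup>+x. indicator {x. norm x \<le> a \<and> sgn x \<in> B} (0 + a *\<^sub>R x) \<partial>lborel) = (\<integral>\<^sup>+x. indicator {x::'a. norm x \<le> 1 \<and> sgn x \<in> B} x \<partial>lborel)"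
    using a by (intro nn_integral_cong) (auto simp: indicator_def sgn_scaleR)
  also have "\<dots> = emeasure lborel {x::'a. norm x \<le> 1 \<and> sgn x \<in> B}" by simp
  also have "ennreal (\<bar>a\<bar> ^ DIM('a)) * emeasure lborel {x::'a. norm x \<le> 1 \<and> sgn x \<in> B} = emeasure ang B * ennreal (a ^ DIM('a) / DIM('a))"
  proof -
    have "ennreal (\<bar>a\<bar> ^ DIM('a)) = ennreal (real DIM('a)) * ennreal (a ^ DIM('a) / DIM('a))"
      using a by (simp add: ennreal_mult[symmetric])
    then show ?thesis by (simp add: emeasure_ang mult_ac)
  qed
  finally show ?thesis .
qed

text \<open>Product measures are determined by rectangles. For a fixed angular set B both sides are
  measures in the radial set, and they agree on half-lines, where they are volumes of truncated
  cones.\<close>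

lemma polar_measure:
  "ang \<Otimes>\<^sub>M rad TYPE('a) = distr lborel (borel \<Otimes>\<^sub>M borel) (\<lambda>x::'a::euclidean_space. (sgn x, norm x))"
proof (rule pair_measure_eqI[OF sigma_finite_ang sigma_finite_rad])
  show "sets (ang \<Otimes>\<^sub>M rad TYPE('a)) = sets (distr lborel (borel \<Otimes>\<^sub>M borel) (\<lambda>x::'a. (sgn x, norm x)))"
    by (auto intro!: sets_pair_measure_cong)
  fix B :: "'a set" and A assume "B \<in> sets ang" and A: "A \<in> sets (rad TYPE('a))"
  then have [measurable]: "B \<in> sets borel" "A \<in> sets borel" by auto
  define N1 where "N1 = distr (density lborel (indicator (sgn -` B :: 'a set))) borel norm"
  define N2 where "N2 = density (rad TYPE('a)) (\<lambda>_. emeasure ang B)"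
  have s [measurable]: "sgn -` B \<in> sets (borel :: 'a measure)"
    using measurable_sets[OF measurable_sgn_euclidean, of B] by simp
  have N1: "emeasure N1 C = emeasure lborel {x. norm x \<in> C \<and> sgn x \<in> B}" if [measurable]: "C \<in> sets borel" for C
  proof -
    have [measurable]: "{x::'a. norm x \<in> C \<and> sgn x \<in> B} \<in> sets borel" by measurable
    have [measurable]: "norm -` C \<in> sets (borel :: 'a measure)"
      using measurable_sets[of norm "borel :: 'a measure" borel C] by simp
    have "emeasure N1 C = (\<integral>\<^sup>+x. indicator (sgn -` B) x * indicator (norm -` C) x \<partial>lborel)"
      by (simp add: N1_def emeasure_distr emeasure_density)
    also have "\<dots> = (\<integral>\<^sup>+x. indicator {x. norm x \<in> C \<and> sgn x \<in> B} x \<partial>lborel)"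
      by (intro nn_integral_cong) (auto simp: indicator_def)
    finally show ?thesis by simp
  qed
  have N2: "emeasure N2 C = emeasure ang B * emeasure (rad TYPE('a)) C" if [measurable]: "C \<in> sets borel" for C
    by (simp add: N2_def emeasure_density nn_integral_cmult)
  have eq: "emeasure N1 {..a} = emeasure N2 {..a}" for a
  proof (cases "0 \<le> a")
    case True then show ?thesis by (simp add: N1 N2 emeasure_cone emeasure_rad_atMost)
  next
    case False
    then have e: "{x::'a. norm x \<le> a \<and> sgn x \<in> B} = {}" by (auto dest: order_trans[OF norm_ge_zero])
    have "emeasure (rad TYPE('a)) {..a} \<le> (\<integral>\<^sup>+r. 0 \<partial>lborel)"
      using False by (simp add: rad_def emeasure_density nn_integral_0_iff_AE)
        (auto simp: indicator_def)
    then show ?thesis by (simp add: N1 N2 e)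
  qed
  have "N1 = N2"
  proof (rule measure_eqI_generator_eq[of "range (\<lambda>a. {..a})" UNIV _ _ "\<lambda>n. {..real n}"])
    show "Int_stable (range (\<lambda>a::real. {..a}))" by (auto simp: Int_stable_def)
    show "(\<Union>i. {..real i}) = UNIV" using real_arch_simple by auto
    show "sets N1 = sigma_sets UNIV (range (\<lambda>a::real. {..a}))" "sets N2 = sigma_sets UNIV (range (\<lambda>a::real. {..a}))"
      by (simp_all add: N1_def N2_def borel_eq_atMost)
    show "emeasure N1 {..real i} \<noteq> \<infinity>" for i
      using ang_finite[of B] by (simp add: eq N2 emeasure_rad_atMost ennreal_mult_eq_top_iff)
  qed (use eq in auto)
  then have "emeasure ang B * emeasure (rad TYPE('a)) A = emeasure lborel {x. norm x \<in> A \<and> sgn x \<in> B}"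
    using N1[of A] N2[of A] by simp
  also have "\<dots> = emeasure (distr lborel (borel \<Otimes>\<^sub>M borel) (\<lambda>x::'a. (sgn x, norm x))) (B \<times> A)"
    by (subst emeasure_distr) (auto intro!: arg_cong[where f = "emeasure lborel"])
  finally show "emeasure ang B * emeasure (rad TYPE('a)) A = emeasure (distr lborel (borel \<Otimes>\<^sub>M borel) (\<lambda>x::'a. (sgn x, norm x))) (B \<times> A)" .
qed

lemma AE_rad: "(AE r in rad TYPE('a::euclidean_space). P r) \<longleftrightarrow> (AE r in lborel. 0 < r \<longrightarrow> P r)"
proof -
  have "(AE r in rad TYPE('a). P r) \<longleftrightarrow> (AE r in lborel. 0 < ennreal (r ^ (DIM('a) - 1)) * indicator {0..} r \<longrightarrow> P r)"
    unfolding rad_def by (rule AE_density) measurable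
  also have "\<dots> \<longleftrightarrow> (AE r in lborel. 0 < r \<longrightarrow> P r)"
  proof (rule iffI)
    assume "AE r in lborel. 0 < ennreal (r ^ (DIM('a) - 1)) * indicator {0..} r \<longrightarrow> P r"
    then show "AE r in lborel. 0 < r \<longrightarrow> P r" by eventually_elim (auto simp: ennreal_zero_less_mult_iff)
  next
    assume "AE r in lborel. 0 < r \<longrightarrow> P r"
    then show "AE r in lborel. 0 < ennreal (r ^ (DIM('a) - 1)) * indicator {0..} r \<longrightarrow> P r"
      using AE_lborel_singleton[of "0::real"]
      by eventually_elim (auto simp: ennreal_zero_less_mult_iff indicator_def split: if_splits)
  qed
  finally show ?thesis .
qed

lemma AE_ang_norm: "AE \<theta> in (ang :: 'a::euclidean_space measure). norm \<theta> = 1"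
  unfolding ang_def
proof (subst AE_distr_iff)
  have "AE x in lborel. 0 < ennreal (DIM('a)) * indicator (cball 0 1) x \<longrightarrow> norm (sgn (x::'a)) = 1"
    using AE_lborel_singleton[of "0::'a"] by eventually_elim (simp add: norm_sgn)
  then show "AE x in density lborel (\<lambda>x::'a. ennreal (DIM('a)) * indicator (cball 0 1) x). norm (sgn x) = 1"
    by (subst AE_density) (simp_all add: measurable_ang_density)
qed auto

lemma AE_ang_const: "(AE \<theta> in (ang :: 'a::euclidean_space measure). Q) \<Longrightarrow> Q"
  using ang_UNIV_pos[where 'a='a] by (cases Q) (auto simp: eventually_False ae_filter_eq_bot_iff)

text \<open>Fubini for a Borel null set enclosing the exceptional set, after writing x as norm x
  times sgn x.\<close>

lemma AE_polar:
  assumes "AE x in lborel. P (x :: 'a::euclidean_space)"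
  shows "AE \<theta> in ang. AE r in lborel. 0 < r \<longrightarrow> P (r *\<^sub>R \<theta>)"
proof -
  interpret pair_sigma_finite "ang :: 'a measure" "rad TYPE('a)"
    by (intro pair_sigma_finite.intro sigma_finite_ang sigma_finite_rad)
  obtain N where N: "{x. \<not> P x} \<subseteq> N" "emeasure lborel N = 0" "N \<in> sets lborel"
    using assms by (rule AE_E) auto
  then have [measurable]: "N \<in> sets borel" by simp
  have "AE x in lborel. snd (sgn x, norm x) *\<^sub>R fst (sgn x, norm x) \<notin> N"
    using N by (auto intro!: AE_not_in simp: null_sets_def)
  then have "AE z in ang \<Otimes>\<^sub>M rad TYPE('a). snd z *\<^sub>R fst z \<notin> N"
    unfolding polar_measure by (subst AE_distr_iff) auto
  then have "AE \<theta> in ang. AE r in rad TYPE('a). snd (\<theta>, r) *\<^sub>R fst (\<theta>, r) \<notin> N" by (rule AE_pair)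
  then show ?thesis
    unfolding AE_rad using N(1) by (auto elim!: eventually_mono)
qed

lemma AE_polar_converse:
  assumes P [measurable]: "Measurable.pred borel P"
    and AE: "AE \<theta> in ang. AE r in lborel. 0 < r \<longrightarrow> P (r *\<^sub>R \<theta>)"
  shows "AE x in lborel. P (x :: 'a::euclidean_space)"
proof -
  interpret pair_sigma_finite "ang :: 'a measure" "rad TYPE('a)"
    by (intro pair_sigma_finite.intro sigma_finite_ang sigma_finite_rad)
  have "AE z in ang \<Otimes>\<^sub>M rad TYPE('a). P (snd z *\<^sub>R fst z)"
  proof (rule AE_pair_measure)
    show "{z \<in> space (ang \<Otimes>\<^sub>M rad TYPE('a)). P (snd z *\<^sub>R fst z)} \<in> sets (ang \<Otimes>\<^sub>M rad TYPE('a))" by measurable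
  qed (use AE in \<open>simp add: AE_rad\<close>)
  then have "AE x in lborel. P (snd (sgn x, norm x) *\<^sub>R fst (sgn x, norm x))"
    unfolding polar_measure by (rule AE_distrD[rotated]) measurable
  then show ?thesis by simp
qed

lemma nn_integral_radial:
  assumes [measurable]: "u \<in> borel_measurable borel"
  shows "(\<integral>\<^sup>+x. u (norm (x :: 'a::euclidean_space)) \<partial>lborel)
    = emeasure ang (UNIV :: 'a set) * (\<integral>\<^sup>+r. ennreal (r ^ (DIM('a) - 1)) * indicator {0..} r * u r \<partial>lborel)"
proof -
  interpret rad: sigma_finite_measure "rad TYPE('a)" by (rule sigma_finite_rad)
  have "(\<integral>\<^sup>+x. u (norm (x :: 'a)) \<partial>lborel) = (\<integral>\<^sup>+z. u (snd z) \<partial>((ang :: 'a measure) \<Otimes>\<^sub>M rad TYPE('a)))"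
    unfolding polar_measure by (subst nn_integral_distr) auto
  also have "\<dots> = (\<integral>\<^sup>+\<theta>. \<integral>\<^sup>+r. u r \<partial>(rad TYPE('a)) \<partial>(ang :: 'a measure))"
    by (subst rad.nn_integral_fst[symmetric]) auto
  also have "\<dots> = (\<integral>\<^sup>+r. u r \<partial>(rad TYPE('a))) * emeasure ang (UNIV :: 'a set)" by simp
  also have "(\<integral>\<^sup>+r. u r \<partial>(rad TYPE('a))) = (\<integral>\<^sup>+r. ennreal (r ^ (DIM('a) - 1)) * indicator {0..} r * u r \<partial>lborel)"
    unfolding rad_def by (subst nn_integral_density) auto
  finally show ?thesis by (simp add: mult.commute)
qed

text \<open>A null set of radii sweeps out a null set of points, by integrating its indicator in
  polar coordinates.\<close>

lemma AE_radial:
  assumes "AE r in lborel. 0 < r \<longrightarrow> Q r"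
  shows "AE x in lborel. Q (norm (x :: 'a::euclidean_space))"
proof -
  obtain N where N: "{r. \<not> (0 < r \<longrightarrow> Q r)} \<subseteq> N" "emeasure lborel N = 0" "N \<in> sets lborel"
    using assms by (rule AE_E) auto
  then have [measurable]: "N \<in> sets borel" and N0: "AE r in lborel. r \<notin> N" by (auto intro!: AE_not_in simp: null_sets_def)
  have "AE r in lborel. ennreal (r ^ (DIM('a) - 1)) * indicator {0..} r * indicator N r = 0"
    using N0 by eventually_elim simp
  then have "(\<integral>\<^sup>+r. ennreal (r ^ (DIM('a) - 1)) * indicator {0..} r * indicator N r \<partial>lborel) = 0"
    by (subst nn_integral_0_iff_AE) auto
  then have "(\<integral>\<^sup>+x. indicator N (norm (x :: 'a)) \<partial>lborel) = 0"
    by (subst nn_integral_radial) auto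
  then have "AE x in lborel. indicator N (norm (x :: 'a)) = (0::ennreal)" by (subst (asm) nn_integral_0_iff_AE) auto
  moreover have "Q r" if "0 < r" "r \<notin> N" for r using N(1) that by blast
  ultimately show ?thesis
    using AE_lborel_singleton[of "0::'a"] by (auto elim!: eventually_elim2 simp: indicator_eq_0_iff)
qed

lemma AE_reflect:
  fixes P :: "'a::euclidean_space \<Rightarrow> bool"
  assumes "AE x in lborel. P x" shows "AE x in lborel. P (- x)"
proof -
  obtain N where N: "{x. \<not> P x} \<subseteq> N" "emeasure lborel N = 0" "N \<in> sets lborel"
    using assms by (rule AE_E) auto
  then have [measurable]: "N \<in> sets borel" by simp
  have "(\<integral>\<^sup>+x. indicator N x \<partial>lborel) = ennreal (\<bar>- 1\<bar> ^ DIM('a)) * (\<integral>\<^sup>+x. indicator N (0 + (- 1) *\<^sub>R x) \<partial>lborel)"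
    by (rule nn_integral_affine) auto
  then have "(\<integral>\<^sup>+x. indicator N (- x) \<partial>lborel) = 0" using N by simp
  then have "AE x in lborel. indicator N (- x) = (0::ennreal)" by (subst (asm) nn_integral_0_iff_AE) auto
  then show ?thesis by eventually_elim (use N(1) in \<open>auto simp: indicator_eq_0_iff\<close>)
qed

lemma AE_real_split:
  assumes "AE r in lborel. 0 < r \<longrightarrow> P r" and "AE r in lborel. 0 < r \<longrightarrow> P (- r)"
  shows "AE r in lborel. P (r::real)"
  using assms(1) AE_reflect[OF assms(2)] AE_lborel_singleton[of "0::real"]
proof eventually_elim
  case (elim r)
  then show ?case by (cases "0 < r") auto
qed

subsection \<open>Traces of radial functions\<close>

lemma borel_representative:
  fixes f :: "'a::euclidean_space \<Rightarrow> complex"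
  assumes f: "f \<in> borel_measurable lebesgue"
  shows "\<exists>f'\<in>borel_measurable borel. AE x in lborel. f x = f' x"
proof -
  have re: "(\<lambda>x. Re (f x)) \<in> borel_measurable lebesgue" and im: "(\<lambda>x. Im (f x)) \<in> borel_measurable lebesgue"
    using f by simp_all
  obtain u where [measurable]: "u \<in> borel_measurable lborel" and u: "AE x in lborel. Re (f x) = u x"
    using completion_ex_borel_measurable_real[OF re] by blast
  obtain v where [measurable]: "v \<in> borel_measurable lborel" and v: "AE x in lborel. Im (f x) = v x"
    using completion_ex_borel_measurable_real[OF im] by blast
  from u v have "AE x in lborel. f x = Complex (u x) (v x)" by eventually_elim (simp add: complex_eq_iff)
  moreover have "(\<lambda>x. of_real (u x) + \<i> * of_real (v x)) \<in> borel_measurable lborel" by measurable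
  then have "(\<lambda>x. Complex (u x) (v x)) \<in> borel_measurable borel" by (simp add: Complex_eq)
  ultimately show ?thesis by (intro bexI[of _ "\<lambda>x. Complex (u x) (v x)"])
qed

lemma measurable_completion_AE_ennreal:
  fixes u U :: "real \<Rightarrow> ennreal"
  assumes [measurable]: "U \<in> borel_measurable borel" and eq: "AE r in lborel. u r = U r"
  shows "u \<in> borel_measurable lebesgue"
proof (rule borel_measurableI_le)
  fix B
  have "AE r in lebesgue. u r = U r" using eq by (rule AE_completion)
  then obtain N where N: "N \<in> null_sets lebesgue" "\<And>r. r \<notin> N \<Longrightarrow> u r = U r"
    unfolding completion.AE_iff_null_sets by auto
  have "{r. U r \<le> B} \<in> sets borel" by measurable
  then have 1: "{r. U r \<le> B} - N \<in> sets lebesgue" using N(1) by (intro sets.Diff) (auto simp: null_sets_def)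
  have 2: "{r. u r \<le> B} \<inter> N \<in> sets lebesgue"
    using N(1) by (meson completion.complete2 inf_le2 null_setsD2 null_sets_subset)
  have "{r. u r \<le> B} = ({r. U r \<le> B} - N) \<union> ({r. u r \<le> B} \<inter> N)" proof -
    have "u r \<le> B \<longleftrightarrow> U r \<le> B" if "r \<notin> N" for r using N(2)[OF that] by simp
    then show ?thesis by blast
  qed
  with sets.Un[OF 1 2] show "{r \<in> space lebesgue. u r \<le> B} \<in> sets lebesgue" by simp
qed

text \<open>Measurability of g comes from f: along almost every direction a Borel version of f
  agrees with g at almost every radius, so one such ray supplies a Borel version of g.\<close>

lemma trace_representative:
  fixes f :: "'a::euclidean_space \<Rightarrow> complex"
  assumes f: "f \<in> borel_measurable lebesgue" and tr: "is_trace f g"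
  shows "\<exists>G\<in>borel_measurable borel. (\<forall>r. G (- r) = G r) \<and> (AE r in lborel. g r = G r) \<and> (AE x in lborel. f x = G (norm x))"
proof -
  obtain f' where [measurable]: "f' \<in> borel_measurable borel" and f': "AE x in lborel. f x = f' x"
    using borel_representative[OF f] by blast
  have g: "AE t in lborel. g (- t) = g t" "AE x in lborel. f x = g (norm x)"
    using tr by (auto simp: is_trace_def AE_completion_iff)
  from f' g(2) have "AE x in lborel. f' x = g (norm x)" by eventually_elim simp
  from AE_polar[OF this] AE_ang_norm
  have "AE \<theta> in ang. norm \<theta> = 1 \<and> (AE r in lborel. 0 < r \<longrightarrow> f' (r *\<^sub>R \<theta>) = g (norm (r *\<^sub>R \<theta>)))"
    by eventually_elim simp
  then have "AE \<theta> in (ang :: 'a measure). \<exists>\<theta>::'a. norm \<theta> = 1 \<and> (AE r in lborel. 0 < r \<longrightarrow> f' (r *\<^sub>R \<theta>) = g (norm (r *\<^sub>R \<theta>)))"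
    by eventually_elim blast
  then have "\<exists>\<theta>::'a. norm \<theta> = 1 \<and> (AE r in lborel. 0 < r \<longrightarrow> f' (r *\<^sub>R \<theta>) = g (norm (r *\<^sub>R \<theta>)))"
    by (rule AE_ang_const)
  then obtain \<theta> :: 'a where \<theta>: "norm \<theta> = 1" and "AE r in lborel. 0 < r \<longrightarrow> f' (r *\<^sub>R \<theta>) = g (norm (r *\<^sub>R \<theta>))" by blast
  then have pos: "AE r in lborel. 0 < r \<longrightarrow> f' (r *\<^sub>R \<theta>) = g r" by (auto elim!: eventually_mono)
  \<comment> \<open>The absolute value makes G even at every point, while g is so only almost
    everywhere.\<close>
  define G where "G r = f' (\<bar>r\<bar> *\<^sub>R \<theta>)" for r
  have [measurable]: "G \<in> borel_measurable borel" unfolding G_def by measurable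
  have Gpos: "AE r in lborel. 0 < r \<longrightarrow> g r = G r" using pos by (auto elim!: eventually_mono simp: G_def)
  have "AE r in lborel. g r = G r"
  proof (rule AE_real_split[OF Gpos])
    show "AE r in lborel. 0 < r \<longrightarrow> g (- r) = G (- r)" using Gpos g(1) by eventually_elim (simp add: G_def)
  qed
  moreover have "AE x in lborel. f x = G (norm x)"
    using g(2) AE_radial[OF Gpos] by eventually_elim simp
  ultimately show ?thesis by (intro bexI[of _ G]) (auto simp: G_def)
qed

section \<open>Maximal differences\<close>

lemma max_diff_le_iff:
  assumes [measurable]: "G \<in> borel_measurable borel"
  shows "max_diff G t r \<le> B \<longleftrightarrow> (AE w in lborel. \<bar>w\<bar> \<le> t \<longrightarrow> ennreal (norm (G (r + w) - G r)) \<le> B)"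
proof -
  have "(\<lambda>w. ennreal (norm (G (r + w) - G r))) \<in> borel_measurable lebesgue" by (intro measurable_completion) simp
  then have "(\<lambda>w. ennreal (norm (G (r + w) - G r))) \<in> borel_measurable (lebesgue_on {-t..t})"
    by (intro measurable_restrict_space1)
  then have "max_diff G t r \<le> B \<longleftrightarrow> (AE w in lebesgue_on {-t..t}. ennreal (norm (G (r + w) - G r)) \<le> B)"
    unfolding max_diff_def by (rule esssup_le_iff)
  also have "\<dots> \<longleftrightarrow> (AE w in lebesgue. w \<in> {-t..t} \<longrightarrow> ennreal (norm (G (r + w) - G r)) \<le> B)"
    by (rule AE_restrict_space_iff) auto
  also have "\<dots> \<longleftrightarrow> (AE w in lborel. \<bar>w\<bar> \<le> t \<longrightarrow> ennreal (norm (G (r + w) - G r)) \<le> B)"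
    by (auto simp: AE_completion_iff abs_le_iff minus_le_iff intro!: arg_cong2[where f = eventually] elim!: eventually_mono)
  finally show ?thesis .
qed

text \<open>Sublevel sets are described by the vanishing of an integral over w, which depends
  measurably on the parameter r.\<close>

lemma measurable_max_diff:
  assumes [measurable]: "G \<in> borel_measurable borel"
  shows "max_diff G t \<in> borel_measurable borel"
proof (rule borel_measurableI_le)
  fix B
  have "max_diff G t r \<le> B \<longleftrightarrow> (\<integral>\<^sup>+w. (if \<bar>w\<bar> \<le> t \<and> \<not> ennreal (norm (G (r + w) - G r)) \<le> B then 1 else 0) \<partial>lborel) = 0" for r
    unfolding max_diff_le_iff[OF assms] by (subst nn_integral_0_iff_AE) (auto intro!: arg_cong2[where f = eventually])
  then show "{r \<in> space borel. max_diff G t r \<le> B} \<in> sets borel" by (simp only:) measurable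
qed

lemma max_diff_even:
  assumes [measurable]: "G \<in> borel_measurable borel" and even: "\<And>r. G (- r) = G r"
  shows "max_diff G t (- r) = max_diff G t r"
proof -
  have le: "max_diff G t (- r) \<le> max_diff G t r" for r
  proof -
    have "AE w in lborel. \<bar>w\<bar> \<le> t \<longrightarrow> ennreal (norm (G (r + w) - G r)) \<le> max_diff G t r"
      using max_diff_le_iff[OF assms(1)] by blast
    from AE_reflect[OF this] have "AE w in lborel. \<bar>w\<bar> \<le> t \<longrightarrow> ennreal (norm (G (- r + w) - G (- r))) \<le> max_diff G t r"
    proof eventually_elim
      case (elim w)
      have "G (- r + w) = G (r + - w)" using even[of "- r + w"] by simp
      with elim even[of r] show ?case by simp
    qed
    then show ?thesis by (simp add: max_diff_le_iff)
  qed
  from le[of r] le[of "- r"] show ?thesis by simp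
qed

lemma max_diff_mono:
  assumes "G \<in> borel_measurable borel" "t \<le> t'"
  shows "max_diff G t r \<le> max_diff G t' r"
proof -
  have "AE w in lborel. \<bar>w\<bar> \<le> t' \<longrightarrow> ennreal (norm (G (r + w) - G r)) \<le> max_diff G t' r"
    using max_diff_le_iff[OF assms(1)] by blast
  then show ?thesis unfolding max_diff_le_iff[OF assms(1)] by eventually_elim (use assms(2) in auto)
qed

text \<open>The a.e. equality handles the moving point r + w; at the centre r the two functions must
  agree exactly, which holds for almost every r.\<close>

lemma max_diff_cong_AE:
  assumes [measurable]: "G \<in> borel_measurable borel" and AE: "AE r in lborel. g r = G r" and r: "g r = G r"
  shows "max_diff g t r = max_diff G t r"
  unfolding max_diff_def
proof (rule esssup_AE_cong)
  have G: "(\<lambda>w. ennreal (norm (G (r + w) - G r))) \<in> borel_measurable lebesgue" by (intro measurable_completion) simp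
  have eq: "AE w in lborel. ennreal (norm (g (r + w) - g r)) = ennreal (norm (G (r + w) - G r))"
    using AE_translate[OF AE, of r] by eventually_elim (simp add: r add.commute)
  have g: "(\<lambda>w. ennreal (norm (g (r + w) - g r))) \<in> borel_measurable lebesgue"
  proof -
    have "(\<lambda>w. G (r + w) - G r) \<in> borel_measurable lebesgue" by (intro measurable_completion) simp
    moreover have "AE w in lebesgue. G (r + w) - G r = g (r + w) - g r"
      using AE_translate[OF AE, of r] by (auto simp: AE_completion_iff r add.commute elim!: eventually_mono)
    ultimately have "(\<lambda>w. g (r + w) - g r) \<in> borel_measurable lebesgue" by (rule borel_measurable_AE)
    then show ?thesis by simp
  qed
  show "(\<lambda>w. ennreal (norm (g (r + w) - g r))) \<in> borel_measurable (lebesgue_on {-t..t})"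
    "(\<lambda>w. ennreal (norm (G (r + w) - G r))) \<in> borel_measurable (lebesgue_on {-t..t})"
    using g G by (auto intro: measurable_restrict_space1)
  show "AE w in lebesgue_on {-t..t}. ennreal (norm (g (r + w) - g r)) = ennreal (norm (G (r + w) - G r))"
    using eq by (subst AE_restrict_space_iff) (auto simp: AE_completion_iff elim!: eventually_mono)
qed

text \<open>The bound | |x+z| - |x| | \<le> |z| puts the radius of x + z among those compared in the
  maximal difference at |x|. For each x this works for almost every z; Fubini exchanges the two
  quantifiers, and a null set of z stays excluded.\<close>

lemma differences_le_max_diff:
  fixes p :: ennreal
  assumes p: "0 < p" and [measurable]: "G \<in> borel_measurable borel"
  shows "AE z in lborel. norm z \<le> t \<longrightarrow>
    Lpe p lborel (\<lambda>x::'a. ennreal (norm (G (norm (x + z)) - G (norm x)))) \<le> Lpe p lborel (\<lambda>x::'a::euclidean_space. max_diff G t (norm x))"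
proof -
  have "AE z in lborel. norm z \<le> t \<longrightarrow> ennreal (norm (G (norm (x + z)) - G (norm x))) \<le> max_diff G t (norm x)" for x :: 'a
  proof -
    have "AE w in lborel. \<bar>w\<bar> \<le> t \<longrightarrow> ennreal (norm (G (norm x + w) - G (norm x))) \<le> max_diff G t (norm x)"
      using max_diff_le_iff[OF assms(2)] by blast
    from AE_translate[OF this, of "- norm x"]
    have "AE s in lborel. 0 < s \<longrightarrow> \<bar>s - norm x\<bar> \<le> t \<longrightarrow> ennreal (norm (G s - G (norm x))) \<le> max_diff G t (norm x)"
      by eventually_elim simp
    from AE_translate[OF AE_radial[OF this], of x]
    show ?thesis
    proof eventually_elim
      case (elim z)
      have "\<bar>norm (z + x) - norm x\<bar> \<le> norm z" using norm_triangle_ineq3[of "z + x" x] by simp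
      with elim show ?case by (auto simp: add.commute)
    qed
  qed
  then have "AE x in lborel. AE z in lborel. norm (z::'a) \<le> t \<longrightarrow> ennreal (norm (G (norm (x + z)) - G (norm x))) \<le> max_diff G t (norm x)" by simp
  moreover define m where "m x = max_diff G t (norm x)" for x :: 'a
  ultimately have ae: "AE x in lborel. AE z in lborel. norm (z::'a) \<le> t \<longrightarrow> ennreal (norm (G (norm (x + z)) - G (norm x))) \<le> m x" by simp
  have [measurable]: "m \<in> borel_measurable borel"
    unfolding m_def by (rule measurable_compose[OF _ measurable_max_diff[OF assms(2)]]) measurable
  let ?LL = "(lborel :: 'a measure) \<Otimes>\<^sub>M (lborel :: 'a measure)"
  have c1: "{x \<in> space ?LL. ennreal (norm (G (norm (fst x + snd x)) - G (norm (fst x)))) \<le> m (fst x)} \<in> sets ?LL"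
    by (rule borel_measurable_le) measurable
  have c2: "{x \<in> space ?LL. norm (snd x) \<le> t} \<in> sets ?LL"
    by measurable
  have "{x \<in> space ?LL. norm (snd x) \<le> t \<longrightarrow> ennreal (norm (G (norm (fst x + snd x)) - G (norm (fst x)))) \<le> m (fst x)}
    = {x \<in> space ?LL. ennreal (norm (G (norm (fst x + snd x)) - G (norm (fst x)))) \<le> m (fst x)} \<union> (space ?LL - {x \<in> space ?LL. norm (snd x) \<le> t})"
    by blast
  also have "\<dots> \<in> sets ?LL" using c1 c2 by (intro sets.Un sets.compl_sets)
  finally have "{x \<in> space ?LL. norm (snd x) \<le> t \<longrightarrow> ennreal (norm (G (norm (fst x + snd x)) - G (norm (fst x)))) \<le> m (fst x)} \<in> sets ?LL" .
  note comm = lborel_pair.AE_commute[OF this]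
  from ae have "AE z in lborel. AE x in lborel. norm (z::'a) \<le> t \<longrightarrow> ennreal (norm (G (norm (x + z)) - G (norm x))) \<le> m x"
    unfolding comm .
  then show ?thesis
  proof eventually_elim
    case (elim z)
    have "(\<lambda>x. ennreal (norm (G (norm (x + z)) - G (norm (x :: 'a))))) \<in> borel_measurable lborel" by measurable
    with elim show ?case unfolding m_def[symmetric] by (intro impI Lpe_mono_AE[OF p]) auto
  qed
qed

text \<open>On almost every line through the origin almost every point lies in S, so the increment
  of G from r to r + w is an increment of the radial function along that line. The line is used in
  full because r + w may be negative; there evenness of G gives the value at the point (r + w)
  \<theta>.\<close>

lemma max_diff_le_majorant:
  fixes M :: "'a::euclidean_space \<Rightarrow> ennreal"
  assumes [measurable]: "G \<in> borel_measurable borel" "M \<in> borel_measurable borel" and even: "\<And>r. G (- r) = G r"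
    and S: "AE x in lborel. x \<in> S"
    and M: "\<And>x h. x \<in> S \<Longrightarrow> x + h \<in> S \<Longrightarrow> norm h \<le> t \<Longrightarrow> ennreal (norm (G (norm (x + h)) - G (norm x))) \<le> M x"
  shows "AE x in lborel. max_diff G t (norm x) \<le> M x"
proof -
  define m where "m x = max_diff G t (norm x)" for x :: 'a
  have [measurable]: "m \<in> borel_measurable borel"
    unfolding m_def by (rule measurable_compose[OF _ measurable_max_diff[OF assms(1)]]) measurable
  have "Measurable.pred borel (\<lambda>x. m x \<le> M x)"
    unfolding pred_def by (rule borel_measurable_le) measurable
  note conv = AE_polar_converse[OF this]
  \<comment> \<open>Polar coordinates see one ray at a time; the reflected point brings in the
    opposite ray for the same direction.\<close>
  have "AE x in lborel. x \<in> S \<and> - x \<in> S" using S AE_reflect[OF S] by eventually_elim simp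
  from AE_polar[OF this] AE_ang_norm
  have "AE \<theta> in ang. AE r in lborel. 0 < r \<longrightarrow> max_diff G t (norm (r *\<^sub>R \<theta>)) \<le> M (r *\<^sub>R \<theta>)"
  proof eventually_elim
    case (elim \<theta>)
    have "AE r in lborel. 0 < r \<longrightarrow> r *\<^sub>R \<theta> \<in> S" using elim(1) by eventually_elim simp
    moreover have "AE r in lborel. 0 < r \<longrightarrow> (- r) *\<^sub>R \<theta> \<in> S" using elim(1) by eventually_elim simp
    ultimately have all: "AE r in lborel. r *\<^sub>R \<theta> \<in> S" by (rule AE_real_split)
    have Gn: "G (norm (r *\<^sub>R \<theta>)) = G r" for r using elim even[of r] by (simp add: abs_if)
    from all show ?case
    proof eventually_elim
      case (elim r)
      show ?case
      proof
        assume "0 < r"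
        then have nr: "norm (r *\<^sub>R \<theta>) = r" using \<open>norm \<theta> = 1\<close> by simp
        show "max_diff G t (norm (r *\<^sub>R \<theta>)) \<le> M (r *\<^sub>R \<theta>)"
          unfolding nr max_diff_le_iff[OF assms(1)]
          using AE_translate[OF all, of r]
        proof eventually_elim
          case (elim w)
          show ?case
          proof
            assume w: "\<bar>w\<bar> \<le> t"
            have e: "r *\<^sub>R \<theta> + w *\<^sub>R \<theta> = (r + w) *\<^sub>R \<theta>" by (simp add: scaleR_add_left)
            have "ennreal (norm (G (norm (r *\<^sub>R \<theta> + w *\<^sub>R \<theta>)) - G (norm (r *\<^sub>R \<theta>)))) \<le> M (r *\<^sub>R \<theta>)"
              using \<open>r *\<^sub>R \<theta> \<in> S\<close> elim w \<open>norm \<theta> = 1\<close> by (intro M) (auto simp: e add.commute)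
            then show "ennreal (norm (G (r + w) - G r)) \<le> M (r *\<^sub>R \<theta>)" by (simp only: e Gn)
          qed
        qed
      qed
    qed
  qed
  then show ?thesis using conv unfolding m_def by blast
qed

text \<open>The constant is (2 / A)^(1/P) with A the area of the unit sphere: the integral over the
  line counts both half-lines, the integral over space counts the half-line A times. For p =
  \<infinity> there is no weight and the constant is 1.\<close>

lemma weighted_Lp_norm_radial:
  fixes p :: ennreal
  assumes p: "0 < p"
  shows "\<exists>\<kappa>>0. \<forall>u U. U \<in> borel_measurable borel \<longrightarrow> (\<forall>r. U (- r) = U r) \<longrightarrow> (AE r in lborel. u r = U r) \<longrightarrow>
    weighted_Lp_norm DIM('a) p u = ennreal \<kappa> * Lpe p lborel (\<lambda>x::'a::euclidean_space. U (norm x))"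
  using p
proof (cases p rule: exponent_cases)
  case infinite
  have "esssup lebesgue u = Lpe top lborel (\<lambda>x::'a. U (norm x))"
    if [measurable]: "U \<in> borel_measurable borel" and even: "\<And>r. U (- r) = U r" and eq: "AE r in lborel. u r = U r" for u U
  proof -
    have U: "U \<in> borel_measurable lebesgue" by (intro measurable_completion) simp
    have u: "u \<in> borel_measurable lebesgue"
      by (rule measurable_completion_AE_ennreal[of U]) (use eq in auto)
    have "esssup lebesgue u = esssup lebesgue U" using u U eq by (intro esssup_AE_cong) (auto simp: AE_completion)
    moreover have "esssup lebesgue U \<le> B \<longleftrightarrow> esssup lborel (\<lambda>x::'a. U (norm x)) \<le> B" for B
    proof -
      have "(AE r in lborel. U r \<le> B) \<longleftrightarrow> (AE x in lborel. U (norm (x::'a)) \<le> B)"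
      proof
        assume "AE r in lborel. U r \<le> B"
        then show "AE x in lborel. U (norm (x::'a)) \<le> B" by (intro AE_radial) (auto elim!: eventually_mono)
      next
        assume "AE x in lborel. U (norm (x::'a)) \<le> B"
        from AE_polar[OF this] AE_ang_norm have "AE \<theta> in (ang :: 'a measure). AE r in lborel. 0 < r \<longrightarrow> U r \<le> B"
          by eventually_elim (auto elim!: eventually_mono)
        then have "AE r in lborel. 0 < r \<longrightarrow> U r \<le> B"
          using AE_ang_const[where 'a='a] by blast
        then show "AE r in lborel. U r \<le> B" using AE_real_split[of "\<lambda>r. U r \<le> B"] by (simp add: even)
      qed
      then show ?thesis using U by (simp add: esssup_le_iff AE_completion_iff)
    qed
    ultimately show ?thesis by (simp add: Lpe_infinity) (meson order_antisym order_refl)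
  qed
  then show ?thesis using infinite by (intro exI[of _ 1]) (auto simp: weighted_Lp_norm_def)
next
  case (finite P)
  define A where "A = enn2real (emeasure ang (UNIV :: 'a set))"
  have A: "emeasure ang (UNIV :: 'a set) = ennreal A" "0 < A"
    using ang_finite[of "UNIV :: 'a set"] ang_UNIV_pos[where 'a='a]
    by (auto simp: A_def enn2real_positive_iff)
  have "weighted_Lp_norm DIM('a) p u = ennreal ((2 / A) powr (1 / P)) * Lpe p lborel (\<lambda>x::'a. U (norm x))"
    if [measurable]: "U \<in> borel_measurable borel" and even: "\<And>r. U (- r) = U r" and eq: "AE r in lborel. u r = U r" for u U
  proof -
    define v where "v r = ennreal (\<bar>r\<bar> ^ (DIM('a) - 1)) * epow (U r) P" for r
    have [measurable]: "v \<in> borel_measurable borel" unfolding v_def by measurable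
    define I where "I = (\<integral>\<^sup>+r. v r * indicator {0..} r \<partial>lborel)"
    have "(\<integral>\<^sup>+r. ennreal (\<bar>r\<bar> ^ (DIM('a) - 1)) * epow (u r) P \<partial>lebesgue) = (\<integral>\<^sup>+r. v r \<partial>lborel)"
      unfolding nn_integral_completion by (rule nn_integral_cong_AE) (use eq in \<open>auto simp: v_def elim!: eventually_mono\<close>)
    also have "\<dots> = (\<integral>\<^sup>+r. v r * indicator {0..} r + v r * indicator {..0} r \<partial>lborel)"
      by (rule nn_integral_cong_AE) (use AE_lborel_singleton[of "0::real"] in \<open>auto elim!: eventually_mono simp: indicator_def\<close>)
    also have "\<dots> = I + (\<integral>\<^sup>+r. v r * indicator {..0} r \<partial>lborel)" unfolding I_def by (rule nn_integral_add) auto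
    also have "(\<integral>\<^sup>+r. v r * indicator {..0} r \<partial>lborel) = I"
    proof -
      have "(\<integral>\<^sup>+r. v r * indicator {..0} r \<partial>lborel) = ennreal \<bar>-1\<bar> * (\<integral>\<^sup>+r. v (0 + (-1) * r) * indicator {..0} (0 + (-1) * r) \<partial>lborel)"
        by (rule nn_integral_real_affine) auto
      then show ?thesis unfolding I_def by (simp add: v_def even indicator_def)
    qed
    finally have II: "(\<integral>\<^sup>+r. ennreal (\<bar>r\<bar> ^ (DIM('a) - 1)) * epow (u r) P \<partial>lebesgue) = I + I" .
    have "(\<integral>\<^sup>+x. epow (U (norm (x::'a))) P \<partial>lborel) = ennreal A * I"
    proof -
      have "ennreal (r ^ (DIM('a) - 1)) * indicator {0..} r * epow (U r) P = v r * indicator {0..} r" for r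
        by (cases "0 \<le> r") (auto simp: v_def)
      then show ?thesis unfolding I_def A(1)[symmetric] by (subst nn_integral_radial[of "\<lambda>r. epow (U r) P"]) auto
    qed
    then have "ennreal (2 / A) * (\<integral>\<^sup>+x. epow (U (norm (x::'a))) P \<partial>lborel) = ennreal (2 / A * A) * I"
      using A(2) by (simp add: ennreal_mult mult.assoc del: times_divide_eq_left)
    also have "2 / A * A = 2" using A(2) by simp
    also have "ennreal 2 * I = I + I" by (simp only: ennreal_numeral mult_2)
    finally have "(\<integral>\<^sup>+r. ennreal (\<bar>r\<bar> ^ (DIM('a) - 1)) * epow (u r) P \<partial>lebesgue) = ennreal (2 / A) * (\<integral>\<^sup>+x. epow (U (norm (x::'a))) P \<partial>lborel)"
      by (simp only: II)
    then show ?thesis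
      using finite A(2) by (simp add: weighted_Lp_norm_def Lpe_real epow_mult epow_ennreal)
  qed
  then show ?thesis using A(2) by (intro exI[of _ "(2 / A) powr (1 / P)"]) auto
qed

subsection \<open>Functions in $L_p$ as tempered distributions\<close>

text \<open>For finite P use a \<le> 1 + a^P and a weight that is integrable and at most 1; for p =
  \<infinity> the function is essentially bounded.\<close>

lemma Lpe_wt_finite:
  fixes u :: "'a::euclidean_space \<Rightarrow> ennreal"
  assumes p: "1 \<le> p" and [measurable]: "u \<in> borel_measurable borel" and fin: "Lpe p lborel u < \<infinity>"
  shows "(\<integral>\<^sup>+x. u x * ennreal (wt (2 * DIM('a)) x) \<partial>lborel) < \<infinity>"
proof -
  have p0: "0 < p" using p by (rule less_le_trans[rotated]) simp
  from p0 show ?thesis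
  proof (cases p rule: exponent_cases)
    case infinite
    have "AE x in lborel. u x \<le> Lpe p lborel u" unfolding infinite Lpe_def by (simp add: esssup_AE)
    then have "(\<integral>\<^sup>+x. u x * ennreal (wt (2 * DIM('a)) x) \<partial>lborel) \<le> (\<integral>\<^sup>+x. Lpe p lborel u * ennreal (wt (2 * DIM('a)) (x::'a)) \<partial>lborel)"
      by (intro nn_integral_mono_AE) (auto elim!: eventually_mono intro!: mult_right_mono)
    also have "\<dots> = Lpe p lborel u * ennreal (wt_mass TYPE('a))" by (simp add: nn_integral_cmult nn_integral_wt)
    also have "\<dots> < \<infinity>" using fin by (simp add: ennreal_mult_less_top)
    finally show ?thesis .
  next
    case (finite P)
    have P: "1 \<le> P" using p finite by simp
    have le: "a \<le> 1 + epow a P" for a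
    proof (cases a)
      case (real r)
      have "r \<le> 1 + r powr P"
      proof (cases "1 \<le> r")
        case True
        then have "r powr 1 \<le> r powr P" using P by (intro powr_mono) auto
        then show ?thesis using True by simp
      next
        case False
        then show ?thesis using powr_ge_zero[of r P] by linarith
      qed
      then have "ennreal r \<le> ennreal (1 + r powr P)" by (rule ennreal_leI)
      then show ?thesis using real by (simp add: epow_ennreal)
    qed auto
    have "(\<integral>\<^sup>+x. u x * ennreal (wt (2 * DIM('a)) x) \<partial>lborel) \<le> (\<integral>\<^sup>+x. ennreal (wt (2 * DIM('a)) x) + epow (u x) P \<partial>lborel)"
    proof (rule nn_integral_mono)
      fix x :: 'a
      have w1: "ennreal (wt (2 * DIM('a)) x) \<le> 1" using wt_le_1[of "2 * DIM('a)" x] by simp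
      have "u x * ennreal (wt (2 * DIM('a)) x) \<le> (1 + epow (u x) P) * ennreal (wt (2 * DIM('a)) x)"
        by (intro mult_right_mono le) auto
      also have "\<dots> = ennreal (wt (2 * DIM('a)) x) + epow (u x) P * ennreal (wt (2 * DIM('a)) x)" by (simp add: distrib_right)
      also have "\<dots> \<le> ennreal (wt (2 * DIM('a)) x) + epow (u x) P * 1" using w1 by (intro add_left_mono mult_left_mono) auto
      finally show "u x * ennreal (wt (2 * DIM('a)) x) \<le> ennreal (wt (2 * DIM('a)) x) + epow (u x) P" by simp
    qed
    also have "\<dots> = ennreal (wt_mass TYPE('a)) + (\<integral>\<^sup>+x. epow (u x) P \<partial>lborel)"
      by (subst nn_integral_add) (auto simp: nn_integral_wt)
    also have "\<dots> < \<infinity>"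
    proof -
      have "(\<integral>\<^sup>+x. epow (u x) P \<partial>lborel) \<le> epow (Lpe p lborel u) P"
        using finite Lpe_real_le_iff[of P lborel u "Lpe p lborel u"] by simp
      moreover have "epow (Lpe p lborel u) P < top" using fin by (auto simp: epow_def less_top)
      ultimately have "(\<integral>\<^sup>+x. epow (u x) P \<partial>lborel) < top" by (rule le_less_trans)
      then show ?thesis by simp
    qed
    finally show ?thesis .
  qed
qed

lemma Lp_wint:
  fixes f :: "'a::euclidean_space \<Rightarrow> complex"
  assumes p: "1 \<le> p" and [measurable]: "f \<in> borel_measurable borel" and fin: "Lpe p lborel (\<lambda>x. ennreal (norm (f x))) < \<infinity>"
  shows "wint f"
  unfolding wint_def
proof (intro conjI exI)
  show "integrable lborel (\<lambda>x. norm (f x) * wt (2 * DIM('a)) x)"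
    using Lpe_wt_finite[OF p _ fin] by (simp add: integrable_iff_bounded abs_mult ennreal_mult)
qed simp

lemma regular_dist_cong_AE:
  assumes "AE x in lborel. f x = F x"
  shows "regular_dist f = regular_dist F"
proof
  fix u :: "'a \<Rightarrow> complex"
  have eq: "AE x in lebesgue. f x * u x = F x * u x" "AE x in lebesgue. F x * u x = f x * u x"
    using assms by (auto simp: AE_completion_iff elim!: eventually_mono)
  show "regular_dist f u = regular_dist F u"
  proof (cases "(\<lambda>x. f x * u x) \<in> borel_measurable lebesgue")
    case True
    with borel_measurable_AE[OF this eq(1)] eq(1) show ?thesis unfolding regular_dist_def by (intro integral_cong_AE)
  next
    \<comment> \<open>If one of the products is not measurable then neither is the other, and both
      integrals take their default value 0.\<close>
    case False
    with borel_measurable_AE[OF _ eq(2)] have "(\<lambda>x. F x * u x) \<notin> borel_measurable lebesgue" by blast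
    with False have "\<not> integrable lebesgue (\<lambda>x. f x * u x)" "\<not> integrable lebesgue (\<lambda>x. F x * u x)" by auto
    then show ?thesis by (simp add: regular_dist_def not_integrable_integral_eq)
  qed
qed

lemma wint_represents:
  assumes F: "wint F" and f: "f \<in> borel_measurable lebesgue" and eq: "AE x in lborel. f x = F x"
  shows "represents f (regular_dist f)"
  unfolding represents_def
proof (intro allI impI conjI refl)
  fix u :: "'a \<Rightarrow> complex" assume u: "schwartz u"
  have "integrable lborel (\<lambda>x. F x * u x)" by (intro wint_mult_rapid_integrable F rapid_schwartz u)
  moreover have [measurable]: "F \<in> borel_measurable borel" "u \<in> borel_measurable borel"
    using F u by (auto simp: wint_def schwartz_measurable)
  ultimately have i: "integrable lebesgue (\<lambda>x. F x * u x)" by (subst integrable_completion) auto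
  have "AE x in lebesgue. F x * u x = f x * u x" using eq by (auto simp: AE_completion_iff elim!: eventually_mono)
  moreover have "(\<lambda>x. f x * u x) \<in> borel_measurable lebesgue"
    using f by (intro borel_measurable_times) (auto intro: measurable_completion)
  ultimately show "integrable lebesgue (\<lambda>x. f x * u x)"
    using i by (subst integrable_cong_AE[of _ _ "\<lambda>x. F x * u x"]) auto
qed

text \<open>A single seminorm, with the weight exponent of F and without derivatives, bounds the
  functional.\<close>

lemma wint_tempered:
  fixes F :: "'a::euclidean_space \<Rightarrow> complex"
  assumes F: "wint F" shows "tempered_distribution (regular_dist F)"
proof -
  have [measurable]: "F \<in> borel_measurable borel" using F by (simp add: wint_def)
  have eq: "regular_dist F u = (LINT x|lborel. F x * u x)" if "schwartz u" for u
    unfolding regular_dist_def using schwartz_measurable[OF that] by (intro integral_lebesgue_eq) measurable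
  have int: "integrable lborel (\<lambda>x. F x * u x)" if "schwartz u" for u
    by (intro wint_mult_rapid_integrable F rapid_schwartz that)
  obtain N where N: "integrable lborel (\<lambda>x. norm (F x) * wt N x)" using F by (auto simp: wint_def)
  define K where "K = (LINT x|lborel. norm (F x) * wt N x)"
  have bound: "norm (regular_dist F u) \<le> K * schwartz_seminorm N [] u" if u: "schwartz u" for u
  proof -
    have "bdd_above (range (\<lambda>x. (1 + norm x) ^ N * norm (iter_deriv [] u x)))"
      using u unfolding schwartz_def by (metis empty_subsetI list.set(1))
    then have "(1 + norm x) ^ N * norm (u x) \<le> schwartz_seminorm N [] u" for x
      unfolding schwartz_seminorm_def using cSUP_upper[of x UNIV "\<lambda>x. (1 + norm x) ^ N * norm (iter_deriv [] u x)"] by simp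
    then have b: "norm (u x) \<le> schwartz_seminorm N [] u * wt N x" for x by (simp add: wt_eq_inverse)
    have "norm (regular_dist F u) \<le> (LINT x|lborel. norm (F x * u x))"
      unfolding eq[OF u] by (rule integral_norm_bound)
    also have "\<dots> \<le> (LINT x|lborel. schwartz_seminorm N [] u * (norm (F x) * wt N x))"
    proof (rule integral_mono)
      show "norm (F x * u x) \<le> schwartz_seminorm N [] u * (norm (F x) * wt N x)" for x
        using mult_left_mono[OF b[of x], of "norm (F x)"] by (simp add: norm_mult mult_ac)
    qed (use int[OF u] N in auto)
    finally show ?thesis by (simp add: K_def mult.commute)
  qed
  show ?thesis unfolding tempered_distribution_def
  proof (intro conjI allI impI)
    fix u v :: "'a \<Rightarrow> complex" assume u: "schwartz u" and v: "schwartz v"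
    have [measurable]: "u \<in> borel_measurable borel" "v \<in> borel_measurable borel" using u v by (auto simp: schwartz_measurable)
    have "regular_dist F (\<lambda>x. u x + v x) = (LINT x|lborel. F x * (u x + v x))"
      unfolding regular_dist_def by (rule integral_lebesgue_eq) measurable
    then show "regular_dist F (\<lambda>x. u x + v x) = regular_dist F u + regular_dist F v"
      using int[OF u] int[OF v] by (simp add: eq u v distrib_left)
  next
    fix c and u :: "'a \<Rightarrow> complex"
    show "regular_dist F (\<lambda>x. c * u x) = c * regular_dist F u"
      unfolding regular_dist_def by (simp only: mult.left_commute[of _ c] integral_mult_right_zero)
  next
    fix u :: "nat \<Rightarrow> 'a \<Rightarrow> complex"
    assume u: "\<forall>n. schwartz (u n)" and lim: "\<forall>k bs. set bs \<subseteq> Basis \<longrightarrow> (\<lambda>n. schwartz_seminorm k bs (u n)) \<longlonglongrightarrow> 0"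
    have "(\<lambda>n. schwartz_seminorm N [] (u n)) \<longlonglongrightarrow> 0" using lim by simp
    then have l: "(\<lambda>n. K * schwartz_seminorm N [] (u n)) \<longlonglongrightarrow> 0" using tendsto_mult_right_zero by blast
    show "(\<lambda>n. regular_dist F (u n)) \<longlonglongrightarrow> 0"
      by (rule Lim_null_comparison[OF always_eventually l]) (use bound u in blast)
  qed
qed

context resolution_of_unity
begin

subsection \<open>Increments of a function from its Littlewood--Paley pieces\<close>

text \<open>Since s > 0 the norms of the pieces are summable, so the series converges absolutely
  almost everywhere and its sum of absolute values lies in L_p. This is the domination that
  \<open>conv_kern_limit\<close> asks for.\<close>

lemma LP_series_limit:
  assumes p: "1 \<le> p" and s: "0 < s"
  shows "\<exists>C>0. \<forall>f B. wint f \<longrightarrow> (\<forall>j. ennreal (2 powr (real j * s)) * piece_norm p j f \<le> B) \<longrightarrow> B < \<infinity> \<longrightarrow>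
    (AE y in lborel. (\<lambda>J. conv (kern J) f y) \<longlonglongrightarrow> f y) \<and> Lpe p lborel (\<lambda>x. ennreal (norm (f x))) \<le> ennreal C * B"
proof -
  have p0: "0 < p" using p by (rule less_le_trans[rotated]) simp
  define C where "C = 2 / (1 - 2 powr - s)"
  have C: "0 < C" using s by (auto simp: C_def powr_less_one)
  have geo: "(\<Sum>j. ennreal (2 powr (- s * real j))) \<le> ennreal C"
    using sum_geometric_dist_le[OF s, of 0] by (simp add: C_def)
  have "(AE y in lborel. (\<lambda>J. conv (kern J) f y) \<longlonglongrightarrow> f y) \<and> Lpe p lborel (\<lambda>x. ennreal (norm (f x))) \<le> ennreal C * B"
    if f: "wint f" and N: "\<And>j. ennreal (2 powr (real j * s)) * piece_norm p j f \<le> B" and B: "B < \<infinity>" for f B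
  proof -
    have [measurable]: "f \<in> borel_measurable borel" using f by (simp add: wint_def)
    note [measurable] = measurable_conv_dkern[OF f]
    define H where "H x = (\<Sum>j. ennreal (norm (conv (dkern j) f x)))" for x
    have [measurable]: "H \<in> borel_measurable borel" unfolding H_def by measurable
    have "Lpe p lborel H \<le> B * (\<Sum>j. ennreal (2 powr (- s * real j)))"
      unfolding H_def
    proof (rule Lpe_suminf_le)
      fix j
      have "ennreal (2 powr (- s * real j)) * (ennreal (2 powr (real j * s)) * piece_norm p j f) \<le> ennreal (2 powr (- s * real j)) * B"
        by (intro mult_left_mono N) auto
      then show "Lpe p lborel (\<lambda>x. ennreal (norm (conv (dkern j) f x))) \<le> B * ennreal (2 powr (- s * real j))"
        by (simp add: piece_norm_def mult.assoc[symmetric] ennreal_mult[symmetric] powr_add[symmetric] mult.commute)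
    qed (use p geo in \<open>auto simp: lborel.sigma_finite_measure_axioms intro: le_less_trans\<close>)
    also have "\<dots> \<le> B * ennreal C" by (intro mult_left_mono geo) auto
    finally have HL: "Lpe p lborel H \<le> ennreal C * B" by (simp add: mult.commute)
    also have "\<dots> < \<infinity>" using B by (simp add: ennreal_mult_less_top)
    finally have fin: "(\<integral>\<^sup>+x. H x * ennreal (wt (2 * DIM('a)) x) \<partial>lborel) < \<infinity>" by (intro Lpe_wt_finite[OF p]) auto
    then have "AE x in lborel. H x * ennreal (wt (2 * DIM('a)) x) \<noteq> \<infinity>" by (intro nn_integral_PInf_AE) auto
    then have Hfin: "AE x in lborel. H x < top"
      by eventually_elim (auto simp: ennreal_mult_eq_top_iff ennreal_eq_0_iff not_le less_top)
    \<comment> \<open>A real-valued version of the majorant, equal to H where H is finite, that is,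
      almost everywhere.\<close>
    define G where "G x = enn2real (H x)" for x
    have [measurable]: "G \<in> borel_measurable borel" unfolding G_def by measurable
    have Gi: "integrable lborel (\<lambda>x. G x * wt (2 * DIM('a)) x)"
    proof -
      have "(\<integral>\<^sup>+x. ennreal (norm (G x * wt (2 * DIM('a)) x)) \<partial>lborel) = (\<integral>\<^sup>+x. H x * ennreal (wt (2 * DIM('a)) x) \<partial>lborel)"
        by (rule nn_integral_cong_AE) (use Hfin in \<open>auto elim!: eventually_mono simp: G_def abs_mult ennreal_mult\<close>)
      then show ?thesis using fin by (simp add: integrable_iff_bounded)
    qed
    have part: "AE y in lborel. summable (\<lambda>j. norm (conv (dkern j) f y)) \<and> (\<forall>J. norm (conv (kern J) f y) \<le> G y)"
      using Hfin
    proof eventually_elim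
      case (elim y)
      then have sm: "summable (\<lambda>j. norm (conv (dkern j) f y))"
        unfolding H_def less_top[symmetric] by (rule summable_suminf_not_top[OF norm_ge_zero])
      have Hs: "G y = (\<Sum>j. norm (conv (dkern j) f y))"
        unfolding G_def H_def using sm by (simp add: suminf_ennreal2 suminf_nonneg)
      have "norm (conv (kern J) f y) \<le> G y" for J
      proof -
        have "norm (conv (kern J) f y) \<le> (\<Sum>j\<le>J. norm (conv (dkern j) f y))"
          unfolding sum_conv_dkern[OF f, symmetric] by (rule norm_sum)
        also have "\<dots> \<le> G y" unfolding Hs by (rule sum_le_suminf[OF sm]) auto
        finally show ?thesis .
      qed
      with sm show ?case by simp
    qed
    have "AE y in lborel. (\<lambda>J. conv (kern J) f y) \<longlonglongrightarrow> f y"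
    proof (rule conv_kern_limit[OF f _ Gi])
      show "AE y in lborel. \<forall>J. norm (conv (kern J) f y) \<le> G y" using part by eventually_elim simp
      show "AE y in lborel. convergent (\<lambda>J. conv (kern J) f y)"
        using part
      proof eventually_elim
        case (elim y)
        then have "summable (\<lambda>j. conv (dkern j) f y)" by (auto intro: summable_norm_cancel)
        then have "(\<lambda>J. \<Sum>j\<le>J. conv (dkern j) f y) \<longlonglongrightarrow> (\<Sum>j. conv (dkern j) f y)" by (rule summable_LIMSEQ')
        then show ?case unfolding sum_conv_dkern[OF f] by (rule convergentI)
      qed
    qed simp
    note lim = this
    have "AE y in lborel. ennreal (norm (f y)) \<le> H y"
      using lim part Hfin
    proof eventually_elim
      case (elim y)
      then have "norm (f y) \<le> G y" by (auto intro: LIMSEQ_le_const2[OF tendsto_norm])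
      then have "ennreal (norm (f y)) \<le> ennreal (G y)" by (rule ennreal_leI)
      then show ?case using elim by (simp add: G_def)
    qed
    then have "Lpe p lborel (\<lambda>x. ennreal (norm (f x))) \<le> Lpe p lborel H" by (intro Lpe_mono_AE p0) auto
    with lim HL show ?thesis by auto
  qed
  then show ?thesis using C by (intro exI[of _ C]) blast
qed

text \<open>The hypothesis holds a reserve 2^(e|j-m|) over the increment bound of each piece, and
  the reserve makes the sum over j geometric. S is the set where the series converges to f, so that
  the bound passes to the limit at both x and x + h.\<close>

lemma function_increment:
  assumes p: "1 \<le> p" and e: "0 < e"
  shows "\<exists>C>0. \<forall>f m B. wint f \<longrightarrow> (AE y in lborel. (\<lambda>J. conv (kern J) f y) \<longlonglongrightarrow> f y) \<longrightarrow>
    (\<forall>j. ennreal ((if j \<le> m then 2 powr (real j - real m) else 2 powr ((real j - real m) * (DIM('a) / enn2real p)))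
        * 2 powr (e * \<bar>real j - real m\<bar>)) * piece_norm p j f \<le> B) \<longrightarrow>
    (\<exists>M\<in>borel_measurable borel. \<exists>S. (AE x in lborel. x \<in> S) \<and>
      (\<forall>x h. x \<in> S \<longrightarrow> x + h \<in> S \<longrightarrow> norm h \<le> 1 / 2 ^ m \<longrightarrow> ennreal (norm (f (x + h) - f x)) \<le> M x) \<and>
      Lpe p lborel M \<le> ennreal C * B)"
proof -
  have p0: "0 < p" using p by (rule less_le_trans[rotated]) simp
  define \<beta> where "\<beta> j m = (if j \<le> m then 2 powr (real j - real m) else 2 powr ((real j - real m) * (DIM('a) / enn2real p)))" for j m :: nat
  have \<beta>: "0 < \<beta> j m" for j m by (simp add: \<beta>_def)
  obtain C where C: "0 < C" and inc: "\<And>f j m. wint f \<Longrightarrow> (\<exists>M\<in>borel_measurable borel.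
    (\<forall>x h. norm h \<le> 1 / 2 ^ m \<longrightarrow> ennreal (norm (conv (dkern j) f (x + h) - conv (dkern j) f x)) \<le> M x) \<and>
    Lpe p lborel M \<le> ennreal (C * \<beta> j m) * piece_norm p j f)"
    using piece_increment[OF p] unfolding \<beta>_def by blast
  define D where "D = 2 / (1 - 2 powr - e)"
  have D: "0 < D" using e by (auto simp: D_def powr_less_one)
  have geo: "(\<Sum>j. ennreal (2 powr (- e * \<bar>real j - real m\<bar>))) \<le> ennreal D" for m
    using sum_geometric_dist_le[OF e, of m] by (simp add: D_def)
  have "\<exists>M\<in>borel_measurable borel. \<exists>S. (AE x in lborel. x \<in> S) \<and>
      (\<forall>x h. x \<in> S \<longrightarrow> x + h \<in> S \<longrightarrow> norm h \<le> 1 / 2 ^ m \<longrightarrow> ennreal (norm (f (x + h) - f x)) \<le> M x) \<and>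
      Lpe p lborel M \<le> ennreal (C * D) * B"
    if f: "wint f" and lim: "AE y in lborel. (\<lambda>J. conv (kern J) f y) \<longlonglongrightarrow> f y"
      and B: "\<And>j. ennreal (\<beta> j m * 2 powr (e * \<bar>real j - real m\<bar>)) * piece_norm p j f \<le> B" for f m B
  proof -
    have "\<forall>j. \<exists>M. M \<in> borel_measurable borel \<and>
      (\<forall>x h. norm h \<le> 1 / 2 ^ m \<longrightarrow> ennreal (norm (conv (dkern j) f (x + h) - conv (dkern j) f x)) \<le> M x) \<and>
      Lpe p lborel M \<le> ennreal (C * \<beta> j m) * piece_norm p j f"
      using inc[OF f] by blast
    from choice[OF this] obtain M where M: "\<forall>j. M j \<in> borel_measurable borel \<and>
      (\<forall>x h. norm h \<le> 1 / 2 ^ m \<longrightarrow> ennreal (norm (conv (dkern j) f (x + h) - conv (dkern j) f x)) \<le> M j x) \<and>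
      Lpe p lborel (M j) \<le> ennreal (C * \<beta> j m) * piece_norm p j f"
      by blast
    then have [measurable]: "M j \<in> borel_measurable borel" for j by blast
    have Mp: "ennreal (norm (conv (dkern j) f (x + h) - conv (dkern j) f x)) \<le> M j x" if "norm h \<le> 1 / 2 ^ m" for j x h using M that by blast
    have Mle: "Lpe p lborel (M j) \<le> ennreal (C * \<beta> j m) * piece_norm p j f" for j using M by blast
    define MM where "MM x = (\<Sum>j. M j x)" for x
    have [measurable]: "MM \<in> borel_measurable borel" unfolding MM_def by measurable
    define S where "S = {y. (\<lambda>J. conv (kern J) f y) \<longlonglongrightarrow> f y}"
    have "ennreal (norm (f (x + h) - f x)) \<le> MM x" if x: "x \<in> S" "x + h \<in> S" and h: "norm h \<le> 1 / 2 ^ m" for x h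
    proof -
      have "(\<lambda>J. norm (conv (kern J) f (x + h) - conv (kern J) f x)) \<longlonglongrightarrow> norm (f (x + h) - f x)"
        using x by (intro tendsto_intros) (auto simp: S_def)
      then have l: "(\<lambda>J. ennreal (norm (conv (kern J) f (x + h) - conv (kern J) f x))) \<longlonglongrightarrow> ennreal (norm (f (x + h) - f x))"
        by (rule tendsto_ennrealI)
      have "ennreal (norm (conv (kern J) f (x + h) - conv (kern J) f x)) \<le> MM x" for J
      proof -
        have "norm (conv (kern J) f (x + h) - conv (kern J) f x) \<le> (\<Sum>j\<le>J. norm (conv (dkern j) f (x + h) - conv (dkern j) f x))"
          unfolding sum_conv_dkern[OF f, symmetric] sum_subtractf[symmetric] by (rule norm_sum)
        then have "ennreal (norm (conv (kern J) f (x + h) - conv (kern J) f x)) \<le> (\<Sum>j\<le>J. ennreal (norm (conv (dkern j) f (x + h) - conv (dkern j) f x)))"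
          by (simp add: sum_ennreal ennreal_leI)
        also have "\<dots> \<le> (\<Sum>j\<le>J. M j x)" by (intro sum_mono Mp h)
        also have "\<dots> \<le> MM x" unfolding MM_def by (rule sum_le_suminf) auto
        finally show ?thesis .
      qed
      then show ?thesis by (intro LIMSEQ_le_const2[OF l]) auto
    qed
    moreover have "AE x in lborel. x \<in> S" using lim by (simp add: S_def)
    moreover have "Lpe p lborel MM \<le> ennreal (C * D) * B"
    proof -
      have "Lpe p lborel MM \<le> ennreal C * B * (\<Sum>j. ennreal (2 powr (- e * \<bar>real j - real m\<bar>)))"
        unfolding MM_def
      proof (rule Lpe_suminf_le)
        fix j
        let ?t = "2 powr (e * \<bar>real j - real m\<bar>)"
        have t: "2 powr (- e * \<bar>real j - real m\<bar>) = 1 / ?t" by (simp add: powr_minus_divide)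
        have "Lpe p lborel (M j) \<le> ennreal (C * \<beta> j m) * piece_norm p j f" by (rule Mle)
        also have "C * \<beta> j m = C * (1 / ?t) * (\<beta> j m * ?t)" by simp
        also have "ennreal (C * (1 / ?t) * (\<beta> j m * ?t)) * piece_norm p j f = ennreal (C * (1 / ?t)) * (ennreal (\<beta> j m * ?t) * piece_norm p j f)"
          using C \<beta>[of j m] by (subst ennreal_mult) (auto simp: mult.assoc)
        also have "\<dots> \<le> ennreal (C * (1 / ?t)) * B" by (intro mult_left_mono B) auto
        also have "ennreal (C * (1 / ?t)) = ennreal C * ennreal (1 / ?t)" using C by (intro ennreal_mult) auto
        finally show "Lpe p lborel (M j) \<le> ennreal C * B * ennreal (2 powr (- e * \<bar>real j - real m\<bar>))"
          by (simp only: t mult_ac)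
      qed (use p geo[of m] in \<open>auto simp: lborel.sigma_finite_measure_axioms intro: le_less_trans\<close>)
      also have "\<dots> \<le> ennreal C * B * ennreal D" by (intro mult_left_mono geo) auto
      also have "\<dots> = ennreal (C * D) * B" using C D by (simp add: ennreal_mult mult_ac)
      finally show ?thesis .
    qed
    ultimately show ?thesis by (intro bexI[of _ MM] exI[of _ S]) auto
  qed
  note main = this
  show ?thesis
  proof (intro exI[of _ "C * D"] conjI allI impI)
    show "0 < C * D" using C D by simp
  qed (rule main, auto simp: \<beta>_def)
qed

end

subsection \<open>Discretisation of the seminorm\<close>

text \<open>The shape of \<open>trace_seminorm\<close> with the bracket replaced by a function W of
  the scale. Discretisation rests on monotonicity of W, which also supplies measurability in
  t.\<close>

definition osc_norm :: "real \<Rightarrow> ennreal \<Rightarrow> (real \<Rightarrow> ennreal) \<Rightarrow> ennreal" where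
  "osc_norm s q W = (if q = \<infinity> then esssup (lebesgue_on {0<..<1}) (\<lambda>t. ennreal (t powr (- s)) * W t)
     else epow (\<integral>\<^sup>+t\<in>{0<..<1}. ennreal (t powr (- s * enn2real q)) * epow (W t) (enn2real q) * ennreal (1 / t) \<partial>lebesgue)
          (1 / enn2real q))"

lemma dyadic_cover:
  assumes "0 < t" "t < (1::real)" shows "\<exists>m. 1 / 2 ^ Suc m \<le> t \<and> t < 1 / 2 ^ m"
proof -
  obtain n where n: "(1 / 2) ^ n < t" using real_arch_pow_inv[of t "1 / 2"] assms by auto
  have ex: "\<exists>n. 1 / 2 ^ n \<le> t" using n by (auto simp: power_divide intro!: exI[of _ n])
  define k where "k = (LEAST n. 1 / 2 ^ n \<le> t)"
  have k: "1 / 2 ^ k \<le> t" unfolding k_def by (rule LeastI_ex[OF ex])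
  have "k \<noteq> 0" using k assms by (cases k) auto
  then obtain m where m: "k = Suc m" by (cases k) auto
  have "\<not> 1 / 2 ^ m \<le> t" using not_less_Least[of m "\<lambda>n. 1 / 2 ^ n \<le> t"] m by (simp add: k_def)
  with k m show ?thesis by (intro exI[of _ m]) auto
qed

lemma powr_half_power: "(1 / 2 ^ m) powr a = 2 powr (- a * real m)"
  by (simp add: powr_divide powr_realpow[symmetric] powr_powr powr_minus_divide mult.commute)

lemma mono_measurable_ennreal:
  fixes W :: "real \<Rightarrow> ennreal"
  assumes "mono W" shows "W \<in> borel_measurable borel"
proof (rule borel_measurableI_greater)
  fix y
  have "is_interval {x. y < W x}"
    using assms unfolding is_interval_1 mono_def by (auto intro: less_le_trans)
  then show "{x \<in> space borel. y < W x} \<in> sets borel" by (simp add: real_interval_borel_measurable)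
qed

text \<open>On [2^(-m-1), 2^(-m)) the weighted W is at most a multiple of its value at the right
  end, and dt/t gives this interval mass of order 1. The factor 2^(1/q), which is 1 for q =
  \<infinity> because \<open>1 / enn2real q\<close> is then 0, makes the constant the same as in the
  converse.\<close>

lemma osc_norm_le_lq:
  assumes q: "0 < q" and s: "0 < s" and W: "mono W"
  shows "osc_norm s q W \<le> ennreal (2 powr s * 2 powr (1 / enn2real q)) * lq q (\<lambda>m. ennreal (2 powr (real m * s)) * W (1 / 2 ^ m))"
  using q
proof (cases q rule: exponent_cases)
  case infinite
  define B where "B = lq top (\<lambda>m. ennreal (2 powr (real m * s)) * W (1 / 2 ^ m))"
  have b: "ennreal (2 powr (real m * s)) * W (1 / 2 ^ m) \<le> B" for m
    using lq_top_le_iff[of "\<lambda>m. ennreal (2 powr (real m * s)) * W (1 / 2 ^ m)" B] by (simp add: B_def)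
  have [measurable]: "W \<in> borel_measurable borel" using W by (rule mono_measurable_ennreal)
  have "esssup (lebesgue_on {0<..<1}) (\<lambda>t. ennreal (t powr (- s)) * W t) \<le> ennreal (2 powr s) * B"
  proof (rule esssup_I)
    show "(\<lambda>t. ennreal (t powr (- s)) * W t) \<in> borel_measurable (lebesgue_on {0<..<1})"
      by (intro measurable_restrict_space1 measurable_completion) measurable
    show "AE t in lebesgue_on {0<..<1}. ennreal (t powr (- s)) * W t \<le> ennreal (2 powr s) * B"
    proof (rule AE_I2)
      fix t :: real assume "t \<in> space (lebesgue_on {0<..<1})"
      then have "0 < t" "t < 1" by auto
      then obtain m where m: "1 / 2 ^ Suc m \<le> t" "t < 1 / 2 ^ m" using dyadic_cover by blast
      have "t powr - s \<le> (1 / 2 ^ Suc m) powr - s" using m s by (intro powr_mono2') auto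
      also have "\<dots> = 2 powr s * 2 powr (real m * s)" by (subst powr_half_power) (simp add: powr_add[symmetric] algebra_simps)
      finally have "ennreal (t powr (- s)) * W t \<le> ennreal (2 powr s * 2 powr (real m * s)) * W (1 / 2 ^ m)"
        using m W by (intro mult_mono ennreal_leI) (auto simp: mono_def)
      also have "\<dots> = ennreal (2 powr s) * (ennreal (2 powr (real m * s)) * W (1 / 2 ^ m))" by (simp add: ennreal_mult mult.assoc)
      also have "\<dots> \<le> ennreal (2 powr s) * B" by (intro mult_left_mono b) auto
      finally show "ennreal (t powr (- s)) * W t \<le> ennreal (2 powr s) * B" .
    qed
  qed
  then show ?thesis using infinite by (simp add: osc_norm_def B_def)
next
  case (finite Q)
  have [measurable]: "W \<in> borel_measurable borel" using W by (rule mono_measurable_ennreal)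
  define a where "a m = epow (ennreal (2 powr (real m * s)) * W (1 / 2 ^ m)) Q" for m
  define I where "I m = {1 / 2 ^ Suc m ..< 1 / 2 ^ m :: real}" for m
  have [measurable]: "I m \<in> sets borel" for m by (simp add: I_def)
  let ?f = "\<lambda>t. ennreal (t powr (- s * Q)) * epow (W t) Q * ennreal (1 / t)"
  \<comment> \<open>The factor 2 * 2^m bounds 1/t and is cancelled by the length 2^(-m-1) of the
    interval.\<close>
  have pt: "?f t \<le> ennreal (2 powr (s * Q) * 2 * 2 ^ m) * a m" if t: "t \<in> I m" for t m
  proof -
    have t': "1 / 2 ^ Suc m \<le> t" "t < 1 / 2 ^ m" using t by (auto simp: I_def)
    have t0: "0 < t" using t'(1) by (rule less_le_trans[rotated]) simp
    have "t powr (- s * Q) \<le> (1 / 2 ^ Suc m) powr (- s * Q)" using t' t0 s finite by (intro powr_mono2') auto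
    also have "\<dots> = 2 powr (s * Q) * 2 powr (real m * s * Q)" by (subst powr_half_power) (simp add: powr_add[symmetric] algebra_simps)
    finally have 1: "t powr (- s * Q) \<le> 2 powr (s * Q) * 2 powr (real m * s * Q)" .
    have 2: "1 / t \<le> 2 * 2 ^ m" using t' t0 by (simp add: field_simps)
    have "?f t = ennreal (t powr (- s * Q)) * ennreal (1 / t) * epow (W t) Q" by (simp only: mult_ac)
    also have "\<dots> \<le> ennreal (2 powr (s * Q) * 2 powr (real m * s * Q)) * ennreal (2 * 2 ^ m) * epow (W (1 / 2 ^ m)) Q"
      using 1 2 t' W finite by (intro mult_mono ennreal_leI epow_mono) (auto simp: mono_def)
    also have "\<dots> = ennreal (2 powr (s * Q) * 2 * 2 ^ m) * a m"
      using finite by (simp add: a_def epow_mult epow_ennreal powr_powr ennreal_mult mult_ac)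
    finally show ?thesis .
  qed
  have "(\<integral>\<^sup>+t\<in>{0<..<1}. ?f t \<partial>lebesgue) = (\<integral>\<^sup>+t. ?f t * indicator {0<..<1} t \<partial>lborel)" by (rule nn_integral_completion)
  also have "\<dots> \<le> (\<integral>\<^sup>+t. (\<Sum>m. ennreal (2 powr (s * Q) * 2 * 2 ^ m) * a m * indicator (I m) t) \<partial>lborel)"
  proof (rule nn_integral_mono)
    fix t :: real
    show "?f t * indicator {0<..<1} t \<le> (\<Sum>m. ennreal (2 powr (s * Q) * 2 * 2 ^ m) * a m * indicator (I m) t)"
    proof (cases "t \<in> {0<..<1}")
      case True
      then obtain m where m: "1 / 2 ^ Suc m \<le> t" "t < 1 / 2 ^ m" using dyadic_cover[of t] by auto
      then have tm: "t \<in> I m" by (simp add: I_def)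
      have "?f t * indicator {0<..<1} t \<le> ennreal (2 powr (s * Q) * 2 * 2 ^ m) * a m * indicator (I m) t"
        using True tm pt[OF tm] by simp
      also have "\<dots> = (\<Sum>m\<in>{m}. ennreal (2 powr (s * Q) * 2 * 2 ^ m) * a m * indicator (I m) t)"
        by (simp only: sum.insert finite.emptyI sum.empty empty_iff not_False_eq_True add_0_right)
      also have "\<dots> \<le> (\<Sum>m. ennreal (2 powr (s * Q) * 2 * 2 ^ m) * a m * indicator (I m) t)"
        by (rule sum_le_suminf) auto
      finally show ?thesis .
    qed simp
  qed
  also have "\<dots> = (\<Sum>m. \<integral>\<^sup>+t. ennreal (2 powr (s * Q) * 2 * 2 ^ m) * a m * indicator (I m) t \<partial>lborel)"
    by (rule nn_integral_suminf) measurable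
  also have "\<dots> = (\<Sum>m. ennreal (2 powr (s * Q)) * a m)"
  proof (rule suminf_cong)
    fix m
    have "emeasure lborel (I m) = ennreal (1 / (2 * 2 ^ m))" unfolding I_def
      by (subst emeasure_lborel_Ico) (auto simp: field_simps)
    then have "(\<integral>\<^sup>+t. ennreal (2 powr (s * Q) * 2 * 2 ^ m) * a m * indicator (I m) t \<partial>lborel) = ennreal (2 powr (s * Q) * 2 * 2 ^ m) * a m * ennreal (1 / (2 * 2 ^ m))"
      by (simp add: nn_integral_cmult)
    also have "\<dots> = (ennreal (2 powr (s * Q) * 2 * 2 ^ m) * ennreal (1 / (2 * 2 ^ m))) * a m" by (simp only: mult_ac)
    also have "ennreal (2 powr (s * Q) * 2 * 2 ^ m) * ennreal (1 / (2 * 2 ^ m)) = ennreal (2 powr (s * Q))"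
      by (subst ennreal_mult[symmetric]) auto
    finally show "(\<integral>\<^sup>+t. ennreal (2 powr (s * Q) * 2 * 2 ^ m) * a m * indicator (I m) t \<partial>lborel) = ennreal (2 powr (s * Q)) * a m" .
  qed
  also have "\<dots> = ennreal (2 powr (s * Q)) * (\<Sum>m. a m)" by (rule ennreal_suminf_cmult)
  also have "\<dots> = epow (ennreal (2 powr s) * lq q (\<lambda>m. ennreal (2 powr (real m * s)) * W (1 / 2 ^ m))) Q"
    using finite by (simp add: epow_mult epow_ennreal powr_powr lq_real a_def)
  finally have "osc_norm s q W \<le> ennreal (2 powr s) * lq q (\<lambda>m. ennreal (2 powr (real m * s)) * W (1 / 2 ^ m))"
    using finite by (simp add: osc_norm_def epow_le_iff)
  also have "\<dots> \<le> ennreal (2 powr s * 2 powr (1 / enn2real q)) * lq q (\<lambda>m. ennreal (2 powr (real m * s)) * W (1 / 2 ^ m))"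
  proof (intro mult_right_mono ennreal_leI)
    have "1 \<le> 2 powr (1 / enn2real q)" using finite by (simp add: ge_one_powr_ge_zero)
    then show "2 powr s \<le> 2 powr s * 2 powr (1 / enn2real q)" by simp
  qed auto
  finally show ?thesis .
qed

text \<open>The m-th term is compared with scales t just above 2^(-m), so the term m = 0 would need
  t > 1 and is set to 0. The factor 2^(1/q) reflects the lower bound 1/2 for the dt/t-mass of a
  dyadic interval.\<close>

lemma lq_le_osc_norm:
  assumes q: "0 < q" and s: "0 < s" and W: "mono W"
  shows "lq q (\<lambda>m. if m = 0 then 0 else ennreal (2 powr (real m * s)) * W (1 / 2 ^ m))
    \<le> ennreal (2 powr s * 2 powr (1 / enn2real q)) * osc_norm s q W"
  using q
proof (cases q rule: exponent_cases)
  case infinite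
  have "ennreal (2 powr (real m * s)) * W (1 / 2 ^ m) \<le> ennreal (2 powr s) * osc_norm s q W" if m: "m \<noteq> 0" for m
  proof -
    obtain i where i: "m = Suc i" using m by (cases m) auto
    have [measurable]: "{1 / 2 ^ m <..< 1 / 2 ^ i :: real} \<in> sets lebesgue" by simp
    have "AE t in lebesgue_on {0<..<1}. ennreal (t powr (- s)) * W t \<le> osc_norm s q W"
      unfolding osc_norm_def using infinite by (simp add: esssup_AE)
    then have ae: "AE t in lborel. t \<in> {0<..<1} \<longrightarrow> ennreal (t powr (- s)) * W t \<le> osc_norm s q W"
      by (simp add: AE_restrict_space_iff AE_completion_iff)
    \<comment> \<open>The a.e. bound is used at one point only: an interval of positive length
      cannot consist of exceptional t.\<close>
    have "\<exists>t. t \<in> {1 / 2 ^ m <..< 1 / 2 ^ i} \<and> (t \<in> {0<..<1} \<longrightarrow> ennreal (t powr (- s)) * W t \<le> osc_norm s q W)"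
    proof (rule ccontr)
      assume "\<not> ?thesis"
      with ae have "AE t in lborel. t \<notin> {1 / 2 ^ m <..< 1 / 2 ^ i :: real}" by (auto elim!: eventually_mono)
      then have "emeasure lborel {1 / 2 ^ m <..< 1 / 2 ^ i :: real} = 0" by (subst (asm) AE_iff_measurable[of "{1 / 2 ^ m <..< 1 / 2 ^ i}"]) auto
      moreover have "1 / 2 ^ m < (1 / 2 ^ i :: real)" by (simp add: i field_simps)
      ultimately show False by (subst (asm) emeasure_lborel_Ioo) auto
    qed
    then obtain t where t: "1 / 2 ^ m < t" "t < 1 / 2 ^ i" and le: "t \<in> {0<..<1} \<longrightarrow> ennreal (t powr (- s)) * W t \<le> osc_norm s q W" by auto
    have t0: "0 < t" using t(1) by (rule less_trans[rotated]) simp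
    have "1 / 2 ^ i \<le> (1::real)" by simp
    with t t0 le have le: "ennreal (t powr (- s)) * W t \<le> osc_norm s q W" by auto
    have "(1 / 2 ^ i) powr - s \<le> t powr - s" using t t0 s by (intro powr_mono2') auto
    then have "2 powr (real i * s) \<le> t powr - s" by (subst (asm) powr_half_power) (simp add: mult.commute)
    then have "2 powr (real m * s) \<le> 2 powr s * t powr - s" by (simp add: i distrib_right powr_add)
    then have "ennreal (2 powr (real m * s)) * W (1 / 2 ^ m) \<le> ennreal (2 powr s * t powr - s) * W t"
      using t W by (intro mult_mono ennreal_leI) (auto simp: mono_def)
    also have "\<dots> = ennreal (2 powr s) * (ennreal (t powr - s) * W t)" by (simp add: ennreal_mult mult.assoc)
    also have "\<dots> \<le> ennreal (2 powr s) * osc_norm s q W" by (intro mult_left_mono le) auto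
    finally show ?thesis .
  qed
  then show ?thesis using infinite by (simp add: lq_top_le_iff)
next
  case (finite Q)
  have [measurable]: "W \<in> borel_measurable borel" using W by (rule mono_measurable_ennreal)
  define a where "a m = epow (ennreal (2 powr (real m * s)) * W (1 / 2 ^ m)) Q" for m
  define I where "I m = {1 / 2 ^ Suc m ..< 1 / 2 ^ m :: real}" for m
  have [measurable]: "I m \<in> sets borel" for m by (simp add: I_def)
  let ?f = "\<lambda>t. ennreal (t powr (- s * Q)) * epow (W t) Q * ennreal (1 / t)"
  have pt: "ennreal (2 ^ m) * a (Suc m) \<le> ennreal (2 powr (s * Q)) * ?f t" if t: "t \<in> I m" for t m
  proof -
    have t': "1 / 2 ^ Suc m \<le> t" "t < 1 / 2 ^ m" using t by (auto simp: I_def)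
    have t0: "0 < t" using t'(1) by (rule less_le_trans[rotated]) simp
    have "(1 / 2 ^ m) powr (- s * Q) \<le> t powr (- s * Q)" using t' t0 s finite by (intro powr_mono2') auto
    then have h1: "2 powr (s * Q) * (1 / 2 ^ m) powr (- s * Q) \<le> 2 powr (s * Q) * t powr (- s * Q)" by (intro mult_left_mono) auto
    have h2: "2 powr (s * Q) * (1 / 2 ^ m) powr (- s * Q) = 2 powr (real (Suc m) * s * Q)"
      by (subst powr_half_power) (simp add: powr_add[symmetric] algebra_simps)
    have 1: "2 powr (real (Suc m) * s * Q) \<le> 2 powr (s * Q) * t powr (- s * Q)" using h1 unfolding h2 .
    have 2: "2 ^ m \<le> 1 / t" using t' t0 by (simp add: field_simps)
    have "ennreal (2 ^ m) * a (Suc m) = ennreal (2 ^ m) * (ennreal (2 powr (real (Suc m) * s * Q)) * epow (W (1 / 2 ^ Suc m)) Q)"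
      using finite by (simp add: a_def epow_mult epow_ennreal powr_powr)
    also have "\<dots> \<le> ennreal (1 / t) * (ennreal (2 powr (s * Q) * t powr (- s * Q)) * epow (W t) Q)"
      using 1 2 t' W finite by (intro mult_mono ennreal_leI epow_mono) (auto simp: mono_def)
    also have "\<dots> = ennreal (2 powr (s * Q)) * ?f t" by (simp add: ennreal_mult mult_ac)
    finally show ?thesis .
  qed
  have disj: "disjoint_family I"
    unfolding disjoint_family_on_def
  proof (intro ballI impI)
    fix m n :: nat assume "m \<noteq> n"
    have "I m \<inter> I n = {}" if "m < n" for m n
    proof -
      have "(2::real) ^ Suc m \<le> 2 ^ n" using that by (intro power_increasing) auto
      then have "1 / 2 ^ n \<le> (1 / 2 ^ Suc m :: real)" by (simp add: frac_le)
      then show ?thesis by (auto simp: I_def)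
    qed
    with \<open>m \<noteq> n\<close> show "I m \<inter> I n = {}" by (metis Int_commute linorder_neqE_nat)
  qed
  have sub: "(\<Union>m. I m) \<subseteq> {0<..<1}"
  proof
    fix t assume "t \<in> (\<Union>m. I m)"
    then obtain m where "1 / 2 ^ Suc m \<le> t" "t < 1 / 2 ^ m" by (auto simp: I_def)
    moreover have "0 < 1 / (2::real) ^ Suc m" "1 / 2 ^ m \<le> (1::real)" by simp_all
    ultimately have "0 < t" "t < 1" by linarith+
    then show "t \<in> {0<..<1}" by simp
  qed
  have "(\<Sum>m. a (Suc m)) = (\<Sum>m. 2 * (\<integral>\<^sup>+t. ennreal (2 ^ m) * a (Suc m) * indicator (I m) t \<partial>lborel))"
  proof (rule suminf_cong)
    fix m
    have "emeasure lborel (I m) = ennreal (1 / (2 * 2 ^ m))" unfolding I_def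
      by (subst emeasure_lborel_Ico) (auto simp: field_simps)
    then have "2 * (\<integral>\<^sup>+t. ennreal (2 ^ m) * a (Suc m) * indicator (I m) t \<partial>lborel) = ennreal 2 * (ennreal (2 ^ m) * a (Suc m) * ennreal (1 / (2 * 2 ^ m)))"
      by (simp add: nn_integral_cmult)
    also have "\<dots> = (ennreal 2 * ennreal (2 ^ m) * ennreal (1 / (2 * 2 ^ m))) * a (Suc m)" by (simp only: mult_ac)
    also have "ennreal 2 * ennreal (2 ^ m) = ennreal (2 * 2 ^ m)" by (rule ennreal_mult[symmetric]) auto
    also have "ennreal (2 * 2 ^ m) * ennreal (1 / (2 * 2 ^ m)) = 1"
      by (subst ennreal_mult[symmetric]) auto
    finally show "a (Suc m) = 2 * (\<integral>\<^sup>+t. ennreal (2 ^ m) * a (Suc m) * indicator (I m) t \<partial>lborel)" by simp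
  qed
  also have "\<dots> = 2 * (\<Sum>m. \<integral>\<^sup>+t. ennreal (2 ^ m) * a (Suc m) * indicator (I m) t \<partial>lborel)" by (rule ennreal_suminf_cmult)
  also have "(\<Sum>m. \<integral>\<^sup>+t. ennreal (2 ^ m) * a (Suc m) * indicator (I m) t \<partial>lborel) \<le> (\<Sum>m. \<integral>\<^sup>+t. ennreal (2 powr (s * Q)) * ?f t * indicator (I m) t \<partial>lborel)"
    using pt by (intro suminf_le nn_integral_mono) (auto simp: indicator_def)
  also have "\<dots> = (\<integral>\<^sup>+t. (\<Sum>m. ennreal (2 powr (s * Q)) * ?f t * indicator (I m) t) \<partial>lborel)"
    by (rule nn_integral_suminf[symmetric]) measurable
  also have "\<dots> \<le> (\<integral>\<^sup>+t. ennreal (2 powr (s * Q)) * (?f t * indicator {0<..<1} t) \<partial>lborel)"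
  proof (rule nn_integral_mono)
    fix t
    have "(\<Sum>m. ennreal (2 powr (s * Q)) * ?f t * indicator (I m) t) = ennreal (2 powr (s * Q)) * ?f t * (\<Sum>m. indicator (I m) t)"
      by (rule ennreal_suminf_cmult)
    also have "(\<Sum>m. indicator (I m) t :: ennreal) = indicator (\<Union>m. I m) t" by (rule suminf_indicator[OF disj])
    also have "\<dots> \<le> indicator {0<..<1} t" by (rule indicator_leI) (use sub in blast)
    finally show "(\<Sum>m. ennreal (2 powr (s * Q)) * ?f t * indicator (I m) t) \<le> ennreal (2 powr (s * Q)) * (?f t * indicator {0<..<1} t)"
      by (simp add: mult.assoc mult_left_mono)
  qed
  also have "\<dots> = ennreal (2 powr (s * Q)) * (\<integral>\<^sup>+t. ?f t * indicator {0<..<1} t \<partial>lborel)" by (rule nn_integral_cmult) measurable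
  also have "(\<integral>\<^sup>+t. ?f t * indicator {0<..<1} t \<partial>lborel) = epow (osc_norm s q W) Q"
    using finite by (simp add: osc_norm_def nn_integral_completion)
  finally have le: "(\<Sum>m. a (Suc m)) \<le> 2 * (ennreal (2 powr (s * Q)) * epow (osc_norm s q W) Q)" by (simp add: mult_left_mono)
  have "(\<Sum>m. epow (if m = 0 then 0 else ennreal (2 powr (real m * s)) * W (1 / 2 ^ m)) Q) = (\<Sum>m. (if m = 0 then 0 else a m))"
    by (intro suminf_cong) (simp add: a_def)
  also have "\<dots> = (\<Sum>m. a (Suc m))"
    using suminf_offset[of "\<lambda>m. if m = 0 then 0 else a m" 1] by simp
  also note le
  also have "2 * (ennreal (2 powr (s * Q)) * epow (osc_norm s q W) Q) = epow (ennreal (2 powr s * 2 powr (1 / enn2real q)) * osc_norm s q W) Q"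
    using finite by (simp add: epow_mult epow_ennreal powr_mult powr_powr ennreal_mult mult_ac)
  finally show ?thesis using finite by (simp add: lq_real_le_iff)
qed

text \<open>Separates the term of the unit scale, which is controlled by the norm of the function
  and not by the seminorm. The constant comes from x^q + y^q \<le> 2 (x + y)^q.\<close>

lemma lq_split:
  assumes q: "0 < q"
  shows "lq q b \<le> ennreal (2 powr (1 / enn2real q)) * (b 0 + lq q (\<lambda>m. if m = 0 then 0 else b m))"
  using q
proof (cases q rule: exponent_cases)
  case infinite
  define r where "r = lq top (\<lambda>m. if m = 0 then 0 else b m)"
  have r: "(if m = 0 then 0 else b m) \<le> r" for m
    using lq_top_le_iff[of "\<lambda>m. if m = 0 then 0 else b m" r] unfolding r_def by blast
  have "b m \<le> b 0 + r" for m
  proof (cases "m = 0")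
    case False
    then have "b m \<le> r" using r[of m] by simp
    then show ?thesis by (rule add_increasing[rotated]) simp
  qed (simp add: add_increasing2)
  then show ?thesis using infinite unfolding r_def by (simp add: lq_top_le_iff)
next
  case (finite Q)
  let ?r = "lq q (\<lambda>m. if m = 0 then 0 else b m)"
  have e0: "(\<Sum>m. epow (if m = 0 then 0 else b m) Q) = (\<Sum>m. epow (b (Suc m)) Q)"
    using suminf_offset[of "\<lambda>m. epow (if m = 0 then 0 else b m) Q" 1] by simp
  have "(\<Sum>m. epow (b m) Q) = epow (b 0) Q + (\<Sum>m. epow (b (Suc m)) Q)"
    using suminf_offset[of "\<lambda>m. epow (b m) Q" 1] by (simp add: add.commute)
  also have "(\<Sum>m. epow (b (Suc m)) Q) = epow ?r Q" using finite e0 by (simp add: lq_real)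
  also have "epow (b 0) Q + epow ?r Q \<le> epow (b 0 + ?r) Q + epow (b 0 + ?r) Q"
    using finite by (intro add_mono epow_mono) (auto simp: add_increasing add_increasing2)
  also have "\<dots> = 2 * epow (b 0 + ?r) Q" by (simp add: mult_2)
  also have "\<dots> = epow (ennreal (2 powr (1 / enn2real q)) * (b 0 + ?r)) Q"
    using finite by (simp add: epow_mult epow_ennreal powr_powr)
  finally show ?thesis using finite by (simp add: lq_real_le_iff)
qed

lemma osc_norm_cmult_le:
  assumes q: "0 < q" and W: "mono W"
  shows "osc_norm s q (\<lambda>t. c * W t) \<le> c * osc_norm s q W"
  using q
proof (cases q rule: exponent_cases)
  case infinite
  have [measurable]: "W \<in> borel_measurable borel" using W by (rule mono_measurable_ennreal)
  have "esssup (lebesgue_on {0<..<1}) (\<lambda>t. ennreal (t powr (- s)) * (c * W t)) \<le> c * osc_norm s q W"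
  proof (rule esssup_I)
    show "(\<lambda>t. ennreal (t powr (- s)) * (c * W t)) \<in> borel_measurable (lebesgue_on {0<..<1})"
      by (intro measurable_restrict_space1 measurable_completion) measurable
    have "AE t in lebesgue_on {0<..<1}. ennreal (t powr (- s)) * W t \<le> osc_norm s q W"
      unfolding osc_norm_def using infinite by (simp add: esssup_AE)
    then show "AE t in lebesgue_on {0<..<1}. ennreal (t powr (- s)) * (c * W t) \<le> c * osc_norm s q W"
    proof eventually_elim
      case (elim t)
      from mult_left_mono[OF this, of c] show ?case by (simp add: mult_ac)
    qed
  qed
  then show ?thesis using infinite by (simp add: osc_norm_def)
next
  case (finite Q)
  have [measurable]: "W \<in> borel_measurable borel" using W by (rule mono_measurable_ennreal)
  let ?f = "\<lambda>t. ennreal (t powr (- s * Q)) * epow (W t) Q * ennreal (1 / t)"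
  have "(\<integral>\<^sup>+t\<in>{0<..<1}. ennreal (t powr (- s * Q)) * epow (c * W t) Q * ennreal (1 / t) \<partial>lebesgue)
      = (\<integral>\<^sup>+t. epow c Q * (?f t * indicator {0<..<1} t) \<partial>lborel)"
    using finite by (simp add: nn_integral_completion epow_mult mult_ac)
  also have "\<dots> = epow c Q * (\<integral>\<^sup>+t\<in>{0<..<1}. ?f t \<partial>lebesgue)"
    unfolding nn_integral_completion by (rule nn_integral_cmult) measurable
  also have "\<dots> = epow (c * osc_norm s q W) Q"
    using finite by (simp add: osc_norm_def epow_mult)
  finally show ?thesis using finite by (simp add: osc_norm_def epow_le_iff)
qed

lemma lq_hardy_scaled:
  assumes q: "0 < q" and e: "0 < e"
  shows "\<exists>C>0. \<forall>K>0. \<forall>b c. (\<forall>j B. (\<forall>i. ennreal (2 powr (- e * \<bar>real i - real j\<bar>)) * b i \<le> B) \<longrightarrow> c j \<le> ennreal K * B)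
    \<longrightarrow> lq q c \<le> ennreal (K * C) * lq q b"
proof (rule lq_hardy[OF q e])
  fix C assume C: "0 < C" and H: "\<And>b c. (\<And>j B. (\<And>i. ennreal (2 powr (- e * \<bar>real i - real j\<bar>)) * b i \<le> B) \<Longrightarrow> c j \<le> B)
      \<Longrightarrow> lq q c \<le> ennreal C * lq q b"
  have "lq q c \<le> ennreal (K * C) * lq q b" if K: "0 < K"
    and c: "\<And>j B. (\<And>i. ennreal (2 powr (- e * \<bar>real i - real j\<bar>)) * b i \<le> B) \<Longrightarrow> c j \<le> ennreal K * B" for K b c
  proof -
    have K1: "ennreal (1 / K) * ennreal K = 1" using K by (subst ennreal_mult[symmetric]) auto
    have "lq q (\<lambda>j. ennreal (1 / K) * c j) \<le> ennreal C * lq q b"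
    proof (rule H)
      fix j B assume "\<And>i. ennreal (2 powr (- e * \<bar>real i - real j\<bar>)) * b i \<le> B"
      then have "c j \<le> ennreal K * B" by (rule c)
      then have "ennreal (1 / K) * c j \<le> ennreal (1 / K) * (ennreal K * B)" by (intro mult_left_mono) auto
      then show "ennreal (1 / K) * c j \<le> B" by (simp only: mult.assoc[symmetric] K1 mult_1_left)
    qed
    then have le: "ennreal K * lq q (\<lambda>j. ennreal (1 / K) * c j) \<le> ennreal K * (ennreal C * lq q b)" by (intro mult_left_mono) auto
    have "lq q c = lq q (\<lambda>j. ennreal K * (ennreal (1 / K) * c j))"
      using K1 by (simp only: mult.assoc[symmetric] mult.commute[of "ennreal K"] mult_1_left)
    also have "\<dots> \<le> ennreal K * lq q (\<lambda>j. ennreal (1 / K) * c j)" by (rule lq_cmult_le[OF q])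
    also note le
    also have "ennreal K * (ennreal C * lq q b) = ennreal (K * C) * lq q b" using K C by (simp add: ennreal_mult mult.assoc)
    finally show ?thesis .
  qed
  with C show ?thesis by (intro exI[of _ C]) blast
qed

lemma ennreal_powr_mult: "ennreal (2 powr a) * (ennreal (2 powr b) * x) = ennreal (2 powr (a + b)) * x"
  by (simp add: powr_add ennreal_mult mult.assoc)

lemma ennreal_powr_shift:
  assumes "ennreal (2 powr a) * x \<le> y" shows "x \<le> ennreal (2 powr (- a)) * y"
  using mult_left_mono[OF assms, of "ennreal (2 powr (- a))"] by (simp add: ennreal_powr_mult)

lemma mono_Lpe_max_diff:
  assumes p: "0 < p" and G: "G \<in> borel_measurable borel"
  shows "mono (\<lambda>t. Lpe p lborel (\<lambda>x::'a::euclidean_space. max_diff G t (norm x)))"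
proof (rule monoI)
  fix t t' :: real assume "t \<le> t'"
  then show "Lpe p lborel (\<lambda>x::'a. max_diff G t (norm x)) \<le> Lpe p lborel (\<lambda>x::'a. max_diff G t' (norm x))"
    by (intro Lpe_mono_AE p AE_I2 max_diff_mono G measurable_compose[OF _ measurable_max_diff[OF G]]) measurable
qed

context resolution_of_unity
begin

subsection \<open>The two estimates for radial functions\<close>

text \<open>The scale sequence consists of 4 times the norm of f at i = 0 and of the maximal
  differences at 2^(-i) otherwise, matching \<open>piece_norm_le_differences\<close>. Only the
  scales i \<le> j act on piece j, and s < 1 keeps their weights within 4^(j-i).\<close>

lemma besov_le_osc_norm:
  assumes p: "1 \<le> p" and q: "0 < q" and s: "0 < s" "s < 1"
  shows "\<exists>C>0. \<forall>G\<in>borel_measurable borel. wint (\<lambda>x::'a. G (norm x)) \<longrightarrow>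
    lq q (\<lambda>j. ennreal (2 powr (real j * s)) * piece_norm p j (\<lambda>x. G (norm x)))
      \<le> ennreal C * (Lpe p lborel (\<lambda>x::'a. ennreal (norm (G (norm x))))
          + osc_norm s q (\<lambda>t. Lpe p lborel (\<lambda>x::'a. max_diff G t (norm x))))"
proof -
  have p0: "0 < p" using p by (rule less_le_trans[rotated]) simp
  obtain K where K: "0 < K" and diff: "\<And>f j e B. wint f \<Longrightarrow> 4 * Lpe p lborel (\<lambda>x. ennreal (norm (f x))) \<le> e 0 \<Longrightarrow>
    (\<forall>i\<ge>1. AE z in lborel. norm z \<le> 1 / 2 ^ i \<longrightarrow> Lpe p lborel (\<lambda>x. ennreal (norm (f (x + z) - f x))) \<le> e i) \<Longrightarrow>
    (\<forall>i\<le>j. e i \<le> ennreal (4 ^ (j - i)) * B) \<Longrightarrow> piece_norm p j f \<le> ennreal K * B"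
    using piece_norm_le_differences[OF p] by blast
  obtain H where H: "0 < H" and hardy: "\<And>K b c. 0 < K \<Longrightarrow>
    (\<forall>j B. (\<forall>i. ennreal (2 powr (- 1 * \<bar>real i - real j\<bar>)) * b i \<le> B) \<longrightarrow> c j \<le> ennreal K * B) \<Longrightarrow> lq q c \<le> ennreal (K * H) * lq q b"
    using lq_hardy_scaled[OF q, of 1] by auto
  define K1 where "K1 = 2 powr (1 / enn2real q)"
  define K2 where "K2 = 2 powr s * 2 powr (1 / enn2real q)"
  have K12: "0 < K1" "0 < K2" by (auto simp: K1_def K2_def)
  \<comment> \<open>The sum \<open>4 + K2\<close> bounds both the factor 4 in front of the norm and
    the factor \<open>K2\<close> in front of the seminorm.\<close>
  define C where "C = K * H * K1 * (4 + K2)"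
  have C: "0 < C" using K H K12 by (simp add: C_def)
  have "lq q (\<lambda>j. ennreal (2 powr (real j * s)) * piece_norm p j F)
      \<le> ennreal C * (Lpe p lborel (\<lambda>x. ennreal (norm (F x))) + osc_norm s q E)"
    if G: "G \<in> borel_measurable borel" and F: "wint F" and Fdef: "F = (\<lambda>x. G (norm x))"
      and Edef: "E = (\<lambda>t. Lpe p lborel (\<lambda>x::'a. max_diff G t (norm x)))" for G F E
  proof -
    define N where "N = Lpe p lborel (\<lambda>x. ennreal (norm (F x)))"
    define e where "e i = (if i = 0 then 4 * N else E (1 / 2 ^ i))" for i :: nat
    define b where "b i = ennreal (2 powr (real i * s)) * e i" for i
    have piece: "ennreal (2 powr (real j * s)) * piece_norm p j F \<le> ennreal K * B"
      if B: "\<And>i. ennreal (2 powr (- 1 * \<bar>real i - real j\<bar>)) * b i \<le> B" for j B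
    proof -
      have "piece_norm p j F \<le> ennreal K * (ennreal (2 powr (- (real j * s))) * B)"
      proof (rule diff[OF F, of e])
        show "4 * Lpe p lborel (\<lambda>x. ennreal (norm (F x))) \<le> e 0" by (simp add: e_def N_def)
        show "\<forall>i\<ge>1. AE z in lborel. norm z \<le> 1 / 2 ^ i \<longrightarrow> Lpe p lborel (\<lambda>x. ennreal (norm (F (x + z) - F x))) \<le> e i"
        proof (intro allI impI)
          fix i :: nat assume "1 \<le> i"
          then have "e i = E (1 / 2 ^ i)" by (simp add: e_def)
          then show "AE z in lborel. norm z \<le> 1 / 2 ^ i \<longrightarrow> Lpe p lborel (\<lambda>x. ennreal (norm (F (x + z) - F x))) \<le> e i"
            using differences_le_max_diff[OF p0 G, of "1 / 2 ^ i"] by (simp only: Fdef Edef)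
        qed
        show "\<forall>i\<le>j. e i \<le> ennreal (4 ^ (j - i)) * (ennreal (2 powr (- (real j * s))) * B)"
        proof (intro allI impI)
          fix i assume i: "i \<le> j"
          have "ennreal (2 powr (real i - real j + real i * s)) * e i \<le> B"
            using B[of i] i by (simp add: b_def ennreal_powr_mult)
          then have "e i \<le> ennreal (2 powr (- (real i - real j + real i * s))) * B" by (rule ennreal_powr_shift)
          \<comment> \<open>One factor 2^(j-i) is the Hardy weight with exponent 1, the other comes
            from 2^((j-i)s) with s < 1.\<close>
          also have "\<dots> \<le> ennreal (2 powr (2 * (real j - real i) + - (real j * s))) * B"
          proof (intro mult_right_mono ennreal_leI powr_mono)
            have "(real j - real i) * s \<le> (real j - real i) * 1" using i s by (intro mult_left_mono) auto
            then show "- (real i - real j + real i * s) \<le> 2 * (real j - real i) + - (real j * s)" by (simp add: algebra_simps)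
          qed auto
          also have "\<dots> = ennreal (2 powr (2 * (real j - real i))) * (ennreal (2 powr (- (real j * s))) * B)"
            by (simp only: ennreal_powr_mult)
          also have "2 powr (2 * (real j - real i)) = 4 ^ (j - i)"
          proof -
            have "2 powr (2 * (real j - real i)) = (2 powr 2) powr real (j - i)" using i by (simp only: powr_powr of_nat_diff)
            also have "\<dots> = 4 ^ (j - i)" by (simp add: powr_realpow)
            finally show ?thesis .
          qed
          finally show "e i \<le> ennreal (4 ^ (j - i)) * (ennreal (2 powr (- (real j * s))) * B)" .
        qed
      qed
      then have "ennreal (2 powr (real j * s)) * piece_norm p j F
          \<le> ennreal (2 powr (real j * s)) * (ennreal K * (ennreal (2 powr (- (real j * s))) * B))" by (intro mult_left_mono) auto
      also have "\<dots> = ennreal K * B" by (simp add: ennreal_powr_mult mult.left_commute[of _ "ennreal K"])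
      finally show ?thesis .
    qed
    have "lq q (\<lambda>j. ennreal (2 powr (real j * s)) * piece_norm p j F) \<le> ennreal (K * H) * lq q b"
      by (rule hardy[OF K]) (use piece in blast)
    also have "lq q b \<le> ennreal K1 * (b 0 + lq q (\<lambda>m. if m = 0 then 0 else b m))"
      unfolding K1_def by (rule lq_split[OF q])
    also have "b 0 = 4 * N" by (simp add: b_def e_def)
    also have "(\<lambda>m. if m = 0 then 0 else b m) = (\<lambda>m. if m = 0 then 0 else ennreal (2 powr (real m * s)) * E (1 / 2 ^ m))"
      by (auto simp: b_def e_def)
    also have "lq q \<dots> \<le> ennreal K2 * osc_norm s q E"
      unfolding K2_def Edef by (rule lq_le_osc_norm[OF q s(1) mono_Lpe_max_diff[OF p0 G]])
    also have "4 * N + ennreal K2 * osc_norm s q E \<le> ennreal (4 + K2) * N + ennreal (4 + K2) * osc_norm s q E"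
      using K12 by (intro add_mono mult_right_mono) (auto intro: ennreal_leI simp: ennreal_numeral[symmetric] simp del: ennreal_numeral)
    also have "ennreal (K * H) * (ennreal K1 * (ennreal (4 + K2) * N + ennreal (4 + K2) * osc_norm s q E)) = ennreal C * (N + osc_norm s q E)"
      using K H K12 by (simp add: C_def ennreal_mult distrib_left mult_ac)
    finally show ?thesis by (simp add: N_def mult_left_mono)
  qed
  with C show ?thesis by blast
qed

lemma osc_norm_le_besov:
  assumes p: "1 \<le> p" and q: "0 < q" and s: "0 < s" "s < 1" and d: "DIM('a) / enn2real p < s"
  shows "\<exists>C>0. \<forall>G\<in>borel_measurable borel. (\<forall>r. G (- r) = G r) \<longrightarrow> wint (\<lambda>x::'a. G (norm x)) \<longrightarrow>
    Lpe p lborel (\<lambda>x::'a. ennreal (norm (G (norm x)))) + osc_norm s q (\<lambda>t. Lpe p lborel (\<lambda>x::'a. max_diff G t (norm x)))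
      \<le> ennreal C * lq q (\<lambda>j. ennreal (2 powr (real j * s)) * piece_norm p j (\<lambda>x. G (norm x)))"
proof -
  have p0: "0 < p" using p by (rule less_le_trans[rotated]) simp
  define \<delta> where "\<delta> = DIM('a) / enn2real p"
  \<comment> \<open>Half of the available gap: e is spent once on summing the increments over j and
    once on the Hardy weights. The gap 1 - s belongs to j \<le> m, the gap s - d/p to j > m.\<close>
  define e where "e = min (1 - s) (s - \<delta>) / 2"
  have e: "0 < e" "2 * e \<le> 1 - s" "2 * e \<le> s - \<delta>" using s d by (auto simp: e_def \<delta>_def)
  obtain K where K: "0 < K" and lim: "\<And>f B. wint f \<Longrightarrow> (\<forall>j. ennreal (2 powr (real j * s)) * piece_norm p j f \<le> B) \<Longrightarrow> B < \<infinity> \<Longrightarrow>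
    (AE y in lborel. (\<lambda>J. conv (kern J) f y) \<longlonglongrightarrow> f y) \<and> Lpe p lborel (\<lambda>x. ennreal (norm (f x))) \<le> ennreal K * B"
    using LP_series_limit[OF p s(1)] by blast
  define \<beta> where "\<beta> j m = (if j \<le> m then 2 powr (real j - real m) else 2 powr ((real j - real m) * \<delta>))" for j m :: nat
  obtain K' where K': "0 < K'" and inc: "\<And>f m B. wint f \<Longrightarrow> (AE y in lborel. (\<lambda>J. conv (kern J) f y) \<longlonglongrightarrow> f y) \<Longrightarrow>
    (\<forall>j. ennreal (\<beta> j m * 2 powr (e * \<bar>real j - real m\<bar>)) * piece_norm p j f \<le> B) \<Longrightarrow>
    (\<exists>M\<in>borel_measurable borel. \<exists>S. (AE x in lborel. x \<in> S) \<and>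
      (\<forall>x h. x \<in> S \<longrightarrow> x + h \<in> S \<longrightarrow> norm h \<le> 1 / 2 ^ m \<longrightarrow> ennreal (norm (f (x + h) - f x)) \<le> M x) \<and>
      Lpe p lborel M \<le> ennreal K' * B)"
    using function_increment[OF p e(1)] unfolding \<beta>_def \<delta>_def by blast
  obtain H where H: "0 < H" and hardy: "\<And>K b c. 0 < K \<Longrightarrow>
    (\<forall>j B. (\<forall>i. ennreal (2 powr (- e * \<bar>real i - real j\<bar>)) * b i \<le> B) \<longrightarrow> c j \<le> ennreal K * B) \<Longrightarrow> lq q c \<le> ennreal (K * H) * lq q b"
    using lq_hardy_scaled[OF q e(1)] by auto
  define K2 where "K2 = 2 powr s * 2 powr (1 / enn2real q)"
  have K2: "0 < K2" by (simp add: K2_def)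
  define C where "C = K + K2 * (K' * H)"
  have C: "0 < C" using K H K' K2 by (simp add: C_def add_pos_pos)
  have "Lpe p lborel (\<lambda>x. ennreal (norm (F x))) + osc_norm s q E
      \<le> ennreal C * lq q (\<lambda>j. ennreal (2 powr (real j * s)) * piece_norm p j F)"
    if G: "G \<in> borel_measurable borel" and even: "\<And>r. G (- r) = G r" and F: "wint F" and Fdef: "F = (\<lambda>x. G (norm x))"
      and Edef: "E = (\<lambda>t. Lpe p lborel (\<lambda>x::'a. max_diff G t (norm x)))" for G F E
  proof -
    define b where "b j = ennreal (2 powr (real j * s)) * piece_norm p j F" for j
    define c where "c m = ennreal (2 powr (real m * s)) * E (1 / 2 ^ m)" for m :: nat
    \<comment> \<open>The series argument needs a finite norm; otherwise the right side is infinite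
      and the estimate trivial.\<close>
    show ?thesis
    proof (cases "lq q b = top")
      case True
      then have "ennreal C * lq q b = top" using C by (simp add: ennreal_mult_top)
      then show ?thesis by (simp add: b_def[abs_def])
    next
      case False
      have "b j \<le> lq q b" for j by (rule le_lq[OF q])
      with lim[OF F, of "lq q b"] False
      have l: "AE y in lborel. (\<lambda>J. conv (kern J) F y) \<longlonglongrightarrow> F y" and N: "Lpe p lborel (\<lambda>x. ennreal (norm (F x))) \<le> ennreal K * lq q b"
        by (auto simp: b_def less_top)
      have step: "c m \<le> ennreal K' * B" if B: "\<And>j. ennreal (2 powr (- e * \<bar>real j - real m\<bar>)) * b j \<le> B" for m B
      proof -
        have "ennreal (\<beta> j m * 2 powr (e * \<bar>real j - real m\<bar>)) * piece_norm p j F \<le> ennreal (2 powr (- (real m * s))) * B" for j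
        proof -
          let ?x = "\<bar>real j - real m\<bar>"
          define k where "k = (if j \<le> m then real j - real m else (real j - real m) * \<delta>)"
          have \<beta>: "\<beta> j m = 2 powr k" by (simp add: \<beta>_def k_def)
          \<comment> \<open>Twice e |j - m|: once for the reserve in
            \<open>function_increment\<close>, once for undoing the Hardy weight in the bound by
            B.\<close>
          have k: "k + 2 * (e * ?x) - real j * s \<le> - (real m * s)"
          proof (cases "j \<le> m")
            case True
            have "(real m - real j) * (2 * e) \<le> (real m - real j) * (1 - s)" using True e by (intro mult_left_mono) auto
            with True show ?thesis by (simp add: k_def algebra_simps)
          next
            case False
            have "(real j - real m) * (2 * e) \<le> (real j - real m) * (s - \<delta>)" using False e by (intro mult_left_mono) auto
            with False show ?thesis by (simp add: k_def algebra_simps)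
          qed
          have "ennreal (2 powr (- e * ?x + real j * s)) * piece_norm p j F \<le> B"
            using B[of j] by (simp only: b_def ennreal_powr_mult)
          then have "piece_norm p j F \<le> ennreal (2 powr (- (- e * ?x + real j * s))) * B" by (rule ennreal_powr_shift)
          then have "ennreal (2 powr (k + e * ?x)) * piece_norm p j F \<le> ennreal (2 powr (k + e * ?x)) * (ennreal (2 powr (- (- e * ?x + real j * s))) * B)"
            by (intro mult_left_mono) auto
          also have "\<dots> = ennreal (2 powr (k + e * ?x + - (- e * ?x + real j * s))) * B" by (rule ennreal_powr_mult)
          also have "\<dots> \<le> ennreal (2 powr (- (real m * s))) * B"
            using k by (intro mult_right_mono ennreal_leI powr_mono) (auto simp: algebra_simps)
          finally show ?thesis by (simp only: \<beta> powr_add)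
        qed
        with inc[OF F l, of m] obtain M S where M: "M \<in> borel_measurable borel" and S: "AE x in lborel. x \<in> S"
          and le: "\<And>x h. x \<in> S \<Longrightarrow> x + h \<in> S \<Longrightarrow> norm h \<le> 1 / 2 ^ m \<Longrightarrow> ennreal (norm (F (x + h) - F x)) \<le> M x"
          and LM: "Lpe p lborel M \<le> ennreal K' * (ennreal (2 powr (- (real m * s))) * B)" by blast
        have "AE x in lborel. max_diff G (1 / 2 ^ m) (norm x) \<le> M x"
          by (rule max_diff_le_majorant[OF G M even S]) (use le in \<open>auto simp: Fdef\<close>)
        then have "E (1 / 2 ^ m) \<le> Lpe p lborel M"
          unfolding Edef by (intro Lpe_mono_AE p0 measurable_compose[OF _ measurable_max_diff[OF G]]) auto
        also note LM
        finally have "c m \<le> ennreal (2 powr (real m * s)) * (ennreal K' * (ennreal (2 powr (- (real m * s))) * B))"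
          unfolding c_def by (intro mult_left_mono) auto
        also have "\<dots> = ennreal K' * B" by (simp add: ennreal_powr_mult mult.left_commute[of _ "ennreal K'"])
        finally show ?thesis .
      qed
      have "osc_norm s q E \<le> ennreal K2 * lq q c"
        unfolding K2_def c_def Edef by (rule osc_norm_le_lq[OF q s(1) mono_Lpe_max_diff[OF p0 G]])
      also have "lq q c \<le> ennreal (K' * H) * lq q b" by (rule hardy[OF K']) (use step in blast)
      finally have "osc_norm s q E \<le> ennreal K2 * (ennreal (K' * H) * lq q b)" by (simp add: mult_left_mono)
      with N have "Lpe p lborel (\<lambda>x. ennreal (norm (F x))) + osc_norm s q E \<le> ennreal K * lq q b + ennreal K2 * (ennreal (K' * H) * lq q b)"
        by (rule add_mono)
      also have "\<dots> = ennreal C * lq q b"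
        using K K2 K' H by (simp add: C_def ennreal_mult ennreal_plus distrib_right mult.assoc)
      finally show ?thesis unfolding b_def .
    qed
  qed
  with C show ?thesis by blast
qed

text \<open>The estimates so far concern Borel functions G; f and g are replaced by Borel versions,
  which changes neither the distribution nor any norm. The constants combine \<open>C0\<close>
  (infimum against convolution), \<open>C1\<close> and \<open>C2\<close> (the two estimates) and
  \<kappa> (polar coordinates).\<close>

lemma radial_characterisation:
  assumes p0: "0 < p" and q: "0 < q" and d: "of_nat DIM('a) / p < ennreal s" and s1: "s < 1"
  shows "\<exists>c1 c2 :: real. 0 < c1 \<and> 0 < c2 \<and>
    (\<forall>(f :: 'a \<Rightarrow> complex) g. in_Lp p f \<longrightarrow> is_trace f g \<longrightarrow>
       (in_besov \<psi> s p q f \<longleftrightarrow> trace_norm DIM('a) s p q g < \<infinity>) \<and>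
       ennreal c1 * trace_norm DIM('a) s p q g \<le> besov_norm \<psi> s p q (regular_dist f) \<and>
       besov_norm \<psi> s p q (regular_dist f) \<le> ennreal c2 * trace_norm DIM('a) s p q g)"
proof -
  \<comment> \<open>For s \<le> 0 the embedding into [0,\<infinity>] sends s to 0, below which
    nothing lies.\<close>
  have s0: "0 < s" using d by (cases "0 < s") (auto simp: ennreal_neg)
  have "1 \<le> p \<and> DIM('a) / enn2real p < s"
    using p0
  proof (cases p rule: exponent_cases)
    case infinite with s0 show ?thesis by simp
  next
    case (finite P)
    have "of_nat DIM('a) / p = ennreal (real DIM('a) / P)"
      using finite by (simp add: ennreal_of_nat_eq_real_of_nat divide_ennreal)
    then have *: "real DIM('a) / P < s" using d finite(2) by (simp add: ennreal_less_iff)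
    \<comment> \<open>Here d < s P < P forces P \<ge> 1, so that Jensen and Minkowski apply.\<close>
    then have "real DIM('a) < s * P" using finite by (simp add: divide_less_eq)
    moreover have "s * P < 1 * P" using s1 finite by (intro mult_strict_right_mono)
    moreover have "1 \<le> real DIM('a)" using DIM_positive[where 'a = 'a] by (simp add: Suc_le_eq)
    ultimately have "1 \<le> P" by linarith
    with * finite show ?thesis by simp
  qed
  then have p: "1 \<le> p" and ds: "DIM('a) / enn2real p < s" by auto
  obtain C0 where C0: "0 < C0" and dist: "\<And>f j. wint f \<Longrightarrow> piece_norm p j f \<le> ennreal C0 * dist_Lp_norm p (LP_piece j f)"
    using piece_norm_le_dist_Lp_norm[OF p] by blast
  obtain C1 where C1: "0 < C1" and lower: "\<And>G. G \<in> borel_measurable borel \<Longrightarrow> (\<forall>r. G (- r) = G r) \<Longrightarrow> wint (\<lambda>x::'a. G (norm x)) \<Longrightarrow>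
    Lpe p lborel (\<lambda>x::'a. ennreal (norm (G (norm x)))) + osc_norm s q (\<lambda>t. Lpe p lborel (\<lambda>x::'a. max_diff G t (norm x)))
      \<le> ennreal C1 * lq q (\<lambda>j. ennreal (2 powr (real j * s)) * piece_norm p j (\<lambda>x. G (norm x)))"
    using osc_norm_le_besov[OF p q s0 s1 ds] by blast
  obtain C2 where C2: "0 < C2" and upper: "\<And>G. G \<in> borel_measurable borel \<Longrightarrow> wint (\<lambda>x::'a. G (norm x)) \<Longrightarrow>
    lq q (\<lambda>j. ennreal (2 powr (real j * s)) * piece_norm p j (\<lambda>x. G (norm x)))
      \<le> ennreal C2 * (Lpe p lborel (\<lambda>x::'a. ennreal (norm (G (norm x))))
          + osc_norm s q (\<lambda>t. Lpe p lborel (\<lambda>x::'a. max_diff G t (norm x))))"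
    using besov_le_osc_norm[OF p q s0 s1] by blast
  obtain \<kappa> where \<kappa>: "0 < \<kappa>" and wt: "\<And>u U. U \<in> borel_measurable borel \<Longrightarrow> (\<forall>r. U (- r) = U r) \<Longrightarrow> (AE r in lborel. u r = U r) \<Longrightarrow>
    weighted_Lp_norm DIM('a) p u = ennreal \<kappa> * Lpe p lborel (\<lambda>x::'a. U (norm x))"
    using weighted_Lp_norm_radial[OF p0, where 'a = 'a] by blast
  define c1 where "c1 = 1 / (\<kappa> * C1 * C0)"
  define c2 where "c2 = C2 / \<kappa>"
  have c: "0 < c1" "0 < c2" using \<kappa> C0 C1 C2 by (auto simp: c1_def c2_def)
  have main: "(in_besov \<psi> s p q f \<longleftrightarrow> trace_norm DIM('a) s p q g < \<infinity>) \<and>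
       ennreal c1 * trace_norm DIM('a) s p q g \<le> besov_norm \<psi> s p q (regular_dist f) \<and>
       besov_norm \<psi> s p q (regular_dist f) \<le> ennreal c2 * trace_norm DIM('a) s p q g"
    if Lp: "in_Lp p f" and tr: "is_trace f g" for f :: "'a \<Rightarrow> complex" and g
  proof -
    have f: "f \<in> borel_measurable lebesgue" and fin: "Lp_norm p f < \<infinity>" using Lp by (auto simp: in_Lp_def)
    obtain G where G[measurable]: "G \<in> borel_measurable borel" and even: "\<forall>r. G (- r) = G r"
      and gG: "AE r in lborel. g r = G r" and fG: "AE x in lborel. f x = G (norm x)"
      using trace_representative[OF f tr] by blast
    define F where "F x = G (norm x)" for x :: 'a
    have [measurable]: "F \<in> borel_measurable borel" unfolding F_def by measurable
    have fF: "AE x in lborel. f x = F x" using fG by (simp add: F_def)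
    define N where "N = Lpe p lborel (\<lambda>x. ennreal (norm (F x)))"
    define E where "E t = Lpe p lborel (\<lambda>x::'a. max_diff G t (norm x))" for t
    have "Lpe p lebesgue (\<lambda>x. ennreal (norm (f x))) = N"
      unfolding N_def by (rule Lpe_lebesgue_eq[OF p0]) (use f fF in \<open>auto simp: AE_completion_iff elim!: eventually_mono\<close>)
    with fin have "N < \<infinity>" by (simp add: Lp_norm_eq_Lpe[OF p0])
    then have F: "wint F" unfolding N_def by (intro Lp_wint[OF p]) auto
    then have F': "wint (\<lambda>x::'a. G (norm x))" by (simp add: F_def[abs_def])
    have dF: "regular_dist f = regular_dist F" by (rule regular_dist_cong_AE[OF fF])
    have E: "mono E" unfolding E_def[abs_def] by (rule mono_Lpe_max_diff[OF p0 G])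
    define L where "L = lq q (\<lambda>j. ennreal (2 powr (real j * s)) * piece_norm p j F)"
    define T where "T = trace_norm DIM('a) s p q g"
    define Bf where "Bf = besov_norm \<psi> s p q (regular_dist f)"
    have Bf: "Bf = lq q (\<lambda>j. ennreal (2 powr (real j * s)) * dist_Lp_norm p (LP_piece j F))"
      by (simp add: Bf_def besov_norm_def weighted_lq_norm_eq_lq[OF q] dF)
    have lo: "N + osc_norm s q E \<le> ennreal C1 * L"
      using lower[OF G even F'] by (simp add: N_def E_def[abs_def] L_def F_def[abs_def])
    have up: "L \<le> ennreal C2 * (N + osc_norm s q E)"
      using upper[OF G F'] by (simp add: N_def E_def[abs_def] L_def F_def[abs_def])
    have T: "T = ennreal \<kappa> * N + osc_norm s q (\<lambda>t. ennreal \<kappa> * E t)"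
    proof -
      have "weighted_Lp_norm DIM('a) p (\<lambda>t. ennreal (norm (g t))) = ennreal \<kappa> * N"
        unfolding N_def F_def by (rule wt[of "\<lambda>r. ennreal (norm (G r))"]) (use even gG in \<open>auto elim!: eventually_mono\<close>)
      moreover have "weighted_Lp_norm DIM('a) p (max_diff g t) = ennreal \<kappa> * E t" for t
        unfolding E_def
      proof (rule wt)
        show "max_diff G t \<in> borel_measurable borel" by (rule measurable_max_diff[OF G])
        show "\<forall>r. max_diff G t (- r) = max_diff G t r" using max_diff_even[OF G] even by blast
        show "AE r in lborel. max_diff g t r = max_diff G t r"
          using gG by eventually_elim (simp add: max_diff_cong_AE[OF G gG])
      qed
      ultimately show ?thesis by (simp add: T_def trace_norm_def trace_seminorm_def osc_norm_def)
    qed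
    have "L \<le> lq q (\<lambda>j. ennreal C0 * (ennreal (2 powr (real j * s)) * dist_Lp_norm p (LP_piece j F)))"
      unfolding L_def
    proof (rule lq_mono[OF q])
      fix j
      show "ennreal (2 powr (real j * s)) * piece_norm p j F \<le> ennreal C0 * (ennreal (2 powr (real j * s)) * dist_Lp_norm p (LP_piece j F))"
        using mult_left_mono[OF dist[OF F, of j], of "ennreal (2 powr (real j * s))"] by (simp add: mult_ac)
    qed
    also have "\<dots> \<le> ennreal C0 * Bf" unfolding Bf by (rule lq_cmult_le[OF q])
    finally have LB: "L \<le> ennreal C0 * Bf" .
    have BL: "Bf \<le> L" unfolding Bf L_def
      by (intro lq_mono[OF q] mult_left_mono dist_Lp_norm_le_piece_norm p0 F) auto
    have "T \<le> ennreal \<kappa> * N + ennreal \<kappa> * osc_norm s q E"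
      unfolding T by (intro add_left_mono osc_norm_cmult_le q E)
    also have "\<dots> = ennreal \<kappa> * (N + osc_norm s q E)" by (simp add: distrib_left)
    also have "\<dots> \<le> ennreal \<kappa> * (ennreal C1 * (ennreal C0 * Bf))"
      by (intro mult_left_mono order_trans[OF lo] LB) auto
    finally have "ennreal c1 * T \<le> ennreal c1 * (ennreal \<kappa> * (ennreal C1 * (ennreal C0 * Bf)))" by (intro mult_left_mono) auto
    also have "\<dots> = ennreal (c1 * (\<kappa> * C1 * C0)) * Bf" using c \<kappa> C1 C0 by (simp add: ennreal_mult mult.assoc)
    also have "c1 * (\<kappa> * C1 * C0) = 1" using \<kappa> C1 C0 by (simp add: c1_def)
    finally have one: "ennreal c1 * T \<le> Bf" by simp
    have \<kappa>1: "ennreal (1 / \<kappa>) * ennreal \<kappa> = 1" using \<kappa> by (subst ennreal_mult[symmetric]) auto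
    \<comment> \<open>\<open>osc_norm_cmult_le\<close> bounds scalar multiples from above; applied
      with 1 / \<kappa> it gives the reverse inequality.\<close>
    have "osc_norm s q E = osc_norm s q (\<lambda>t. ennreal (1 / \<kappa>) * (ennreal \<kappa> * E t))"
      by (simp only: mult.assoc[symmetric] \<kappa>1 mult_1_left)
    also have "\<dots> \<le> ennreal (1 / \<kappa>) * osc_norm s q (\<lambda>t. ennreal \<kappa> * E t)"
      using E by (intro osc_norm_cmult_le q) (auto simp: mono_def intro: mult_left_mono)
    finally have "N + osc_norm s q E \<le> ennreal (1 / \<kappa>) * (ennreal \<kappa> * N) + ennreal (1 / \<kappa>) * osc_norm s q (\<lambda>t. ennreal \<kappa> * E t)"
      by (simp only: mult.assoc[symmetric] \<kappa>1 mult_1_left add_left_mono)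
    also have "\<dots> = ennreal (1 / \<kappa>) * T" by (simp add: T distrib_left)
    finally have "ennreal C2 * (N + osc_norm s q E) \<le> ennreal C2 * (ennreal (1 / \<kappa>) * T)" by (intro mult_left_mono) auto
    also have "\<dots> = ennreal c2 * T" using C2 \<kappa> by (simp add: c2_def mult.assoc[symmetric] ennreal_mult[symmetric])
    finally have two: "Bf \<le> ennreal c2 * T" using BL up by (meson order_trans)
    have "Bf < \<infinity> \<longleftrightarrow> T < \<infinity>"
    proof
      assume "Bf < \<infinity>"
      then have "ennreal c1 * T < top" using one by (auto intro: le_less_trans)
      then show "T < \<infinity>" using c by (auto simp: ennreal_mult_less_top)
    next
      assume "T < \<infinity>"
      then have "ennreal c2 * T < top" by (simp add: ennreal_mult_less_top)
      then show "Bf < \<infinity>" using two by (auto intro: le_less_trans)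
    qed
    \<comment> \<open>Integrability of F against a weight already yields the representation and the
      tempered distribution, so membership reduces to a finite norm.\<close>
    moreover have "in_besov \<psi> s p q f \<longleftrightarrow> Bf < \<infinity>"
      using wint_represents[OF F f fF] wint_tempered[OF F] by (simp add: in_besov_def besov_space_def Bf_def dF)
    ultimately show ?thesis using one two by (simp add: T_def Bf_def)
  qed
  show ?thesis using c main by blast
qed

end

theorem theorem3:
  fixes \<psi> :: "real ^ 'n \<Rightarrow> complex" and p q :: ennreal and s :: real
  assumes "CARD('n) \<ge> 2"
    and "resolution_generator \<psi>"
    and "0 < p" and "0 < q"
    and "of_nat CARD('n) / p < ennreal s" and "s < 1"
  shows "\<exists>c1 c2 :: real. 0 < c1 \<and> 0 < c2 \<and>
    (\<forall>(f :: real ^ 'n \<Rightarrow> complex) g.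
       in_Lp p f \<longrightarrow> radial f \<longrightarrow> is_trace f g \<longrightarrow>
         (in_besov \<psi> s p q f \<longleftrightarrow> trace_norm CARD('n) s p q g < \<infinity>) \<and>
         ennreal c1 * trace_norm CARD('n) s p q g \<le> besov_norm \<psi> s p q (regular_dist f) \<and>
         besov_norm \<psi> s p q (regular_dist f) \<le> ennreal c2 * trace_norm CARD('n) s p q g)"
proof -
  interpret resolution_of_unity \<psi> by unfold_locales (rule assms)
  show ?thesis using radial_characterisation[OF assms(3,4) _ assms(6)] assms(5) by auto
qed

end
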